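(* Suppose that $M$ is a connected, compact, Riemannian manifold and equip $C(M)$ with the densely defined, lower semi-continuous semi-norm $L_{C(M)}\colon C^\infty(M)\to[0,\infty)$ given by $L_{C(M)}(f) := \sup_{p\in M}\|df(p)\|_\infty$, where $d$ denotes the exterior derivative. Suppose, moreover, that $\psi\colon T\to\mathrm{Diff}(M)$, $t\mapsto\psi_t$, is a family of diffeomorphisms of $M$, parametrized by a compact Hausdorff space $T$, which is continuous with respect to the Whitney $C^1$-topology, and that $|||\cdot|||\colon C_c(\mathbb{Z})\to[0,\infty)$ is an order preserving norm. For each $t\in T$, define the $*$-automorphism $\beta_t$ of $C(M)$ by $\beta_t(f) := f\circ\psi_t$ and let $L_t\colon C_c(\mathbb{Z},C^\infty(M))\to[0,\infty)$ be the densely defined semi-norm on $C_r^*(\mathbb{Z},C(M),\beta_t)$ given by \[ L_t(x) := \max\Big\{ \Big\|\sum_n n\,x(n)U^n\Big\|_{C_r^*(\mathbb{Z},C(M),\beta_t)},\ |||L_{C(M)}\circ x|||,\ |||L_{C(M)}\circ x^*|||\Big\}. \] Then $\{(C_r^*(\mathbb{Z},C(M),\beta_t),L_t)\}_{t\in T}$ is a family of compact quantum metric spaces which varies continuously in the quantum Gromov-Hausdorff distance, i.e. for every $t_0\in T$, \[ \lim_{t\to t_0}\mathrm{dist}_q\big((C_r^*(\mathbb{Z},C(M),\beta_t),L_t),(C_r^*(\mathbb{Z},C(M),\beta_{t_0}),L_{t_0})\big)=0. \]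
   Context: **Compact quantum metric spaces.** Let $A$ be a unital $C^*$-algebra and $V\subseteq A$ a (not necessarily dense) complex subspace with $1\in V$, $V^*=V$. $V^{\mathrm{sa}}=\{\xi\in V\mid \xi=\xi^*\}$ is an order unit space with the order and unit of $A$; its state space $S(V^{\mathrm{sa}})$ is the set of positive $\mathbb{R}$-linear $\mu\colon V^{\mathrm{sa}}\to\mathbb{R}$ with $\mu(1)=1$, with the weak $*$-topology. For a semi-norm $L^{\mathrm{sa}}$ on $V^{\mathrm{sa}}$ with $L^{\mathrm{sa}}(1)=0$ put $\rho_{L^{\mathrm{sa}}}(\mu,\nu)=\sup\{|\mu(\xi)-\nu(\xi)| \mid \xi\in V^{\mathrm{sa}}, L^{\mathrm{sa}}(\xi)\le 1\}$. $(V^{\mathrm{sa}},L^{\mathrm{sa}})$ is an order unit compact quantum metric space if $\rho_{L^{\mathrm{sa}}}$ metrizes the weak $*$-topology on $S(V^{\mathrm{sa}})$. If $V$ is norm-dense and $L\colon V\to[0,\infty)$ is a semi-norm with $L(1)=0$, $L(\xi^* )=L(\xi)$, then $(A,L)$ is a ($C^*$-algebraic) compact quantum metric space if $\rho_L(\mu,\nu)=\sup\{|\mu(\xi)-\nu(\xi)|\mid \xi\in V, L(\xi)\le1\}$ metrizes the weak $*$-topology on the state space $S(A)$. **Quantum Gromov-Hausdorff distance.** For order unit compact quantum metric spaces $(V_j^{\mathrm{sa}},L_j^{\mathrm{sa}})$, $j=1,2$, a semi-norm $L^{\mathrm{sa}}$ on $V_1^{\mathrm{sa}}\oplus V_2^{\mathrm{sa}}$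 vanishing on the unit is admissible if $(V_1^{\mathrm{sa}}\oplus V_2^{\mathrm{sa}},L^{\mathrm{sa}})$ is an order unit compact quantum metric space and $L_j^{\mathrm{sa}}$ is the quotient semi-norm of $L^{\mathrm{sa}}$ under the projection onto $V_j^{\mathrm{sa}}$, $j=1,2$. Then $\mathrm{dist}_q(V_1^{\mathrm{sa}},V_2^{\mathrm{sa}})$ is the infimum over admissible $L^{\mathrm{sa}}$ of the Hausdorff distance, with respect to $\rho_{L^{\mathrm{sa}}}$, between $S(V_1^{\mathrm{sa}})$ and $S(V_2^{\mathrm{sa}})$ viewed (via the projections) as subsets of $S(V_1^{\mathrm{sa}}\oplus V_2^{\mathrm{sa}})$. For $C^*$-algebraic compact quantum metric spaces, $\mathrm{dist}_q((A_1,L_1),(A_2,L_2)):=\mathrm{dist}_q(V_1^{\mathrm{sa}},V_2^{\mathrm{sa}})$, where $V_j$ is the domain of $L_j$. **Crossed products.** $C_r^*(\mathbb{Z},B,\beta)$ is the reduced crossed product of $B$ by the $\mathbb{Z}$-action generated by $\beta$, generated by $B$ and a unitary $U$ with $UbU^*=\beta(b)$. $C_c(\mathbb{Z})$ is the space of finitely supported complex functions on $\mathbb{Z}$; for a subspace $V_B\subseteq B$, a finitely supported $x\colon\mathbb{Z}\to V_B$ is identified with $\sum_n x(n)U^n$, and these form $C_c(\mathbb{Z},V_B)$. $x^*$ is the adjoint in the crossed product, $x^*(n)=\beta^n(x(-n)^* )$, and $L_B\circ x\in C_c(\mathbb{Z})$ is $n\mapsto L_B(x(n))$. A norm $|||\cdot|||$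 on $C_c(\mathbb{Z})$ is order preserving if $|||h|||\le|||k|||$ whenever $0\le h(n)\le k(n)$ for all $n\in\mathbb{Z}$. **Manifolds.** $T_pM$ denotes the complexified tangent space with the Hilbert space structure coming from the Riemannian metric, $C^\infty(M)$ is the space of smooth complex-valued functions, and $\|df(p)\|_\infty$ is the operator norm of $df(p)\colon T_pM\to\mathbb{C}$. Let $d$ also denote the Riemannian distance on $M$. Whitney $C^1$-topology on $C^\infty(M,M)$: for $f\in C^\infty(M,M)$, coordinate charts $(U,x)$, $(V,y)$, a compact $K\subseteq U$ with $f(K)\subseteq V$ and $\varepsilon>0$, let $W_f(x,y,K,\varepsilon)$ be the set of $g\in C^\infty(M,M)$ with $\sup_{p\in K}d(f(p),g(p))<\varepsilon$, $g(K)\subseteq V$ and $\sup_{p\in K}\|J_{y,x}(f)(p)-J_{y,x}(g)(p)\|_\infty<\varepsilon$, where $J_{y,x}(f)(p)_{ij}=\frac{\partial(y_i\circ f)}{\partial x_j}|_p$ is the Jacobian. Finite intersections of such sets form a neighbourhood basis at $f$. $\mathrm{Diff}(M)\subseteq C^\infty(M,M)$, the group of diffeomorphisms, carries the subspace topology. *)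

theory Defs
  imports "HOL-Analysis.Analysis"
begin

section \<open>Unital C*-algebras\<close>

class scaleC =
  fixes scaleC :: "complex \<Rightarrow> 'a \<Rightarrow> 'a"  (infixr \<open>*\<^sub>C\<close> 75)

class complex_vector = real_vector + scaleC +
  assumes scaleC_add_right: "c *\<^sub>C (x + y) = c *\<^sub>C x + c *\<^sub>C y"
    and scaleC_add_left: "(c + d) *\<^sub>C x = c *\<^sub>C x + d *\<^sub>C x"
    and scaleC_scaleC: "c *\<^sub>C d *\<^sub>C x = (c * d) *\<^sub>C x"
    and scaleR_scaleC: "r *\<^sub>R x = complex_of_real r *\<^sub>C x"

class star =
  fixes star :: "'a \<Rightarrow> 'a"

class cstar_algebra = real_normed_algebra_1 + banach + complex_vector + star +
  assumes mult_scaleC_left: "(c *\<^sub>C x) * y = c *\<^sub>C (x * y)"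
    and mult_scaleC_right: "x * (c *\<^sub>C y) = c *\<^sub>C (x * y)"
    and star_star: "star (star x) = x"
    and star_add: "star (x + y) = star x + star y"
    and star_mult: "star (x * y) = star y * star x"
    and star_scaleC: "star (c *\<^sub>C x) = cnj c *\<^sub>C star x"
    and cstar_identity: "norm (star x * x) = (norm x)\<^sup>2"

lemma scaleC_one [simp]: "1 *\<^sub>C x = (x :: 'a::complex_vector)"
  by (metis of_real_1 scaleR_one scaleR_scaleC)

lemma scaleC_zero_right [simp]: "c *\<^sub>C 0 = (0 :: 'a::complex_vector)"
  using scaleC_add_right[of c "0::'a" 0] by simp

lemma scaleC_zero_left [simp]: "0 *\<^sub>C x = (0 :: 'a::complex_vector)"
  using scaleC_add_left[of 0 0 x] by simp

section \<open>The Hilbert space of square summable families\<close>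

typedef 'i ell2 = "{f :: 'i \<Rightarrow> complex. (\<lambda>i. (cmod (f i))\<^sup>2) summable_on UNIV}"
  morphisms ell2_apply Abs_ell2
  by (rule exI[of _ "\<lambda>_. 0"]) simp

setup_lifting type_definition_ell2

lemma ell2_eqI: "(\<And>i. ell2_apply x i = ell2_apply y i) \<Longrightarrow> x = y"
  by (metis ell2_apply_inject ext)

lemma ell2_summable: "(\<lambda>i. (cmod (ell2_apply x i))\<^sup>2) summable_on UNIV"
  using ell2_apply by blast

lemma square_summableI:
  assumes "\<And>F. finite F \<Longrightarrow> (\<Sum>i\<in>F. (cmod (f i))\<^sup>2) \<le> B"
  shows "(\<lambda>i. (cmod (f i))\<^sup>2) summable_on UNIV"
  by (rule nonneg_bdd_above_summable_on) (auto intro!: bdd_aboveI[of _ B] assms)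

lemma square_summable_add:
  fixes f g :: "'i \<Rightarrow> complex"
  assumes "(\<lambda>i. (cmod (f i))\<^sup>2) summable_on UNIV" "(\<lambda>i. (cmod (g i))\<^sup>2) summable_on UNIV"
  shows "(\<lambda>i. (cmod (f i + g i))\<^sup>2) summable_on UNIV"
proof (rule summable_on_comparison_test)
  show "(\<lambda>i. 2 * (cmod (f i))\<^sup>2 + 2 * (cmod (g i))\<^sup>2) summable_on UNIV"
    by (intro summable_on_add summable_on_cmult_right assms)
  fix i
  have "(cmod (f i + g i))\<^sup>2 \<le> (cmod (f i) + cmod (g i))\<^sup>2"
    by (simp add: norm_triangle_ineq power_mono)
  also have "\<dots> \<le> 2 * (cmod (f i))\<^sup>2 + 2 * (cmod (g i))\<^sup>2"
    using sum_squares_bound[of "cmod (f i)" "cmod (g i)"] by (simp add: power2_sum)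
  finally show "(cmod (f i + g i))\<^sup>2 \<le> 2 * (cmod (f i))\<^sup>2 + 2 * (cmod (g i))\<^sup>2" .
qed auto

lemma square_summable_cmult:
  fixes f :: "'i \<Rightarrow> complex"
  assumes "(\<lambda>i. (cmod (f i))\<^sup>2) summable_on UNIV"
  shows "(\<lambda>i. (cmod (c * f i))\<^sup>2) summable_on UNIV"
  by (simp add: norm_mult power_mult_distrib summable_on_cmult_right assms)

instantiation ell2 :: (type) complex_vector
begin

lift_definition zero_ell2 :: "'a ell2" is "\<lambda>_. 0" by simp
lift_definition plus_ell2 :: "'a ell2 \<Rightarrow> 'a ell2 \<Rightarrow> 'a ell2" is "\<lambda>f g i. f i + g i"
  by (rule square_summable_add)
lift_definition uminus_ell2 :: "'a ell2 \<Rightarrow> 'a ell2" is "\<lambda>f i. - f i" by simp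
lift_definition minus_ell2 :: "'a ell2 \<Rightarrow> 'a ell2 \<Rightarrow> 'a ell2" is "\<lambda>f g i. f i - g i"
  subgoal for f g
    using square_summable_add[of f "\<lambda>i. - g i"] by simp
  done
lift_definition scaleC_ell2 :: "complex \<Rightarrow> 'a ell2 \<Rightarrow> 'a ell2" is "\<lambda>c f i. c * f i"
  by (rule square_summable_cmult)
lift_definition scaleR_ell2 :: "real \<Rightarrow> 'a ell2 \<Rightarrow> 'a ell2" is "\<lambda>r f i. complex_of_real r * f i"
  by (rule square_summable_cmult)

instance
  by standard (transfer; auto simp: algebra_simps)+

end

lemmas ell2_apply_simps [simp] = zero_ell2.rep_eq plus_ell2.rep_eq uminus_ell2.rep_eq
  minus_ell2.rep_eq scaleC_ell2.rep_eq scaleR_ell2.rep_eq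

lemma ell2_cinner_summable:
  "(\<lambda>i. norm (cnj (ell2_apply x i) * ell2_apply y i)) summable_on UNIV"
proof (rule summable_on_comparison_test)
  show "(\<lambda>i. (cmod (ell2_apply x i))\<^sup>2 + (cmod (ell2_apply y i))\<^sup>2) summable_on UNIV"
    by (intro summable_on_add ell2_summable)
  fix i
  show "cmod (cnj (ell2_apply x i) * ell2_apply y i)
      \<le> (cmod (ell2_apply x i))\<^sup>2 + (cmod (ell2_apply y i))\<^sup>2"
  proof -
    have "0 \<le> cmod (ell2_apply x i) * cmod (ell2_apply y i)" by simp
    moreover have "2 * cmod (ell2_apply x i) * cmod (ell2_apply y i)
        \<le> (cmod (ell2_apply x i))\<^sup>2 + (cmod (ell2_apply y i))\<^sup>2"
      by (rule sum_squares_bound)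
    ultimately have "cmod (ell2_apply x i) * cmod (ell2_apply y i)
        \<le> (cmod (ell2_apply x i))\<^sup>2 + (cmod (ell2_apply y i))\<^sup>2"
      by linarith
    thus ?thesis by (simp add: norm_mult)
  qed
qed auto

definition cinner :: "'i ell2 \<Rightarrow> 'i ell2 \<Rightarrow> complex"
  where "cinner x y = (\<Sum>\<^sub>\<infinity>i. cnj (ell2_apply x i) * ell2_apply y i)"

lemma cinner_summable: "(\<lambda>i. cnj (ell2_apply x i) * ell2_apply y i) summable_on UNIV"
  by (rule Infinite_Sum.abs_summable_summable) (rule ell2_cinner_summable)

lemma cinner_commute: "cinner x y = cnj (cinner y x)"
  unfolding cinner_def by (simp add: mult.commute flip: infsum_cnj)

lemma cinner_add_right: "cinner x (y + z) = cinner x y + cinner x z"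
  unfolding cinner_def by (simp add: distrib_left infsum_add cinner_summable)

lemma cinner_add_left: "cinner (x + y) z = cinner x z + cinner y z"
  by (metis cinner_commute cinner_add_right complex_cnj_add)

lemma cinner_scaleC_right: "cinner x (c *\<^sub>C y) = c * cinner x y"
proof -
  have "cinner x (c *\<^sub>C y) = (\<Sum>\<^sub>\<infinity>i. c * (cnj (ell2_apply x i) * ell2_apply y i))"
    unfolding cinner_def by (simp add: mult.left_commute)
  also have "\<dots> = c * cinner x y"
    unfolding cinner_def by (rule infsum_cmult_right) (rule cinner_summable)
  finally show ?thesis .
qed

lemma cinner_scaleC_left: "cinner (c *\<^sub>C x) y = cnj c * cinner x y"
  by (metis cinner_commute cinner_scaleC_right complex_cnj_mult)

lemma cinner_self: "cinner x x = complex_of_real (\<Sum>\<^sub>\<infinity>i. (cmod (ell2_apply x i))\<^sup>2)"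
proof -
  have "((\<lambda>i. complex_of_real ((cmod (ell2_apply x i))\<^sup>2)) has_sum
      complex_of_real (\<Sum>\<^sub>\<infinity>i. (cmod (ell2_apply x i))\<^sup>2)) UNIV"
    by (intro has_sum_of_real has_sum_infsum ell2_summable)
  moreover have "cnj (ell2_apply x i) * ell2_apply x i
      = complex_of_real ((cmod (ell2_apply x i))\<^sup>2)" for i
    by (simp only: complex_norm_square mult.commute)
  ultimately show ?thesis
    unfolding cinner_def by (simp only: infsumI)
qed

instantiation ell2 :: (type) real_inner
begin

definition inner_ell2 :: "'a ell2 \<Rightarrow> 'a ell2 \<Rightarrow> real"
  where "inner_ell2 x y = Re (cinner x y)"
definition norm_ell2 :: "'a ell2 \<Rightarrow> real"
  where "norm_ell2 x = sqrt (\<Sum>\<^sub>\<infinity>i. (cmod (ell2_apply x i))\<^sup>2)"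
definition dist_ell2 :: "'a ell2 \<Rightarrow> 'a ell2 \<Rightarrow> real"
  where "dist_ell2 x y = norm (x - y)"
definition sgn_ell2 :: "'a ell2 \<Rightarrow> 'a ell2"
  where "sgn_ell2 x = x /\<^sub>R norm x"
definition uniformity_ell2 :: "('a ell2 \<times> 'a ell2) filter"
  where "uniformity_ell2 = (INF e\<in>{0 <..}. principal {(x, y). dist x y < e})"
definition open_ell2 :: "'a ell2 set \<Rightarrow> bool"
  where "open_ell2 U \<longleftrightarrow> (\<forall>x\<in>U. eventually (\<lambda>(x', y). x' = x \<longrightarrow> y \<in> U) uniformity)"

instance
proof
  fix x y z :: "'a ell2" and r :: real and U :: "'a ell2 set"
  show "dist x y = norm (x - y)" by (simp add: dist_ell2_def)
  show "sgn x = x /\<^sub>R norm x" by (simp add: sgn_ell2_def)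
  show "uniformity = (INF e\<in>{0 <..}. principal {(x::'a ell2, y). dist x y < e})"
    by (simp add: uniformity_ell2_def)
  show "open U = (\<forall>x\<in>U. eventually (\<lambda>(x', y). x' = x \<longrightarrow> y \<in> U) uniformity)"
    by (simp add: open_ell2_def)
  show "inner x y = inner y x"
    unfolding inner_ell2_def by (simp only: cinner_commute[of x y] cnj.simps)
  show "inner (x + y) z = inner x z + inner y z"
    by (simp add: inner_ell2_def cinner_add_left)
  show "inner (r *\<^sub>R x) y = r * inner x y"
    by (simp add: inner_ell2_def scaleR_scaleC cinner_scaleC_left)
  show "0 \<le> inner x x"
    by (simp add: inner_ell2_def cinner_self infsum_nonneg)
  show "(inner x x = 0) = (x = 0)"
  proof
    assume "inner x x = 0"
    hence *: "(\<Sum>\<^sub>\<infinity>i. (cmod (ell2_apply x i))\<^sup>2) \<le> 0"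
      by (simp add: inner_ell2_def cinner_self)
    have "(cmod (ell2_apply x i))\<^sup>2 = 0" for i
      by (rule nonneg_infsum_le_0D[OF * ell2_summable]) auto
    thus "x = 0"
      by (intro ell2_eqI) simp
  qed (simp add: inner_ell2_def cinner_self)
  show "norm x = sqrt (inner x x)"
    by (simp add: norm_ell2_def inner_ell2_def cinner_self)
qed

end

lemma ell2_norm_sq: "(norm x)\<^sup>2 = (\<Sum>\<^sub>\<infinity>i. (cmod (ell2_apply x i))\<^sup>2)"
  by (simp add: norm_ell2_def infsum_nonneg)

lemma cinner_self_norm: "cinner x x = complex_of_real ((norm x)\<^sup>2)"
  by (simp only: cinner_self ell2_norm_sq)

lemma ell2_sum_le_norm:
  assumes "finite F"
  shows "(\<Sum>i\<in>F. (cmod (ell2_apply x i))\<^sup>2) \<le> (norm x)\<^sup>2"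
  unfolding ell2_norm_sq by (rule finite_sum_le_infsum[OF ell2_summable assms]) auto

lemma ell2_apply_le_norm: "cmod (ell2_apply x i) \<le> norm x"
  by (rule power2_le_imp_le) (use ell2_sum_le_norm[of "{i}" x] in auto)

lemma ell2_norm_leI:
  assumes "\<And>F. finite F \<Longrightarrow> (\<Sum>i\<in>F. (cmod (ell2_apply x i))\<^sup>2) \<le> B\<^sup>2" and "0 \<le> B"
  shows "norm x \<le> B"
proof -
  have "(norm x)\<^sup>2 \<le> B\<^sup>2"
    unfolding ell2_norm_sq by (rule infsum_le_finite_sums[OF ell2_summable]) (use assms in auto)
  thus ?thesis
    using assms(2) by (rule power2_le_imp_le)
qed

lemma norm_scaleC_ell2: "norm (c *\<^sub>C x) = cmod c * norm (x :: 'i ell2)"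
proof -
  have "complex_of_real ((norm (c *\<^sub>C x))\<^sup>2) = (c * cnj c) * cinner x x"
    by (simp only: cinner_self_norm[symmetric] cinner_scaleC_left cinner_scaleC_right mult.assoc)
  also have "\<dots> = complex_of_real ((cmod c * norm x)\<^sup>2)"
    by (simp only: cinner_self_norm complex_norm_square[symmetric] of_real_mult[symmetric]
        power_mult_distrib)
  finally have "(norm (c *\<^sub>C x))\<^sup>2 = (cmod c * norm x)\<^sup>2"
    using of_real_eq_iff by blast
  thus ?thesis by simp
qed

lemma cinner_cauchy_schwarz: "cmod (cinner x y) \<le> norm x * norm y"
proof (cases "cinner x y = 0")
  case False
  define u where "u = cnj (sgn (cinner x y))"
  have "u * cinner x y = complex_of_real (cmod (cinner x y))"
  proof -
    have "u * cinner x y = (cinner x y * cnj (cinner x y)) / complex_of_real (cmod (cinner x y))"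
      by (simp add: u_def sgn_eq)
    also have "\<dots> = complex_of_real ((cmod (cinner x y))\<^sup>2 / cmod (cinner x y))"
      by (simp only: complex_norm_square[symmetric] of_real_divide)
    finally show ?thesis
      by (simp add: power2_eq_square)
  qed
  hence "cmod (cinner x y) = inner x (u *\<^sub>C y)"
    by (simp add: inner_ell2_def cinner_scaleC_right)
  also have "\<dots> \<le> norm x * norm (u *\<^sub>C y)"
    by (rule norm_cauchy_schwarz)
  also have "norm (u *\<^sub>C y) = norm y"
    using False by (simp add: norm_scaleC_ell2 u_def norm_sgn)
  finally show ?thesis .
qed simp

instance ell2 :: (type) complete_space
proof
  fix X :: "nat \<Rightarrow> 'a ell2"
  assume "Cauchy X"
  have "Cauchy (\<lambda>n. ell2_apply (X n) i)" for i
  proof (rule CauchyI)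
    fix e :: real assume "0 < e"
    then obtain N where N: "\<And>m n. m \<ge> N \<Longrightarrow> n \<ge> N \<Longrightarrow> norm (X m - X n) < e"
      using CauchyD[OF \<open>Cauchy X\<close>] by blast
    have "norm (ell2_apply (X m) i - ell2_apply (X n) i) < e" if "m \<ge> N" "n \<ge> N" for m n
      using ell2_apply_le_norm[of "X m - X n" i] N[OF that] by simp
    thus "\<exists>M. \<forall>m\<ge>M. \<forall>n\<ge>M. norm (ell2_apply (X m) i - ell2_apply (X n) i) < e"
      by blast
  qed
  hence "\<forall>i. \<exists>l. (\<lambda>n. ell2_apply (X n) i) \<longlonglongrightarrow> l"
    using Cauchy_convergent_iff convergent_def by blast
  then obtain l where l: "\<And>i. (\<lambda>n. ell2_apply (X n) i) \<longlonglongrightarrow> l i"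
    by metis
  have bound: "(\<Sum>i\<in>F. (cmod (l i - ell2_apply (X n) i))\<^sup>2) \<le> e\<^sup>2"
    if "finite F" "n \<ge> N" and N: "\<And>m n. m \<ge> N \<Longrightarrow> n \<ge> N \<Longrightarrow> norm (X m - X n) < e"
    for F n N e
  proof (rule tendsto_upperbound)
    show "(\<lambda>m. \<Sum>i\<in>F. (cmod (ell2_apply (X m) i - ell2_apply (X n) i))\<^sup>2)
        \<longlonglongrightarrow> (\<Sum>i\<in>F. (cmod (l i - ell2_apply (X n) i))\<^sup>2)"
      by (intro tendsto_intros l)
    have "(\<Sum>i\<in>F. (cmod (ell2_apply (X m) i - ell2_apply (X n) i))\<^sup>2) \<le> e\<^sup>2" if "m \<ge> N" for m
      using ell2_sum_le_norm[OF \<open>finite F\<close>, of "X m - X n"]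
        power_mono[OF less_imp_le[OF N[OF that \<open>n \<ge> N\<close>]], of 2] by simp
    thus "\<forall>\<^sub>F m in sequentially.
        (\<Sum>i\<in>F. (cmod (ell2_apply (X m) i - ell2_apply (X n) i))\<^sup>2) \<le> e\<^sup>2"
      by (auto simp: eventually_sequentially)
  qed simp
  have "(\<lambda>i. (cmod (l i))\<^sup>2) summable_on UNIV"
  proof -
    obtain N where N: "\<And>m n. m \<ge> N \<Longrightarrow> n \<ge> N \<Longrightarrow> norm (X m - X n) < 1"
      using CauchyD[OF \<open>Cauchy X\<close>, of 1] by auto
    have "(\<lambda>i. (cmod (l i - ell2_apply (X N) i))\<^sup>2) summable_on UNIV"
      using bound[OF _ order_refl N] by (intro square_summableI[of _ "1\<^sup>2"]) auto
    from square_summable_add[OF this ell2_summable[of "X N"]] show ?thesis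
      by simp
  qed
  hence L: "ell2_apply (Abs_ell2 l) = l"
    by (simp add: Abs_ell2_inverse)
  have "X \<longlonglongrightarrow> Abs_ell2 l"
  proof (rule LIMSEQ_I)
    fix r :: real assume "0 < r"
    then obtain N where N: "\<And>m n. m \<ge> N \<Longrightarrow> n \<ge> N \<Longrightarrow> norm (X m - X n) < r / 2"
      using CauchyD[OF \<open>Cauchy X\<close>, of "r / 2"] by auto
    have "norm (Abs_ell2 l - X n) \<le> r / 2" if "n \<ge> N" for n
      using bound[OF _ that N] \<open>0 < r\<close> by (intro ell2_norm_leI) (auto simp: L)
    thus "\<exists>no. \<forall>n\<ge>no. norm (X n - Abs_ell2 l) < r"
      using \<open>0 < r\<close> by (metis norm_minus_commute half_gt_zero_iff less_add_same_cancel1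
          field_sum_of_halves le_less_trans)
  qed
  thus "convergent X"
    by (auto simp: convergent_def)
qed

instance ell2 :: (type) banach ..

lift_definition ket :: "'i \<Rightarrow> 'i ell2" is "\<lambda>i j. if j = i then 1 else 0"
  subgoal for i
  proof -
    have "(\<lambda>j. (cmod (if j = i then 1 else 0))\<^sup>2) summable_on {i}"
      by simp
    thus ?thesis
      by (subst summable_on_cong_neutral[where T = "{i}"]) auto
  qed
  done

lemma cinner_ket: "cinner (ket i) x = ell2_apply x i"
proof -
  have "cinner (ket i) x = (\<Sum>\<^sub>\<infinity>j\<in>{i}. cnj (ell2_apply (ket i) j) * ell2_apply x j)"
    unfolding cinner_def by (rule infsum_cong_neutral) (auto simp: ket.rep_eq)
  thus ?thesis by (simp add: ket.rep_eq)
qed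

lemma cinner_zero_right [simp]: "cinner x 0 = 0"
  by (simp add: cinner_def)

lemma cinner_zero_left [simp]: "cinner 0 x = 0"
  by (simp add: cinner_def)

lemma ell2_eq_cinnerI:
  assumes "\<And>z. cinner z x = cinner z y"
  shows "x = y"
  by (rule ell2_eqI) (metis assms cinner_ket)

section \<open>Bounded operators on \<open>\<ell>\<^sup>2\<close>\<close>

typedef 'i ell2_op = "{T :: 'i ell2 \<Rightarrow>\<^sub>L 'i ell2. \<forall>c x. blinfun_apply T (c *\<^sub>C x) = c *\<^sub>C blinfun_apply T x}"
  morphisms op_blinfun Abs_ell2_op
  by (rule exI[of _ 0]) simp

setup_lifting type_definition_ell2_op

definition op_apply :: "'i ell2_op \<Rightarrow> 'i ell2 \<Rightarrow> 'i ell2"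
  where "op_apply T = blinfun_apply (op_blinfun T)"

lemma op_apply_scaleC [simp]: "op_apply T (c *\<^sub>C x) = c *\<^sub>C op_apply T x"
  using op_blinfun[of T] by (simp add: op_apply_def)

lemma op_apply_add [simp]: "op_apply T (x + y) = op_apply T x + op_apply T y"
  by (simp add: op_apply_def blinfun.add_right)

lemma op_apply_zero [simp]: "op_apply T 0 = 0"
  by (simp add: op_apply_def)

lemma op_eqI: "(\<And>x. op_apply S x = op_apply T x) \<Longrightarrow> S = T"
  by (simp add: op_apply_def blinfun_eqI flip: op_blinfun_inject)

lemma bounded_linear_scaleC_ell2: "bounded_linear (\<lambda>x :: 'i ell2. c *\<^sub>C x)"
  by (rule bounded_linear_intro[of _ "cmod c"])
    (simp_all add: scaleC_add_right scaleR_scaleC scaleC_scaleC norm_scaleC_ell2 mult.commute)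

lemma scaleC_blinfun_apply:
  "blinfun_apply (Blinfun (\<lambda>x. c *\<^sub>C blinfun_apply T x)) x = c *\<^sub>C (blinfun_apply T x :: 'i ell2)"
  for T :: "'i ell2 \<Rightarrow>\<^sub>L 'i ell2"
  by (subst bounded_linear_Blinfun_apply)
    (auto intro: bounded_linear_compose[OF bounded_linear_scaleC_ell2] blinfun.bounded_linear_right)

definition op_of_map :: "('i ell2 \<Rightarrow> 'i ell2) \<Rightarrow> 'i ell2_op"
  where "op_of_map F = Abs_ell2_op (Blinfun F)"

lemma op_of_map_apply:
  assumes "\<And>x y. F (x + y) = F x + F y" "\<And>c x. F (c *\<^sub>C x) = c *\<^sub>C F x"
    and "\<And>x. norm (F x) \<le> B * norm x"
  shows "op_apply (op_of_map F) = F"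
proof -
  have "bounded_linear F"
    by (rule bounded_linear_intro[of F B]) (use assms in \<open>auto simp: scaleR_scaleC mult.commute\<close>)
  thus ?thesis
    using assms(2)
    by (simp add: op_apply_def op_of_map_def Abs_ell2_op_inverse bounded_linear_Blinfun_apply)
qed

text \<open>The adjoint is given by its coordinates; it is characterised by \<open>cinner_star\<close> below.\<close>

definition op_adjoint_apply :: "'i ell2_op \<Rightarrow> 'i ell2 \<Rightarrow> 'i ell2"
  where "op_adjoint_apply T y = Abs_ell2 (\<lambda>i. cinner (op_apply T (ket i)) y)"

instantiation ell2_op :: (type) "{complex_vector, ring_1, star}"
begin

lift_definition zero_ell2_op :: "'a ell2_op" is 0 by simp
lift_definition one_ell2_op :: "'a ell2_op" is id_blinfun by simp
lift_definition plus_ell2_op :: "'a ell2_op \<Rightarrow> 'a ell2_op \<Rightarrow> 'a ell2_op" is "(+)"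
  by (simp add: blinfun.add_left scaleC_add_right)
lift_definition uminus_ell2_op :: "'a ell2_op \<Rightarrow> 'a ell2_op" is uminus
  by (simp add: blinfun.minus_left) (metis add.inverse_inverse add_eq_0_iff2 scaleC_add_right scaleC_zero_right)
lift_definition minus_ell2_op :: "'a ell2_op \<Rightarrow> 'a ell2_op \<Rightarrow> 'a ell2_op" is "(-)"
  by (simp add: blinfun.diff_left) (metis add_diff_cancel diff_add_cancel scaleC_add_right)
lift_definition times_ell2_op :: "'a ell2_op \<Rightarrow> 'a ell2_op \<Rightarrow> 'a ell2_op" is "(o\<^sub>L)"
  by simp
lift_definition scaleR_ell2_op :: "real \<Rightarrow> 'a ell2_op \<Rightarrow> 'a ell2_op" is "(*\<^sub>R)"
  by (simp add: blinfun.scaleR_left scaleR_scaleC scaleC_scaleC mult.commute)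
lift_definition scaleC_ell2_op :: "complex \<Rightarrow> 'a ell2_op \<Rightarrow> 'a ell2_op"
  is "\<lambda>c T. Blinfun (\<lambda>x. c *\<^sub>C blinfun_apply T x)"
  by (simp add: scaleC_blinfun_apply scaleC_scaleC mult.commute)
definition star_ell2_op :: "'a ell2_op \<Rightarrow> 'a ell2_op"
  where "star T = op_of_map (op_adjoint_apply T)"

lemma op_apply_rules:
  "op_apply 0 x = 0" "op_apply 1 x = x" "op_apply (S + T) x = op_apply S x + op_apply T x"
  "op_apply (- T) x = - op_apply T x" "op_apply (S - T) x = op_apply S x - op_apply T x"
  "op_apply (S * T) x = op_apply S (op_apply T x)" "op_apply (r *\<^sub>R T) x = r *\<^sub>R op_apply T x"
  "op_apply (c *\<^sub>C T) x = c *\<^sub>C op_apply T x"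
  by (simp_all add: op_apply_def zero_ell2_op.rep_eq one_ell2_op.rep_eq plus_ell2_op.rep_eq
      uminus_ell2_op.rep_eq minus_ell2_op.rep_eq times_ell2_op.rep_eq scaleR_ell2_op.rep_eq
      scaleC_ell2_op.rep_eq blinfun.add_left blinfun.diff_left blinfun.minus_left
      blinfun.scaleR_left scaleC_blinfun_apply)

instance
proof
  have "ell2_apply (ket (undefined :: 'a)) undefined = 1"
    by (simp add: ket.rep_eq)
  hence "op_apply 0 (ket (undefined :: 'a)) \<noteq> op_apply 1 (ket undefined)"
    by (metis ell2_apply_simps(1) op_apply_rules(1,2) zero_neq_one)
  thus "(0 :: 'a ell2_op) \<noteq> 1"
    by metis
qed (rule op_eqI, simp add: op_apply_rules scaleC_add_right scaleC_add_left scaleC_scaleC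
      scaleR_scaleC algebra_simps)+

end

instantiation ell2_op :: (type) real_normed_algebra_1
begin

lift_definition norm_ell2_op :: "'a ell2_op \<Rightarrow> real" is norm .
definition dist_ell2_op :: "'a ell2_op \<Rightarrow> 'a ell2_op \<Rightarrow> real"
  where "dist_ell2_op x y = norm (x - y)"
definition sgn_ell2_op :: "'a ell2_op \<Rightarrow> 'a ell2_op"
  where "sgn_ell2_op x = x /\<^sub>R norm x"
definition uniformity_ell2_op :: "('a ell2_op \<times> 'a ell2_op) filter"
  where "uniformity_ell2_op = (INF e\<in>{0 <..}. principal {(x, y). dist x y < e})"
definition open_ell2_op :: "'a ell2_op set \<Rightarrow> bool"
  where "open_ell2_op U \<longleftrightarrow> (\<forall>x\<in>U. eventually (\<lambda>(x', y). x' = x \<longrightarrow> y \<in> U) uniformity)"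

instance
proof
  fix x y z :: "'a ell2_op" and r :: real and U :: "'a ell2_op set"
  show "dist x y = norm (x - y)" by (simp add: dist_ell2_op_def)
  show "sgn x = x /\<^sub>R norm x" by (simp add: sgn_ell2_op_def)
  show "uniformity = (INF e\<in>{0 <..}. principal {(x::'a ell2_op, y). dist x y < e})"
    by (simp add: uniformity_ell2_op_def)
  show "open U = (\<forall>x\<in>U. eventually (\<lambda>(x', y). x' = x \<longrightarrow> y \<in> U) uniformity)"
    by (simp add: open_ell2_op_def)
  show "norm x = 0 \<longleftrightarrow> x = 0" by transfer simp
  show "norm (x + y) \<le> norm x + norm y" by transfer (rule norm_triangle_ineq)
  show "norm (r *\<^sub>R x) = \<bar>r\<bar> * norm x" by transfer simp
  show "r *\<^sub>R x * y = r *\<^sub>R (x * y)"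
    by (rule op_eqI) (simp add: op_apply_rules)
  show "x * r *\<^sub>R y = r *\<^sub>R (x * y)"
    by (rule op_eqI) (simp add: op_apply_rules scaleR_scaleC)
  show "norm (x * y) \<le> norm x * norm y"
    by transfer (rule norm_blinfun_compose)
  have "norm (ket (undefined :: 'a)) \<ge> 1"
    using ell2_apply_le_norm[of "ket (undefined :: 'a)" undefined] by (simp add: ket.rep_eq)
  hence "ket (undefined :: 'a) \<noteq> 0"
    by auto
  show "norm (1 :: 'a ell2_op) = 1"
  proof transfer
    show "norm (id_blinfun :: 'a ell2 \<Rightarrow>\<^sub>L 'a ell2) = 1"
    proof (rule antisym)
      show "norm (id_blinfun :: 'a ell2 \<Rightarrow>\<^sub>L 'a ell2) \<le> 1"
        by (rule norm_blinfun_bound) auto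
      have "norm (ket (undefined :: 'a)) \<le> norm (id_blinfun :: 'a ell2 \<Rightarrow>\<^sub>L 'a ell2) * norm (ket (undefined :: 'a))"
        using norm_blinfun[of "id_blinfun :: 'a ell2 \<Rightarrow>\<^sub>L 'a ell2" "ket (undefined :: 'a)"] by simp
      thus "1 \<le> norm (id_blinfun :: 'a ell2 \<Rightarrow>\<^sub>L 'a ell2)"
        using \<open>ket (undefined :: 'a) \<noteq> 0\<close> by simp
    qed
  qed
qed

end

lemma norm_op_apply: "norm (op_apply T x) \<le> norm T * norm x"
  by (simp add: op_apply_def norm_ell2_op.rep_eq norm_blinfun)

lemma norm_op_leI: "0 \<le> B \<Longrightarrow> (\<And>x. norm (op_apply T x) \<le> B * norm x) \<Longrightarrow> norm T \<le> B"
  by (simp add: op_apply_def norm_ell2_op.rep_eq norm_blinfun_bound)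

instance ell2_op :: (type) banach
proof
  fix X :: "nat \<Rightarrow> 'a ell2_op"
  assume "Cauchy X"
  hence "Cauchy (\<lambda>n. op_blinfun (X n))"
    by (simp add: Cauchy_def dist_norm flip: norm_ell2_op.rep_eq minus_ell2_op.rep_eq)
  then obtain T where T: "(\<lambda>n. op_blinfun (X n)) \<longlonglongrightarrow> T"
    using Cauchy_convergent_iff convergent_def by blast
  have "blinfun_apply T (c *\<^sub>C x) = c *\<^sub>C blinfun_apply T x" for c x
  proof (rule LIMSEQ_unique)
    have "(\<lambda>n. op_apply (X n) (c *\<^sub>C x)) \<longlonglongrightarrow> blinfun_apply T (c *\<^sub>C x)"
      unfolding op_apply_def by (intro blinfun.tendsto T tendsto_const)
    thus "(\<lambda>n. c *\<^sub>C op_apply (X n) x) \<longlonglongrightarrow> blinfun_apply T (c *\<^sub>C x)"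
      by simp
    show "(\<lambda>n. c *\<^sub>C op_apply (X n) x) \<longlonglongrightarrow> c *\<^sub>C blinfun_apply T x"
      unfolding op_apply_def
      by (intro bounded_linear.tendsto[OF bounded_linear_scaleC_ell2] blinfun.tendsto T tendsto_const)
  qed
  hence "op_blinfun (Abs_ell2_op T) = T"
    by (simp add: Abs_ell2_op_inverse)
  hence "X \<longlonglongrightarrow> Abs_ell2_op T"
    using T by (simp add: LIMSEQ_iff flip: norm_ell2_op.rep_eq minus_ell2_op.rep_eq)
               (simp add: norm_ell2_op.rep_eq minus_ell2_op.rep_eq)
  thus "convergent X"
    by (auto simp: convergent_def)
qed

lemma cinner_diff_left: "cinner (x - y) z = cinner x z - cinner y z"
  by (metis add_diff_cancel cinner_add_left diff_add_cancel)

lemma cinner_sum_left: "cinner (sum f F) y = (\<Sum>i\<in>F. cinner (f i) y)"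
  by (induction F rule: infinite_finite_induct) (simp_all add: cinner_add_left)

lemma op_apply_sum: "op_apply T (sum f F) = (\<Sum>i\<in>F. op_apply T (f i))"
  by (induction F rule: infinite_finite_induct) simp_all

lemma ell2_apply_sum: "ell2_apply (sum f F) j = (\<Sum>i\<in>F. ell2_apply (f i) j)"
  by (induction F rule: infinite_finite_induct) simp_all

lemma ell2_apply_sum_ket:
  assumes "finite F"
  shows "ell2_apply (\<Sum>i\<in>F. a i *\<^sub>C ket i) j = (if j \<in> F then a j else 0)"
proof -
  have "ell2_apply (\<Sum>i\<in>F. a i *\<^sub>C ket i) j = (\<Sum>i\<in>F. if i = j then a i else 0)"
    unfolding ell2_apply_sum by (intro sum.cong) (auto simp: ket.rep_eq)
  thus ?thesis using assms by simp
qed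

lemma norm_sum_ket:
  assumes "finite F"
  shows "(norm (\<Sum>i\<in>F. a i *\<^sub>C ket i))\<^sup>2 = (\<Sum>i\<in>F. (cmod (a i))\<^sup>2)"
proof -
  have "(\<Sum>\<^sub>\<infinity>j. (cmod (ell2_apply (\<Sum>i\<in>F. a i *\<^sub>C ket i) j))\<^sup>2) = (\<Sum>\<^sub>\<infinity>j\<in>F. (cmod (a j))\<^sup>2)"
    by (rule infsum_cong_neutral) (auto simp: ell2_apply_sum_ket assms)
  thus ?thesis using assms by (simp add: ell2_norm_sq)
qed

lemma op_adjoint_sum_le:
  assumes "finite F"
  shows "(\<Sum>i\<in>F. (cmod (cinner (op_apply T (ket i)) y))\<^sup>2) \<le> (norm T * norm y)\<^sup>2"
proof -
  define a where "a i = cinner (op_apply T (ket i)) y" for i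
  define z where "z = (\<Sum>i\<in>F. a i *\<^sub>C ket i)"
  have nz: "(norm z)\<^sup>2 = (\<Sum>i\<in>F. (cmod (a i))\<^sup>2)"
    unfolding z_def by (rule norm_sum_ket[OF assms])
  have "cinner (op_apply T z) y = (\<Sum>i\<in>F. cnj (a i) * a i)"
    by (simp add: z_def op_apply_sum cinner_sum_left cinner_scaleC_left flip: a_def)
  also have "\<dots> = complex_of_real ((norm z)\<^sup>2)"
    by (simp only: nz of_real_sum complex_norm_square mult.commute)
  finally have "(norm z)\<^sup>2 = cmod (cinner (op_apply T z) y)"
    by (simp only: norm_of_real abs_power2 power2_abs)
  also have "\<dots> \<le> norm (op_apply T z) * norm y"
    by (rule cinner_cauchy_schwarz)
  also have "\<dots> \<le> (norm T * norm z) * norm y"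
    by (intro mult_right_mono norm_op_apply norm_ge_zero)
  finally have "norm z * norm z \<le> norm z * (norm T * norm y)"
    by (simp add: power2_eq_square mult_ac)
  hence "norm z \<le> norm T * norm y"
    by (metis less_eq_real_def mult_le_cancel_left_pos mult_nonneg_nonneg norm_ge_zero)
  hence "(norm z)\<^sup>2 \<le> (norm T * norm y)\<^sup>2"
    by (rule power_mono) simp
  thus ?thesis
    by (simp only: nz a_def)
qed

lemma op_adjoint_apply_nth:
  "ell2_apply (op_adjoint_apply T y) i = cinner (op_apply T (ket i)) y"
  unfolding op_adjoint_apply_def
  by (subst Abs_ell2_inverse) (auto intro!: square_summableI op_adjoint_sum_le)

lemma op_adjoint_norm: "norm (op_adjoint_apply T y) \<le> norm T * norm y"
  by (rule ell2_norm_leI) (simp_all add: op_adjoint_apply_nth op_adjoint_sum_le)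

lemma op_adjoint_add: "op_adjoint_apply T (x + y) = op_adjoint_apply T x + op_adjoint_apply T y"
  by (rule ell2_eqI) (simp add: op_adjoint_apply_nth cinner_add_right)

lemma op_adjoint_scaleC: "op_adjoint_apply T (c *\<^sub>C y) = c *\<^sub>C op_adjoint_apply T y"
  by (rule ell2_eqI) (simp add: op_adjoint_apply_nth cinner_scaleC_right)

lemma op_apply_star: "op_apply (star T) = op_adjoint_apply T"
  unfolding star_ell2_op_def
  by (rule op_of_map_apply[OF op_adjoint_add op_adjoint_scaleC op_adjoint_norm])

lemma ell2_ket_dense:
  assumes "0 < e"
  shows "\<exists>F. finite F \<and> norm (x - (\<Sum>i\<in>F. ell2_apply x i *\<^sub>C ket i)) < e"
proof -
  have "((\<lambda>i. (cmod (ell2_apply x i))\<^sup>2) has_sum (norm x)\<^sup>2) UNIV"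
    using has_sum_infsum[OF ell2_summable[of x]] by (simp add: ell2_norm_sq)
  then obtain F where F: "finite F" "dist (\<Sum>i\<in>F. (cmod (ell2_apply x i))\<^sup>2) ((norm x)\<^sup>2) < e\<^sup>2"
    using assms unfolding has_sum_def tendsto_iff eventually_finite_subsets_at_top
    by (meson order_refl zero_less_power)
  define w where "w = (\<Sum>i\<in>F. ell2_apply x i *\<^sub>C ket i)"
  have "cinner w x = (\<Sum>i\<in>F. cnj (ell2_apply x i) * ell2_apply x i)"
    by (simp add: w_def cinner_sum_left cinner_scaleC_left cinner_ket)
  also have "\<dots> = complex_of_real (\<Sum>i\<in>F. (cmod (ell2_apply x i))\<^sup>2)"
    by (simp only: of_real_sum complex_norm_square mult.commute)
  finally have "inner w x = (\<Sum>i\<in>F. (cmod (ell2_apply x i))\<^sup>2)"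
    by (simp only: inner_ell2_def complex.sel Re_complex_of_real)
  moreover have "(norm w)\<^sup>2 = (\<Sum>i\<in>F. (cmod (ell2_apply x i))\<^sup>2)"
    unfolding w_def by (rule norm_sum_ket[OF F(1)])
  ultimately have "(norm (x - w))\<^sup>2 = (norm x)\<^sup>2 - (\<Sum>i\<in>F. (cmod (ell2_apply x i))\<^sup>2)"
    by (simp add: power2_norm_eq_inner inner_diff_left inner_diff_right inner_commute)
  hence "(norm (x - w))\<^sup>2 < e\<^sup>2"
    using F(2) unfolding dist_real_def by linarith
  hence "norm (x - w) < e"
    by (rule power_less_imp_less_base) (use assms in simp)
  thus ?thesis
    using F(1) w_def by blast
qed

lemma cinner_star: "cinner (op_apply T x) y = cinner x (op_apply (star T) y)"
proof -
  define C where "C = 2 * (norm T * norm y) + 1"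
  have "C > 0" by (simp add: C_def add_nonneg_pos)
  have "cmod (cinner (op_apply T x) y - cinner x (op_adjoint_apply T y)) \<le> 0 + e" if "e > 0" for e
  proof -
    obtain F where F: "finite F" "norm (x - (\<Sum>i\<in>F. ell2_apply x i *\<^sub>C ket i)) < e / C"
      using ell2_ket_dense[of "e / C" x] \<open>e > 0\<close> \<open>C > 0\<close> by auto
    define w where "w = (\<Sum>i\<in>F. ell2_apply x i *\<^sub>C ket i)"
    have key: "cinner (op_apply T w) y = cinner w (op_adjoint_apply T y)"
      by (simp add: w_def op_apply_sum cinner_sum_left cinner_scaleC_left cinner_ket
          op_adjoint_apply_nth)
    have "cinner (op_apply T x) y - cinner x (op_adjoint_apply T y)
        = cinner (op_apply T (x - w)) y - cinner (x - w) (op_adjoint_apply T y)"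
      using key by (simp add: cinner_diff_left op_apply_def blinfun.diff_right)
    also have "cmod \<dots> \<le> norm T * norm (x - w) * norm y + norm (x - w) * (norm T * norm y)"
      by (intro order_trans[OF norm_triangle_ineq4] add_mono
          order_trans[OF cinner_cauchy_schwarz] mult_right_mono mult_left_mono norm_op_apply
          op_adjoint_norm norm_ge_zero)
    also have "\<dots> \<le> C * norm (x - w)"
      by (simp add: C_def algebra_simps)
    also have "\<dots> \<le> e"
      using F(2) \<open>C > 0\<close> by (simp add: w_def field_simps)
    finally show ?thesis by simp
  qed
  hence "cmod (cinner (op_apply T x) y - cinner x (op_adjoint_apply T y)) \<le> 0"
    by (rule field_le_epsilon)
  thus ?thesis by (simp add: op_apply_star)
qed

lemma cinner_star': "cinner x (op_apply T y) = cinner (op_apply (star T) x) y"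
  by (metis cinner_commute cinner_star)

lemma op_eq_cinnerI:
  assumes "\<And>x y. cinner x (op_apply S y) = cinner x (op_apply T y)"
  shows "S = T"
  by (rule op_eqI, rule ell2_eq_cinnerI) (rule assms)

instance ell2_op :: (type) cstar_algebra
proof
  fix x y :: "'a ell2_op" and c
  show "c *\<^sub>C x * y = c *\<^sub>C (x * y)"
    by (rule op_eqI) (simp add: op_apply_rules)
  show "x * c *\<^sub>C y = c *\<^sub>C (x * y)"
    by (rule op_eqI) (simp add: op_apply_rules)
  show ss: "star (star x) = x" for x :: "'a ell2_op"
    by (rule op_eq_cinnerI) (simp flip: cinner_star cinner_star')
  show "star (x + y) = star x + star y"
    by (rule op_eq_cinnerI)
      (simp add: op_apply_rules cinner_add_right cinner_add_left flip: cinner_star)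
  show "star (x * y) = star y * star x"
    by (rule op_eq_cinnerI) (simp add: op_apply_rules flip: cinner_star)
  show "star (c *\<^sub>C x) = cnj c *\<^sub>C star x"
    by (rule op_eq_cinnerI)
      (simp add: op_apply_rules cinner_scaleC_right cinner_scaleC_left flip: cinner_star)
  have le: "norm (star x) \<le> norm x" for x :: "'a ell2_op"
    by (rule norm_op_leI) (simp_all add: op_apply_star op_adjoint_norm)
  have eq: "norm (star x) = norm x"
    using le[of x] le[of "star x"] by (simp add: ss)
  show "norm (star x * x) = (norm x)\<^sup>2"
  proof (rule antisym)
    show "norm (star x * x) \<le> (norm x)\<^sup>2"
      using norm_mult_ineq[of "star x" x] by (simp add: eq power2_eq_square)
    have "norm (op_apply x v) \<le> sqrt (norm (star x * x)) * norm v" for v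
    proof (rule power2_le_imp_le)
      have "(norm (op_apply x v))\<^sup>2 = cmod (cinner (op_apply x v) (op_apply x v))"
        by (simp only: cinner_self_norm norm_of_real abs_power2)
      also have "\<dots> = cmod (cinner v (op_apply (star x * x) v))"
        by (simp add: cinner_star op_apply_rules)
      also have "\<dots> \<le> norm v * (norm (star x * x) * norm v)"
        by (intro order_trans[OF cinner_cauchy_schwarz] mult_left_mono norm_op_apply norm_ge_zero)
      finally show "(norm (op_apply x v))\<^sup>2 \<le> (sqrt (norm (star x * x)) * norm v)\<^sup>2"
        by (simp add: power_mult_distrib power2_eq_square[of "norm v"] mult_ac)
    qed simp
    hence "norm x \<le> sqrt (norm (star x * x))"
      by (intro norm_op_leI) simp_all
    hence "(norm x)\<^sup>2 \<le> (sqrt (norm (star x * x)))\<^sup>2"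
      by (rule power_mono) simp
    thus "(norm x)\<^sup>2 \<le> norm (star x * x)"
      by simp
  qed
qed

section \<open>Reduced crossed products of \<open>C(X)\<close> by \<open>\<int>\<close>\<close>

definition diag_op :: "('i \<Rightarrow> complex) \<Rightarrow> 'i ell2_op"
  where "diag_op h = op_of_map (\<lambda>\<xi>. Abs_ell2 (\<lambda>i. h i * ell2_apply \<xi> i))"

definition reindex_op :: "('i \<Rightarrow> 'i) \<Rightarrow> 'i ell2_op"
  where "reindex_op \<sigma> = op_of_map (\<lambda>\<xi>. Abs_ell2 (\<lambda>i. ell2_apply \<xi> (\<sigma> i)))"

lemma diag_op_apply:
  assumes "\<And>i. cmod (h i) \<le> B"
  shows "ell2_apply (op_apply (diag_op h) \<xi>) i = h i * ell2_apply \<xi> i"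
proof -
  have "0 \<le> B"
    using assms norm_ge_zero order_trans by blast
  have le: "(\<Sum>i\<in>F. (cmod (h i * ell2_apply \<xi> i))\<^sup>2) \<le> (B * norm \<xi>)\<^sup>2" if "finite F" for F \<xi>
  proof -
    have "(\<Sum>i\<in>F. (cmod (h i * ell2_apply \<xi> i))\<^sup>2) \<le> (\<Sum>i\<in>F. B\<^sup>2 * (cmod (ell2_apply \<xi> i))\<^sup>2)"
      by (intro sum_mono) (simp add: norm_mult power_mult_distrib assms mult_right_mono power_mono)
    also have "\<dots> \<le> B\<^sup>2 * (norm \<xi>)\<^sup>2"
      using ell2_sum_le_norm[OF that, of \<xi>]
      by (simp add: mult_left_mono flip: sum_distrib_left)
    finally show ?thesis by (simp add: power_mult_distrib)
  qed
  have nth: "ell2_apply (Abs_ell2 (\<lambda>i. h i * ell2_apply \<xi> i)) = (\<lambda>i. h i * ell2_apply \<xi> i)" for \<xi>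
    by (subst Abs_ell2_inverse) (auto intro!: square_summableI le)
  have "op_apply (diag_op h) = (\<lambda>\<xi>. Abs_ell2 (\<lambda>i. h i * ell2_apply \<xi> i))"
    unfolding diag_op_def
  proof (rule op_of_map_apply[where B = B])
    show "norm (Abs_ell2 (\<lambda>i. h i * ell2_apply \<xi> i)) \<le> B * norm \<xi>" for \<xi>
      by (rule ell2_norm_leI) (simp_all add: nth le \<open>0 \<le> B\<close>)
  qed (rule ell2_eqI, subst nth, simp add: nth algebra_simps)+
  thus ?thesis by (simp add: nth)
qed

lemma reindex_op_apply:
  assumes "inj \<sigma>"
  shows "ell2_apply (op_apply (reindex_op \<sigma>) \<xi>) i = ell2_apply \<xi> (\<sigma> i)"
proof -
  have le: "(\<Sum>i\<in>F. (cmod (ell2_apply \<xi> (\<sigma> i)))\<^sup>2) \<le> (norm \<xi>)\<^sup>2" if "finite F" for F \<xi>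
  proof -
    have "(\<Sum>i\<in>F. (cmod (ell2_apply \<xi> (\<sigma> i)))\<^sup>2) = (\<Sum>i\<in>\<sigma> ` F. (cmod (ell2_apply \<xi> i))\<^sup>2)"
      using assms by (subst sum.reindex) (auto intro: inj_on_subset)
    thus ?thesis
      using ell2_sum_le_norm[of "\<sigma> ` F" \<xi>] that by simp
  qed
  have nth: "ell2_apply (Abs_ell2 (\<lambda>i. ell2_apply \<xi> (\<sigma> i))) = (\<lambda>i. ell2_apply \<xi> (\<sigma> i))" for \<xi>
    by (subst Abs_ell2_inverse) (auto intro!: square_summableI le)
  have "op_apply (reindex_op \<sigma>) = (\<lambda>\<xi>. Abs_ell2 (\<lambda>i. ell2_apply \<xi> (\<sigma> i)))"
    unfolding reindex_op_def
  proof (rule op_of_map_apply[where B = 1])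
    show "norm (Abs_ell2 (\<lambda>i. ell2_apply \<xi> (\<sigma> i))) \<le> 1 * norm \<xi>" for \<xi>
      by (rule ell2_norm_leI) (simp_all add: nth le)
  qed (rule ell2_eqI, subst nth, simp add: nth)+
  thus ?thesis by (simp add: nth)
qed

lemma star_reindex_op:
  assumes "bij \<sigma>"
  shows "star (reindex_op \<sigma>) = reindex_op (inv \<sigma>)"
proof (rule op_eq_cinnerI)
  fix x y
  have inj: "inj \<sigma>" "inj (inv \<sigma>)"
    using assms by (simp_all add: bij_is_inj bij_imp_bij_inv)
  have "cinner (op_apply (reindex_op \<sigma>) x) y
      = (\<Sum>\<^sub>\<infinity>i. cnj (ell2_apply x (\<sigma> i)) * ell2_apply y i)"
    by (simp add: cinner_def reindex_op_apply inj)
  also have "\<dots> = (\<Sum>\<^sub>\<infinity>i. cnj (ell2_apply x i) * ell2_apply y (inv \<sigma> i))"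
    using infsum_reindex_bij_betw[OF assms, of "\<lambda>i. cnj (ell2_apply x i) * ell2_apply y (inv \<sigma> i)"] inj
    by simp
  also have "\<dots> = cinner x (op_apply (reindex_op (inv \<sigma>)) y)"
    by (simp add: cinner_def reindex_op_apply inj)
  finally show "cinner x (op_apply (star (reindex_op \<sigma>)) y) = cinner x (op_apply (reindex_op (inv \<sigma>)) y)"
    by (simp add: cinner_star)
qed

definition int_iterate :: "('b \<Rightarrow> 'b) \<Rightarrow> int \<Rightarrow> 'b \<Rightarrow> 'b"
  where "int_iterate \<beta> n = (if 0 \<le> n then \<beta> ^^ nat n else inv \<beta> ^^ nat (- n))"

lemma int_iterate_Suc:
  assumes "bij \<beta>"
  shows "int_iterate \<beta> (n + 1) f = int_iterate \<beta> n (\<beta> f)"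
proof (cases "0 \<le> n")
  case True
  hence "nat (n + 1) = Suc (nat n)" by simp
  thus ?thesis using True by (simp add: int_iterate_def funpow_swap1)
next
  case False
  hence n: "nat (- n) = Suc (nat (- (n + 1)))" by simp
  have "(inv \<beta> ^^ nat (- n)) (\<beta> f) = (inv \<beta> ^^ nat (- (n + 1))) f"
    using assms unfolding n by (simp add: funpow_swap1 bij_is_inj)
  thus ?thesis using False n by (auto simp: int_iterate_def)
qed

definition cnj_bcontfun :: "('x::topological_space \<Rightarrow>\<^sub>C complex) \<Rightarrow> 'x \<Rightarrow>\<^sub>C complex"
  where "cnj_bcontfun f = Bcontfun (\<lambda>x. cnj (apply_bcontfun f x))"

lemma cnj_bcontfun_apply: "apply_bcontfun (cnj_bcontfun f) x = cnj (apply_bcontfun f x)"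
proof -
  have "continuous_on UNIV (\<lambda>x. cnj (apply_bcontfun f x))"
    by (intro continuous_intros continuous_on_apply_bcontfun)
  hence "(\<lambda>x. cnj (apply_bcontfun f x)) \<in> bcontfun"
    by (rule bcontfun_normI[of _ "norm f"]) (simp add: norm_bounded)
  thus ?thesis by (simp add: cnj_bcontfun_def Bcontfun_inverse)
qed

text \<open>
  The algebra \<open>C(X)\<close> is represented faithfully on \<open>\<ell>\<^sup>2(X)\<close> by multiplication operators; the reduced
  crossed product is realised through the induced regular representation on
  \<open>\<ell>\<^sup>2(\<int>, \<ell>\<^sup>2(X)) = \<ell>\<^sup>2(\<int> \<times> X)\<close>, in which \<open>(f \<xi>)(n) = \<beta>\<^sup>-\<^sup>n(f) \<xi>(n)\<close> and \<open>(U \<xi>)(n) = \<xi>(n - 1)\<close>.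
  The relation \<open>U f U\<^sup>* = \<beta>(f)\<close> is \<open>crossed_covariance\<close> below.
\<close>

definition coeff_op ::
    "(('x::topological_space \<Rightarrow>\<^sub>C complex) \<Rightarrow> ('x \<Rightarrow>\<^sub>C complex)) \<Rightarrow> ('x \<Rightarrow>\<^sub>C complex) \<Rightarrow> (int \<times> 'x) ell2_op"
  where "coeff_op \<beta> f = diag_op (\<lambda>(n, p). apply_bcontfun (int_iterate \<beta> (- n) f) p)"

definition shift_op :: "(int \<times> 'x) ell2_op"
  where "shift_op = reindex_op (\<lambda>(n, p). (n - 1, p))"

definition shift_power :: "int \<Rightarrow> (int \<times> 'x) ell2_op"
  where "shift_power n = (if 0 \<le> n then shift_op ^ nat n else star shift_op ^ nat (- n))"

definition finite_support :: "('v::zero) set \<Rightarrow> (int \<Rightarrow> 'v) set"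
  where "finite_support V = {x. finite {n. x n \<noteq> 0} \<and> (\<forall>n. x n \<in> V)}"

definition crossed_sum ::
    "(('x::topological_space \<Rightarrow>\<^sub>C complex) \<Rightarrow> ('x \<Rightarrow>\<^sub>C complex)) \<Rightarrow> (int \<Rightarrow> ('x \<Rightarrow>\<^sub>C complex)) \<Rightarrow> (int \<times> 'x) ell2_op"
  where "crossed_sum \<beta> x = (\<Sum>n | x n \<noteq> 0. coeff_op \<beta> (x n) * shift_power n)"

definition crossed_adjoint ::
    "(('x::topological_space \<Rightarrow>\<^sub>C complex) \<Rightarrow> ('x \<Rightarrow>\<^sub>C complex)) \<Rightarrow> (int \<Rightarrow> ('x \<Rightarrow>\<^sub>C complex)) \<Rightarrow> int \<Rightarrow> ('x \<Rightarrow>\<^sub>C complex)"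
  where "crossed_adjoint \<beta> x = (\<lambda>n. int_iterate \<beta> n (cnj_bcontfun (x (- n))))"

definition reduced_crossed_product ::
    "(('x::topological_space \<Rightarrow>\<^sub>C complex) \<Rightarrow> ('x \<Rightarrow>\<^sub>C complex)) \<Rightarrow> (int \<times> 'x) ell2_op set"
  where "reduced_crossed_product \<beta> = closure (crossed_sum \<beta> ` finite_support UNIV)"

text \<open>The subspace \<open>C\<^sub>c(\<int>, V)\<close>, as a set of elements of the crossed product.\<close>

definition crossed_subspace ::
    "(('x::topological_space \<Rightarrow>\<^sub>C complex) \<Rightarrow> ('x \<Rightarrow>\<^sub>C complex)) \<Rightarrow> ('x \<Rightarrow>\<^sub>C complex) set \<Rightarrow> (int \<times> 'x) ell2_op set"
  where "crossed_subspace \<beta> V = crossed_sum \<beta> ` finite_support V"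

text \<open>
  The semi-norm built from \<open>L : V \<rightarrow> [0, \<infinity>)\<close> and a norm on \<open>C\<^sub>c(\<int>)\<close>. An element of
  \<open>crossed_subspace \<beta> V\<close> determines its coefficients, see \<open>crossed_sum_inj\<close> below.
\<close>

definition crossed_seminorm ::
    "(('x::topological_space \<Rightarrow>\<^sub>C complex) \<Rightarrow> ('x \<Rightarrow>\<^sub>C complex)) \<Rightarrow> ('x \<Rightarrow>\<^sub>C complex) set
      \<Rightarrow> (('x \<Rightarrow>\<^sub>C complex) \<Rightarrow> real) \<Rightarrow> ((int \<Rightarrow> complex) \<Rightarrow> real) \<Rightarrow> (int \<times> 'x) ell2_op \<Rightarrow> real"
  where "crossed_seminorm \<beta> V L nrm a =
    (let x = inv_into (finite_support V) (crossed_sum \<beta>) a in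
      max (norm (crossed_sum \<beta> (\<lambda>n. real_of_int n *\<^sub>R x n)))
        (max (nrm (\<lambda>n. complex_of_real (L (x n))))
          (nrm (\<lambda>n. complex_of_real (L (crossed_adjoint \<beta> x n))))))"

definition order_preserving_norm :: "((int \<Rightarrow> complex) \<Rightarrow> real) \<Rightarrow> bool"
  where "order_preserving_norm nrm \<longleftrightarrow>
    (\<forall>h\<in>finite_support UNIV. 0 \<le> nrm h \<and> (nrm h = 0 \<longleftrightarrow> h = (\<lambda>_. 0))) \<and>
    (\<forall>h\<in>finite_support UNIV. \<forall>k\<in>finite_support UNIV. nrm (\<lambda>n. h n + k n) \<le> nrm h + nrm k) \<and>
    (\<forall>c. \<forall>h\<in>finite_support UNIV. nrm (\<lambda>n. c * h n) = cmod c * nrm h) \<and>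
    (\<forall>h\<in>finite_support UNIV. \<forall>k\<in>finite_support UNIV.
      (\<forall>n. h n \<in> \<real> \<and> k n \<in> \<real> \<and> 0 \<le> Re (h n) \<and> Re (h n) \<le> Re (k n)) \<longrightarrow> nrm h \<le> nrm k)"

definition pullback :: "('x \<Rightarrow> 'x) \<Rightarrow> ('x::topological_space \<Rightarrow>\<^sub>C complex) \<Rightarrow> ('x \<Rightarrow>\<^sub>C complex)"
  where "pullback \<psi> f = Bcontfun (apply_bcontfun f \<circ> \<psi>)"

lemma pullback_apply:
  assumes "continuous_on UNIV \<psi>"
  shows "apply_bcontfun (pullback \<psi> f) p = apply_bcontfun f (\<psi> p)"
proof -
  have "continuous_on UNIV (apply_bcontfun f \<circ> \<psi>)"
    by (intro continuous_on_compose assms continuous_on_apply_bcontfun)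
  hence "apply_bcontfun f \<circ> \<psi> \<in> bcontfun"
    by (rule bcontfun_normI[of _ "norm f"]) (simp add: norm_bounded)
  thus ?thesis by (simp add: pullback_def Bcontfun_inverse)
qed

lemma pullback_inverse:
  assumes "bij \<psi>" "continuous_on UNIV \<psi>" "continuous_on UNIV (inv \<psi>)"
  shows "bij (pullback \<psi>)" "inv (pullback \<psi>) = pullback (inv \<psi>)"
proof -
  have *: "pullback (inv \<psi>) \<circ> pullback \<psi> = id" "pullback \<psi> \<circ> pullback (inv \<psi>) = id"
    using assms
    by (auto intro!: ext bcontfun_eqI simp: pullback_apply bij_is_surj bij_is_inj surj_f_inv_f)
  show "bij (pullback \<psi>)" by (rule o_bij[OF *])
  show "inv (pullback \<psi>) = pullback (inv \<psi>)"
    by (rule inv_unique_comp[OF *(2,1)])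
qed

lemma int_iterate_pullback_bound:
  assumes "bij \<psi>" "continuous_on UNIV \<psi>" "continuous_on UNIV (inv \<psi>)"
  shows "cmod (apply_bcontfun (int_iterate (pullback \<psi>) n f) p) \<le> norm f"
proof -
  have *: "cmod (apply_bcontfun ((pullback \<phi> ^^ k) f) p) \<le> norm f"
    if "continuous_on UNIV \<phi>" for \<phi> :: "'a \<Rightarrow> 'a" and k p
    by (induction k arbitrary: p) (simp_all add: norm_bounded pullback_apply that)
  show ?thesis
    by (simp add: int_iterate_def pullback_inverse(2)[OF assms] * assms)
qed

lemma bij_int_shift: "bij (\<lambda>(n :: int, p). (n - 1, p))" "bij (\<lambda>(n :: int, p). (n + 1, p))"
  "inv (\<lambda>(n :: int, p). (n - 1, p)) = (\<lambda>(n, p). (n + 1, p))"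
proof -
  have *: "(\<lambda>(n :: int, p). (n - 1, p)) \<circ> (\<lambda>(n, p). (n + 1, p)) = id"
    "(\<lambda>(n :: int, p). (n + 1, p)) \<circ> (\<lambda>(n, p). (n - 1, p)) = id"
    by auto
  show "bij (\<lambda>(n :: int, p). (n - 1, p))" "bij (\<lambda>(n :: int, p). (n + 1, p))"
    by (rule o_bij[OF *(2,1)], rule o_bij[OF *])
  show "inv (\<lambda>(n :: int, p). (n - 1, p)) = (\<lambda>(n, p). (n + 1, p))"
    by (rule inv_unique_comp[OF *])
qed

lemma shift_op_apply: "ell2_apply (op_apply shift_op \<xi>) (n, p) = ell2_apply \<xi> (n - 1, p)"
  by (simp add: shift_op_def reindex_op_apply bij_int_shift bij_is_inj)

lemma star_shift_op_apply: "ell2_apply (op_apply (star shift_op) \<xi>) (n, p) = ell2_apply \<xi> (n + 1, p)"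
  by (simp add: shift_op_def star_reindex_op reindex_op_apply bij_int_shift bij_is_inj)

lemma shift_op_unitary: "star shift_op * shift_op = 1" "shift_op * star shift_op = 1"
  by (auto intro!: op_eqI ell2_eqI simp: op_apply_rules shift_op_apply star_shift_op_apply)

lemma shift_power_apply:
  "ell2_apply (op_apply (shift_power k) \<xi>) (n, p) = ell2_apply \<xi> (n - k, p)"
proof -
  have 1: "ell2_apply (op_apply (shift_op ^ j) \<xi>) (n, p) = ell2_apply \<xi> (n - int j, p)" for j n
    by (induction j arbitrary: n) (simp_all add: op_apply_rules shift_op_apply algebra_simps)
  have 2: "ell2_apply (op_apply (star shift_op ^ j) \<xi>) (n, p) = ell2_apply \<xi> (n + int j, p)" for j n
    by (induction j arbitrary: n) (simp_all add: op_apply_rules star_shift_op_apply algebra_simps)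
  show ?thesis by (simp add: shift_power_def 1 2)
qed

context
  fixes \<psi> :: "'x::topological_space \<Rightarrow> 'x"
  assumes homeo: "bij \<psi>" "continuous_on UNIV \<psi>" "continuous_on UNIV (inv \<psi>)"
begin

lemma coeff_op_apply:
  "ell2_apply (op_apply (coeff_op (pullback \<psi>) f) \<xi>) (n, p)
    = apply_bcontfun (int_iterate (pullback \<psi>) (- n) f) p * ell2_apply \<xi> (n, p)"
proof -
  have "cmod (case i of (n, p) \<Rightarrow> apply_bcontfun (int_iterate (pullback \<psi>) (- n) f) p) \<le> norm f" for i
    by (cases i) (simp add: int_iterate_pullback_bound[OF homeo])
  from diag_op_apply[OF this, where \<xi> = \<xi> and i = "(n, p)"] show ?thesis
    by (simp add: coeff_op_def)
qed

lemma crossed_covariance: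
  "shift_op * coeff_op (pullback \<psi>) f * star shift_op = coeff_op (pullback \<psi>) (pullback \<psi> f)"
proof (rule op_eqI, rule ell2_eqI)
  fix \<xi> and i :: "int \<times> 'x"
  obtain n p where i: "i = (n, p)" by (cases i)
  show "ell2_apply (op_apply (shift_op * coeff_op (pullback \<psi>) f * star shift_op) \<xi>) i
      = ell2_apply (op_apply (coeff_op (pullback \<psi>) (pullback \<psi> f)) \<xi>) i"
    using int_iterate_Suc[OF pullback_inverse(1)[OF homeo], of "- n" f]
    by (simp add: i op_apply_rules shift_op_apply star_shift_op_apply coeff_op_apply)
qed

lemma op_apply_sum_left: "op_apply (sum g F) \<xi> = (\<Sum>i\<in>F. op_apply (g i) \<xi>)"
  by (induction F rule: infinite_finite_induct) (simp_all add: op_apply_rules)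

lemma crossed_sum_coeff:
  assumes "finite {n. x n \<noteq> 0}"
  shows "ell2_apply (op_apply (crossed_sum (pullback \<psi>) x) (ket (- n, p))) (0, p) = apply_bcontfun (x n) p"
proof -
  have "ell2_apply (op_apply (crossed_sum (pullback \<psi>) x) (ket (- n, p))) (0, p)
      = (\<Sum>k | x k \<noteq> 0. if n = k then apply_bcontfun (x k) p else 0)"
    unfolding crossed_sum_def op_apply_sum_left ell2_apply_sum
    by (intro sum.cong)
      (auto simp: op_apply_rules coeff_op_apply shift_power_apply ket.rep_eq int_iterate_def)
  also have "\<dots> = apply_bcontfun (x n) p"
    using assms by (simp add: zero_bcontfun.rep_eq)
  finally show ?thesis .
qed

lemma crossed_sum_inj: "inj_on (crossed_sum (pullback \<psi>)) (finite_support V)"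
proof (rule inj_onI)
  fix x y assume xy: "x \<in> finite_support V" "y \<in> finite_support V"
    and "crossed_sum (pullback \<psi>) x = crossed_sum (pullback \<psi>) y"
  hence "apply_bcontfun (x n) p = apply_bcontfun (y n) p" for n p
    using crossed_sum_coeff[of x n p] crossed_sum_coeff[of y n p] by (simp add: finite_support_def)
  thus "x = y"
    by (intro ext bcontfun_eqI) auto
qed

end

section \<open>Compact quantum metric spaces\<close>

definition metrizes :: "('p \<Rightarrow> 'p \<Rightarrow> ennreal) \<Rightarrow> 'p topology \<Rightarrow> bool"
  where "metrizes \<rho> X \<longleftrightarrow>
    (\<forall>\<mu>\<in>topspace X. \<forall>\<nu>\<in>topspace X. \<rho> \<mu> \<nu> < \<infinity>) \<and>
    Metric_space (topspace X) (\<lambda>\<mu> \<nu>. enn2real (\<rho> \<mu> \<nu>)) \<and>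
    Metric_space.mtopology (topspace X) (\<lambda>\<mu> \<nu>. enn2real (\<rho> \<mu> \<nu>)) = X"

text \<open>
  Functionals on a subspace \<open>V\<close> of a type are functions that are \<open>undefined\<close> outside \<open>V\<close>.
\<close>

definition functional_dist ::
    "'v set \<Rightarrow> ('v \<Rightarrow> real) \<Rightarrow> ('v \<Rightarrow> 's) \<Rightarrow> ('v \<Rightarrow> 's::real_normed_vector) \<Rightarrow> ennreal"
  where "functional_dist V L \<mu> \<nu> = (SUP \<xi>\<in>{\<xi>\<in>V. L \<xi> \<le> 1}. ennreal (norm (\<mu> \<xi> - \<nu> \<xi>)))"

definition weak_star_topology :: "'v set \<Rightarrow> ('v \<Rightarrow> 's::topological_space) set \<Rightarrow> ('v \<Rightarrow> 's) topology"
  where "weak_star_topology V S = subtopology (product_topology (\<lambda>_. euclidean) V) S"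

record 'v order_unit_space =
  ou_carrier :: "'v set"
  ou_le :: "'v \<Rightarrow> 'v \<Rightarrow> bool"
  ou_unit :: 'v

definition is_order_unit_space :: "'v::real_vector order_unit_space \<Rightarrow> bool"
  where "is_order_unit_space W \<longleftrightarrow>
    subspace (ou_carrier W) \<and> ou_unit W \<in> ou_carrier W \<and>
    (\<forall>\<xi>\<in>ou_carrier W. ou_le W \<xi> \<xi>) \<and>
    (\<forall>\<xi>\<in>ou_carrier W. \<forall>\<eta>\<in>ou_carrier W. ou_le W \<xi> \<eta> \<and> ou_le W \<eta> \<xi> \<longrightarrow> \<xi> = \<eta>) \<and>
    (\<forall>\<xi>\<in>ou_carrier W. \<forall>\<eta>\<in>ou_carrier W. \<forall>\<zeta>\<in>ou_carrier W.
      ou_le W \<xi> \<eta> \<and> ou_le W \<eta> \<zeta> \<longrightarrow> ou_le W \<xi> \<zeta>) \<and>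
    (\<forall>\<xi>\<in>ou_carrier W. \<forall>\<eta>\<in>ou_carrier W. \<forall>\<zeta>\<in>ou_carrier W.
      ou_le W \<xi> \<eta> \<longrightarrow> ou_le W (\<xi> + \<zeta>) (\<eta> + \<zeta>)) \<and>
    (\<forall>\<xi>\<in>ou_carrier W. \<forall>\<eta>\<in>ou_carrier W. \<forall>r\<ge>0.
      ou_le W \<xi> \<eta> \<longrightarrow> ou_le W (r *\<^sub>R \<xi>) (r *\<^sub>R \<eta>)) \<and>
    (\<forall>\<xi>\<in>ou_carrier W. \<exists>r. ou_le W \<xi> (r *\<^sub>R ou_unit W)) \<and>
    (\<forall>\<xi>\<in>ou_carrier W. (\<forall>r>0. ou_le W \<xi> (r *\<^sub>R ou_unit W)) \<longrightarrow> ou_le W \<xi> 0)"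

definition ou_states :: "'v::real_vector order_unit_space \<Rightarrow> ('v \<Rightarrow> real) set"
  where "ou_states W = {\<mu> \<in> extensional (ou_carrier W).
    (\<forall>\<xi>\<in>ou_carrier W. \<forall>\<eta>\<in>ou_carrier W. \<mu> (\<xi> + \<eta>) = \<mu> \<xi> + \<mu> \<eta>) \<and>
    (\<forall>r. \<forall>\<xi>\<in>ou_carrier W. \<mu> (r *\<^sub>R \<xi>) = r * \<mu> \<xi>) \<and>
    (\<forall>\<xi>\<in>ou_carrier W. ou_le W 0 \<xi> \<longrightarrow> 0 \<le> \<mu> \<xi>) \<and>
    \<mu> (ou_unit W) = 1}"

definition ou_seminorm :: "'v::real_vector order_unit_space \<Rightarrow> ('v \<Rightarrow> real) \<Rightarrow> bool"
  where "ou_seminorm W L \<longleftrightarrow>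
    (\<forall>\<xi>\<in>ou_carrier W. 0 \<le> L \<xi>) \<and>
    (\<forall>\<xi>\<in>ou_carrier W. \<forall>\<eta>\<in>ou_carrier W. L (\<xi> + \<eta>) \<le> L \<xi> + L \<eta>) \<and>
    (\<forall>r. \<forall>\<xi>\<in>ou_carrier W. L (r *\<^sub>R \<xi>) = \<bar>r\<bar> * L \<xi>) \<and>
    L (ou_unit W) = 0"

definition ou_cqms :: "'v::real_vector order_unit_space \<Rightarrow> ('v \<Rightarrow> real) \<Rightarrow> bool"
  where "ou_cqms W L \<longleftrightarrow> is_order_unit_space W \<and> ou_seminorm W L \<and>
    metrizes (functional_dist (ou_carrier W) L) (weak_star_topology (ou_carrier W) (ou_states W))"

definition ou_sum ::
    "'v order_unit_space \<Rightarrow> 'w order_unit_space \<Rightarrow> ('v \<times> 'w) order_unit_space"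
  where "ou_sum W1 W2 = \<lparr>
    ou_carrier = ou_carrier W1 \<times> ou_carrier W2,
    ou_le = (\<lambda>(\<xi>, \<eta>) (\<xi>', \<eta>'). ou_le W1 \<xi> \<xi>' \<and> ou_le W2 \<eta> \<eta>'),
    ou_unit = (ou_unit W1, ou_unit W2)\<rparr>"

definition admissible_seminorm ::
    "'v::real_vector order_unit_space \<Rightarrow> ('v \<Rightarrow> real) \<Rightarrow> 'w::real_vector order_unit_space \<Rightarrow> ('w \<Rightarrow> real)
      \<Rightarrow> ('v \<times> 'w \<Rightarrow> real) \<Rightarrow> bool"
  where "admissible_seminorm W1 L1 W2 L2 L \<longleftrightarrow> ou_cqms (ou_sum W1 W2) L \<and>
    (\<forall>\<xi>\<in>ou_carrier W1. L1 \<xi> = (INF \<eta>\<in>ou_carrier W2. L (\<xi>, \<eta>))) \<and>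
    (\<forall>\<eta>\<in>ou_carrier W2. L2 \<eta> = (INF \<xi>\<in>ou_carrier W1. L (\<xi>, \<eta>)))"

definition hausdorff_distance :: "('p \<Rightarrow> 'p \<Rightarrow> ennreal) \<Rightarrow> 'p set \<Rightarrow> 'p set \<Rightarrow> ennreal"
  where "hausdorff_distance \<rho> X Y =
    max (SUP x\<in>X. INF y\<in>Y. \<rho> x y) (SUP y\<in>Y. INF x\<in>X. \<rho> x y)"

text \<open>The infimum over admissible semi-norms is \<open>\<infinity>\<close> if there are none.\<close>

definition ou_dist_q ::
    "'v::real_vector order_unit_space \<Rightarrow> ('v \<Rightarrow> real) \<Rightarrow> 'w::real_vector order_unit_space \<Rightarrow> ('w \<Rightarrow> real)
      \<Rightarrow> ennreal"
  where "ou_dist_q W1 L1 W2 L2 =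
    (INF L\<in>{L. admissible_seminorm W1 L1 W2 L2 L}.
      hausdorff_distance (functional_dist (ou_carrier (ou_sum W1 W2)) L)
        ((\<lambda>\<mu>. restrict (\<mu> \<circ> fst) (ou_carrier (ou_sum W1 W2))) ` ou_states W1)
        ((\<lambda>\<mu>. restrict (\<mu> \<circ> snd) (ou_carrier (ou_sum W1 W2))) ` ou_states W2))"

definition unital_cstar_subalgebra :: "'b::cstar_algebra set \<Rightarrow> bool"
  where "unital_cstar_subalgebra A \<longleftrightarrow> closed A \<and> 1 \<in> A \<and>
    (\<forall>a\<in>A. \<forall>b\<in>A. a + b \<in> A \<and> a * b \<in> A) \<and> (\<forall>c. \<forall>a\<in>A. c *\<^sub>C a \<in> A) \<and> (\<forall>a\<in>A. star a \<in> A)"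

definition cstar_states :: "'b::cstar_algebra set \<Rightarrow> ('b \<Rightarrow> complex) set"
  where "cstar_states A = {\<mu> \<in> extensional A.
    (\<forall>a\<in>A. \<forall>b\<in>A. \<mu> (a + b) = \<mu> a + \<mu> b) \<and> (\<forall>c. \<forall>a\<in>A. \<mu> (c *\<^sub>C a) = c * \<mu> a) \<and>
    (\<forall>a\<in>A. \<mu> (star a * a) \<in> \<real>\<^sub>\<ge>\<^sub>0) \<and> \<mu> 1 = 1}"

text \<open>\<open>(A, L)\<close> is a compact quantum metric space, where the semi-norm \<open>L\<close> has domain \<open>V\<close>.\<close>

definition cqms :: "'b::cstar_algebra set \<Rightarrow> 'b set \<Rightarrow> ('b \<Rightarrow> real) \<Rightarrow> bool"
  where "cqms A V L \<longleftrightarrow> unital_cstar_subalgebra A \<and>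
    V \<subseteq> A \<and> A \<subseteq> closure V \<and> 1 \<in> V \<and>
    (\<forall>\<xi>\<in>V. \<forall>\<eta>\<in>V. \<xi> + \<eta> \<in> V) \<and> (\<forall>c. \<forall>\<xi>\<in>V. c *\<^sub>C \<xi> \<in> V) \<and> (\<forall>\<xi>\<in>V. star \<xi> \<in> V) \<and>
    (\<forall>\<xi>\<in>V. 0 \<le> L \<xi>) \<and> (\<forall>\<xi>\<in>V. \<forall>\<eta>\<in>V. L (\<xi> + \<eta>) \<le> L \<xi> + L \<eta>) \<and>
    (\<forall>c. \<forall>\<xi>\<in>V. L (c *\<^sub>C \<xi>) = cmod c * L \<xi>) \<and> L 1 = 0 \<and> (\<forall>\<xi>\<in>V. L (star \<xi>) = L \<xi>) \<and>
    metrizes (functional_dist V L) (weak_star_topology A (cstar_states A))"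

definition sa_part :: "'b::cstar_algebra set \<Rightarrow> 'b set \<Rightarrow> 'b order_unit_space"
  where "sa_part A V = \<lparr>
    ou_carrier = {\<xi>\<in>V. star \<xi> = \<xi>},
    ou_le = (\<lambda>\<xi> \<eta>. \<exists>a\<in>A. \<eta> - \<xi> = star a * a),
    ou_unit = 1\<rparr>"

definition dist_q ::
    "'b::cstar_algebra set \<Rightarrow> 'b set \<Rightarrow> ('b \<Rightarrow> real) \<Rightarrow> 'c::cstar_algebra set \<Rightarrow> 'c set \<Rightarrow> ('c \<Rightarrow> real) \<Rightarrow> ennreal"
  where "dist_q A1 V1 L1 A2 V2 L2 = ou_dist_q (sa_part A1 V1) L1 (sa_part A2 V2) L2"

section \<open>Riemannian manifolds\<close>

text \<open>
  Charts take values in a finite-dimensional real inner product space, i.e. in \<open>\<real>\<^sup>n\<close> up to isometry.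
  In contrast to \<open>euclidean_space\<close>, dimension zero is not excluded.
\<close>

class finite_dim_inner = real_inner +
  assumes finite_spanning_set: "\<exists>B. finite B \<and> (\<forall>x. \<exists>a. x = (\<Sum>b\<in>B. a b *\<^sub>R b))"

instance euclidean_space \<subseteq> finite_dim_inner
proof
  show "\<exists>B :: 'a set. finite B \<and> (\<forall>x. \<exists>a. x = (\<Sum>b\<in>B. a b *\<^sub>R b))"
    by (intro exI[of _ Basis] conjI allI finite_Basis) (metis euclidean_representation)
qed

primrec Ck_on :: "nat \<Rightarrow> 'e::real_normed_vector set \<Rightarrow> ('e \<Rightarrow> 'f::real_normed_vector) \<Rightarrow> bool"
  where
    "Ck_on 0 S f \<longleftrightarrow> continuous_on S f"
  | "Ck_on (Suc k) S f \<longleftrightarrow>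
      (\<forall>x\<in>S. f differentiable at x) \<and> (\<forall>v. Ck_on k S (\<lambda>x. frechet_derivative f (at x) v))"

definition smooth_on :: "'e::real_normed_vector set \<Rightarrow> ('e \<Rightarrow> 'f::real_normed_vector) \<Rightarrow> bool"
  where "smooth_on S f \<longleftrightarrow> (\<forall>k. Ck_on k S f)"

type_synonym ('a, 'e) chart = "'a set \<times> ('a \<Rightarrow> 'e)"

abbreviation chart_dom :: "('a, 'e) chart \<Rightarrow> 'a set"
  where "chart_dom \<equiv> fst"

abbreviation chart_map :: "('a, 'e) chart \<Rightarrow> 'a \<Rightarrow> 'e"
  where "chart_map \<equiv> snd"

definition chart_inv :: "('a, 'e) chart \<Rightarrow> 'e \<Rightarrow> 'a"
  where "chart_inv c = inv_into (chart_dom c) (chart_map c)"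

definition is_chart :: "('a::topological_space, 'e::finite_dim_inner) chart \<Rightarrow> bool"
  where "is_chart c \<longleftrightarrow> open (chart_dom c) \<and> open (chart_map c ` chart_dom c) \<and>
    homeomorphism (chart_dom c) (chart_map c ` chart_dom c) (chart_map c) (chart_inv c)"

definition compatible_charts ::
    "('a::topological_space, 'e::finite_dim_inner) chart \<Rightarrow> ('a, 'e) chart \<Rightarrow> bool"
  where "compatible_charts c c' \<longleftrightarrow>
    smooth_on (chart_map c ` (chart_dom c \<inter> chart_dom c')) (chart_map c' \<circ> chart_inv c) \<and>
    smooth_on (chart_map c' ` (chart_dom c \<inter> chart_dom c')) (chart_map c \<circ> chart_inv c')"

definition smooth_atlas :: "('a::topological_space, 'e::finite_dim_inner) chart set \<Rightarrow> bool"
  where "smooth_atlas A \<longleftrightarrow> (\<forall>c\<in>A. is_chart c) \<and> (\<Union>c\<in>A. chart_dom c) = UNIV \<and>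
    (\<forall>c\<in>A. \<forall>c'\<in>A. compatible_charts c c')"

definition coordinate_charts ::
    "('a::topological_space, 'e::finite_dim_inner) chart set \<Rightarrow> ('a, 'e) chart set"
  where "coordinate_charts A = {c. is_chart c \<and> (\<forall>c'\<in>A. compatible_charts c c')}"

definition chart_at :: "('a, 'e) chart set \<Rightarrow> 'a \<Rightarrow> ('a, 'e) chart"
  where "chart_at A p = (SOME c. c \<in> A \<and> p \<in> chart_dom c)"

definition smooth_function ::
    "('a::topological_space, 'e::finite_dim_inner) chart set \<Rightarrow> ('a \<Rightarrow> complex) \<Rightarrow> bool"
  where "smooth_function A f \<longleftrightarrow> (\<forall>c\<in>A. smooth_on (chart_map c ` chart_dom c) (f \<circ> chart_inv c))"

definition smooth_bcontfuns ::
    "('a::topological_space, 'e::finite_dim_inner) chart set \<Rightarrow> ('a \<Rightarrow>\<^sub>C complex) set"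
  where "smooth_bcontfuns A = {f. smooth_function A (apply_bcontfun f)}"

definition smooth_maps :: "('a::topological_space, 'e::finite_dim_inner) chart set \<Rightarrow> ('a \<Rightarrow> 'a) set"
  where "smooth_maps A = {f. continuous_on UNIV f \<and>
    (\<forall>c\<in>A. \<forall>c'\<in>A. smooth_on (chart_map c ` (chart_dom c \<inter> f -` chart_dom c'))
      (chart_map c' \<circ> f \<circ> chart_inv c))}"

definition diffeos :: "('a::topological_space, 'e::finite_dim_inner) chart set \<Rightarrow> ('a \<Rightarrow> 'a) set"
  where "diffeos A = {f \<in> smooth_maps A. bij f \<and> inv f \<in> smooth_maps A}"

text \<open>
  A Riemannian metric is given by its coordinate representations: \<open>m c p v w\<close> is the inner product of the
  tangent vectors at \<open>p\<close> with coordinates \<open>v\<close> and \<open>w\<close> in the chart \<open>c\<close>.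
\<close>

type_synonym ('a, 'e) metric_tensor = "('a, 'e) chart \<Rightarrow> 'a \<Rightarrow> 'e \<Rightarrow> 'e \<Rightarrow> real"

definition riemannian_metric ::
    "('a::topological_space, 'e::finite_dim_inner) chart set \<Rightarrow> ('a, 'e) metric_tensor \<Rightarrow> bool"
  where "riemannian_metric A m \<longleftrightarrow>
    (\<forall>c\<in>A. \<forall>p\<in>chart_dom c. bilinear (m c p) \<and> (\<forall>v w. m c p v w = m c p w v) \<and>
      (\<forall>v. v \<noteq> 0 \<longrightarrow> 0 < m c p v v)) \<and>
    (\<forall>c\<in>A. \<forall>v w. smooth_on (chart_map c ` chart_dom c) (\<lambda>x. m c (chart_inv c x) v w)) \<and>
    (\<forall>c\<in>A. \<forall>c'\<in>A. \<forall>p\<in>chart_dom c \<inter> chart_dom c'. \<forall>v w.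
      let D = frechet_derivative (chart_map c' \<circ> chart_inv c) (at (chart_map c p))
      in m c' p (D v) (D w) = m c p v w)"

definition riemannian_manifold ::
    "('a::t2_space, 'e::finite_dim_inner) chart set \<Rightarrow> ('a, 'e) metric_tensor \<Rightarrow> bool"
  where "riemannian_manifold A m \<longleftrightarrow> smooth_atlas A \<and> riemannian_metric A m"

text \<open>
  The operator norm of \<open>df(p)\<close> on the complexified tangent space, whose elements are \<open>v + \<i> w\<close> with
  real tangent vectors \<open>v\<close>, \<open>w\<close>. The choice of the chart does not matter, by the
  transformation law of \<open>m\<close>.
\<close>

definition norm_df ::
    "('a::topological_space, 'e::finite_dim_inner) chart set \<Rightarrow> ('a, 'e) metric_tensor \<Rightarrow> ('a \<Rightarrow> complex) \<Rightarrow> 'a \<Rightarrow> real"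
  where "norm_df A m f p =
    (let c = chart_at A p; D = frechet_derivative (f \<circ> chart_inv c) (at (chart_map c p))
     in Sup {cmod (D v + \<i> * D w) | v w. m c p v v + m c p w w \<le> 1})"

definition lipschitz_seminorm ::
    "('a::topological_space, 'e::finite_dim_inner) chart set \<Rightarrow> ('a, 'e) metric_tensor \<Rightarrow> ('a \<Rightarrow>\<^sub>C complex) \<Rightarrow> real"
  where "lipschitz_seminorm A m f = (SUP p. norm_df A m (apply_bcontfun f) p)"

definition piecewise_C1_curve :: "('a::topological_space, 'e::finite_dim_inner) chart set \<Rightarrow> (real \<Rightarrow> 'a) \<Rightarrow> bool"
  where "piecewise_C1_curve A \<gamma> \<longleftrightarrow> continuous_on {0..1} \<gamma> \<and>
    (\<forall>c\<in>A. \<forall>a b. 0 \<le> a \<and> a \<le> b \<and> b \<le> 1 \<and> \<gamma> ` {a..b} \<subseteq> chart_dom c \<longrightarrow>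
      (chart_map c \<circ> \<gamma>) piecewise_C1_differentiable_on {a..b})"

definition curve_speed ::
    "('a::topological_space, 'e::finite_dim_inner) chart set \<Rightarrow> ('a, 'e) metric_tensor \<Rightarrow> (real \<Rightarrow> 'a) \<Rightarrow> real \<Rightarrow> real"
  where "curve_speed A m \<gamma> t =
    (let c = chart_at A (\<gamma> t); v = vector_derivative (chart_map c \<circ> \<gamma>) (at t)
     in sqrt (m c (\<gamma> t) v v))"

text \<open>
  The length of a curve is a Lebesgue integral with values in \<open>[0, \<infinity>]\<close>: the derivative of a curve
  that is \<open>C\<^sup>1\<close> outside a finite set need not be integrable near that set.
\<close>

definition riemannian_dist ::
    "('a::topological_space, 'e::finite_dim_inner) chart set \<Rightarrow> ('a, 'e) metric_tensor \<Rightarrow> 'a \<Rightarrow> 'a \<Rightarrow> ennreal"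
  where "riemannian_dist A m p q =
    (INF \<gamma>\<in>{\<gamma>. piecewise_C1_curve A \<gamma> \<and> \<gamma> 0 = p \<and> \<gamma> 1 = q}.
      \<integral>\<^sup>+t\<in>{0..1}. ennreal (curve_speed A m \<gamma> t) \<partial>lborel)"

definition jacobian ::
    "('a, 'e::finite_dim_inner) chart \<Rightarrow> ('a, 'e) chart \<Rightarrow> ('a \<Rightarrow> 'a) \<Rightarrow> 'a \<Rightarrow> 'e \<Rightarrow> 'e"
  where "jacobian c c' f p = frechet_derivative (chart_map c' \<circ> f \<circ> chart_inv c) (at (chart_map c p))"

text \<open>The suprema are taken in \<open>[0, \<infinity>]\<close>, so that they are \<open>0\<close> for empty \<open>K\<close>.\<close>

definition whitney_nbhd ::
    "('a::topological_space, 'e::finite_dim_inner) chart set \<Rightarrow> ('a, 'e) metric_tensor \<Rightarrow> ('a \<Rightarrow> 'a)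
      \<Rightarrow> ('a, 'e) chart \<Rightarrow> ('a, 'e) chart \<Rightarrow> 'a set \<Rightarrow> real \<Rightarrow> ('a \<Rightarrow> 'a) set"
  where "whitney_nbhd A m f c c' K \<epsilon> = {g \<in> smooth_maps A.
    (SUP p\<in>K. riemannian_dist A m (f p) (g p)) < ennreal \<epsilon> \<and> g ` K \<subseteq> chart_dom c' \<and>
    (SUP p\<in>K. ennreal (onorm (\<lambda>v. jacobian c c' f p v - jacobian c c' g p v))) < ennreal \<epsilon>}"

definition whitney_nbhds ::
    "('a::topological_space, 'e::finite_dim_inner) chart set \<Rightarrow> ('a, 'e) metric_tensor \<Rightarrow> ('a \<Rightarrow> 'a)
      \<Rightarrow> ('a \<Rightarrow> 'a) set set"
  where "whitney_nbhds A m f = {whitney_nbhd A m f c c' K \<epsilon> | c c' K \<epsilon>.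
    c \<in> coordinate_charts A \<and> c' \<in> coordinate_charts A \<and> compact K \<and> K \<subseteq> chart_dom c \<and>
    f ` K \<subseteq> chart_dom c' \<and> 0 < \<epsilon>}"

definition whitney_open ::
    "('a::topological_space, 'e::finite_dim_inner) chart set \<Rightarrow> ('a, 'e) metric_tensor \<Rightarrow> ('a \<Rightarrow> 'a) set \<Rightarrow> bool"
  where "whitney_open A m S \<longleftrightarrow> S \<subseteq> smooth_maps A \<and>
    (\<forall>f\<in>S. \<exists>F. finite F \<and> F \<subseteq> whitney_nbhds A m f \<and> smooth_maps A \<inter> \<Inter>F \<subseteq> S)"

definition whitney_topology ::
    "('a::topological_space, 'e::finite_dim_inner) chart set \<Rightarrow> ('a, 'e) metric_tensor \<Rightarrow> ('a \<Rightarrow> 'a) topology"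
  where "whitney_topology A m = topology (whitney_open A m)"

lemma istopology_whitney_open: "istopology (whitney_open A m)"
  unfolding istopology_def
proof (intro conjI allI impI)
  fix S T assume S: "whitney_open A m S" and T: "whitney_open A m T"
  show "whitney_open A m (S \<inter> T)"
    unfolding whitney_open_def
  proof (intro conjI ballI)
    fix f assume "f \<in> S \<inter> T"
    then obtain F G where "finite F" "F \<subseteq> whitney_nbhds A m f" "smooth_maps A \<inter> \<Inter>F \<subseteq> S"
      "finite G" "G \<subseteq> whitney_nbhds A m f" "smooth_maps A \<inter> \<Inter>G \<subseteq> T"
      using S T unfolding whitney_open_def by (meson IntD1 IntD2)
    thus "\<exists>F. finite F \<and> F \<subseteq> whitney_nbhds A m f \<and> smooth_maps A \<inter> \<Inter>F \<subseteq> S \<inter> T"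
      by (intro exI[of _ "F \<union> G"]) auto
  qed (use S in \<open>auto simp: whitney_open_def\<close>)
next
  fix \<K> assume K: "\<forall>S\<in>\<K>. whitney_open A m S"
  show "whitney_open A m (\<Union>\<K>)"
    unfolding whitney_open_def
  proof (intro conjI ballI)
    fix f assume "f \<in> \<Union>\<K>"
    then obtain S where S: "S \<in> \<K>" "f \<in> S" by blast
    then obtain F where "finite F" "F \<subseteq> whitney_nbhds A m f" "smooth_maps A \<inter> \<Inter>F \<subseteq> S"
      using K unfolding whitney_open_def by meson
    thus "\<exists>F. finite F \<and> F \<subseteq> whitney_nbhds A m f \<and> smooth_maps A \<inter> \<Inter>F \<subseteq> \<Union>\<K>"
      using S(1) by (intro exI[of _ F]) auto
  qed (use K in \<open>auto simp: whitney_open_def\<close>)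
qed

lemma openin_whitney_topology: "openin (whitney_topology A m) = whitney_open A m"
  by (simp add: whitney_topology_def istopology_whitney_open)

lemma topspace_whitney_topology: "topspace (whitney_topology A m) = smooth_maps A"
proof -
  have "whitney_open A m (smooth_maps A)"
    unfolding whitney_open_def by (auto intro!: exI[of _ "{}"])
  thus ?thesis
    unfolding topspace_def openin_whitney_topology
    by (intro equalityI Union_least Union_upper) (auto simp: whitney_open_def)
qed

definition diffeo_topology ::
    "('a::topological_space, 'e::finite_dim_inner) chart set \<Rightarrow> ('a, 'e) metric_tensor \<Rightarrow> ('a \<Rightarrow> 'a) topology"
  where "diffeo_topology A m = subtopology (whitney_topology A m) (diffeos A)"

end

theory Submission
  imports Defs
begin

text \<open>
  For two diffeomorphisms \<open>\<phi>\<close>, \<open>\<psi>\<close> and a finite interval \<open>I\<close> of integers, the map sending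
  \<open>\<Sum>x(n) U\<^sup>n\<close> to \<open>1/|I| \<Sum>\<^bsub>i, i-n \<in> I\<^esub> \<beta>\<^bsub>\<psi>\<^esub>\<^sup>i \<beta>\<^bsub>\<phi>\<^esub>\<^sup>-\<^sup>i(x(n)) U\<^sup>n\<close> is unital and positive between
  the two crossed products, being an average of compressions. If \<open>\<psi>\<^sup>i\<close> and \<open>\<phi>\<^sup>i\<close> are close in the
  \<open>C\<^sup>1\<close>-sense for \<open>i \<in> I\<close>, it increases the seminorms at most by a factor
  close to \<open>1\<close>. Following it by the corresponding map in the
  opposite direction multiplies \<open>x(n)\<close> by the square of the Fejer weight \<open>1 - |n|/|I|\<close>, up to a small twist;
  the error is controlled by \<open>\<Sum>n x(n) U\<^sup>n\<close>, because \<open>(1 - (1 - |n|/|I|)\<^sup>2)/n\<close> is a Schur multiplier of norm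
  \<open>O(|I|\<^sup>-\<^sup>1\<^sup>/\<^sup>2)\<close>. Such a pair of maps bounds the quantum Gromov-Hausdorff distance. The same multiplier
  argument shows that the balls of the seminorms are totally bounded, whence the metrization of the weak
  topology.

  Choosing \<open>I\<close> to the left of \<open>0\<close> in one direction and to the right in the other, only inverses of
  the limit diffeomorphism occur, so that continuity of inversion in the Whitney topology is not needed.
\<close>

section \<open>Square roots in C*-algebras\<close>

text \<open>The obstacle is that coefficients can be compared only finitely many at a time. An order
  preserving norm may let the norms of the unit vectors of \<open>C_c(Z)\<close> tend to 0, so that
  the Lipschitz constant of \<open>x(n)\<close> is bounded separately for each \<open>n\<close>, but
  not uniformly. The tail is therefore left to the derivation term alone, with a constant that
  depends neither on the diffeomorphism nor on the norm. This dictates the order of the choices: the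
  tolerance fixes the length \<open>N\<close> of the interval, \<open>N\<close> and the norms of
  finitely many unit vectors fix the admissible displacement \<open>\<eta>\<close>, and only then is
  the neighbourhood of \<open>t0\<close> taken, on which just the powers below \<open>N\<close> have
  to be close. The quantum distance sees self-adjoint elements only. For these the two Lipschitz
  terms of the seminorm coincide, and the derivation is skew, so that \<open>\<i>\<close> times it
  is again self-adjoint. Contractivity of unital positive maps on self-adjoint elements, which
  follows from the order alone, is thus enough to control all three terms.\<close>

lemma scaleC_minus_right: "c *\<^sub>C (- x) = - (c *\<^sub>C (x :: 'a::complex_vector))"
  by (metis add_eq_0_iff2 add.right_inverse scaleC_add_right scaleC_zero_right)

lemma scaleC_minus_left: "(- c) *\<^sub>C x = - (c *\<^sub>C (x :: 'a::complex_vector))"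
  by (metis add_eq_0_iff2 add.right_inverse scaleC_add_left scaleC_zero_left)

lemma scaleC_minus_one: "(- 1) *\<^sub>C x = - (x :: 'a::complex_vector)"
  by (metis of_real_1 of_real_minus scaleR_minus1_left scaleR_scaleC)

lemma star_scaleR: "star (r *\<^sub>R x) = r *\<^sub>R star (x :: 'a::cstar_algebra)"
  by (simp add: scaleR_scaleC star_scaleC)

lemma star_minus: "star (- x) = - star (x :: 'a::cstar_algebra)"
  using star_scaleR[of "-1" x] by simp

lemma star_diff: "star (x - y) = star x - star (y :: 'a::cstar_algebra)"
  using star_add[of x "- y"] by (simp add: star_minus)

lemma star_zero [simp]: "star 0 = (0 :: 'a::cstar_algebra)"
  using star_scaleR[of 0 "0 :: 'a"] by simp

lemma star_one [simp]: "star 1 = (1 :: 'a::cstar_algebra)"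
  by (metis mult.right_neutral mult.left_neutral star_mult star_star)

lemma star_sum: "star (sum f F) = (\<Sum>i\<in>F. star (f i :: 'a::cstar_algebra))"
  by (induction F rule: infinite_finite_induct) (simp_all add: star_add)

lemma star_power: "star (x ^ n) = star (x :: 'a::cstar_algebra) ^ n"
  by (induction n) (simp_all add: star_mult power_commutes)

lemma norm_star: "norm (star x) = norm (x :: 'a::cstar_algebra)"
proof -
  have le: "norm x \<le> norm (star x)" for x :: 'a
  proof (cases "x = 0")
    case False
    have "norm x * norm x \<le> norm (star x) * norm x"
      using norm_mult_ineq[of "star x" x] by (simp add: cstar_identity power2_eq_square)
    thus ?thesis using False by simp
  qed simp
  show ?thesis using le[of x] le[of "star x"] by (simp add: star_star)
qed

lemma norm_scaleC: "norm (c *\<^sub>C x) = cmod c * norm (x :: 'a::cstar_algebra)"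
proof -
  have "complex_of_real ((norm (c *\<^sub>C x))\<^sup>2) = complex_of_real ((cmod c * norm x)\<^sup>2)"
  proof -
    have "star (c *\<^sub>C x) * (c *\<^sub>C x) = (c * cnj c) *\<^sub>C (star x * x)"
      by (simp add: star_scaleC mult_scaleC_left mult_scaleC_right scaleC_scaleC)
    also have "\<dots> = ((cmod c)\<^sup>2) *\<^sub>R (star x * x)"
      by (simp only: complex_norm_square[symmetric] scaleR_scaleC)
    finally have "norm (star (c *\<^sub>C x) * (c *\<^sub>C x)) = (cmod c)\<^sup>2 * norm (star x * x)"
      by simp
    thus ?thesis by (simp add: cstar_identity power_mult_distrib)
  qed
  thus ?thesis by (simp only: of_real_eq_iff power2_eq_iff_nonneg norm_ge_zero mult_nonneg_nonneg)
qed

lemma bounded_linear_star: "bounded_linear (star :: 'a::cstar_algebra \<Rightarrow> 'a)"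
  by (rule bounded_linear_intro[of _ 1]) (simp_all add: star_add star_scaleR norm_star)

lemma bounded_linear_scaleC: "bounded_linear (\<lambda>x :: 'a::cstar_algebra. c *\<^sub>C x)"
  by (rule bounded_linear_intro[of _ "cmod c"])
    (simp_all add: scaleC_add_right scaleR_scaleC scaleC_scaleC norm_scaleC mult.commute)

lemma cstar_subalgebraD:
  assumes "unital_cstar_subalgebra A"
  shows "closed A" "1 \<in> A" "\<And>a b. a \<in> A \<Longrightarrow> b \<in> A \<Longrightarrow> a + b \<in> A"
    "\<And>a b. a \<in> A \<Longrightarrow> b \<in> A \<Longrightarrow> a * b \<in> A" "\<And>c a. a \<in> A \<Longrightarrow> c *\<^sub>C a \<in> A"
    "\<And>a. a \<in> A \<Longrightarrow> star a \<in> A" "\<And>r a. a \<in> A \<Longrightarrow> r *\<^sub>R a \<in> A" "0 \<in> A"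
    "\<And>a. a \<in> A \<Longrightarrow> - a \<in> A" "\<And>a b. a \<in> A \<Longrightarrow> b \<in> A \<Longrightarrow> a - b \<in> A"
    "\<And>a n. a \<in> A \<Longrightarrow> a ^ n \<in> A"
proof -
  note A = assms[unfolded unital_cstar_subalgebra_def]
  show 1: "closed A" "1 \<in> A" "\<And>a b. a \<in> A \<Longrightarrow> b \<in> A \<Longrightarrow> a + b \<in> A"
    "\<And>a b. a \<in> A \<Longrightarrow> b \<in> A \<Longrightarrow> a * b \<in> A" "\<And>c a. a \<in> A \<Longrightarrow> c *\<^sub>C a \<in> A"
    "\<And>a. a \<in> A \<Longrightarrow> star a \<in> A"
    using A by auto
  show 2: "r *\<^sub>R a \<in> A" if "a \<in> A" for r a
    using 1(5)[OF that, of "of_real r"] by (simp add: scaleR_scaleC)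
  show "0 \<in> A" using 2[OF 1(2), of 0] by simp
  show 3: "- a \<in> A" if "a \<in> A" for a
    using 2[OF that, of "-1"] by simp
  show "a - b \<in> A" if "a \<in> A" "b \<in> A" for a b
    using 1(3)[OF that(1) 3[OF that(2)]] by simp
  show "a ^ n \<in> A" if "a \<in> A" for a n
    by (induction n) (use 1 that in auto)
qed

text \<open>The Taylor coefficients of the square root of \<open>1 - x\<close>; with this sign all
  but the constant one are nonpositive.\<close>

definition sqrt_coeff :: "nat \<Rightarrow> real"
  where "sqrt_coeff n = (- 1) ^ n * ((1 / 2) gchoose n)"

lemma sqrt_coeff_0: "sqrt_coeff 0 = 1"
  by (simp add: sqrt_coeff_def)

lemma sqrt_coeff_nonpos: "sqrt_coeff (Suc n) \<le> 0"
proof (induction n)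
  case 0
  show ?case by (simp add: sqrt_coeff_def)
next
  case (Suc n)
  have rec: "((1 / 2 :: real) gchoose Suc k) = ((1 / 2) gchoose k) * (1 / 2 - real k) / real (Suc k)" for k
    by (simp add: gbinomial_Suc_rec gbinomial_prod_rev field_simps)
  have "sqrt_coeff (Suc (Suc n)) = sqrt_coeff (Suc n) * ((real (Suc n) - 1 / 2) / real (Suc (Suc n)))"
    unfolding sqrt_coeff_def by (subst rec) (simp add: field_simps)
  also have "\<dots> \<le> 0"
    by (rule mult_nonpos_nonneg[OF Suc]) simp
  finally show ?case .
qed

text \<open>This gives absolute convergence up to the boundary \<open>norm x = 1\<close>. Only the
  constant coefficient is positive, so the sums of absolute values are 2 minus the partial sums;
  these are \<open>(- 1) ^ n\<close> times the binomial coefficients of \<open>-1/2\<close>, hence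
  nonnegative.\<close>

lemma summable_sqrt_coeff: "summable (\<lambda>n. \<bar>sqrt_coeff n\<bar>)"
proof (rule summableI_nonneg_bounded)
  fix n
  have pos: "0 \<le> (- 1) ^ k * ((- 1 / 2 :: real) gchoose k)" for k
  proof (induction k)
    case (Suc k)
    have "((- 1 / 2 :: real) gchoose Suc k) = ((- 1 / 2) gchoose k) * (- 1 / 2 - real k) / real (Suc k)"
      by (simp add: gbinomial_prod_rev field_simps)
    hence "(- 1) ^ Suc k * ((- 1 / 2 :: real) gchoose Suc k)
        = - ((- 1) ^ k * (((- 1 / 2) gchoose k) * (- 1 / 2 - real k) / real (Suc k)))"
      by simp
    also have "\<dots> = ((- 1) ^ k * ((- 1 / 2 :: real) gchoose k)) * (- (- 1 / 2 - real k) / real (Suc k))"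
      by (simp only: mult_minus_right mult.assoc times_divide_eq_right minus_divide_left)
    also have "\<dots> \<ge> 0"
      by (intro mult_nonneg_nonneg Suc.IH) auto
    finally show ?case .
  qed simp
  have "(\<Sum>k\<le>n. sqrt_coeff k) = (- 1) ^ n * ((1 / 2 - 1 :: real) gchoose n)" for n
    unfolding sqrt_coeff_def using gbinomial_sum_lower_neg[of "1/2 :: real" n]
    by (simp add: mult.commute)
  hence ge: "(\<Sum>k\<le>n. sqrt_coeff k) \<ge> 0" for n
    using pos[of n] by simp
  have "(\<Sum>k\<le>n. \<bar>sqrt_coeff k\<bar>) = 2 - (\<Sum>k\<le>n. sqrt_coeff k)" for n
  proof (induction n)
    case 0 show ?case by (simp add: sqrt_coeff_0)
  next
    case (Suc n) thus ?case using sqrt_coeff_nonpos[of n] by simp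
  qed
  hence "(\<Sum>k\<le>n. \<bar>sqrt_coeff k\<bar>) \<le> 2" for n
    using ge[of n] by simp
  moreover have "(\<Sum>k<n. \<bar>sqrt_coeff k\<bar>) \<le> (\<Sum>k\<le>n. \<bar>sqrt_coeff k\<bar>)"
    by (rule sum_mono2) auto
  ultimately show "(\<Sum>k<n. \<bar>sqrt_coeff k\<bar>) \<le> 2"
    using order_trans by blast
qed simp

text \<open>Vandermonde's identity for \<open>1/2 + 1/2 = 1\<close>: the Cauchy square of the series
  is \<open>1 - x\<close>.\<close>

lemma sqrt_coeff_convolution:
  "(\<Sum>i\<le>n. sqrt_coeff i * sqrt_coeff (n - i)) = (if n = 0 then 1 else if n = 1 then - 1 else 0)"
proof -
  have "(\<Sum>i\<le>n. sqrt_coeff i * sqrt_coeff (n - i))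
      = (\<Sum>i\<le>n. (- 1) ^ n * (((1 / 2) gchoose i) * ((1 / 2) gchoose (n - i))))"
    by (intro sum.cong) (auto simp: sqrt_coeff_def simp flip: power_add)
  also have "\<dots> = (- 1) ^ n * ((1 :: real) gchoose n)"
    using gbinomial_Vandermonde[of "1/2 :: real" "1/2" n]
    by (simp flip: sum_distrib_left add: atMost_atLeast0)
  also have "(1 :: real) gchoose n = real (1 choose n)"
    by (simp add: binomial_gbinomial)
  also have "(- 1) ^ n * real (1 choose n) = (if n = 0 then 1 else if n = 1 then - 1 else 0)"
    by (cases n) (auto simp: binomial_eq_0)
  finally show ?thesis .
qed

text \<open>The root is a norm limit of polynomials in \<open>x\<close> with real coefficients, so
  it remains in the closed algebra and is self-adjoint.\<close>

lemma cstar_sqrt: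
  fixes x :: "'a::cstar_algebra"
  assumes A: "unital_cstar_subalgebra A" and x: "x \<in> A" "star x = x" "norm x \<le> 1"
  obtains b where "b \<in> A" "star b = b" "b * b = 1 - x"
proof
  define f where "f n = sqrt_coeff n *\<^sub>R x ^ n" for n
  define b where "b = suminf f"
  note A' = cstar_subalgebraD[OF A]
  have "norm (x ^ n) \<le> 1" for n
    using norm_power_ineq[of x n] power_mono[OF x(3) norm_ge_zero, of n] by simp
  hence "norm (f n) \<le> \<bar>sqrt_coeff n\<bar>" for n
    unfolding f_def by (simp add: mult_left_le)
  hence sum_norm: "summable (\<lambda>n. norm (f n))"
    by (intro summable_comparison_test'[OF summable_sqrt_coeff]) auto
  have "summable f"
    by (rule summable_norm_cancel[OF sum_norm])
  hence "f sums b"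
    unfolding b_def by (rule summable_sums)
  hence lim: "(\<lambda>n. \<Sum>k<n. f k) \<longlonglongrightarrow> b"
    by (simp add: sums_def)
  have fA: "f n \<in> A" for n
    unfolding f_def by (intro A'(7,11) x(1))
  have "(\<Sum>k<n. f k) \<in> A" for n
    by (induction n) (simp_all add: A'(3,8) fA)
  thus "b \<in> A"
    using closed_sequentially[OF A'(1) _ lim] by blast
  have "star (\<Sum>k<n. f k) = (\<Sum>k<n. f k)" for n
    by (simp add: star_sum f_def star_scaleR star_power x)
  hence "(\<lambda>n. \<Sum>k<n. f k) \<longlonglongrightarrow> star b"
    using bounded_linear.tendsto[OF bounded_linear_star lim] by simp
  thus "star b = b"
    by (rule LIMSEQ_unique[OF _ lim])
  have "(\<lambda>n. \<Sum>i\<le>n. f i * f (n - i)) sums (b * b)"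
    unfolding b_def by (rule Cauchy_product_sums[OF sum_norm sum_norm])
  moreover have "(\<Sum>i\<le>n. f i * f (n - i)) = (if n = 0 then 1 else if n = 1 then - x else 0)" for n
  proof -
    have "(\<Sum>i\<le>n. f i * f (n - i)) = (\<Sum>i\<le>n. (sqrt_coeff i * sqrt_coeff (n - i)) *\<^sub>R x ^ n)"
      by (intro sum.cong) (auto simp: f_def simp flip: power_add)
    also have "\<dots> = (\<Sum>i\<le>n. sqrt_coeff i * sqrt_coeff (n - i)) *\<^sub>R x ^ n"
      by (simp add: scaleR_sum_left)
    finally show ?thesis
      unfolding sqrt_coeff_convolution by auto
  qed
  ultimately have "(\<lambda>n. if n = 0 then 1 else if n = 1 then - x else 0) sums (b * b)"
    by simp
  moreover have "(\<lambda>n. if n = 0 then 1 else if n = 1 then - x else 0) sums (1 - x)"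
    using sums_finite[of "{0, 1::nat}" "\<lambda>n. if n = 0 then 1 else if n = 1 then - x else 0"] by simp
  ultimately show "b * b = 1 - x"
    by (rule sums_unique2)
qed

text \<open>For a self-adjoint contraction \<open>x\<close> the element \<open>1 - x\<close> is a
  square in \<open>A\<close>, so positivity on squares bounds the state at \<open>x\<close> by 1.
  The factor 2 comes from estimating the self-adjoint and the skew part separately; for the
  metrization some uniform constant is enough.\<close>

lemma cstar_state_bound:
  assumes A: "unital_cstar_subalgebra A" and \<mu>: "\<mu> \<in> cstar_states A" and a: "a \<in> A"
  shows "cmod (\<mu> a) \<le> 2 * norm a"
proof -
  note A' = cstar_subalgebraD[OF A]
  have add: "\<mu> (x + y) = \<mu> x + \<mu> y" if "x \<in> A" "y \<in> A" for x y
    using \<mu> that by (simp add: cstar_states_def)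
  have sc: "\<mu> (c *\<^sub>C x) = c * \<mu> x" if "x \<in> A" for x c
    using \<mu> that by (simp add: cstar_states_def)
  have pos: "\<mu> (star x * x) \<in> \<real>\<^sub>\<ge>\<^sub>0" if "x \<in> A" for x
    using \<mu> that by (simp add: cstar_states_def)
  have one: "\<mu> 1 = 1"
    using \<mu> by (simp add: cstar_states_def)
  have up: "of_real (norm x) - \<mu> x \<in> \<real>\<^sub>\<ge>\<^sub>0" if x: "x \<in> A" "star x = x" "x \<noteq> 0" for x
  proof -
    define y where "y = (1 / norm x) *\<^sub>R x"
    have y: "y \<in> A" "star y = y" "norm y \<le> 1"
      using x A' by (auto simp: y_def star_scaleR)
    then obtain b where b: "b \<in> A" "star b = b" "b * b = 1 - y"
      using cstar_sqrt[OF A] by metis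
    have "x = norm x *\<^sub>R y" using x by (simp add: y_def)
    have "\<mu> (1 - y) = 1 - \<mu> y"
      using add[of 1 "- y"] sc[of y "-1"] A' y one by (simp add: scaleC_minus_one)
    moreover have "\<mu> (1 - y) \<in> \<real>\<^sub>\<ge>\<^sub>0" using pos[OF b(1)] b by simp
    moreover have "\<mu> x = of_real (norm x) * \<mu> y"
      using sc[OF y(1), of "of_real (norm x)"] \<open>x = norm x *\<^sub>R y\<close> by (metis scaleR_scaleC)
    ultimately have "of_real (norm x) - \<mu> x = of_real (norm x) * \<mu> (1 - y)" "\<mu> (1 - y) \<in> \<real>\<^sub>\<ge>\<^sub>0"
      by (simp_all only: right_diff_distrib mult_1_right)
    thus ?thesis by (simp add: nonneg_Reals_mult_I)
  qed
  have sa: "cmod (\<mu> x) \<le> norm x" if x: "x \<in> A" "star x = x" for x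
  proof (cases "x = 0")
    case True
    thus ?thesis using sc[OF x(1), of 0] by simp
  next
    case False
    have m: "\<mu> (- x) = - \<mu> x" using sc[OF x(1), of "-1"] by (simp add: scaleC_minus_one)
    have "of_real (norm x) - \<mu> x \<in> \<real>\<^sub>\<ge>\<^sub>0" "of_real (norm x) + \<mu> x \<in> \<real>\<^sub>\<ge>\<^sub>0"
      using up[OF x False] up[of "- x"] x A' False m by (auto simp: star_minus)
    hence "Im (\<mu> x) = 0" "Re (\<mu> x) \<le> norm x" "- Re (\<mu> x) \<le> norm x"
      by (auto simp: complex_nonneg_Reals_iff)
    thus ?thesis by (simp add: cmod_eq_Re)
  qed
  define u where "u = (1/2) *\<^sub>R (a + star a)"
  define v where "v = (1/2) *\<^sub>R (\<i> *\<^sub>C (star a - a))"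
  have u: "u \<in> A" "star u = u" "norm u \<le> norm a"
    using a A' norm_triangle_ineq[of a "star a"]
    by (auto simp: u_def star_scaleR star_add star_star add.commute norm_star)
  have w: "star (\<i> *\<^sub>C (star a - a)) = \<i> *\<^sub>C (star a - a)"
    by (simp add: star_scaleC star_diff star_star scaleC_minus_left flip: scaleC_minus_right)
  have v: "v \<in> A" "star v = v" "norm v \<le> norm a"
    using a A' norm_triangle_ineq4[of "star a" "a"]
    unfolding v_def star_scaleR w norm_scaleR norm_scaleC by (auto simp: norm_star)
  have "a = u + \<i> *\<^sub>C v"
  proof -
    have "\<i> *\<^sub>C v = (1/2) *\<^sub>R (\<i> *\<^sub>C \<i> *\<^sub>C (star a - a))"
      by (simp add: v_def scaleR_scaleC scaleC_scaleC)
    also have "\<dots> = (1/2) *\<^sub>R (a - star a)"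
      by (simp add: scaleC_scaleC scaleC_minus_one)
    also have "u + \<dots> = (1/2) *\<^sub>R (a + a)"
      unfolding u_def by (simp flip: scaleR_add_right)
    finally show ?thesis by (simp flip: scaleR_2)
  qed
  hence "\<mu> a = \<mu> u + \<i> * \<mu> v"
    using add[OF u(1), of "\<i> *\<^sub>C v"] sc[OF v(1), of \<i>] A'(5)[OF v(1)] by simp
  hence "cmod (\<mu> a) \<le> cmod (\<mu> u) + cmod (\<mu> v)"
    using norm_triangle_ineq[of "\<mu> u" "\<i> * \<mu> v"] by (simp add: norm_mult)
  thus ?thesis using sa[OF u(1,2)] sa[OF v(1,2)] u v by simp
qed


section \<open>Positive operators and Schur multipliers\<close>

abbreviation ket_sum :: "'i set \<Rightarrow> ('i \<Rightarrow> complex) \<Rightarrow> 'i ell2"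
  where "ket_sum F a \<equiv> (\<Sum>i\<in>F. a i *\<^sub>C ket i)"

lemma ell2_dense_induct:
  assumes "\<And>F a. finite F \<Longrightarrow> ket_sum F a \<in> S" "closed S"
  shows "x \<in> S"
proof -
  have "x \<in> closure S"
    unfolding closure_approachable
  proof (intro allI impI)
    fix e :: real assume "0 < e"
    from ell2_ket_dense[OF this, of x] obtain F where
      "finite F" "norm (x - ket_sum F (ell2_apply x)) < e" by blast
    thus "\<exists>y\<in>S. dist y x < e"
      using assms(1) by (metis dist_norm norm_minus_commute)
  qed
  thus ?thesis using assms(2) by simp
qed

lemma bounded_linear_op_apply: "bounded_linear (op_apply T)"
  unfolding op_apply_def by (rule blinfun.bounded_linear_right)

lemma norm_ket: "norm (ket i) = 1"
  using norm_sum_ket[of "{i}" "\<lambda>_. 1"] norm_ge_zero[of "ket i"] by (auto simp: power2_eq_1_iff simp del: norm_ge_zero)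

lemma cinner_sum_right: "cinner x (sum f F) = (\<Sum>i\<in>F. cinner x (f i))"
  by (induction F rule: infinite_finite_induct) (simp_all add: cinner_add_right)

lemma cinner_op_sum:
  "cinner (\<Sum>u\<in>G. b u *\<^sub>C g u) (op_apply T (\<Sum>v\<in>F. a v *\<^sub>C h v))
    = (\<Sum>u\<in>G. \<Sum>v\<in>F. cnj (b u) * a v * cinner (g u) (op_apply T (h v)))"
proof -
  have "cinner (\<Sum>u\<in>G. b u *\<^sub>C g u) (op_apply T (\<Sum>v\<in>F. a v *\<^sub>C h v))
      = (\<Sum>u\<in>G. cinner (b u *\<^sub>C g u) (\<Sum>v\<in>F. op_apply T (a v *\<^sub>C h v)))"
    by (simp only: cinner_sum_left op_apply_sum)
  also have "\<dots> = (\<Sum>u\<in>G. \<Sum>v\<in>F. cinner (b u *\<^sub>C g u) (op_apply T (a v *\<^sub>C h v)))"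
    by (simp only: cinner_sum_right)
  also have "\<dots> = (\<Sum>u\<in>G. \<Sum>v\<in>F. cnj (b u) * a v * cinner (g u) (op_apply T (h v)))"
    by (intro sum.cong refl) (simp add: cinner_scaleC_left cinner_scaleC_right)
  finally show ?thesis .
qed

text \<open>Pairing the image of a vector with its own finite truncations recovers its norm, so
  finite combinations of basis vectors suffice on both sides.\<close>

lemma norm_op_le_ket_sum:
  assumes "0 \<le> B"
    and B: "\<And>F G a b. finite F \<Longrightarrow> finite G \<Longrightarrow>
      cmod (cinner (ket_sum G b) (op_apply S (ket_sum F a))) \<le> B * norm (ket_sum F a) * norm (ket_sum G b)"
  shows "norm S \<le> B"
proof (rule norm_op_leI[OF assms(1)])
  fix x
  have "x \<in> {x. norm (op_apply S x) \<le> B * norm x}"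
  proof (rule ell2_dense_induct)
    show "closed {x. norm (op_apply S x) \<le> B * norm x}"
      by (intro closed_Collect_le continuous_intros bounded_linear.continuous_on[OF bounded_linear_op_apply])
    fix F :: "'a set" and a assume F: "finite F"
    define y where "y = op_apply S (ket_sum F a)"
    have "norm y \<le> B * norm (ket_sum F a)"
    proof (rule ell2_norm_leI)
      fix G :: "'a set" assume G: "finite G"
      define w where "w = ket_sum G (ell2_apply y)"
      have nw: "(norm w)\<^sup>2 = (\<Sum>i\<in>G. (cmod (ell2_apply y i))\<^sup>2)"
        unfolding w_def by (rule norm_sum_ket[OF G])
      have "cinner w y = (\<Sum>i\<in>G. cnj (ell2_apply y i) * ell2_apply y i)"
        by (simp add: w_def cinner_sum_left cinner_scaleC_left cinner_ket)
      also have "\<dots> = complex_of_real ((norm w)\<^sup>2)"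
        by (simp only: nw of_real_sum complex_norm_square mult.commute)
      finally have "(norm w)\<^sup>2 = cmod (cinner w y)"
        by (simp only: norm_of_real abs_power2 power2_abs)
      also have "\<dots> \<le> (B * norm (ket_sum F a)) * norm w"
        using B[OF F G] by (simp add: w_def y_def)
      finally have "norm w * norm w \<le> (B * norm (ket_sum F a)) * norm w"
        by (simp add: power2_eq_square)
      hence "norm w \<le> B * norm (ket_sum F a)"
        using assms(1) by (cases "w = 0") simp_all
      hence "(norm w)\<^sup>2 \<le> (B * norm (ket_sum F a))\<^sup>2"
        by (rule power_mono) simp
      thus "(\<Sum>i\<in>G. (cmod (ell2_apply y i))\<^sup>2) \<le> (B * norm (ket_sum F a))\<^sup>2"
        by (simp only: nw)
    qed (use assms(1) in simp)
    thus "ket_sum F a \<in> {x. norm (op_apply S x) \<le> B * norm x}" by (simp add: y_def)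
  qed
  thus "norm (op_apply S x) \<le> B * norm x" by simp
qed

text \<open>The entry \<open>m u v\<close> is the inner product of row \<open>u\<close>, of length
  at most \<open>M\<close>, with a unit vector indexed by \<open>v\<close>; such a factorization
  bounds the Schur multiplier by \<open>M\<close>.\<close>

lemma schur_multiplier_norm:
  fixes S T :: "'i ell2_op" and m :: "'i \<Rightarrow> 'i \<Rightarrow> real"
  assumes ST: "\<And>u v. cinner (ket u) (op_apply S (ket v)) = of_real (m u v) * cinner (ket u) (op_apply T (ket v))"
    and M: "\<And>u F. finite F \<Longrightarrow> (\<Sum>v\<in>F. (m u v)\<^sup>2) \<le> M\<^sup>2" and "0 \<le> M"
  shows "norm S \<le> M * norm T"
proof (rule norm_op_le_ket_sum)
  show "0 \<le> M * norm T" using \<open>0 \<le> M\<close> by simp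
  fix F G :: "'i set" and a b assume fin: "finite F" "finite G"
  \<comment> \<open>The multiplier is moved into the left vector, which becomes a different one for
    each column \<open>v\<close>. After exchanging the sums, the row bound controls the total of the
    squared norms of the \<open>w v\<close>.\<close>
  define w where "w v = ket_sum G (\<lambda>u. of_real (m u v) * b u)" for v
  have nw: "(norm (w v))\<^sup>2 = (\<Sum>u\<in>G. (m u v)\<^sup>2 * (cmod (b u))\<^sup>2)" for v
    unfolding w_def norm_sum_ket[OF fin(2)] by (simp add: norm_mult power_mult_distrib)
  have "cinner (ket_sum G b) (op_apply S (ket_sum F a))
      = (\<Sum>u\<in>G. \<Sum>v\<in>F. cnj (b u) * a v * (of_real (m u v) * cinner (ket u) (op_apply T (ket v))))"
    by (simp only: cinner_op_sum ST)
  also have "\<dots> = (\<Sum>v\<in>F. a v * cinner (w v) (op_apply T (ket v)))"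
    by (subst sum.swap)
      (simp add: w_def cinner_sum_left cinner_scaleC_left sum_distrib_left mult_ac)
  also have "cmod \<dots> \<le> (\<Sum>v\<in>F. cmod (a v) * (norm (w v) * norm T))"
  proof (rule order_trans[OF norm_sum], rule sum_mono)
    fix v
    have "norm (op_apply T (ket v)) \<le> norm T"
      using norm_op_apply[of T "ket v"] by (simp add: norm_ket)
    hence "cmod (cinner (w v) (op_apply T (ket v))) \<le> norm (w v) * norm T"
      by (intro order_trans[OF cinner_cauchy_schwarz] mult_left_mono) auto
    thus "cmod (a v * cinner (w v) (op_apply T (ket v))) \<le> cmod (a v) * (norm (w v) * norm T)"
      by (simp add: norm_mult mult_left_mono)
  qed
  also have "\<dots> = norm T * (\<Sum>v\<in>F. \<bar>cmod (a v)\<bar> * \<bar>norm (w v)\<bar>)"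
    by (simp add: sum_distrib_left mult_ac)
  also have "(\<Sum>v\<in>F. \<bar>cmod (a v)\<bar> * \<bar>norm (w v)\<bar>) \<le> L2_set (\<lambda>v. cmod (a v)) F * L2_set (\<lambda>v. norm (w v)) F"
    by (rule L2_set_mult_ineq)
  also have "L2_set (\<lambda>v. cmod (a v)) F = norm (ket_sum F a)"
    unfolding L2_set_def norm_sum_ket[OF fin(1), of a, symmetric] by simp
  also have "L2_set (\<lambda>v. norm (w v)) F \<le> M * norm (ket_sum G b)"
  proof -
    have "(\<Sum>v\<in>F. (norm (w v))\<^sup>2) = (\<Sum>u\<in>G. (\<Sum>v\<in>F. (m u v)\<^sup>2) * (cmod (b u))\<^sup>2)"
      unfolding nw by (subst sum.swap) (simp add: sum_distrib_right)
    also have "\<dots> \<le> (\<Sum>u\<in>G. M\<^sup>2 * (cmod (b u))\<^sup>2)"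
      by (intro sum_mono mult_right_mono M fin) simp
    also have "\<dots> = (M * norm (ket_sum G b))\<^sup>2"
      by (simp add: power_mult_distrib norm_sum_ket fin sum_distrib_left)
    finally show ?thesis
      unfolding L2_set_def using \<open>0 \<le> M\<close> by (intro real_le_lsqrt) (auto simp: sum_nonneg)
  qed
  finally have "cmod (cinner (ket_sum G b) (op_apply S (ket_sum F a)))
      \<le> norm T * (norm (ket_sum F a) * (M * norm (ket_sum G b)))"
    by (simp add: mult_left_mono)
  thus "cmod (cinner (ket_sum G b) (op_apply S (ket_sum F a)))
      \<le> M * norm T * norm (ket_sum F a) * norm (ket_sum G b)"
    by (simp add: mult_ac)
qed

text \<open>Positivity through the quadratic form refers to no subalgebra. Self-adjointness is
  demanded explicitly, since \<open>inner\<close> is only the real part of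
  \<open>cinner\<close>.\<close>

definition op_pos :: "'i ell2_op \<Rightarrow> bool"
  where "op_pos T \<longleftrightarrow> star T = T \<and> (\<forall>v. 0 \<le> inner v (op_apply T v))"

lemma inner_op_star: "inner x (op_apply T y) = inner (op_apply (star T) x) y"
  by (simp add: inner_ell2_def cinner_star')

lemma op_pos_star_mult: "op_pos (star a * a)"
  using inner_op_star[of _ "star a"] by (simp add: op_pos_def star_mult star_star op_apply_rules)

lemma op_pos_add: "op_pos S \<Longrightarrow> op_pos T \<Longrightarrow> op_pos (S + T)"
  by (simp add: op_pos_def star_add op_apply_rules inner_add_right)

lemma op_pos_scaleR: "0 \<le> r \<Longrightarrow> op_pos T \<Longrightarrow> op_pos (r *\<^sub>R T)"
  by (simp add: op_pos_def star_scaleR op_apply_rules)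

text \<open>From right to left this says that the norm of a self-adjoint operator is its numerical
  radius, which is proved by polarization.\<close>

lemma op_norm_le_iff:
  assumes sa: "star T = T" and "0 \<le> r"
  shows "norm T \<le> r \<longleftrightarrow> op_pos (r *\<^sub>R 1 - T) \<and> op_pos (r *\<^sub>R 1 + T)"
proof
  assume "norm T \<le> r"
  hence "\<bar>inner v (op_apply T v)\<bar> \<le> r * inner v v" for v
  proof -
    have "\<bar>inner v (op_apply T v)\<bar> \<le> norm v * norm (op_apply T v)"
      by (rule Cauchy_Schwarz_ineq2)
    also have "\<dots> \<le> norm v * (r * norm v)"
      using \<open>norm T \<le> r\<close> by (intro mult_left_mono order_trans[OF norm_op_apply] mult_right_mono) auto
    finally show ?thesis by (simp add: dot_square_norm power2_eq_square mult_ac)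
  qed
  thus "op_pos (r *\<^sub>R 1 - T) \<and> op_pos (r *\<^sub>R 1 + T)"
    by (auto simp: op_pos_def star_diff star_add star_scaleR sa op_apply_rules inner_diff_right
        inner_add_right abs_le_iff) (smt (verit))
next
  assume "op_pos (r *\<^sub>R 1 - T) \<and> op_pos (r *\<^sub>R 1 + T)"
  hence bd: "\<bar>inner v (op_apply T v)\<bar> \<le> r * inner v v" for v
    by (auto simp: op_pos_def op_apply_rules inner_diff_right inner_add_right abs_le_iff) (smt (verit))
  show "norm T \<le> r"
  proof (rule norm_op_leI[OF \<open>0 \<le> r\<close>])
    fix v
    show "norm (op_apply T v) \<le> r * norm v"
    proof (cases "op_apply T v = 0")
      case False
      hence v: "norm v > 0" and Tv: "norm (op_apply T v) > 0" by auto
      \<comment> \<open>\<open>u\<close> is parallel to the image of \<open>v\<close> and as long as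
        \<open>v\<close>. So its inner product with that image is
        \<open>norm v * norm (op_apply T v)\<close>, while polarization and the parallelogram law
        bound it by \<open>r\<close> times the square of \<open>norm v\<close>.\<close>
      define u where "u = (norm v / norm (op_apply T v)) *\<^sub>R op_apply T v"
      have nu: "norm u = norm v" using Tv by (simp add: u_def)
      have "4 * inner u (op_apply T v)
          = inner (u + v) (op_apply T (u + v)) - inner (u - v) (op_apply T (u - v))"
      proof -
        have "inner v (op_apply T u) = inner u (op_apply T v)"
          by (metis inner_op_star sa inner_commute)
        moreover have "op_apply T (u - v) = op_apply T u - op_apply T v"
          using bounded_linear_op_apply by (rule linear_diff[OF bounded_linear.linear])
        ultimately show ?thesis by (simp add: inner_add_left inner_add_right inner_diff_left inner_diff_right)
      qed
      also have "\<dots> \<le> r * inner (u + v) (u + v) + r * inner (u - v) (u - v)"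
        using bd[of "u + v"] bd[of "u - v"] by linarith
      also have "\<dots> = 4 * r * (norm v)\<^sup>2"
        using nu by (simp add: dot_square_norm[symmetric] inner_add_left inner_add_right
            inner_diff_left inner_diff_right inner_commute algebra_simps)
          (simp add: power2_norm_eq_inner[symmetric])
      also have "inner u (op_apply T v) = norm v * norm (op_apply T v)"
        using Tv by (simp add: u_def dot_square_norm power2_eq_square)
      finally show ?thesis using v by (simp add: power2_eq_square)
    qed (use \<open>0 \<le> r\<close> in simp)
  qed
qed

lemma op_pos_norm: "star T = T \<Longrightarrow> op_pos (norm T *\<^sub>R 1 - T)"
  using op_norm_le_iff[of T "norm T"] by simp

lemma op_pos_antisym:
  assumes "op_pos T" "op_pos (- T)"
  shows "T = 0"
proof -
  have "star T = T" using assms by (simp add: op_pos_def)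
  hence "norm T \<le> 0" using op_norm_le_iff[of T 0] assms by simp
  thus ?thesis by simp
qed

text \<open>The order of \<open>sa_part\<close> does not depend on the subalgebra: after division by
  its norm, a positive \<open>T\<close> has the form \<open>1 - x\<close> with a self-adjoint
  contraction \<open>x\<close> in \<open>A\<close>, and \<open>cstar_sqrt\<close> finds the root
  inside \<open>A\<close>.\<close>

lemma op_pos_iff_square:
  assumes A: "unital_cstar_subalgebra A" and T: "T \<in> A"
  shows "(\<exists>a\<in>A. T = star a * a) \<longleftrightarrow> op_pos T"
proof
  assume pos: "op_pos T"
  note A' = cstar_subalgebraD[OF A]
  show "\<exists>a\<in>A. T = star a * a"
  proof (cases "T = 0")
    case True
    thus ?thesis by (intro bexI[of _ 0]) (auto simp: A')
  next
    case False
    define r where "r = norm T"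
    define x where "x = 1 - (1 / r) *\<^sub>R T"
    have r: "r > 0" using False by (simp add: r_def)
    have Ts: "star T = T" using pos by (simp add: op_pos_def)
    have x: "x \<in> A" "star x = x"
      unfolding x_def by (intro A'(2,7,10) T) (simp add: star_diff star_scaleR Ts)
    have "norm x \<le> 1"
    proof -
      have "op_pos (1 - x)" using pos r by (simp add: x_def op_pos_scaleR)
      moreover have "op_pos (1 + x)"
      proof -
        have "1 + x = 1 + (1 / r) *\<^sub>R (norm T *\<^sub>R 1 - T)"
          using r by (simp add: x_def r_def scaleR_diff_right)
        moreover have "op_pos (1 :: 'a ell2_op)" using op_pos_star_mult[of 1] by simp
        ultimately show ?thesis
          using op_pos_add[OF _ op_pos_scaleR[OF _ op_pos_norm[OF Ts], of "1 / r"]] r by simp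
      qed
      ultimately show ?thesis using op_norm_le_iff[of x 1] x by simp
    qed
    then obtain b where b: "b \<in> A" "star b = b" "b * b = 1 - x"
      using cstar_sqrt[OF A x] by metis
    have "T = star (sqrt r *\<^sub>R b) * (sqrt r *\<^sub>R b)"
      using b r by (simp add: star_scaleR x_def)
    thus ?thesis using A'(7)[OF b(1)] by blast
  qed
qed (auto simp: op_pos_star_mult)

text \<open>Supplies the Archimedean axiom of order unit spaces.\<close>

lemma op_pos_limit:
  assumes T: "star T = T" and "\<And>r. r > 0 \<Longrightarrow> op_pos (T + r *\<^sub>R 1)"
  shows "op_pos T"
  unfolding op_pos_def
proof (intro conjI allI T)
  fix v
  show "0 \<le> inner v (op_apply T v)"
  proof (rule field_le_epsilon)
    fix e :: real assume "e > 0"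
    define r where "r = e / (inner v v + 1)"
    have "r > 0" using \<open>e > 0\<close> by (simp add: r_def add_nonneg_pos)
    hence "0 \<le> inner v (op_apply T v) + r * inner v v"
      using assms(2)[of r] by (simp add: op_pos_def op_apply_rules inner_add_right)
    also have "r * inner v v \<le> e"
    proof -
      have "e * inner v v \<le> e * (inner v v + 1)"
        using \<open>e > 0\<close> by (intro mult_left_mono) auto
      moreover have "inner v v + 1 > 0" by (simp add: add_nonneg_pos)
      ultimately show ?thesis by (simp add: r_def pos_divide_le_eq)
    qed
    finally show "0 \<le> inner v (op_apply T v) + e" by simp
  qed
qed

lemma op_pos_ket_sumI:
  assumes "star T = T" and "\<And>F a. finite F \<Longrightarrow> 0 \<le> Re (cinner (ket_sum F a) (op_apply T (ket_sum F a)))"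
  shows "op_pos T"
  unfolding op_pos_def
proof (intro conjI allI assms(1))
  fix x
  have "x \<in> {x. 0 \<le> inner x (op_apply T x)}"
  proof (rule ell2_dense_induct)
    show "closed {x. 0 \<le> inner x (op_apply T x)}"
      by (intro closed_Collect_le continuous_intros bounded_linear.continuous_on[OF bounded_linear_op_apply])
  qed (use assms(2) in \<open>simp add: inner_ell2_def\<close>)
  thus "0 \<le> inner x (op_apply T x)" by simp
qed

text \<open>
  The hypothesis says that \<open>S\<close> is the sum over \<open>l\<close> of the compressions of \<open>T\<close> by the partial
  isometries \<open>ket u \<mapsto> ket (r l u)\<close>, \<open>u \<in> D l\<close>.
\<close>

lemma op_pos_compression:
  fixes S :: "'i ell2_op" and T :: "'j ell2_op"
  assumes "op_pos T" "star S = S" "0 \<le> k"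
    and S: "\<And>F. finite F \<Longrightarrow> \<exists>\<Lambda>. finite \<Lambda> \<and> (\<forall>u\<in>F. \<forall>v\<in>F. cinner (ket u) (op_apply S (ket v))
      = of_real k * (\<Sum>l\<in>\<Lambda>. if u \<in> D l \<and> v \<in> D l then cinner (ket (r l u)) (op_apply T (ket (r l v))) else 0))"
  shows "op_pos S"
proof (rule op_pos_ket_sumI[OF assms(2)])
  fix F :: "'i set" and a assume F: "finite F"
  then obtain \<Lambda> where \<Lambda>: "finite \<Lambda>" "\<And>u v. u \<in> F \<Longrightarrow> v \<in> F \<Longrightarrow> cinner (ket u) (op_apply S (ket v))
      = of_real k * (\<Sum>l\<in>\<Lambda>. if u \<in> D l \<and> v \<in> D l then cinner (ket (r l u)) (op_apply T (ket (r l v))) else 0)"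
    using S by meson
  \<comment> \<open>The image of the test vector under the partial isometry of index
    \<open>l\<close>; the form of \<open>S\<close> at the test vector becomes \<open>k\<close> times
    the sum of the forms of \<open>T\<close> at the \<open>\<xi> l\<close>.\<close>
  define \<xi> where "\<xi> l = (\<Sum>u\<in>F. (if u \<in> D l then a u else 0) *\<^sub>C ket (r l u))" for l
  have "cinner (ket_sum F a) (op_apply S (ket_sum F a))
      = (\<Sum>u\<in>F. \<Sum>v\<in>F. cnj (a u) * a v * (of_real k * (\<Sum>l\<in>\<Lambda>. if u \<in> D l \<and> v \<in> D l then cinner (ket (r l u)) (op_apply T (ket (r l v))) else 0)))"
    unfolding cinner_op_sum by (intro sum.cong refl) (simp add: \<Lambda>(2))
  also have "\<dots> = (\<Sum>u\<in>F. \<Sum>v\<in>F. \<Sum>l\<in>\<Lambda>. of_real k * (cnj (if u \<in> D l then a u else 0) * (if v \<in> D l then a v else 0) * cinner (ket (r l u)) (op_apply T (ket (r l v)))))"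
    unfolding sum_distrib_left by (intro sum.cong refl) auto
  also have "\<dots> = (\<Sum>l\<in>\<Lambda>. \<Sum>u\<in>F. \<Sum>v\<in>F. of_real k * (cnj (if u \<in> D l then a u else 0) * (if v \<in> D l then a v else 0) * cinner (ket (r l u)) (op_apply T (ket (r l v)))))"
    by (simp only: sum.swap[where A = F and B = \<Lambda>])
  also have "\<dots> = (\<Sum>l\<in>\<Lambda>. of_real k * cinner (\<xi> l) (op_apply T (\<xi> l)))"
    unfolding \<xi>_def cinner_op_sum by (simp only: sum_distrib_left)
  finally have "Re (cinner (ket_sum F a) (op_apply S (ket_sum F a)))
      = (\<Sum>l\<in>\<Lambda>. k * inner (\<xi> l) (op_apply T (\<xi> l)))"
    by (simp add: inner_ell2_def)
  also have "\<dots> \<ge> 0"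
    using assms(1,3) by (intro sum_nonneg mult_nonneg_nonneg) (auto simp: op_pos_def)
  finally show "0 \<le> Re (cinner (ket_sum F a) (op_apply S (ket_sum F a)))" .
qed

section \<open>Metrizing weak topologies\<close>

lemma functional_dist_upper:
  "\<xi> \<in> V \<Longrightarrow> L \<xi> \<le> 1 \<Longrightarrow> ennreal (norm (\<mu> \<xi> - \<nu> \<xi>)) \<le> functional_dist V L \<mu> \<nu>"
  unfolding functional_dist_def by (rule SUP_upper) simp

lemma functional_dist_least:
  "(\<And>\<xi>. \<xi> \<in> V \<Longrightarrow> L \<xi> \<le> 1 \<Longrightarrow> norm (\<mu> \<xi> - \<nu> \<xi>) \<le> r) \<Longrightarrow> functional_dist V L \<mu> \<nu> \<le> ennreal r"
  unfolding functional_dist_def by (rule SUP_least) (auto intro: ennreal_leI)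

lemma openin_finite_conj:
  assumes "finite F" "\<And>i. i \<in> F \<Longrightarrow> openin T {x \<in> topspace T. P i x}"
  shows "openin T {x \<in> topspace T. \<forall>i\<in>F. P i x}"
  using assms
proof (induction F rule: finite_induct)
  case (insert i F)
  have "{x \<in> topspace T. \<forall>j\<in>insert i F. P j x}
      = {x \<in> topspace T. P i x} \<inter> {x \<in> topspace T. \<forall>j\<in>F. P j x}" by auto
  thus ?case using insert by (metis (no_types, lifting) insertCI openin_Int)
qed simp

text \<open>Both hypotheses speak of differences of states only, for which adding a constant to
  \<open>\<xi>\<close> is invisible; otherwise no finite set could control the whole Lipschitz ball.
  \<open>approx\<close> separates states and makes evaluations continuous for the metric.
  \<open>bounded\<close> makes the metric finite and reduces it, up to \<open>e\<close>, to finitely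
  many evaluations. Values in a normed space cover real states of order unit spaces and complex
  states of C*-algebras at once.\<close>

lemma metrizes_weak_star:
  fixes S :: "('v \<Rightarrow> 's::real_normed_vector) set"
  assumes ext: "S \<subseteq> extensional X"
    and approx: "\<And>\<xi> e. \<xi> \<in> X \<Longrightarrow> 0 < e \<Longrightarrow> \<exists>c \<eta>. \<eta> \<in> V \<and> L \<eta> \<le> 1 \<and> 0 \<le> c \<and>
      (\<forall>\<mu>\<in>S. \<forall>\<nu>\<in>S. norm (\<mu> \<xi> - \<nu> \<xi>) \<le> c * norm (\<mu> \<eta> - \<nu> \<eta>) + e)"
    and bounded: "\<And>e. 0 < e \<Longrightarrow> \<exists>F. finite F \<and> F \<subseteq> X \<and> (\<forall>\<xi>\<in>V. L \<xi> \<le> 1 \<longrightarrow>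
      (\<exists>\<eta>\<in>F. \<forall>\<mu>\<in>S. \<forall>\<nu>\<in>S. norm (\<mu> \<xi> - \<nu> \<xi>) \<le> norm (\<mu> \<eta> - \<nu> \<eta>) + e))"
  shows "metrizes (functional_dist V L) (weak_star_topology X S)"
proof -
  define D where "D \<mu> \<nu> = enn2real (functional_dist V L \<mu> \<nu>)" for \<mu> \<nu> :: "'v \<Rightarrow> 's"
  have top: "topspace (weak_star_topology X S) = S"
    unfolding weak_star_topology_def topspace_subtopology topspace_product_topology PiE_def
    using ext by (simp add: Int_absorb1)
  have fin: "functional_dist V L \<mu> \<nu> < \<infinity>" if "\<mu> \<in> S" "\<nu> \<in> S" for \<mu> \<nu>
  proof -
    obtain F where F: "finite F" "\<forall>\<xi>\<in>V. L \<xi> \<le> 1 \<longrightarrow>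
      (\<exists>\<eta>\<in>F. \<forall>\<mu>\<in>S. \<forall>\<nu>\<in>S. norm (\<mu> \<xi> - \<nu> \<xi>) \<le> norm (\<mu> \<eta> - \<nu> \<eta>) + 1)"
      using bounded[OF zero_less_one] by blast
    have "functional_dist V L \<mu> \<nu> \<le> ennreal ((\<Sum>\<eta>\<in>F. norm (\<mu> \<eta> - \<nu> \<eta>)) + 1)"
    proof (rule functional_dist_least)
      fix \<xi> assume "\<xi> \<in> V" "L \<xi> \<le> 1"
      with F(2) obtain \<eta> where \<eta>: "\<eta> \<in> F"
          "\<forall>\<mu>\<in>S. \<forall>\<nu>\<in>S. norm (\<mu> \<xi> - \<nu> \<xi>) \<le> norm (\<mu> \<eta> - \<nu> \<eta>) + 1" by meson
      have "norm (\<mu> \<xi> - \<nu> \<xi>) \<le> norm (\<mu> \<eta> - \<nu> \<eta>) + 1"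
        using bspec[OF bspec[OF \<eta>(2) that(1)] that(2)] .
      moreover have "norm (\<mu> \<eta> - \<nu> \<eta>) \<le> (\<Sum>\<eta>\<in>F. norm (\<mu> \<eta> - \<nu> \<eta>))"
        by (rule member_le_sum) (use F(1) \<eta>(1) in auto)
      ultimately show "norm (\<mu> \<xi> - \<nu> \<xi>) \<le> (\<Sum>\<eta>\<in>F. norm (\<mu> \<eta> - \<nu> \<eta>)) + 1" by simp
    qed
    thus ?thesis using le_less_trans by fastforce
  qed
  have upper: "norm (\<mu> \<xi> - \<nu> \<xi>) \<le> D \<mu> \<nu>" if "\<mu> \<in> S" "\<nu> \<in> S" "\<xi> \<in> V" "L \<xi> \<le> 1" for \<mu> \<nu> \<xi>
    using enn2real_mono[OF functional_dist_upper[of \<xi> V L \<mu> \<nu>, OF that(3,4)]] fin[OF that(1,2)]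
    by (simp add: D_def)
  have least: "D \<mu> \<nu> \<le> r"
    if "0 \<le> r" "\<And>\<xi>. \<xi> \<in> V \<Longrightarrow> L \<xi> \<le> 1 \<Longrightarrow> norm (\<mu> \<xi> - \<nu> \<xi>) \<le> r" for \<mu> \<nu> r
    using enn2real_mono[OF functional_dist_least[OF that(2)]] that(1) by (simp add: D_def)
  interpret Metric_space S D
  proof
    show "0 \<le> D \<mu> \<nu>" for \<mu> \<nu> by (simp add: D_def)
    show "D \<mu> \<nu> = D \<nu> \<mu>" for \<mu> \<nu>
      by (simp add: D_def functional_dist_def norm_minus_commute)
    fix \<mu> \<nu> assume \<mu>: "\<mu> \<in> S" and \<nu>: "\<nu> \<in> S"
    show "D \<mu> \<nu> = 0 \<longleftrightarrow> \<mu> = \<nu>"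
    proof
      assume D0: "D \<mu> \<nu> = 0"
      show "\<mu> = \<nu>"
      proof (rule extensionalityI)
        show "\<mu> \<in> extensional X" "\<nu> \<in> extensional X" using ext \<mu> \<nu> by auto
        fix \<xi> assume \<xi>: "\<xi> \<in> X"
        have "norm (\<mu> \<xi> - \<nu> \<xi>) \<le> 0"
        proof (rule field_le_epsilon)
          fix e :: real assume "0 < e"
          then obtain c \<eta> where c: "\<eta> \<in> V" "L \<eta> \<le> 1" "0 \<le> c"
            and "\<forall>\<mu>\<in>S. \<forall>\<nu>\<in>S. norm (\<mu> \<xi> - \<nu> \<xi>) \<le> c * norm (\<mu> \<eta> - \<nu> \<eta>) + e"
            using approx[OF \<xi> \<open>0 < e\<close>] by meson
          hence le: "norm (\<mu> \<xi> - \<nu> \<xi>) \<le> c * norm (\<mu> \<eta> - \<nu> \<eta>) + e" using \<mu> \<nu> by simp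
          have "norm (\<mu> \<eta> - \<nu> \<eta>) = 0" using upper[OF \<mu> \<nu> c(1,2)] D0 by simp
          thus "norm (\<mu> \<xi> - \<nu> \<xi>) \<le> 0 + e" using le by simp
        qed
        thus "\<mu> \<xi> = \<nu> \<xi>" by simp
      qed
    next
      assume "\<mu> = \<nu>"
      hence "D \<mu> \<nu> \<le> 0" by (intro least) auto
      thus "D \<mu> \<nu> = 0" by (simp add: D_def order_antisym)
    qed
    fix \<kappa> assume \<kappa>: "\<kappa> \<in> S"
    show "D \<mu> \<kappa> \<le> D \<mu> \<nu> + D \<nu> \<kappa>"
    proof (rule least)
      fix \<xi> assume "\<xi> \<in> V" "L \<xi> \<le> 1"
      thus "norm (\<mu> \<xi> - \<kappa> \<xi>) \<le> D \<mu> \<nu> + D \<nu> \<kappa>"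
        using upper[OF \<mu> \<nu>] upper[OF \<nu> \<kappa>] norm_triangle_ineq[of "\<mu> \<xi> - \<nu> \<xi>" "\<nu> \<xi> - \<kappa> \<xi>"]
        by fastforce
    qed (simp add: D_def)
  qed
  have eval: "continuous_map mtopology euclidean (\<lambda>\<mu>. \<mu> \<xi>)" if \<xi>: "\<xi> \<in> X" for \<xi>
    unfolding continuous_map_def
  proof (intro conjI allI impI)
    fix U :: "'s set" assume "openin euclidean U"
    hence "open U" by simp
    show "openin mtopology {\<mu> \<in> topspace mtopology. \<mu> \<xi> \<in> U}"
      unfolding openin_mtopology
    proof (intro conjI allI impI)
      fix \<mu> assume "\<mu> \<in> {\<mu> \<in> topspace mtopology. \<mu> \<xi> \<in> U}"
      hence \<mu>: "\<mu> \<in> S" "\<mu> \<xi> \<in> U" by auto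
      obtain e where e: "e > 0" "ball (\<mu> \<xi>) e \<subseteq> U"
        using \<open>open U\<close> \<mu> by (meson open_contains_ball)
      then obtain c \<eta> where c: "\<eta> \<in> V" "L \<eta> \<le> 1" "0 \<le> c"
          "\<forall>\<mu>\<in>S. \<forall>\<nu>\<in>S. norm (\<mu> \<xi> - \<nu> \<xi>) \<le> c * norm (\<mu> \<eta> - \<nu> \<eta>) + e / 2"
        using approx[OF \<xi> half_gt_zero[OF e(1)]] by meson
      \<comment> \<open>The summand 1 keeps the radius positive also for
        \<open>c = 0\<close>.\<close>
      define r where "r = e / 2 / (c + 1)"
      have "r > 0" using e c by (simp add: r_def)
      have "mball \<mu> r \<subseteq> {\<mu> \<in> topspace mtopology. \<mu> \<xi> \<in> U}"
      proof
        fix \<nu> assume "\<nu> \<in> mball \<mu> r"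
        hence \<nu>: "\<nu> \<in> S" "D \<mu> \<nu> < r" by auto
        have "norm (\<mu> \<xi> - \<nu> \<xi>) \<le> c * norm (\<mu> \<eta> - \<nu> \<eta>) + e / 2" using c(4) \<mu>(1) \<nu>(1) by simp
        also have "c * norm (\<mu> \<eta> - \<nu> \<eta>) \<le> c * r"
          using upper[OF \<mu>(1) \<nu>(1) c(1,2)] \<nu>(2) c(3) by (intro mult_left_mono) auto
        also have "c * r < e / 2"
          using e c by (simp add: r_def field_simps)
        finally have "\<nu> \<xi> \<in> ball (\<mu> \<xi>) e" by (simp add: dist_norm)
        thus "\<nu> \<in> {\<mu> \<in> topspace mtopology. \<mu> \<xi> \<in> U}" using e \<nu> by auto
      qed
      thus "\<exists>r>0. mball \<mu> r \<subseteq> {\<mu> \<in> topspace mtopology. \<mu> \<xi> \<in> U}" using \<open>r > 0\<close> by blast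
    qed auto
  qed auto
  have "openin mtopology U \<longleftrightarrow> openin (weak_star_topology X S) U" for U
  proof
    assume U: "openin mtopology U"
    show "openin (weak_star_topology X S) U"
    proof (subst openin_subopen, rule ballI)
      fix \<mu> assume "\<mu> \<in> U"
      then obtain r where r: "r > 0" "mball \<mu> r \<subseteq> U" and \<mu>: "\<mu> \<in> S"
        using U unfolding openin_mtopology by blast
      obtain F where F: "finite F" "F \<subseteq> X" "\<forall>\<xi>\<in>V. L \<xi> \<le> 1 \<longrightarrow>
          (\<exists>\<eta>\<in>F. \<forall>\<mu>\<in>S. \<forall>\<nu>\<in>S. norm (\<mu> \<xi> - \<nu> \<xi>) \<le> norm (\<mu> \<eta> - \<nu> \<eta>) + r / 3)"
        using bounded[of "r / 3"] r(1) by (meson divide_pos_pos zero_less_numeral)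
      define N where "N = {\<nu> \<in> topspace (weak_star_topology X S). \<forall>\<eta>\<in>F. \<nu> \<eta> \<in> ball (\<mu> \<eta>) (r / 3)}"
      have "openin (weak_star_topology X S) N"
        unfolding N_def
      proof (rule openin_finite_conj[OF F(1)])
        fix \<eta> assume "\<eta> \<in> F"
        hence "continuous_map (weak_star_topology X S) euclidean (\<lambda>\<nu>. \<nu> \<eta>)"
          unfolding weak_star_topology_def using F
          by (intro continuous_map_from_subtopology continuous_map_product_projection) auto
        from openin_continuous_map_preimage[OF this, of "ball (\<mu> \<eta>) (r / 3)"]
        show "openin (weak_star_topology X S)
            {\<nu> \<in> topspace (weak_star_topology X S). \<nu> \<eta> \<in> ball (\<mu> \<eta>) (r / 3)}"
          by simp
      qed
      moreover have "\<mu> \<in> N" using \<mu> r by (simp add: N_def top)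
      moreover have "N \<subseteq> U"
      proof
        fix \<nu> assume "\<nu> \<in> N"
        hence \<nu>: "\<nu> \<in> S" "\<And>\<eta>. \<eta> \<in> F \<Longrightarrow> norm (\<mu> \<eta> - \<nu> \<eta>) < r / 3"
          by (auto simp: N_def top dist_norm)
        have "D \<mu> \<nu> \<le> 2 * r / 3"
        proof (rule least)
          fix \<xi> assume "\<xi> \<in> V" "L \<xi> \<le> 1"
          with F(3) obtain \<eta> where \<eta>: "\<eta> \<in> F"
            "\<forall>\<mu>\<in>S. \<forall>\<nu>\<in>S. norm (\<mu> \<xi> - \<nu> \<xi>) \<le> norm (\<mu> \<eta> - \<nu> \<eta>) + r / 3" by meson
          have "norm (\<mu> \<xi> - \<nu> \<xi>) \<le> norm (\<mu> \<eta> - \<nu> \<eta>) + r / 3"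
            using bspec[OF bspec[OF \<eta>(2) \<mu>] \<nu>(1)] .
          thus "norm (\<mu> \<xi> - \<nu> \<xi>) \<le> 2 * r / 3" using \<nu>(2)[OF \<eta>(1)] by linarith
        qed (use r in simp)
        hence "\<nu> \<in> mball \<mu> r" using \<mu> \<nu> r by simp
        thus "\<nu> \<in> U" using r by blast
      qed
      ultimately show "\<exists>T. openin (weak_star_topology X S) T \<and> \<mu> \<in> T \<and> T \<subseteq> U" by blast
    qed
  next
    assume U: "openin (weak_star_topology X S) U"
    have "continuous_map mtopology (weak_star_topology X S) (\<lambda>\<mu>. \<mu>)"
      unfolding weak_star_topology_def continuous_map_in_subtopology continuous_map_componentwise
      using ext eval by auto
    from openin_continuous_map_preimage[OF this U]
    have "openin mtopology {\<mu> \<in> S. \<mu> \<in> U}" by simp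
    moreover have "U \<subseteq> S" using openin_subset[OF U] top by simp
    hence "{\<mu> \<in> S. \<mu> \<in> U} = U" by auto
    ultimately show "openin mtopology U" by simp
  qed
  hence "mtopology = weak_star_topology X S" by (simp add: topology_eq)
  moreover have "Metric_space S D" ..
  ultimately show ?thesis
    unfolding metrizes_def top using fin by (simp add: D_def[abs_def])
qed

section \<open>A bound for the quantum Gromov-Hausdorff distance\<close>

lemma order_unit_spaceD:
  assumes "is_order_unit_space W"
  shows "subspace (ou_carrier W)" "ou_unit W \<in> ou_carrier W"
    "\<And>\<xi>. \<xi> \<in> ou_carrier W \<Longrightarrow> ou_le W \<xi> \<xi>"
    "\<And>\<xi> \<eta>. \<xi> \<in> ou_carrier W \<Longrightarrow> \<eta> \<in> ou_carrier W \<Longrightarrow> ou_le W \<xi> \<eta> \<Longrightarrow> ou_le W \<eta> \<xi> \<Longrightarrow> \<xi> = \<eta>"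
    "\<And>\<xi> \<eta> \<zeta>. \<xi> \<in> ou_carrier W \<Longrightarrow> \<eta> \<in> ou_carrier W \<Longrightarrow> \<zeta> \<in> ou_carrier W \<Longrightarrow>
      ou_le W \<xi> \<eta> \<Longrightarrow> ou_le W \<eta> \<zeta> \<Longrightarrow> ou_le W \<xi> \<zeta>"
    "\<And>\<xi> \<eta> \<zeta>. \<xi> \<in> ou_carrier W \<Longrightarrow> \<eta> \<in> ou_carrier W \<Longrightarrow> \<zeta> \<in> ou_carrier W \<Longrightarrow>
      ou_le W \<xi> \<eta> \<Longrightarrow> ou_le W (\<xi> + \<zeta>) (\<eta> + \<zeta>)"
    "\<And>\<xi> \<eta> r. \<xi> \<in> ou_carrier W \<Longrightarrow> \<eta> \<in> ou_carrier W \<Longrightarrow> 0 \<le> r \<Longrightarrow>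
      ou_le W \<xi> \<eta> \<Longrightarrow> ou_le W (r *\<^sub>R \<xi>) (r *\<^sub>R \<eta>)"
    "\<And>\<xi>. \<xi> \<in> ou_carrier W \<Longrightarrow> \<exists>r. ou_le W \<xi> (r *\<^sub>R ou_unit W)"
    "\<And>\<xi>. \<xi> \<in> ou_carrier W \<Longrightarrow> (\<And>r. r > 0 \<Longrightarrow> ou_le W \<xi> (r *\<^sub>R ou_unit W)) \<Longrightarrow> ou_le W \<xi> 0"
proof -
  note d1 = assms[unfolded is_order_unit_space_def]
  note d2 = conjunct2[OF d1]
  note d3 = conjunct2[OF d2]
  note d4 = conjunct2[OF d3]
  note d5 = conjunct2[OF d4]
  note d6 = conjunct2[OF d5]
  note d7 = conjunct2[OF d6]
  note d8 = conjunct2[OF d7]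
  note d9 = conjunct2[OF d8]
  show "subspace (ou_carrier W)" "ou_unit W \<in> ou_carrier W"
    by (rule conjunct1[OF d1], rule conjunct1[OF d2])
  show "ou_le W \<xi> \<xi>" if "\<xi> \<in> ou_carrier W" for \<xi>
    using conjunct1[OF d3] that by simp
  show "\<xi> = \<eta>" if "\<xi> \<in> ou_carrier W" "\<eta> \<in> ou_carrier W" "ou_le W \<xi> \<eta>" "ou_le W \<eta> \<xi>" for \<xi> \<eta>
    using conjunct1[OF d4] that by simp
  show "ou_le W \<xi> \<zeta>" if "\<xi> \<in> ou_carrier W" "\<eta> \<in> ou_carrier W" "\<zeta> \<in> ou_carrier W"
    "ou_le W \<xi> \<eta>" "ou_le W \<eta> \<zeta>" for \<xi> \<eta> \<zeta>
    by (rule conjunct1[OF d5, rule_format, of _ \<eta>]) (simp_all add: that)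
  show "ou_le W (\<xi> + \<zeta>) (\<eta> + \<zeta>)"
    if "\<xi> \<in> ou_carrier W" "\<eta> \<in> ou_carrier W" "\<zeta> \<in> ou_carrier W" "ou_le W \<xi> \<eta>" for \<xi> \<eta> \<zeta>
    by (rule conjunct1[OF d6, rule_format]) (simp_all add: that)
  show "ou_le W (r *\<^sub>R \<xi>) (r *\<^sub>R \<eta>)"
    if "\<xi> \<in> ou_carrier W" "\<eta> \<in> ou_carrier W" "0 \<le> r" "ou_le W \<xi> \<eta>" for \<xi> \<eta> r
    by (rule conjunct1[OF d7, rule_format]) (simp_all add: that)
  show "\<exists>r. ou_le W \<xi> (r *\<^sub>R ou_unit W)" if "\<xi> \<in> ou_carrier W" for \<xi>
    by (rule conjunct1[OF d8, rule_format]) (simp_all add: that)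
  show "ou_le W \<xi> 0" if "\<xi> \<in> ou_carrier W" "\<And>r. r > 0 \<Longrightarrow> ou_le W \<xi> (r *\<^sub>R ou_unit W)" for \<xi>
    by (rule d9[rule_format]) (simp_all add: that)
qed

lemma ou_statesD:
  assumes "\<mu> \<in> ou_states W"
  shows "\<mu> \<in> extensional (ou_carrier W)" "\<mu> (ou_unit W) = 1"
    "\<And>\<xi> \<eta>. \<xi> \<in> ou_carrier W \<Longrightarrow> \<eta> \<in> ou_carrier W \<Longrightarrow> \<mu> (\<xi> + \<eta>) = \<mu> \<xi> + \<mu> \<eta>"
    "\<And>r \<xi>. \<xi> \<in> ou_carrier W \<Longrightarrow> \<mu> (r *\<^sub>R \<xi>) = r * \<mu> \<xi>"
    "\<And>\<xi>. \<xi> \<in> ou_carrier W \<Longrightarrow> ou_le W 0 \<xi> \<Longrightarrow> 0 \<le> \<mu> \<xi>"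
  using assms by (simp_all add: ou_states_def)

lemma ou_state_bound:
  assumes W: "is_order_unit_space W" and \<mu>: "\<mu> \<in> ou_states W" and \<xi>: "\<xi> \<in> ou_carrier W"
    and le: "ou_le W \<xi> (r *\<^sub>R ou_unit W)" "ou_le W (- \<xi>) (r *\<^sub>R ou_unit W)"
  shows "\<bar>\<mu> \<xi>\<bar> \<le> r"
proof -
  note [simp] = ou_statesD(2)[OF \<mu>]
  note sub = order_unit_spaceD(1)[OF W] and u = order_unit_spaceD(2)[OF W]
    and tr = order_unit_spaceD(6)[OF W]
    and add = ou_statesD(3)[OF \<mu>] and sc = ou_statesD(4)[OF \<mu>] and pos = ou_statesD(5)[OF \<mu>]
  have main: "\<mu> \<eta> \<le> r" if \<eta>: "\<eta> \<in> ou_carrier W" "ou_le W \<eta> (r *\<^sub>R ou_unit W)" for \<eta>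
  proof -
    have c: "r *\<^sub>R ou_unit W \<in> ou_carrier W" "- \<eta> \<in> ou_carrier W"
      "r *\<^sub>R ou_unit W + - \<eta> \<in> ou_carrier W"
      using sub u \<eta> by (simp_all add: subspace_scale subspace_neg subspace_add subspace_diff)
    have "ou_le W 0 (r *\<^sub>R ou_unit W + - \<eta>)"
      using tr[OF \<eta>(1) c(1,2) \<eta>(2)] by simp
    from pos[OF c(3) this] have "0 \<le> r * \<mu> (ou_unit W) + \<mu> (- \<eta>)"
      using add[OF c(1,2)] sc[OF u] by simp
    thus ?thesis using sc[OF \<eta>(1), of "-1"] by simp
  qed
  have "- \<xi> \<in> ou_carrier W" using sub \<xi> by (simp add: subspace_neg)
  thus ?thesis using main[OF \<xi> le(1)] main[of "- \<xi>"] le(2) sc[OF \<xi>, of "-1"] by simp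
qed

definition normed_order_unit :: "'v::real_normed_vector order_unit_space \<Rightarrow> bool"
  where "normed_order_unit W \<longleftrightarrow> is_order_unit_space W \<and>
    (\<forall>\<xi>\<in>ou_carrier W. \<forall>r\<ge>norm \<xi>. ou_le W \<xi> (r *\<^sub>R ou_unit W))"

text \<open>The order unit axiom provides a bound \<open>r\<close> for each component; the norm
  hypothesis admits every larger \<open>r\<close>, and so a common one.\<close>

lemma is_order_unit_space_sum:
  assumes W1: "normed_order_unit W1" and W2: "normed_order_unit W2"
  shows "is_order_unit_space (ou_sum W1 W2)"
proof -
  have W: "is_order_unit_space W1" "is_order_unit_space W2"
    "\<And>\<xi> r. \<xi> \<in> ou_carrier W1 \<Longrightarrow> norm \<xi> \<le> r \<Longrightarrow> ou_le W1 \<xi> (r *\<^sub>R ou_unit W1)"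
    "\<And>\<xi> r. \<xi> \<in> ou_carrier W2 \<Longrightarrow> norm \<xi> \<le> r \<Longrightarrow> ou_le W2 \<xi> (r *\<^sub>R ou_unit W2)"
    using W1 W2 by (auto simp: normed_order_unit_def)
  have sel: "ou_carrier (ou_sum W1 W2) = ou_carrier W1 \<times> ou_carrier W2"
    "ou_unit (ou_sum W1 W2) = (ou_unit W1, ou_unit W2)"
    "\<And>a b c d. ou_le (ou_sum W1 W2) (a, b) (c, d) \<longleftrightarrow> ou_le W1 a c \<and> ou_le W2 b d"
    by (simp_all add: ou_sum_def)
  have unit: "\<exists>r. ou_le W1 a (r *\<^sub>R ou_unit W1) \<and> ou_le W2 b (r *\<^sub>R ou_unit W2)"
    if "a \<in> ou_carrier W1" "b \<in> ou_carrier W2" for a b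
    using W(3)[OF that(1), of "max (norm a) (norm b)"] W(4)[OF that(2), of "max (norm a) (norm b)"]
    by auto
  note d1 = order_unit_spaceD[OF W(1)] and d2 = order_unit_spaceD[OF W(2)]
  have sub: "subspace (ou_carrier W1 \<times> ou_carrier W2)"
    by (rule subspace_Times[OF d1(1) d2(1)])
  show ?thesis
    unfolding is_order_unit_space_def sel split_paired_Ball_Sigma
    apply (intro conjI ballI allI impI)
    subgoal by (rule sub)
    subgoal by (simp add: d1(2) d2(2))
    subgoal by (rule d1(3))
    subgoal by (rule d2(3))
    subgoal by (simp add: sel d1(4) d2(4))
    subgoal by (elim conjE) (erule (4) d1(5))
    subgoal by (elim conjE) (erule (4) d2(5))
    subgoal by (simp add: sel d1(6) d2(6))
    subgoal by (simp add: sel d1(7) d2(7))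
    subgoal by (simp add: sel unit)
    subgoal by (simp add: sel zero_prod_def d1(9) d2(9))
    done
qed


lemma ou_state_le_norm:
  assumes W: "normed_order_unit W" and \<mu>: "\<mu> \<in> ou_states W" and \<xi>: "\<xi> \<in> ou_carrier W"
  shows "\<bar>\<mu> \<xi>\<bar> \<le> norm \<xi>"
proof -
  have W': "is_order_unit_space W" using W by (simp add: normed_order_unit_def)
  have "- \<xi> \<in> ou_carrier W" by (rule subspace_neg[OF order_unit_spaceD(1)[OF W'] \<xi>])
  thus ?thesis
    by (intro ou_state_bound[OF W' \<mu> \<xi>]) (use W \<xi> in \<open>simp_all add: normed_order_unit_def\<close>)
qed

definition unital_positive_map ::
    "'v::real_normed_vector order_unit_space \<Rightarrow> 'w::real_normed_vector order_unit_space \<Rightarrow> ('v \<Rightarrow> 'w) \<Rightarrow> bool"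
  where "unital_positive_map W1 W2 \<Psi> \<longleftrightarrow>
    (\<forall>a\<in>ou_carrier W1. \<Psi> a \<in> ou_carrier W2 \<and> norm (\<Psi> a) \<le> norm a \<and> (ou_le W1 0 a \<longrightarrow> ou_le W2 0 (\<Psi> a))) \<and>
    (\<forall>a\<in>ou_carrier W1. \<forall>b\<in>ou_carrier W1. \<Psi> (a + b) = \<Psi> a + \<Psi> b) \<and>
    (\<forall>r. \<forall>a\<in>ou_carrier W1. \<Psi> (r *\<^sub>R a) = r *\<^sub>R \<Psi> a) \<and> \<Psi> (ou_unit W1) = ou_unit W2"

lemma unital_positive_mapD:
  assumes "unital_positive_map W1 W2 \<Psi>"
  shows "\<And>a. a \<in> ou_carrier W1 \<Longrightarrow> \<Psi> a \<in> ou_carrier W2" "\<And>a. a \<in> ou_carrier W1 \<Longrightarrow> norm (\<Psi> a) \<le> norm a"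
    "\<And>a. a \<in> ou_carrier W1 \<Longrightarrow> ou_le W1 0 a \<Longrightarrow> ou_le W2 0 (\<Psi> a)"
    "\<And>a b. a \<in> ou_carrier W1 \<Longrightarrow> b \<in> ou_carrier W1 \<Longrightarrow> \<Psi> (a + b) = \<Psi> a + \<Psi> b"
    "\<And>r a. a \<in> ou_carrier W1 \<Longrightarrow> \<Psi> (r *\<^sub>R a) = r *\<^sub>R \<Psi> a" "\<Psi> (ou_unit W1) = ou_unit W2"
  using assms by (simp_all add: unital_positive_map_def)

lemma unital_positive_map_diff:
  assumes "unital_positive_map W1 W2 \<Psi>" "subspace (ou_carrier W1)" "a \<in> ou_carrier W1" "b \<in> ou_carrier W1"
  shows "\<Psi> (a - b) = \<Psi> a - \<Psi> b"
  using unital_positive_mapD(4)[OF assms(1,3), of "(-1) *\<^sub>R b"] unital_positive_mapD(5)[OF assms(1,4), of "-1"]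
    subspace_neg[OF assms(2,4)] by simp

lemma state_comp_unital_positive_map:
  assumes \<Phi>: "unital_positive_map W2 W1 \<Phi>" and W2: "is_order_unit_space W2" and \<mu>: "\<mu> \<in> ou_states W1"
  shows "restrict (\<mu> \<circ> \<Phi>) (ou_carrier W2) \<in> ou_states W2"
proof -
  note \<Phi>' = unital_positive_mapD[OF \<Phi>] and \<mu>' = ou_statesD[OF \<mu>] and W = order_unit_spaceD[OF W2]
  have c: "a + b \<in> ou_carrier W2" "r *\<^sub>R a \<in> ou_carrier W2" if "a \<in> ou_carrier W2" "b \<in> ou_carrier W2" for a b r
    using W(1) that by (auto simp: subspace_add subspace_scale)
  show ?thesis
    unfolding ou_states_def by (auto simp: c \<Phi>' \<mu>' W(2))
qed

text \<open>A quantitative form of Rieffel's criterion: the Lipschitz ball is totally bounded modulo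
  scalars, with radius \<open>D\<close>. The radius \<open>R\<close> is left free because on a
  direct sum the second component has to be cut off at a radius larger than
  \<open>D\<close>.\<close>

definition bounded_lip_seminorm ::
    "'v::real_normed_vector order_unit_space \<Rightarrow> ('v \<Rightarrow> real) \<Rightarrow> real \<Rightarrow> bool"
  where "bounded_lip_seminorm W L D \<longleftrightarrow> normed_order_unit W \<and> ou_seminorm W L \<and> 0 \<le> D \<and>
    (\<forall>a\<in>ou_carrier W. \<exists>s. norm (a - s *\<^sub>R ou_unit W) \<le> D * L a) \<and>
    (\<forall>R. \<forall>e>0. \<exists>F. finite F \<and> F \<subseteq> ou_carrier W \<and>
      (\<forall>a\<in>ou_carrier W. L a \<le> 1 \<longrightarrow> norm a \<le> R \<longrightarrow> (\<exists>b\<in>F. norm (a - b) \<le> e)))"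

lemma bounded_lip_seminormD:
  assumes "bounded_lip_seminorm W L D"
  shows "normed_order_unit W" "is_order_unit_space W" "subspace (ou_carrier W)" "ou_unit W \<in> ou_carrier W"
    "0 \<le> D" "\<And>a. a \<in> ou_carrier W \<Longrightarrow> \<exists>s. norm (a - s *\<^sub>R ou_unit W) \<le> D * L a"
    "\<And>e R. 0 < e \<Longrightarrow> \<exists>F. finite F \<and> F \<subseteq> ou_carrier W \<and>
      (\<forall>a\<in>ou_carrier W. L a \<le> 1 \<longrightarrow> norm a \<le> R \<longrightarrow> (\<exists>b\<in>F. norm (a - b) \<le> e))"
    "\<And>a. a \<in> ou_carrier W \<Longrightarrow> 0 \<le> L a"
    "\<And>a b. a \<in> ou_carrier W \<Longrightarrow> b \<in> ou_carrier W \<Longrightarrow> L (a + b) \<le> L a + L b"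
    "\<And>r a. a \<in> ou_carrier W \<Longrightarrow> L (r *\<^sub>R a) = \<bar>r\<bar> * L a" "L (ou_unit W) = 0"
  using assms order_unit_spaceD(1,2)[of W]
  by (simp_all add: bounded_lip_seminorm_def normed_order_unit_def ou_seminorm_def)

text \<open>The quotient seminorms have to agree exactly, while \<open>\<Psi>\<close> may increase
  the seminorm by the factor \<open>1 + \<epsilon>\<close>. Hence \<open>\<Psi> a\<close> is
  contracted by \<open>1 / (1 + \<epsilon>)\<close>, and not towards 0 but towards a scalar near
  \<open>a\<close>: the distance of \<open>a\<close> to the scalars is controlled by
  \<open>L1 a\<close>, its norm is not.\<close>

lemma lip_approximant:
  assumes B1: "bounded_lip_seminorm W1 L1 D" and B2: "bounded_lip_seminorm W2 L2 D"
    and \<Psi>: "unital_positive_map W1 W2 \<Psi>" and \<Phi>: "unital_positive_map W2 W1 \<Phi>"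
    and lip: "\<And>a. a \<in> ou_carrier W1 \<Longrightarrow> L2 (\<Psi> a) \<le> (1 + \<epsilon>) * L1 a"
    and inv: "\<And>a. a \<in> ou_carrier W1 \<Longrightarrow> norm (a - \<Phi> (\<Psi> a)) \<le> \<epsilon> * L1 a"
    and "0 < \<epsilon>" and a: "a \<in> ou_carrier W1"
  shows "\<exists>b\<in>ou_carrier W2. L2 b \<le> L1 a \<and> norm (a - \<Phi> b) \<le> \<epsilon> * (1 + D) * L1 a \<and>
    norm (b - \<Psi> a) \<le> \<epsilon> * (1 + D) * L1 a"
proof -
  note b1 = bounded_lip_seminormD[OF B1] and b2 = bounded_lip_seminormD[OF B2]
    and p = unital_positive_mapD[OF \<Psi>] and q = unital_positive_mapD[OF \<Phi>]
  obtain s where s: "norm (a - s *\<^sub>R ou_unit W1) \<le> D * L1 a" using b1(6)[OF a] by blast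
  define k where "k = 1 / (1 + \<epsilon>)"
  have k: "0 < k" "k \<le> 1" "1 - k \<le> \<epsilon>" "k * (1 + \<epsilon>) = 1"
    using \<open>0 < \<epsilon>\<close> by (auto simp: k_def field_simps)
  define c where "c = \<Psi> (a - s *\<^sub>R ou_unit W1)"
  have as: "a - s *\<^sub>R ou_unit W1 \<in> ou_carrier W1"
    by (intro subspace_diff subspace_scale b1 a)
  have c: "c \<in> ou_carrier W2" "c = \<Psi> a - s *\<^sub>R ou_unit W2" "norm c \<le> D * L1 a"
    using p(1)[OF as] unital_positive_map_diff[OF \<Psi> b1(3) a subspace_scale[OF b1(3,4)], of s]
      p(5)[OF b1(4), of s] p(6) p(2)[OF as] s by (auto simp: c_def)
  define b where "b = s *\<^sub>R ou_unit W2 + k *\<^sub>R c"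
  have b: "b \<in> ou_carrier W2"
    unfolding b_def by (intro subspace_add subspace_scale b2 c)
  have unit0: "L2 (r *\<^sub>R ou_unit W2) = 0" for r
    using b2(10)[OF b2(4), of r] b2(11) by simp
  have "L2 c \<le> L2 (\<Psi> a) + L2 ((- s) *\<^sub>R ou_unit W2)"
    using b2(9)[OF p(1)[OF a] subspace_scale[OF b2(3,4)], of "- s"] by (simp add: c(2))
  hence Lc: "L2 c \<le> (1 + \<epsilon>) * L1 a" using lip[OF a] unit0[of "- s"] by simp
  have "L2 b \<le> L2 (s *\<^sub>R ou_unit W2) + L2 (k *\<^sub>R c)"
    unfolding b_def by (intro b2(9) subspace_scale b2(3,4) c(1))
  also have "\<dots> = k * L2 c" using unit0 b2(10)[OF c(1), of k] k by simp
  also have "\<dots> \<le> k * ((1 + \<epsilon>) * L1 a)"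
    using Lc k by (intro mult_left_mono) auto
  also have "\<dots> = L1 a" using k(4) by (simp flip: mult.assoc)
  finally have Lb: "L2 b \<le> L1 a" .
  have La: "0 \<le> L1 a" by (rule b1(8)[OF a])
  have "\<Psi> a - b = (1 - k) *\<^sub>R c" by (simp add: b_def c(2) algebra_simps)
  hence "norm (\<Psi> a - b) = (1 - k) * norm c" using k by simp
  also have "\<dots> \<le> \<epsilon> * (D * L1 a)"
    using k c(3) \<open>0 < \<epsilon>\<close> by (intro mult_mono) auto
  finally have n: "norm (\<Psi> a - b) \<le> \<epsilon> * D * L1 a" by (simp add: mult.assoc)
  have pa: "\<Psi> a \<in> ou_carrier W2" by (rule p(1)[OF a])
  have "norm (a - \<Phi> b) \<le> norm (a - \<Phi> (\<Psi> a)) + norm (\<Phi> (\<Psi> a) - \<Phi> b)"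
    using norm_triangle_ineq[of "a - \<Phi> (\<Psi> a)" "\<Phi> (\<Psi> a) - \<Phi> b"] by simp
  also have "norm (\<Phi> (\<Psi> a) - \<Phi> b) \<le> norm (\<Psi> a - b)"
    using q(2)[OF subspace_diff[OF b2(3) pa b]] unital_positive_map_diff[OF \<Phi> b2(3) pa b] by simp
  finally have "norm (a - \<Phi> b) \<le> \<epsilon> * (1 + D) * L1 a"
    using n inv[OF a] by (simp add: algebra_simps)
  moreover have "norm (b - \<Psi> a) \<le> \<epsilon> * (1 + D) * L1 a"
  proof -
    have "0 \<le> \<epsilon> * L1 a" using La \<open>0 < \<epsilon>\<close> by simp
    thus ?thesis using n by (simp add: norm_minus_commute algebra_simps)
  qed
  ultimately show ?thesis using b Lb by blast
qed

text \<open>The seminorm on the sum penalizes the distance of \<open>(a, b)\<close> from the graphs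
  of both maps. Each graph serves one half of the Hausdorff distance. The hypotheses
  \<open>inv1\<close> and \<open>inv2\<close> make the lift of an element, which is built from its
  image on the other side, lie close to both graphs.\<close>

lemma ou_dist_q_le:
  fixes W1 :: "'v::real_normed_vector order_unit_space" and W2 :: "'w::real_normed_vector order_unit_space"
  assumes B1: "bounded_lip_seminorm W1 L1 D" and B2: "bounded_lip_seminorm W2 L2 D"
    and \<Psi>: "unital_positive_map W1 W2 \<Psi>" and \<Phi>: "unital_positive_map W2 W1 \<Phi>"
    and lip1: "\<And>a. a \<in> ou_carrier W1 \<Longrightarrow> L2 (\<Psi> a) \<le> (1 + \<epsilon>) * L1 a"
    and lip2: "\<And>b. b \<in> ou_carrier W2 \<Longrightarrow> L1 (\<Phi> b) \<le> (1 + \<epsilon>) * L2 b"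
    and inv1: "\<And>a. a \<in> ou_carrier W1 \<Longrightarrow> norm (a - \<Phi> (\<Psi> a)) \<le> \<epsilon> * L1 a"
    and inv2: "\<And>b. b \<in> ou_carrier W2 \<Longrightarrow> norm (b - \<Psi> (\<Phi> b)) \<le> \<epsilon> * L2 b"
    and "0 < \<epsilon>"
  shows "ou_dist_q W1 L1 W2 L2 \<le> ennreal (\<epsilon> * (1 + D))"
proof -
  note b1 = bounded_lip_seminormD[OF B1] and b2 = bounded_lip_seminormD[OF B2]
    and p = unital_positive_mapD[OF \<Psi>] and q = unital_positive_mapD[OF \<Phi>]
  let ?C1 = "ou_carrier W1" and ?C2 = "ou_carrier W2" and ?W = "ou_sum W1 W2"
  have sel: "ou_carrier ?W = ?C1 \<times> ?C2"
    "ou_unit ?W = (ou_unit W1, ou_unit W2)"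
    "\<And>a b c d. ou_le ?W (a, b) (c, d) \<longleftrightarrow> ou_le W1 a c \<and> ou_le W2 b d"
    by (simp_all add: ou_sum_def)
  text \<open>The terms \<open>a - \<Phi> b\<close> and \<open>b - \<Psi> a\<close> make \<open>\<mu>\<close> and \<open>\<mu> \<circ> \<Phi>\<close>, and likewise \<open>\<nu>\<close> and \<open>\<nu> \<circ> \<Psi>\<close>, \<open>K\<close>-close.
    The summand \<open>D\<close> in \<open>K\<close> pays for rescaling \<open>\<Psi> a\<close> by \<open>1 + \<epsilon>\<close> in order to lift \<open>a\<close> without increasing \<open>L1\<close>.\<close>
  define K where "K = \<epsilon> * (1 + D)"
  have K: "K > 0" using \<open>0 < \<epsilon>\<close> b1(5) by (simp add: K_def add_pos_nonneg)
  define N where "N a b = max (norm (a - \<Phi> b)) (norm (b - \<Psi> a))" for a b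
  define L where "L = (\<lambda>(a, b). max (L1 a) (max (L2 b) (N a b / K)))"
  have L_le: "L (a, b) \<le> r \<longleftrightarrow> L1 a \<le> r \<and> L2 b \<le> r \<and> norm (a - \<Phi> b) \<le> K * r \<and> norm (b - \<Psi> a) \<le> K * r" for a b r
    using K by (auto simp: L_def N_def field_simps)
  have ouW: "is_order_unit_space ?W" by (rule is_order_unit_space_sum[OF b1(1) b2(1)])
  have semi: "ou_seminorm ?W L"
    unfolding ou_seminorm_def sel split_paired_Ball_Sigma
  proof (intro conjI ballI allI)
    fix a b assume ab: "a \<in> ?C1" "b \<in> ?C2"
    show "0 \<le> L (a, b)" using b1(8)[OF ab(1)] by (simp add: L_def le_max_iff_disj)
    show "L (r *\<^sub>R (a, b)) = \<bar>r\<bar> * L (a, b)" for r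
    proof -
      have "N (r *\<^sub>R a) (r *\<^sub>R b) = \<bar>r\<bar> * N a b"
        using ab by (simp add: N_def p q max_mult_distrib_left flip: scaleR_diff_right)
      thus ?thesis using ab by (simp add: L_def b1 b2 max_mult_distrib_left)
    qed
    fix c d assume cd: "c \<in> ?C1" "d \<in> ?C2"
    have "L1 (a + c) \<le> L1 a + L1 c" "L2 (b + d) \<le> L2 b + L2 d"
      using ab cd b1(9) b2(9) by auto
    moreover have "norm ((a + c) - \<Phi> (b + d)) \<le> norm (a - \<Phi> b) + norm (c - \<Phi> d)"
      using norm_triangle_ineq[of "a - \<Phi> b" "c - \<Phi> d"] ab cd by (simp add: q(4) algebra_simps)
    moreover have "norm ((b + d) - \<Psi> (a + c)) \<le> norm (b - \<Psi> a) + norm (d - \<Psi> c)"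
      using norm_triangle_ineq[of "b - \<Psi> a" "d - \<Psi> c"] ab cd by (simp add: p(4) algebra_simps)
    moreover note L_le[of a b "L (a, b)"] L_le[of c d "L (c, d)"]
    ultimately show "L ((a, b) + (c, d)) \<le> L (a, b) + L (c, d)"
      by (simp add: L_le distrib_left)
  next
    show "L (ou_unit W1, ou_unit W2) = 0"
      using b1(11) b2(11) by (simp add: L_def N_def p(6) q(6))
  qed
  have state_bound: "\<bar>\<mu> (a, b)\<bar> \<le> max (norm a) (norm b)"
    if "\<mu> \<in> ou_states ?W" "a \<in> ?C1" "b \<in> ?C2" for \<mu> a b
  proof (rule ou_state_bound[OF ouW that(1)])
    show "(a, b) \<in> ou_carrier ?W" using that by (simp add: sel)
    have "- a \<in> ?C1" "- b \<in> ?C2" using that b1(3) b2(3) by (simp_all add: subspace_neg)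
    thus "ou_le ?W (a, b) (max (norm a) (norm b) *\<^sub>R ou_unit ?W)"
      "ou_le ?W (- (a, b)) (max (norm a) (norm b) *\<^sub>R ou_unit ?W)"
      using b1(1) b2(1) that by (simp_all add: sel normed_order_unit_def)
  qed
  have met: "metrizes (functional_dist (ou_carrier ?W) L) (weak_star_topology (ou_carrier ?W) (ou_states ?W))"
  proof (rule metrizes_weak_star)
    show "ou_states ?W \<subseteq> extensional (ou_carrier ?W)" by (auto simp: ou_states_def)
    fix e :: real assume e: "0 < e"
    {
      fix \<xi> assume \<xi>: "\<xi> \<in> ou_carrier ?W"
      define c where "c = L \<xi> + 1"
      have c: "c > 0" using semi \<xi> by (auto simp: c_def ou_seminorm_def add_nonneg_pos)
      have "L ((1 / c) *\<^sub>R \<xi>) = L \<xi> / c"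
        using semi \<xi> c by (simp add: ou_seminorm_def)
      hence le: "L ((1 / c) *\<^sub>R \<xi>) \<le> 1" using c by (simp add: c_def)
      have m: "(1 / c) *\<^sub>R \<xi> \<in> ou_carrier ?W"
        by (rule subspace_scale[OF order_unit_spaceD(1)[OF ouW] \<xi>])
      have "norm (\<mu> \<xi> - \<nu> \<xi>) \<le> c * norm (\<mu> ((1 / c) *\<^sub>R \<xi>) - \<nu> ((1 / c) *\<^sub>R \<xi>)) + e"
        if "\<mu> \<in> ou_states ?W" "\<nu> \<in> ou_states ?W" for \<mu> \<nu>
        using ou_statesD(4)[OF that(1) \<xi>, of "1 / c"] ou_statesD(4)[OF that(2) \<xi>, of "1 / c"] c e
        by (simp add: abs_mult flip: diff_divide_distrib)
      thus "\<exists>c \<eta>. \<eta> \<in> ou_carrier ?W \<and> L \<eta> \<le> 1 \<and> 0 \<le> c \<and>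
          (\<forall>\<mu>\<in>ou_states ?W. \<forall>\<nu>\<in>ou_states ?W. norm (\<mu> \<xi> - \<nu> \<xi>) \<le> c * norm (\<mu> \<eta> - \<nu> \<eta>) + e)"
        using c le m by (intro exI[of _ c] exI[of _ "(1 / c) *\<^sub>R \<xi>"]) auto
    }
    obtain F1 where F1: "finite F1" "F1 \<subseteq> ?C1"
      "\<forall>a\<in>?C1. L1 a \<le> 1 \<longrightarrow> norm a \<le> D \<longrightarrow> (\<exists>b\<in>F1. norm (a - b) \<le> e / 2)"
      using b1(7)[OF half_gt_zero[OF e]] by meson
    obtain F2 where F2: "finite F2" "F2 \<subseteq> ?C2"
      "\<forall>a\<in>?C2. L2 a \<le> 1 \<longrightarrow> norm a \<le> K + D \<longrightarrow> (\<exists>b\<in>F2. norm (a - b) \<le> e / 2)"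
      using b2(7)[OF half_gt_zero[OF e]] by meson
    show "\<exists>F. finite F \<and> F \<subseteq> ou_carrier ?W \<and> (\<forall>\<xi>\<in>ou_carrier ?W. L \<xi> \<le> 1 \<longrightarrow>
      (\<exists>\<eta>\<in>F. \<forall>\<mu>\<in>ou_states ?W. \<forall>\<nu>\<in>ou_states ?W. norm (\<mu> \<xi> - \<nu> \<xi>) \<le> norm (\<mu> \<eta> - \<nu> \<eta>) + e))"
      unfolding sel split_paired_Ball_Sigma
    proof (intro exI[of _ "F1 \<times> F2"] conjI ballI impI)
      show "finite (F1 \<times> F2)" "F1 \<times> F2 \<subseteq> ?C1 \<times> ?C2" using F1 F2 by auto
      fix a b assume ab: "a \<in> ?C1" "b \<in> ?C2" and "L (a, b) \<le> 1"
      hence L1: "L1 a \<le> 1" "L2 b \<le> 1" "norm (b - \<Psi> a) \<le> K" by (simp_all add: L_le)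
      obtain s where s: "norm (a - s *\<^sub>R ou_unit W1) \<le> D * L1 a" using b1(6)[OF ab(1)] by blast
      \<comment> \<open>The same scalar is removed from both components, since differences of states
        of the sum ignore multiples of the joint unit only. Then \<open>b'\<close> remains bounded
        because it is \<open>K\<close>-close to \<open>\<Psi> a'\<close>; this explains the radius
        \<open>K + D\<close> for \<open>F2\<close>.\<close>
      define a' where "a' = a - s *\<^sub>R ou_unit W1"
      define b' where "b' = b - s *\<^sub>R ou_unit W2"
      have ab': "a' \<in> ?C1" "b' \<in> ?C2"
        unfolding a'_def b'_def by (intro subspace_diff subspace_scale b1 b2 ab)+
      have na: "norm a' \<le> D" using s mult_left_mono[OF L1(1) b1(5)] by (simp add: a'_def)
      have "\<Psi> a' = \<Psi> a - s *\<^sub>R ou_unit W2"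
        unfolding a'_def unital_positive_map_diff[OF \<Psi> b1(3) ab(1) subspace_scale[OF b1(3,4)]]
        by (simp add: p(5)[OF b1(4)] p(6))
      hence "norm (b' - \<Psi> a') \<le> K" using L1(3) by (simp add: b'_def)
      hence nb: "norm b' \<le> K + D"
        using norm_triangle_ineq[of "b' - \<Psi> a'" "\<Psi> a'"] p(2)[OF ab'(1)] na by simp
      have "L1 a' \<le> 1"
      proof -
        have "L1 a' \<le> L1 a + L1 ((- s) *\<^sub>R ou_unit W1)"
          using b1(9)[OF ab(1) subspace_scale[OF b1(3,4)], of "- s"] by (simp add: a'_def)
        thus ?thesis using L1(1) b1(10)[OF b1(4), of "- s"] b1(11) by simp
      qed
      then obtain c where c: "c \<in> F1" "norm (a' - c) \<le> e / 2" using F1(3) ab'(1) na by blast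
      have "L2 b' \<le> 1"
      proof -
        have "L2 b' \<le> L2 b + L2 ((- s) *\<^sub>R ou_unit W2)"
          using b2(9)[OF ab(2) subspace_scale[OF b2(3,4)], of "- s"] by (simp add: b'_def)
        thus ?thesis using L1(2) b2(10)[OF b2(4), of "- s"] b2(11) by simp
      qed
      then obtain d where d: "d \<in> F2" "norm (b' - d) \<le> e / 2" using F2(3) ab'(2) nb by blast
      have cd: "c \<in> ?C1" "d \<in> ?C2" using c d F1(2) F2(2) by auto
      have ev: "\<bar>\<mu> (a, b) - s - \<mu> (c, d)\<bar> \<le> e / 2" if \<mu>: "\<mu> \<in> ou_states ?W" for \<mu>
      proof -
        note \<mu>' = ou_statesD[OF \<mu>, unfolded sel]
        have m: "(a' - c, b' - d) \<in> ?C1 \<times> ?C2"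
          using ab' cd b1(3) b2(3) by (simp add: subspace_diff)
        have "(a, b) = (a' - c, b' - d) + ((c, d) + s *\<^sub>R (ou_unit W1, ou_unit W2))"
          by (simp add: a'_def b'_def)
        moreover have "s *\<^sub>R (ou_unit W1, ou_unit W2) \<in> ?C1 \<times> ?C2"
          "(c, d) + s *\<^sub>R (ou_unit W1, ou_unit W2) \<in> ?C1 \<times> ?C2" "(c, d) \<in> ?C1 \<times> ?C2"
          using cd b1(3,4) b2(3,4) by (auto simp: subspace_scale subspace_add)
        ultimately have "\<mu> (a, b) = \<mu> (a' - c, b' - d) + (\<mu> (c, d) + s * \<mu> (ou_unit W1, ou_unit W2))"
          using \<mu>'(3,4) m b1(4) b2(4) by (metis SigmaI)
        hence "\<mu> (a, b) - s - \<mu> (c, d) = \<mu> (a' - c, b' - d)" using \<mu>'(2) by simp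
        thus ?thesis using state_bound[OF \<mu>, of "a' - c" "b' - d"] m c(2) d(2) by simp
      qed
      show "\<exists>\<eta>\<in>F1 \<times> F2. \<forall>\<mu>\<in>ou_states ?W. \<forall>\<nu>\<in>ou_states ?W.
          norm (\<mu> (a, b) - \<nu> (a, b)) \<le> norm (\<mu> \<eta> - \<nu> \<eta>) + e"
      proof (intro bexI[of _ "(c, d)"] ballI)
        fix \<mu> \<nu> assume "\<mu> \<in> ou_states ?W" "\<nu> \<in> ou_states ?W"
        from ev[OF this(1)] ev[OF this(2)]
        show "norm (\<mu> (a, b) - \<nu> (a, b)) \<le> norm (\<mu> (c, d) - \<nu> (c, d)) + e"
          unfolding real_norm_def by linarith
      qed (use c d in auto)
    qed
  qed
  have adm: "admissible_seminorm W1 L1 W2 L2 L"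
    unfolding admissible_seminorm_def
  proof (intro conjI ballI)
    show "ou_cqms ?W L" using ouW semi met by (simp add: ou_cqms_def)
    have L0: "0 \<le> L (a, b)" if "a \<in> ?C1" "b \<in> ?C2" for a b
      using semi that by (simp add: ou_seminorm_def sel)
    show "L1 a = (INF b\<in>?C2. L (a, b))" if a: "a \<in> ?C1" for a
    proof (rule antisym)
      show "L1 a \<le> (INF b\<in>?C2. L (a, b))"
        using b2(4) by (intro cINF_greatest) (auto simp: L_def)
      obtain b where "b \<in> ?C2" "L2 b \<le> L1 a" "norm (a - \<Phi> b) \<le> \<epsilon> * (1 + D) * L1 a"
          "norm (b - \<Psi> a) \<le> \<epsilon> * (1 + D) * L1 a"
        using lip_approximant[OF B1 B2 \<Psi> \<Phi> lip1 inv1 \<open>0 < \<epsilon>\<close> a] by blast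
      moreover have "L (a, b) \<le> L1 a" using calculation by (simp add: L_le K_def)
      ultimately show "(INF b\<in>?C2. L (a, b)) \<le> L1 a"
        by (intro cINF_lower2[of _ _ b]) (auto intro!: bdd_belowI2[where m = 0] L0 a)
    qed
    show "L2 b = (INF a\<in>?C1. L (a, b))" if b: "b \<in> ?C2" for b
    proof (rule antisym)
      show "L2 b \<le> (INF a\<in>?C1. L (a, b))"
        using b1(4) by (intro cINF_greatest) (auto simp: L_def)
      obtain a where "a \<in> ?C1" "L1 a \<le> L2 b" "norm (b - \<Psi> a) \<le> \<epsilon> * (1 + D) * L2 b"
          "norm (a - \<Phi> b) \<le> \<epsilon> * (1 + D) * L2 b"
        using lip_approximant[OF B2 B1 \<Phi> \<Psi> lip2 inv2 \<open>0 < \<epsilon>\<close> b] by blast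
      moreover have "L (a, b) \<le> L2 b" using calculation by (simp add: L_le K_def)
      ultimately show "(INF a\<in>?C1. L (a, b)) \<le> L2 b"
        by (intro cINF_lower2[of _ _ a]) (auto intro!: bdd_belowI2[where m = 0] L0 b)
    qed
  qed
  let ?p1 = "\<lambda>\<mu>. restrict (\<mu> \<circ> fst) (ou_carrier ?W)" and ?p2 = "\<lambda>\<mu>. restrict (\<mu> \<circ> snd) (ou_carrier ?W)"
  have d1: "functional_dist (ou_carrier ?W) L (?p1 \<mu>) (?p2 (restrict (\<mu> \<circ> \<Phi>) ?C2)) \<le> ennreal K"
    if \<mu>: "\<mu> \<in> ou_states W1" for \<mu>
  proof (rule functional_dist_least)
    fix \<xi> assume "\<xi> \<in> ou_carrier ?W" "L \<xi> \<le> 1"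
    then obtain a b where \<xi>: "\<xi> = (a, b)" and ab: "a \<in> ?C1" "b \<in> ?C2" and le: "L (a, b) \<le> 1"
      by (cases \<xi>) (auto simp: sel)
    note m = subspace_diff[OF b1(3) ab(1) q(1)[OF ab(2)]]
    have "\<mu> a = \<mu> (a - \<Phi> b) + \<mu> (\<Phi> b)"
      using ou_statesD(3)[OF \<mu> m q(1)[OF ab(2)]] by simp
    thus "norm (?p1 \<mu> \<xi> - ?p2 (restrict (\<mu> \<circ> \<Phi>) ?C2) \<xi>) \<le> K"
      using ou_state_le_norm[OF b1(1) \<mu> m] le ab by (simp add: \<xi> sel L_le)
  qed
  have d2: "functional_dist (ou_carrier ?W) L (?p1 (restrict (\<nu> \<circ> \<Psi>) ?C1)) (?p2 \<nu>) \<le> ennreal K"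
    if \<nu>: "\<nu> \<in> ou_states W2" for \<nu>
  proof (rule functional_dist_least)
    fix \<xi> assume "\<xi> \<in> ou_carrier ?W" "L \<xi> \<le> 1"
    then obtain a b where \<xi>: "\<xi> = (a, b)" and ab: "a \<in> ?C1" "b \<in> ?C2" and le: "L (a, b) \<le> 1"
      by (cases \<xi>) (auto simp: sel)
    note m = subspace_diff[OF b2(3) ab(2) p(1)[OF ab(1)]]
    have "\<nu> b = \<nu> (b - \<Psi> a) + \<nu> (\<Psi> a)"
      using ou_statesD(3)[OF \<nu> m p(1)[OF ab(1)]] by simp
    thus "norm (?p1 (restrict (\<nu> \<circ> \<Psi>) ?C1) \<xi> - ?p2 \<nu> \<xi>) \<le> K"
      using ou_state_le_norm[OF b2(1) \<nu> m] le ab by (simp add: \<xi> sel L_le abs_minus_commute)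
  qed
  have "hausdorff_distance (functional_dist (ou_carrier ?W) L) (?p1 ` ou_states W1) (?p2 ` ou_states W2) \<le> ennreal K"
    unfolding hausdorff_distance_def
  proof (intro max.boundedI SUP_least)
    fix x assume "x \<in> ?p1 ` ou_states W1"
    then obtain \<mu> where \<mu>: "\<mu> \<in> ou_states W1" "x = ?p1 \<mu>" by blast
    have "?p2 (restrict (\<mu> \<circ> \<Phi>) ?C2) \<in> ?p2 ` ou_states W2"
      by (intro imageI state_comp_unital_positive_map[OF \<Phi> b2(2) \<mu>(1)])
    from INF_lower[OF this, of "functional_dist (ou_carrier ?W) L x"] d1[OF \<mu>(1)]
    show "(INF y\<in>?p2 ` ou_states W2. functional_dist (ou_carrier ?W) L x y) \<le> ennreal K"
      unfolding \<mu>(2) by (rule order_trans)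
  next
    fix y assume "y \<in> ?p2 ` ou_states W2"
    then obtain \<nu> where \<nu>: "\<nu> \<in> ou_states W2" "y = ?p2 \<nu>" by blast
    have "?p1 (restrict (\<nu> \<circ> \<Psi>) ?C1) \<in> ?p1 ` ou_states W1"
      by (intro imageI state_comp_unital_positive_map[OF \<Psi> b1(2) \<nu>(1)])
    from INF_lower[OF this, of "\<lambda>x. functional_dist (ou_carrier ?W) L x y"] d2[OF \<nu>(1)]
    show "(INF x\<in>?p1 ` ou_states W1. functional_dist (ou_carrier ?W) L x y) \<le> ennreal K"
      unfolding \<nu>(2) by (rule order_trans)
  qed
  thus ?thesis
    unfolding ou_dist_q_def K_def[symmetric] by (intro INF_lower2[of L]) (use adm in simp_all)
qed

section \<open>Crossed products by the integers\<close>

lemma op_eq_ketI: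
  assumes "\<And>u v. cinner (ket u) (op_apply S (ket v)) = cinner (ket u) (op_apply T (ket v))"
  shows "S = T"
proof (rule op_eqI)
  fix x
  have eq: "op_apply S (ket v) = op_apply T (ket v)" for v
    by (rule ell2_eqI) (use assms[of _ v] in \<open>simp add: cinner_ket\<close>)
  have "x \<in> {x. op_apply S x = op_apply T x}"
  proof (rule ell2_dense_induct)
    show "closed {x. op_apply S x = op_apply T x}"
      by (intro closed_Collect_eq bounded_linear.continuous_on[OF bounded_linear_op_apply] continuous_on_id)
  qed (simp add: op_apply_sum eq)
  thus "op_apply S x = op_apply T x" by simp
qed

lemma star_eq_ketI:
  assumes "\<And>u v. cinner (ket u) (op_apply S (ket v)) = cnj (cinner (ket v) (op_apply T (ket u)))"
  shows "star T = S"
  by (rule op_eq_ketI) (metis assms cinner_commute cinner_star)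

lemma int_iterate_0 [simp]: "int_iterate f 0 x = x"
  by (simp add: int_iterate_def)

lemma int_iterate_add:
  assumes "bij f"
  shows "int_iterate f (m + n) x = int_iterate f m (int_iterate f n x)"
proof (induction n arbitrary: x rule: int_induct[where k = 0])
  case (step1 i)
  have "int_iterate f (m + (i + 1)) x = int_iterate f (m + i) (f x)"
    using int_iterate_Suc[OF assms, of "m + i" x] by (simp add: add.assoc)
  thus ?case using step1 by (simp add: int_iterate_Suc[OF assms])
next
  case (step2 i)
  define y where "y = inv f x"
  have x: "x = f y" using assms by (simp add: y_def bij_is_surj surj_f_inv_f)
  have "int_iterate f (m + (i - 1)) (f y) = int_iterate f (m + i) y"
    "int_iterate f (i - 1) (f y) = int_iterate f i y"
    using int_iterate_Suc[OF assms, of "m + (i - 1)" y] int_iterate_Suc[OF assms, of "i - 1" y] by simp_all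
  thus ?case using step2 by (simp add: x)
qed simp

lemma int_iterate_cancel:
  assumes "bij f"
  shows "int_iterate f n (int_iterate f (- n) x) = x" "int_iterate f (- n) (int_iterate f n x) = x"
  using int_iterate_add[OF assms, of n "- n" x] int_iterate_add[OF assms, of "- n" n x] by simp_all

lemma bij_int_iterate:
  assumes "bij f"
  shows "bij (int_iterate f n)"
  by (rule o_bij[of "int_iterate f (- n)"]) (auto simp: int_iterate_cancel[OF assms])

lemma int_iterate_invariant:
  assumes "\<And>x. x \<in> S \<Longrightarrow> f x \<in> S" "\<And>x. x \<in> S \<Longrightarrow> inv f x \<in> S" "x \<in> S"
  shows "int_iterate f n x \<in> S"
proof -
  have "(g ^^ k) x \<in> S" if "\<And>x. x \<in> S \<Longrightarrow> g x \<in> S" for g k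
    by (induction k) (use that assms(3) in auto)
  thus ?thesis using assms(1,2) by (simp add: int_iterate_def)
qed

section \<open>Pointwise operations on functions and finitely supported sequences\<close>

lemma bcontfun_sum_apply: "apply_bcontfun (sum f F) p = (\<Sum>i\<in>F. apply_bcontfun (f i) p)"
  by (induction F rule: infinite_finite_induct) (simp_all add: zero_bcontfun.rep_eq plus_bcontfun.rep_eq)

definition bcontfun_cmult :: "complex \<Rightarrow> ('x::topological_space \<Rightarrow>\<^sub>C complex) \<Rightarrow> 'x \<Rightarrow>\<^sub>C complex"
  where "bcontfun_cmult c f = Bcontfun (\<lambda>p. c * apply_bcontfun f p)"

lemma bcontfun_cmult_apply [simp]: "apply_bcontfun (bcontfun_cmult c f) p = c * apply_bcontfun f p"
proof -
  have "continuous_on UNIV (\<lambda>p. c * apply_bcontfun f p)"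
    by (intro continuous_intros continuous_on_apply_bcontfun)
  hence "(\<lambda>p. c * apply_bcontfun f p) \<in> bcontfun"
    by (rule bcontfun_normI[of _ "cmod c * norm f"]) (simp add: norm_mult mult_left_mono norm_bounded)
  thus ?thesis by (simp add: bcontfun_cmult_def Bcontfun_inverse)
qed

definition bcontfun_mult :: "('x::topological_space \<Rightarrow>\<^sub>C complex) \<Rightarrow> ('x \<Rightarrow>\<^sub>C complex) \<Rightarrow> 'x \<Rightarrow>\<^sub>C complex"
  where "bcontfun_mult g f = Bcontfun (\<lambda>p. apply_bcontfun g p * apply_bcontfun f p)"

lemma bcontfun_mult_apply [simp]: "apply_bcontfun (bcontfun_mult g f) p = apply_bcontfun g p * apply_bcontfun f p"
proof -
  have "continuous_on UNIV (\<lambda>p. apply_bcontfun g p * apply_bcontfun f p)"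
    by (intro continuous_intros continuous_on_apply_bcontfun)
  hence "(\<lambda>p. apply_bcontfun g p * apply_bcontfun f p) \<in> bcontfun"
    by (rule bcontfun_normI[of _ "norm g * norm f"]) (simp add: norm_mult mult_mono norm_bounded)
  thus ?thesis by (simp add: bcontfun_mult_def Bcontfun_inverse)
qed

lemmas bcontfun_apply_simps [simp] = uminus_bcontfun.rep_eq minus_bcontfun.rep_eq
  scaleR_bcontfun.rep_eq zero_bcontfun.rep_eq const_bcontfun.rep_eq cnj_bcontfun_apply

lemma bcontfun_cmult_0 [simp]: "bcontfun_cmult c 0 = 0"
  by (rule bcontfun_eqI) simp

lemma scaleR_bcontfun_cmult: "r *\<^sub>R f = bcontfun_cmult (complex_of_real r) f"
  by (rule bcontfun_eqI) (simp add: scaleR_conv_of_real)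

lemma finite_supportD:
  assumes "x \<in> finite_support V"
  shows "finite {n. x n \<noteq> 0}" "\<And>n. x n \<in> V"
  using assms by (auto simp: finite_support_def)

lemma finite_support_UNIV: "x \<in> finite_support V \<Longrightarrow> x \<in> finite_support UNIV"
  by (simp add: finite_support_def)

lemma finite_supportI:
  assumes "finite G" "\<And>n. n \<notin> G \<Longrightarrow> x n = 0" "\<And>n. x n \<in> V"
  shows "x \<in> finite_support V"
  using assms by (auto simp: finite_support_def intro: finite_subset[of _ G])

lemma finite_support_map:
  assumes "x \<in> finite_support V" "\<And>n. x n = 0 \<Longrightarrow> g n = 0" "\<And>n. g n \<in> V'"
  shows "g \<in> finite_support V'"
  by (rule finite_supportI[of "{n. x n \<noteq> 0}"]) (use assms in \<open>auto simp: finite_support_def\<close>)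

lemma finite_support_map2:
  assumes "x \<in> finite_support V" "y \<in> finite_support V'" "\<And>n. x n = 0 \<Longrightarrow> y n = 0 \<Longrightarrow> g n = 0" "\<And>n. g n \<in> V''"
  shows "g \<in> finite_support V''"
  by (rule finite_supportI[of "{n. x n \<noteq> 0} \<union> {n. y n \<noteq> 0}"]) (use assms in \<open>auto simp: finite_support_def\<close>)

lemma unital_cstar_subalgebra_closure:
  fixes P :: "'b::cstar_algebra set"
  assumes "1 \<in> P" "\<And>a b. a \<in> P \<Longrightarrow> b \<in> P \<Longrightarrow> a + b \<in> P" "\<And>a b. a \<in> P \<Longrightarrow> b \<in> P \<Longrightarrow> a * b \<in> P"
    "\<And>c a. a \<in> P \<Longrightarrow> c *\<^sub>C a \<in> P" "\<And>a. a \<in> P \<Longrightarrow> star a \<in> P"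
  shows "unital_cstar_subalgebra (closure P)"
proof -
  have bin: "f a b \<in> closure P" if ab: "a \<in> closure P" "b \<in> closure P"
    and f: "\<And>a b. a \<in> P \<Longrightarrow> b \<in> P \<Longrightarrow> f a b \<in> P"
    and lim: "\<And>X Y a b. X \<longlonglongrightarrow> a \<Longrightarrow> Y \<longlonglongrightarrow> b \<Longrightarrow> (\<lambda>n. f (X n) (Y n)) \<longlonglongrightarrow> f a b"
    for f :: "'b \<Rightarrow> 'b \<Rightarrow> 'b" and a b
  proof -
    obtain X where "\<And>n. X n \<in> P" "X \<longlonglongrightarrow> a"
      using ab(1) unfolding closure_sequential by blast
    moreover obtain Y where "\<And>n. Y n \<in> P" "Y \<longlonglongrightarrow> b"
      using ab(2) unfolding closure_sequential by blast
    ultimately have "\<forall>n. f (X n) (Y n) \<in> P" "(\<lambda>n. f (X n) (Y n)) \<longlonglongrightarrow> f a b"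
      using f lim by simp_all
    thus ?thesis unfolding closure_sequential by (intro exI conjI)
  qed
  have un: "g a \<in> closure P" if a: "a \<in> closure P" "\<And>a. a \<in> P \<Longrightarrow> g a \<in> P" "bounded_linear g" for g :: "'b \<Rightarrow> 'b" and a
  proof -
    obtain X where "\<And>n. X n \<in> P" "X \<longlonglongrightarrow> a"
      using a(1) unfolding closure_sequential by blast
    hence "\<forall>n. g (X n) \<in> P" "(\<lambda>n. g (X n)) \<longlonglongrightarrow> g a"
      using a(2) bounded_linear.tendsto[OF a(3)] by simp_all
    thus ?thesis unfolding closure_sequential by (intro exI conjI)
  qed
  have "a + b \<in> closure P" "a * b \<in> closure P" if "a \<in> closure P" "b \<in> closure P" for a b
    using bin[OF that, of "(+)"] bin[OF that, of "(*)"] assms by (auto intro: tendsto_add tendsto_mult)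
  moreover have "c *\<^sub>C a \<in> closure P" "star a \<in> closure P" if "a \<in> closure P" for a c
    by (rule un[OF that assms(4) bounded_linear_scaleC], assumption)
      (rule un[OF that assms(5) bounded_linear_star])
  moreover have "1 \<in> closure P" using assms(1) closure_subset by blast
  ultimately show ?thesis by (simp add: unital_cstar_subalgebra_def)
qed

locale homeo_system =
  fixes \<psi> :: "'x::topological_space \<Rightarrow> 'x"
  assumes homeo: "bij \<psi>" "continuous_on UNIV \<psi>" "continuous_on UNIV (inv \<psi>)"
begin

abbreviation "\<beta> \<equiv> pullback \<psi>"
abbreviation "cs \<equiv> crossed_sum \<beta>"

lemma int_iterate_pullback:
  "apply_bcontfun (int_iterate \<beta> n f) p = apply_bcontfun f (int_iterate \<psi> n p)"
proof -
  have *: "apply_bcontfun ((pullback \<phi> ^^ k) f) p = apply_bcontfun f ((\<phi> ^^ k) p)"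
    if "continuous_on UNIV \<phi>" for \<phi> :: "'x \<Rightarrow> 'x" and k p
  proof (induction k arbitrary: p)
    case (Suc k)
    thus ?case by (simp add: pullback_apply that) (simp add: funpow_swap1)
  qed simp
  show ?thesis
    by (simp add: int_iterate_def pullback_inverse(2)[OF homeo] * homeo)
qed

text \<open>A crossed sum is a Toeplitz matrix in the integer variable, twisted along the orbits of
  \<open>\<psi>\<close>, and diagonal in the space variable. Algebraic identities, the coefficient
  bound and the compressions below are checked on these entries.\<close>

lemma cs_entry:
  assumes "finite {n. x n \<noteq> 0}"
  shows "cinner (ket (i, p)) (op_apply (cs x) (ket (j, q)))
    = (if p = q then apply_bcontfun (x (i - j)) (int_iterate \<psi> (- i) p) else 0)"
proof -
  have "cinner (ket (i, p)) (op_apply (cs x) (ket (j, q)))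
      = (\<Sum>k | x k \<noteq> 0. if k = i - j then (if p = q then apply_bcontfun (x k) (int_iterate \<psi> (- i) p) else 0) else 0)"
    unfolding cinner_ket crossed_sum_def op_apply_sum_left[OF homeo] ell2_apply_sum
    by (intro sum.cong)
      (auto simp: op_apply_rules coeff_op_apply[OF homeo] shift_power_apply ket.rep_eq int_iterate_pullback)
  also have "\<dots> = (if p = q then apply_bcontfun (x (i - j)) (int_iterate \<psi> (- i) p) else 0)"
    using assms by (simp add: sum.delta)
  finally show ?thesis .
qed

lemma cs_eqI:
  assumes "finite {n. x n \<noteq> 0}"
    and "\<And>i p j q. cinner (ket (i, p)) (op_apply T (ket (j, q)))
      = (if p = q then apply_bcontfun (x (i - j)) (int_iterate \<psi> (- i) p) else 0)"
  shows "T = cs x"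
proof (rule op_eq_ketI)
  fix u v :: "int \<times> 'x"
  show "cinner (ket u) (op_apply T (ket v)) = cinner (ket u) (op_apply (cs x) (ket v))"
    by (cases u; cases v) (simp add: assms(2) cs_entry[OF assms(1)])
qed

lemma cs_inj: "x \<in> finite_support V \<Longrightarrow> y \<in> finite_support V \<Longrightarrow> cs x = cs y \<Longrightarrow> x = y"
  using crossed_sum_inj[OF homeo] by (rule inj_onD)

lemma cs_add:
  assumes "x \<in> finite_support UNIV" "y \<in> finite_support UNIV"
  shows "cs (\<lambda>n. x n + y n) = cs x + cs y"
proof -
  have "(\<lambda>n. x n + y n) \<in> finite_support UNIV"
    by (rule finite_support_map2[OF assms]) auto
  thus ?thesis
    by (intro cs_eqI[symmetric]) (use assms in \<open>auto simp: finite_support_def op_apply_rules cinner_add_right cs_entry\<close>)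
qed

lemma cs_cmult:
  assumes "x \<in> finite_support UNIV"
  shows "cs (\<lambda>n. bcontfun_cmult c (x n)) = c *\<^sub>C cs x"
proof -
  have "(\<lambda>n. bcontfun_cmult c (x n)) \<in> finite_support UNIV"
    by (rule finite_support_map[OF assms]) auto
  thus ?thesis
    by (intro cs_eqI[symmetric]) (use assms in \<open>auto simp: finite_support_def op_apply_rules cinner_scaleC_right cs_entry\<close>)
qed

lemma cs_scaleR:
  assumes "x \<in> finite_support UNIV"
  shows "cs (\<lambda>n. r *\<^sub>R x n) = r *\<^sub>R cs x"
  using cs_cmult[OF assms, of "of_real r"] by (simp add: scaleR_bcontfun_cmult scaleR_scaleC)

lemma cs_diff:
  assumes "x \<in> finite_support UNIV" "y \<in> finite_support UNIV"
  shows "cs (\<lambda>n. x n - y n) = cs x - cs y"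
proof -
  have "(\<lambda>n. (-1) *\<^sub>R y n) \<in> finite_support UNIV"
    by (rule finite_support_map[OF assms(2)]) auto
  from cs_add[OF assms(1) this] cs_scaleR[OF assms(2), of "-1"] show ?thesis by simp
qed

lemma adjoint_finite_support:
  assumes "x \<in> finite_support V" "\<And>f. f \<in> V \<Longrightarrow> cnj_bcontfun f \<in> V'" "\<And>f n. f \<in> V' \<Longrightarrow> int_iterate \<beta> n f \<in> V'"
  shows "crossed_adjoint \<beta> x \<in> finite_support V'"
proof (rule finite_supportI[of "uminus ` {n. x n \<noteq> 0}"])
  show "finite (uminus ` {n. x n \<noteq> 0})" using assms by (simp add: finite_support_def)
  fix n assume "n \<notin> uminus ` {n. x n \<noteq> 0}"
  hence "x (- n) = 0" by force
  thus "crossed_adjoint \<beta> x n = 0"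
    by (intro bcontfun_eqI) (simp add: crossed_adjoint_def int_iterate_pullback)
qed (use assms in \<open>simp add: crossed_adjoint_def finite_support_def\<close>)

lemma crossed_adjoint_apply:
  "apply_bcontfun (crossed_adjoint \<beta> x n) p = cnj (apply_bcontfun (x (- n)) (int_iterate \<psi> n p))"
  by (simp add: crossed_adjoint_def int_iterate_pullback)

lemma star_cs:
  assumes "x \<in> finite_support UNIV"
  shows "star (cs x) = cs (crossed_adjoint \<beta> x)"
proof (rule star_eq_ketI)
  fix u v :: "int \<times> 'x"
  have "crossed_adjoint \<beta> x \<in> finite_support UNIV"
    by (rule adjoint_finite_support[OF assms]) auto
  hence f: "finite {n. crossed_adjoint \<beta> x n \<noteq> 0}" "finite {n. x n \<noteq> 0}"
    using assms by (auto simp: finite_support_def)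
  obtain i p j q where "u = (i, p)" "v = (j, q)" by (cases u; cases v)
  moreover have "int_iterate \<psi> (i - j) (int_iterate \<psi> (- i) p) = int_iterate \<psi> (- j) p" for p
    using int_iterate_add[OF homeo(1), of "i - j" "- i" p] by simp
  ultimately show "cinner (ket u) (op_apply (cs (crossed_adjoint \<beta> x)) (ket v))
      = cnj (cinner (ket v) (op_apply (cs x) (ket u)))"
    by (simp add: cs_entry f crossed_adjoint_apply)
qed

lemma crossed_adjoint_twice:
  assumes "x \<in> finite_support UNIV"
  shows "crossed_adjoint \<beta> (crossed_adjoint \<beta> x) = x"
proof (rule ext, rule bcontfun_eqI)
  fix n p
  show "apply_bcontfun (crossed_adjoint \<beta> (crossed_adjoint \<beta> x) n) p = apply_bcontfun (x n) p"
    by (simp add: crossed_adjoint_apply int_iterate_cancel[OF homeo(1)])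
qed

abbreviation "poly_alg \<equiv> cs ` finite_support UNIV"

lemma poly_alg_add:
  assumes "a \<in> poly_alg" "b \<in> poly_alg"
  shows "a + b \<in> poly_alg"
proof -
  obtain x where x: "a = cs x" "x \<in> finite_support UNIV" using assms(1) by (rule imageE)
  obtain y where y: "b = cs y" "y \<in> finite_support UNIV" using assms(2) by (rule imageE)
  have "(\<lambda>n. x n + y n) \<in> finite_support UNIV"
    by (rule finite_support_map2[OF x(2) y(2)]) auto
  thus ?thesis unfolding x(1) y(1) cs_add[OF x(2) y(2), symmetric] by (rule imageI)
qed

lemma poly_alg_sum:
  assumes "\<And>i. i \<in> F \<Longrightarrow> f i \<in> poly_alg"
  shows "sum f F \<in> poly_alg"
proof -
  have zero: "0 \<in> poly_alg"
    by (rule image_eqI[of _ _ "\<lambda>_. 0"]) (auto simp: crossed_sum_def finite_support_def)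
  show ?thesis
    using assms
  proof (induction F rule: infinite_finite_induct)
    case (insert i F)
    have "f i + sum f F \<in> poly_alg"
      by (intro poly_alg_add insert.IH insert.prems) simp_all
    thus ?case by (simp only: sum.insert[OF insert.hyps])
  next
    case empty
    show ?case unfolding sum.empty by (rule zero)
  next
    case (infinite F)
    show ?case unfolding sum.infinite[OF infinite(1)] by (rule zero)
  qed
qed

text \<open>By covariance, left multiplication by a single term with coefficient \<open>f\<close>
  and shift \<open>k\<close> multiplies the \<open>k\<close>-th iterate of \<open>y (n - k)\<close>
  by \<open>f\<close>; a general product is a finite sum of these.\<close>

lemma poly_alg_mult:
  assumes "a \<in> poly_alg" "b \<in> poly_alg"
  shows "a * b \<in> poly_alg"
proof -
  obtain x y where xy: "a = cs x" "b = cs y" "x \<in> finite_support UNIV" "y \<in> finite_support UNIV"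
    using assms by blast
  have "coeff_op \<beta> f * (shift_power k * cs y) \<in> poly_alg" for f k
  proof -
    define z where "z n = bcontfun_mult f (int_iterate \<beta> k (y (n - k)))" for n
    have z: "z \<in> finite_support UNIV"
    proof (rule finite_supportI[of "(\<lambda>n. n + k) ` {n. y n \<noteq> 0}"])
      show "finite ((\<lambda>n. n + k) ` {n. y n \<noteq> 0})" using xy by (simp add: finite_support_def)
      fix n assume "n \<notin> (\<lambda>n. n + k) ` {n. y n \<noteq> 0}"
      hence "y (n - k) = 0" by force
      thus "z n = 0" by (intro bcontfun_eqI) (simp add: z_def int_iterate_pullback)
    qed simp
    have "coeff_op \<beta> f * (shift_power k * cs y) = cs z"
    proof (rule cs_eqI)
      show "finite {n. z n \<noteq> 0}" using z by (simp add: finite_support_def)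
      fix i j p q
      have "cinner (ket (i, p)) (op_apply (coeff_op \<beta> f * (shift_power k * cs y)) (ket (j, q)))
          = apply_bcontfun f (int_iterate \<psi> (- i) p) * cinner (ket (i - k, p)) (op_apply (cs y) (ket (j, q)))"
        by (simp add: cinner_ket op_apply_rules coeff_op_apply[OF homeo] shift_power_apply int_iterate_pullback)
      moreover have "int_iterate \<psi> k (int_iterate \<psi> (- i) p) = int_iterate \<psi> (k - i) p" for p
        using int_iterate_add[OF homeo(1), of k "- i" p] by simp
      ultimately show "cinner (ket (i, p)) (op_apply (coeff_op \<beta> f * (shift_power k * cs y)) (ket (j, q)))
        = (if p = q then apply_bcontfun (z (i - j)) (int_iterate \<psi> (- i) p) else 0)"
        using xy by (simp add: cs_entry finite_support_def z_def int_iterate_pullback algebra_simps)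
    qed
    thus ?thesis using z by blast
  qed
  hence "(\<Sum>n | x n \<noteq> 0. coeff_op \<beta> (x n) * (shift_power n * cs y)) \<in> poly_alg"
    by (intro poly_alg_sum) auto
  thus ?thesis by (simp add: xy crossed_sum_def[of \<beta> x] sum_distrib_right mult.assoc)
qed

end

section \<open>The unital algebra and norm estimates for coefficients and multipliers\<close>

context homeo_system begin

definition single :: "int \<Rightarrow> ('x \<Rightarrow>\<^sub>C complex) \<Rightarrow> int \<Rightarrow> ('x \<Rightarrow>\<^sub>C complex)"
  where "single k f = (\<lambda>n. if n = k then f else 0)"

lemma single_finite_support: "f \<in> V \<Longrightarrow> 0 \<in> V \<Longrightarrow> single k f \<in> finite_support V"
  by (rule finite_supportI[of "{k}"]) (auto simp: single_def)

lemma cs_const: "cs (single 0 (const_bcontfun c)) = c *\<^sub>C 1"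
proof (rule cs_eqI[symmetric])
  show "finite {n. single 0 (const_bcontfun c) n \<noteq> 0}"
    by (rule finite_subset[of _ "{0}"]) (auto simp: single_def)
  show "cinner (ket (i, p)) (op_apply (c *\<^sub>C 1) (ket (j, q)))
      = (if p = q then apply_bcontfun (single 0 (const_bcontfun c) (i - j)) (int_iterate \<psi> (- i) p) else 0)" for i p j q
    by (cases "i = j"; cases "p = q") (simp_all add: cinner_ket op_apply_rules ket.rep_eq single_def)
qed

lemma unital_cstar_subalgebra_crossed: "unital_cstar_subalgebra (reduced_crossed_product \<beta>)"
  unfolding reduced_crossed_product_def
proof (rule unital_cstar_subalgebra_closure)
  show "1 \<in> poly_alg"
    using cs_const[of 1] by (intro image_eqI[of _ _ "single 0 (const_bcontfun 1)"] single_finite_support) auto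
  fix a c assume "a \<in> poly_alg"
  then obtain x where x: "a = cs x" "x \<in> finite_support UNIV" by blast
  have "(\<lambda>n. bcontfun_cmult c (x n)) \<in> finite_support UNIV"
    by (rule finite_support_map[OF x(2)]) auto
  thus "c *\<^sub>C a \<in> poly_alg" unfolding x(1) cs_cmult[OF x(2), symmetric] by (rule imageI)
  show "star a \<in> poly_alg"
    unfolding x(1) star_cs[OF x(2)] by (intro imageI adjoint_finite_support[OF x(2)]) auto
qed (rule poly_alg_add poly_alg_mult; assumption)+

text \<open>The values of \<open>x n\<close> occur untwisted in the rows with integer index 0, where
  no iterate of \<open>\<psi>\<close> intervenes.\<close>

lemma norm_coeff_le:
  assumes "x \<in> finite_support V"
  shows "norm (x n) \<le> norm (cs x)"
proof (rule norm_bound)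
  fix p
  have "apply_bcontfun (x n) p = cinner (ket (0, p)) (op_apply (cs x) (ket (- n, p)))"
    using assms by (simp add: cs_entry finite_support_def)
  also have "cmod \<dots> \<le> norm (ket (0 :: int, p)) * norm (op_apply (cs x) (ket (- n, p)))"
    by (rule cinner_cauchy_schwarz)
  also have "\<dots> \<le> norm (cs x)"
    using norm_op_apply[of "cs x" "ket (- n, p)"] by (simp add: norm_ket)
  finally show "norm (apply_bcontfun (x n) p) \<le> norm (cs x)" .
qed

text \<open>The multiplier depends only on the difference of the integer indices. It is cut off at
  different space points, where the matrix entries vanish anyway; thereby a row sum runs over
  distinct integers and \<open>M\<close> bounds it.\<close>

lemma cs_multiplier:
  assumes x: "x \<in> finite_support V" and M: "\<And>F. finite F \<Longrightarrow> (\<Sum>n\<in>F. (m n)\<^sup>2) \<le> M\<^sup>2" "0 \<le> M"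
  shows "norm (cs (\<lambda>n. m n *\<^sub>R x n)) \<le> M * norm (cs x)"
proof (rule schur_multiplier_norm[where m = "\<lambda>u v. if snd u = snd v then m (fst u - fst v) else 0"])
  have "(\<lambda>n. m n *\<^sub>R x n) \<in> finite_support UNIV"
    by (rule finite_support_map[OF x]) auto
  hence f: "finite {n. m n *\<^sub>R x n \<noteq> 0}" "finite {n. x n \<noteq> 0}"
    using x unfolding finite_support_def by blast+
  show "cinner (ket u) (op_apply (cs (\<lambda>n. m n *\<^sub>R x n)) (ket v))
    = of_real (if snd u = snd v then m (fst u - fst v) else 0) * cinner (ket u) (op_apply (cs x) (ket v))" for u v
    by (cases u; cases v) (simp add: cs_entry[OF f(1)] cs_entry[OF f(2)] scaleR_conv_of_real)
  fix u :: "int \<times> 'x" and F :: "(int \<times> 'x) set" assume F: "finite F"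
  let ?F = "{v \<in> F. snd u = snd v}"
  have inj: "inj_on (\<lambda>v. fst u - fst v) ?F" by (auto simp: inj_on_def prod_eq_iff)
  have "(\<Sum>v\<in>F. (if snd u = snd v then m (fst u - fst v) else 0)\<^sup>2) = (\<Sum>v\<in>?F. (m (fst u - fst v))\<^sup>2)"
    using F by (intro sum.mono_neutral_cong_right) auto
  also have "\<dots> = (\<Sum>n\<in>(\<lambda>v. fst u - fst v) ` ?F. (m n)\<^sup>2)"
    by (simp add: sum.reindex[OF inj])
  also have "\<dots> \<le> M\<^sup>2" by (rule M) (use F in simp)
  finally show "(\<Sum>v\<in>F. (if snd u = snd v then m (fst u - fst v) else 0)\<^sup>2) \<le> M\<^sup>2" .
qed (rule M(2))

lemma norm_coeff_op: "norm (coeff_op \<beta> f) \<le> norm f"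
proof (rule norm_op_leI)
  fix \<xi> :: "(int \<times> 'x) ell2"
  show "norm (op_apply (coeff_op \<beta> f) \<xi>) \<le> norm f * norm \<xi>"
  proof (rule ell2_norm_leI)
    fix F :: "(int \<times> 'x) set" assume F: "finite F"
    have "(\<Sum>i\<in>F. (cmod (ell2_apply (op_apply (coeff_op \<beta> f) \<xi>) i))\<^sup>2) \<le> (\<Sum>i\<in>F. (norm f)\<^sup>2 * (cmod (ell2_apply \<xi> i))\<^sup>2)"
      by (intro sum_mono) (auto simp: coeff_op_apply[OF homeo] norm_mult power_mult_distrib
          int_iterate_pullback norm_bounded intro!: mult_right_mono power_mono)
    also have "\<dots> \<le> (norm f * norm \<xi>)\<^sup>2"
      using ell2_sum_le_norm[OF F, of \<xi>] by (simp add: power_mult_distrib mult_left_mono flip: sum_distrib_left)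
    finally show "(\<Sum>i\<in>F. (cmod (ell2_apply (op_apply (coeff_op \<beta> f) \<xi>) i))\<^sup>2) \<le> (norm f * norm \<xi>)\<^sup>2" .
  qed simp
qed simp

lemma norm_shift_power: "norm (shift_power k :: (int \<times> 'x) ell2_op) \<le> 1"
proof -
  have 1: "norm (shift_op :: (int \<times> 'x) ell2_op) = 1"
    using cstar_identity[of "shift_op :: (int \<times> 'x) ell2_op"] norm_ge_zero[of "shift_op :: (int \<times> 'x) ell2_op"]
    by (auto simp: shift_op_unitary power2_eq_1_iff simp del: norm_ge_zero)
  have "norm (shift_op ^ n :: (int \<times> 'x) ell2_op) \<le> 1" "norm (star shift_op ^ n :: (int \<times> 'x) ell2_op) \<le> 1" for n
    using norm_power_ineq[of "shift_op :: (int \<times> 'x) ell2_op" n]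
      norm_power_ineq[of "star shift_op :: (int \<times> 'x) ell2_op" n] by (simp_all add: norm_star 1)
  thus ?thesis by (simp add: shift_power_def)
qed

lemma norm_cs_le:
  assumes "finite G" "\<And>n. n \<notin> G \<Longrightarrow> x n = 0"
  shows "norm (cs x) \<le> (\<Sum>n\<in>G. norm (x n))"
proof -
  have "norm (cs x) \<le> (\<Sum>n | x n \<noteq> 0. norm (x n))"
    unfolding crossed_sum_def
  proof (rule sum_norm_le)
    fix n
    have "norm (coeff_op \<beta> (x n) * shift_power n) \<le> norm (coeff_op \<beta> (x n)) * norm (shift_power n :: (int \<times> 'x) ell2_op)"
      by (rule norm_mult_ineq)
    also have "\<dots> \<le> norm (x n) * 1"
      by (intro mult_mono norm_coeff_op norm_shift_power) auto
    finally show "norm (coeff_op \<beta> (x n) * shift_power n) \<le> norm (x n)" by simp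
  qed
  also have "\<dots> \<le> (\<Sum>n\<in>G. norm (x n))"
    by (rule sum_mono2) (use assms in auto)
  finally show ?thesis .
qed

end

section \<open>Lipschitz seminorms on operator algebras\<close>

text \<open>Rieffel's conditions, isolated from crossed products. They yield the metrization for the
  states of the algebra and, through the self-adjoint part, the hypotheses of
  \<open>ou_dist_q_le\<close>.\<close>

locale lip_algebra =
  fixes A V :: "'i ell2_op set" and L :: "'i ell2_op \<Rightarrow> real" and D :: real
  assumes A: "unital_cstar_subalgebra A" and VA: "V \<subseteq> A" and AV: "A \<subseteq> closure V" and V1: "1 \<in> V"
    and V_add: "a \<in> V \<Longrightarrow> b \<in> V \<Longrightarrow> a + b \<in> V" and V_scale: "a \<in> V \<Longrightarrow> c *\<^sub>C a \<in> V"
    and V_star: "a \<in> V \<Longrightarrow> star a \<in> V" and L_nonneg: "a \<in> V \<Longrightarrow> 0 \<le> L a"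
    and L_add: "a \<in> V \<Longrightarrow> b \<in> V \<Longrightarrow> L (a + b) \<le> L a + L b"
    and L_scale: "a \<in> V \<Longrightarrow> L (c *\<^sub>C a) = cmod c * L a" and L_one: "L 1 = 0"
    and L_star: "a \<in> V \<Longrightarrow> L (star a) = L a" and D_nonneg: "0 \<le> D"
    and diam: "a \<in> V \<Longrightarrow> \<exists>c. norm (a - c *\<^sub>C 1) \<le> D * L a"
    and tot_bdd: "0 < e \<Longrightarrow> \<exists>F. finite F \<and> F \<subseteq> V \<and>
      (\<forall>a\<in>V. L a \<le> 1 \<longrightarrow> norm a \<le> R \<longrightarrow> (\<exists>b\<in>F. norm (a - b) \<le> e))"
begin

lemma V_scaleR: "a \<in> V \<Longrightarrow> r *\<^sub>R a \<in> V"
  by (simp add: scaleR_scaleC V_scale)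

lemma V_diff: "a \<in> V \<Longrightarrow> b \<in> V \<Longrightarrow> a - b \<in> V"
  using V_add[of a "(-1) *\<^sub>R b"] V_scaleR[of b "-1"] by simp

lemma L_sub_const:
  assumes "a \<in> V"
  shows "L (a - c *\<^sub>C 1) \<le> L a"
  using L_add[OF assms V_scale[OF V1], of "- c"] L_scale[OF V1, of "- c"]
  by (simp add: L_one scaleC_minus_left)

lemma L_scaleR: "a \<in> V \<Longrightarrow> L (r *\<^sub>R a) = \<bar>r\<bar> * L a"
  by (simp add: scaleR_scaleC L_scale)

text \<open>Density of \<open>V\<close> supplies the approximation of evaluations at points of
  \<open>A\<close>; subtracting the scalar from \<open>diam\<close> confines the Lipschitz ball to
  radius \<open>D\<close>, where a finite net exists.\<close>

lemma states_metrizable: "metrizes (functional_dist V L) (weak_star_topology A (cstar_states A))"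
proof (rule metrizes_weak_star)
  note A' = cstar_subalgebraD[OF A]
  show "cstar_states A \<subseteq> extensional A" by (auto simp: cstar_states_def)
  have st: "\<mu> (a + b) = \<mu> a + \<mu> b" "\<mu> (c *\<^sub>C a) = c * \<mu> a" "\<mu> 1 = 1"
    if "\<mu> \<in> cstar_states A" "a \<in> A" "b \<in> A" for \<mu> a b c
    using that by (simp_all add: cstar_states_def)
  \<comment> \<open>The constant 4 counts two states, each with the factor 2 of
    \<open>cstar_state_bound\<close>.\<close>
  have close: "norm (\<mu> a - \<nu> a) \<le> norm (\<mu> b - \<nu> b) + 4 * norm (a - b)"
    if "\<mu> \<in> cstar_states A" "\<nu> \<in> cstar_states A" "a \<in> A" "b \<in> A" for \<mu> \<nu> a b
  proof -
    have ab: "a - b \<in> A" by (rule A'(10)[OF that(3,4)])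
    have "\<mu> a = \<mu> b + \<mu> (a - b)" "\<nu> a = \<nu> b + \<nu> (a - b)"
      using st(1)[OF that(1) that(4) ab] st(1)[OF that(2) that(4) ab] by simp_all
    hence "\<mu> a - \<nu> a = (\<mu> b - \<nu> b) + (\<mu> (a - b) - \<nu> (a - b))" by simp
    hence "norm (\<mu> a - \<nu> a) \<le> norm (\<mu> b - \<nu> b) + (norm (\<mu> (a - b)) + norm (\<nu> (a - b)))"
      using norm_triangle_ineq[of "\<mu> b - \<nu> b" "\<mu> (a - b) - \<nu> (a - b)"]
        norm_triangle_ineq4[of "\<mu> (a - b)" "\<nu> (a - b)"] by simp
    thus ?thesis
      using cstar_state_bound[OF A that(1) ab] cstar_state_bound[OF A that(2) ab] by linarith
  qed
  fix e :: real assume e: "0 < e"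
  {
    fix \<xi> assume \<xi>: "\<xi> \<in> A"
    then obtain \<eta> where \<eta>: "\<eta> \<in> V" "norm (\<xi> - \<eta>) < e / 4"
    proof -
      have "\<exists>y\<in>V. dist y \<xi> < e / 4"
        using subsetD[OF AV \<xi>] e unfolding closure_approachable by (meson divide_pos_pos zero_less_numeral)
      thus ?thesis using that by (auto simp: dist_norm norm_minus_commute)
    qed
    define c where "c = L \<eta> + 1"
    have c: "c > 0" using L_nonneg[OF \<eta>(1)] by (simp add: c_def)
    have m: "(1 / c) *\<^sub>R \<eta> \<in> V" by (rule V_scaleR[OF \<eta>(1)])
    have le: "L ((1 / c) *\<^sub>R \<eta>) \<le> 1"
      using c L_nonneg[OF \<eta>(1)] by (simp add: L_scaleR[OF \<eta>(1)] c_def)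
    have "norm (\<mu> \<xi> - \<nu> \<xi>) \<le> c * norm (\<mu> ((1 / c) *\<^sub>R \<eta>) - \<nu> ((1 / c) *\<^sub>R \<eta>)) + e"
      if "\<mu> \<in> cstar_states A" "\<nu> \<in> cstar_states A" for \<mu> \<nu>
    proof -
      have \<eta>A: "\<eta> \<in> A" using \<eta>(1) VA by blast
      have "\<mu> ((1 / c) *\<^sub>R \<eta>) - \<nu> ((1 / c) *\<^sub>R \<eta>) = complex_of_real (1 / c) * (\<mu> \<eta> - \<nu> \<eta>)"
        using st(2)[OF that(1) \<eta>A \<eta>A] st(2)[OF that(2) \<eta>A \<eta>A]
        by (simp only: scaleR_scaleC right_diff_distrib)
      hence "c * norm (\<mu> ((1 / c) *\<^sub>R \<eta>) - \<nu> ((1 / c) *\<^sub>R \<eta>)) = norm (\<mu> \<eta> - \<nu> \<eta>)"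
        using c by (simp only: norm_mult norm_of_real) simp
      thus ?thesis using close[OF that \<xi> \<eta>A] \<eta>(2) by simp
    qed
    thus "\<exists>c \<eta>. \<eta> \<in> V \<and> L \<eta> \<le> 1 \<and> 0 \<le> c \<and>
        (\<forall>\<mu>\<in>cstar_states A. \<forall>\<nu>\<in>cstar_states A. norm (\<mu> \<xi> - \<nu> \<xi>) \<le> c * norm (\<mu> \<eta> - \<nu> \<eta>) + e)"
      using c le m by (intro exI[of _ c] exI[of _ "(1 / c) *\<^sub>R \<eta>"]) simp
  }
  obtain F where F: "finite F" "F \<subseteq> V"
    "\<forall>a\<in>V. L a \<le> 1 \<longrightarrow> norm a \<le> D \<longrightarrow> (\<exists>b\<in>F. norm (a - b) \<le> e / 4)"
    using tot_bdd[of "e / 4" D] e by (meson divide_pos_pos zero_less_numeral)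
  show "\<exists>F. finite F \<and> F \<subseteq> A \<and> (\<forall>\<xi>\<in>V. L \<xi> \<le> 1 \<longrightarrow> (\<exists>\<eta>\<in>F. \<forall>\<mu>\<in>cstar_states A. \<forall>\<nu>\<in>cstar_states A.
      norm (\<mu> \<xi> - \<nu> \<xi>) \<le> norm (\<mu> \<eta> - \<nu> \<eta>) + e))"
  proof (intro exI[of _ F] conjI ballI impI)
    show "finite F" "F \<subseteq> A" using F VA by auto
    fix \<xi> assume \<xi>: "\<xi> \<in> V" "L \<xi> \<le> 1"
    obtain c where c: "norm (\<xi> - c *\<^sub>C 1) \<le> D * L \<xi>" using diam[OF \<xi>(1)] by blast
    define \<zeta> where "\<zeta> = \<xi> - c *\<^sub>C 1"
    have \<zeta>: "\<zeta> \<in> V" "L \<zeta> \<le> 1" "norm \<zeta> \<le> D"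
      using V_diff[OF \<xi>(1) V_scale[OF V1]] L_sub_const[OF \<xi>(1), of c] \<xi>(2) c
        mult_left_mono[OF \<xi>(2) D_nonneg] by (auto simp: \<zeta>_def)
    then obtain \<eta> where \<eta>: "\<eta> \<in> F" "norm (\<zeta> - \<eta>) \<le> e / 4" using F(3) by blast
    have AA: "\<zeta> \<in> A" "\<eta> \<in> A" "\<xi> \<in> A" "c *\<^sub>C 1 \<in> A" using \<zeta> \<eta> F VA \<xi> A'(2,5) by auto
    show "\<exists>\<eta>\<in>F. \<forall>\<mu>\<in>cstar_states A. \<forall>\<nu>\<in>cstar_states A. norm (\<mu> \<xi> - \<nu> \<xi>) \<le> norm (\<mu> \<eta> - \<nu> \<eta>) + e"
    proof (intro bexI[of _ \<eta>] ballI \<eta>(1))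
      fix \<mu> \<nu> assume \<mu>: "\<mu> \<in> cstar_states A" and \<nu>: "\<nu> \<in> cstar_states A"
      have shift: "\<kappa> \<xi> = \<kappa> \<zeta> + c" if "\<kappa> \<in> cstar_states A" for \<kappa>
        using st(1)[OF that AA(1,4)] st(2,3)[OF that A'(2) A'(2)] by (simp add: \<zeta>_def)
      have "norm (\<mu> \<xi> - \<nu> \<xi>) = norm (\<mu> \<zeta> - \<nu> \<zeta>)"
        using shift[OF \<mu>] shift[OF \<nu>] by simp
      thus "norm (\<mu> \<xi> - \<nu> \<xi>) \<le> norm (\<mu> \<eta> - \<nu> \<eta>) + e"
        using close[OF \<mu> \<nu> AA(1,2)] \<eta>(2) by simp
    qed
  qed
qed

lemma cqms: "cqms A V L"
  unfolding cqms_def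
  by (intro conjI A VA AV V1 ballI allI V_add V_scale V_star L_nonneg L_add L_scale L_one L_star states_metrizable)

lemma sa_part_sel:
  "ou_carrier (sa_part A V) = {\<xi>\<in>V. star \<xi> = \<xi>}" "ou_unit (sa_part A V) = 1"
  by (simp_all add: sa_part_def)

lemma sa_part_le: "\<xi> \<in> V \<Longrightarrow> \<eta> \<in> V \<Longrightarrow> ou_le (sa_part A V) \<xi> \<eta> \<longleftrightarrow> op_pos (\<eta> - \<xi>)"
  using op_pos_iff_square[OF A, of "\<eta> - \<xi>"] V_diff[of \<eta> \<xi>] VA by (auto simp: sa_part_def)

lemma subspace_sa_part: "subspace (ou_carrier (sa_part A V))"
  unfolding sa_part_sel subspace_def
  using V_scaleR[OF V1, of 0] by (auto simp: V_add V_scaleR star_add star_scaleR)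

lemma op_pos_zero: "op_pos 0"
  using op_pos_star_mult[of 0] by simp

lemma normed_order_unit_sa_part: "normed_order_unit (sa_part A V)"
proof -
  let ?W = "sa_part A V"
  have V0: "0 \<in> V" using V_scaleR[OF V1, of 0] by simp
  have norm_le: "ou_le ?W \<xi> (r *\<^sub>R ou_unit ?W)" if "\<xi> \<in> ou_carrier ?W" "norm \<xi> \<le> r" for \<xi> r
    using that op_norm_le_iff[of \<xi> r] norm_ge_zero[of \<xi>]
    by (simp add: sa_part_le V_scaleR V1 sa_part_sel del: norm_ge_zero)
  have "is_order_unit_space ?W"
    unfolding is_order_unit_space_def
  proof (intro conjI ballI allI impI subspace_sa_part)
    show "ou_unit ?W \<in> ou_carrier ?W" by (simp add: sa_part_sel V1)
    fix \<xi> assume \<xi>: "\<xi> \<in> ou_carrier ?W"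
    hence \<xi>': "\<xi> \<in> V" "star \<xi> = \<xi>" by (simp_all add: sa_part_sel)
    show "ou_le ?W \<xi> \<xi>" by (simp add: sa_part_le \<xi>' op_pos_zero)
    show "\<exists>r. ou_le ?W \<xi> (r *\<^sub>R ou_unit ?W)" using norm_le[OF \<xi>] by blast
    show "ou_le ?W \<xi> 0" if "\<forall>r>0. ou_le ?W \<xi> (r *\<^sub>R ou_unit ?W)"
    proof -
      have "op_pos (- \<xi>)"
      proof (rule op_pos_limit)
        show "star (- \<xi>) = - \<xi>" by (simp add: star_minus \<xi>')
        show "op_pos (- \<xi> + r *\<^sub>R 1)" if "r > 0" for r
          using \<open>\<forall>r>0. _\<close> that by (simp add: sa_part_le \<xi>' V1 V_scaleR sa_part_sel)
      qed
      thus ?thesis by (simp add: sa_part_le \<xi>' V0)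
    qed
    fix \<eta> assume "\<eta> \<in> ou_carrier ?W"
    hence \<eta>': "\<eta> \<in> V" "star \<eta> = \<eta>" by (simp_all add: sa_part_sel)
    show "\<xi> = \<eta>" if "ou_le ?W \<xi> \<eta> \<and> ou_le ?W \<eta> \<xi>"
      using that op_pos_antisym[of "\<eta> - \<xi>"] by (simp add: sa_part_le \<xi>' \<eta>')
    show "ou_le ?W (r *\<^sub>R \<xi>) (r *\<^sub>R \<eta>)" if "0 \<le> r" "ou_le ?W \<xi> \<eta>" for r
      using op_pos_scaleR[OF that(1), of "\<eta> - \<xi>"] that(2)
      by (simp add: sa_part_le \<xi>' \<eta>' V_scaleR scaleR_diff_right)
    fix \<zeta> assume "\<zeta> \<in> ou_carrier ?W"
    hence \<zeta>': "\<zeta> \<in> V" "star \<zeta> = \<zeta>" by (simp_all add: sa_part_sel)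
    show "ou_le ?W \<xi> \<zeta>" if "ou_le ?W \<xi> \<eta> \<and> ou_le ?W \<eta> \<zeta>"
      using that op_pos_add[of "\<eta> - \<xi>" "\<zeta> - \<eta>"] by (simp add: sa_part_le \<xi>' \<eta>' \<zeta>')
    show "ou_le ?W (\<xi> + \<zeta>) (\<eta> + \<zeta>)" if "ou_le ?W \<xi> \<eta>"
      using that by (simp add: sa_part_le \<xi>' \<eta>' \<zeta>' V_add)
  qed
  thus ?thesis using norm_le by (simp add: normed_order_unit_def)
qed

text \<open>Averaging with the adjoint is a contraction that fixes self-adjoint elements. So the
  scalars and the finite nets may be replaced by their self-adjoint parts without loss in
  \<open>D\<close> or \<open>e\<close>.\<close>

lemma bounded_lip_seminorm_sa_part: "bounded_lip_seminorm (sa_part A V) L D"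
  unfolding bounded_lip_seminorm_def sa_part_sel
proof (intro conjI ballI allI impI normed_order_unit_sa_part D_nonneg)
  show "ou_seminorm (sa_part A V) L"
    unfolding ou_seminorm_def sa_part_sel by (auto simp: L_nonneg L_add L_scaleR L_one)
  have half: "norm ((1/2) *\<^sub>R (b + star b)) \<le> norm b" for b :: "'i ell2_op"
    using norm_triangle_ineq[of b "star b"] by (simp add: norm_star)
  fix a assume a: "a \<in> {\<xi>\<in>V. star \<xi> = \<xi>}"
  then obtain c where c: "norm (a - c *\<^sub>C 1) \<le> D * L a" using diam by blast
  have "(1/2) *\<^sub>R ((a - c *\<^sub>C 1) + star (a - c *\<^sub>C 1)) = a - Re c *\<^sub>R 1"
  proof -
    have "(a - c *\<^sub>C 1) + star (a - c *\<^sub>C 1) = (a + a) - (c *\<^sub>C 1 + cnj c *\<^sub>C 1)"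
      using a by (simp add: star_diff star_scaleC)
    also have "c *\<^sub>C 1 + cnj c *\<^sub>C 1 = (2 * Re c) *\<^sub>R (1 :: 'i ell2_op)"
      by (simp add: scaleC_add_left[symmetric] complex_add_cnj scaleR_scaleC)
    finally show ?thesis by (simp only: scaleR_diff_right scaleR_half_double) simp
  qed
  thus "\<exists>s. norm (a - s *\<^sub>R 1) \<le> D * L a"
    using half[of "a - c *\<^sub>C 1"] c by (metis order_trans)
next
  fix R e :: real assume e: "0 < e"
  obtain F where F: "finite F" "F \<subseteq> V"
    "\<forall>a\<in>V. L a \<le> 1 \<longrightarrow> norm a \<le> R \<longrightarrow> (\<exists>b\<in>F. norm (a - b) \<le> e)"
    using tot_bdd[OF e, of R] by meson
  define h where "h b = (1/2) *\<^sub>R (b + star b)" for b :: "'i ell2_op"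
  show "\<exists>F. finite F \<and> F \<subseteq> {\<xi>\<in>V. star \<xi> = \<xi>} \<and>
    (\<forall>a\<in>{\<xi>\<in>V. star \<xi> = \<xi>}. L a \<le> 1 \<longrightarrow> norm a \<le> R \<longrightarrow> (\<exists>b\<in>F. norm (a - b) \<le> e))"
  proof (intro exI[of _ "h ` F"] conjI ballI impI)
    show "finite (h ` F)" using F by simp
    show "h ` F \<subseteq> {\<xi>\<in>V. star \<xi> = \<xi>}"
      using F(2) by (auto simp: h_def V_scaleR V_add V_star star_scaleR star_add star_star add.commute)
    fix a assume a: "a \<in> {\<xi>\<in>V. star \<xi> = \<xi>}" "L a \<le> 1" "norm a \<le> R"
    then obtain b where b: "b \<in> F" "norm (a - b) \<le> e" using F(3) by blast
    have "a - h b = (1/2) *\<^sub>R ((a - b) + star (a - b))"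
    proof -
      have "(a - b) + star (a - b) = (a + a) - (b + star b)" using a by (simp add: star_diff)
      thus ?thesis by (simp only: h_def scaleR_diff_right scaleR_half_double)
    qed
    hence "norm (a - h b) \<le> norm (a - b)"
      using norm_triangle_ineq[of "a - b" "star (a - b)"] by (simp add: norm_star)
    thus "\<exists>b\<in>h ` F. norm (a - b) \<le> e" using b by (metis imageI order_trans)
  qed
qed

end

text \<open>Contractivity needs no separate hypothesis on the map: for a self-adjoint element the
  bound \<open>norm a \<le> r\<close> is expressed by two order relations with
  \<open>r *\<^sub>R 1\<close>, which a unital positive map preserves.\<close>

lemma unital_positive_map_sa_part:
  assumes 1: "lip_algebra A1 V1 L1 D1" and 2: "lip_algebra A2 V2 L2 D2"
    and map: "\<And>a. a \<in> V1 \<Longrightarrow> \<Psi> a \<in> V2" "\<Psi> 1 = 1"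
    and add: "\<And>a b. a \<in> V1 \<Longrightarrow> b \<in> V1 \<Longrightarrow> \<Psi> (a + b) = \<Psi> a + \<Psi> b"
    and scale: "\<And>a r. a \<in> V1 \<Longrightarrow> \<Psi> (r *\<^sub>R a) = r *\<^sub>R \<Psi> a"
    and star: "\<And>a. a \<in> V1 \<Longrightarrow> star a = a \<Longrightarrow> star (\<Psi> a) = \<Psi> a"
    and pos: "\<And>a. a \<in> V1 \<Longrightarrow> op_pos a \<Longrightarrow> op_pos (\<Psi> a)"
  shows "unital_positive_map (sa_part A1 V1) (sa_part A2 V2) \<Psi>"
proof -
  interpret A1: lip_algebra A1 V1 L1 D1 by (rule 1)
  interpret A2: lip_algebra A2 V2 L2 D2 by (rule 2)
  have z: "0 \<in> V1" "0 \<in> V2" using A1.V_scaleR[OF A1.V1, of 0] A2.V_scaleR[OF A2.V1, of 0] by simp_all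
  have nrm: "norm (\<Psi> a) \<le> norm a" if a: "a \<in> V1" "star a = a" for a
  proof -
    have c: "norm a *\<^sub>R 1 \<in> V1" "- a \<in> V1" using A1.V_scaleR A1.V1 a(1) A1.V_scaleR[of a "-1"] by auto
    have "\<Psi> (norm a *\<^sub>R 1 + a) = norm a *\<^sub>R 1 + \<Psi> a" "\<Psi> (norm a *\<^sub>R 1 - a) = norm a *\<^sub>R 1 - \<Psi> a"
      using add[OF c(1) a(1)] add[OF c] scale[OF A1.V1, of "norm a"] scale[OF a(1), of "-1"] map(2) by simp_all
    moreover have "op_pos (norm a *\<^sub>R 1 + a)" "op_pos (norm a *\<^sub>R 1 - a)"
      using op_norm_le_iff[OF a(2), of "norm a"] by simp_all
    moreover have "norm a *\<^sub>R 1 + a \<in> V1" "norm a *\<^sub>R 1 - a \<in> V1"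
      using A1.V_add[OF c(1) a(1)] A1.V_diff[OF c(1) a(1)] by simp_all
    ultimately have "op_pos (norm a *\<^sub>R 1 + \<Psi> a)" "op_pos (norm a *\<^sub>R 1 - \<Psi> a)"
      using pos by metis+
    thus ?thesis using op_norm_le_iff[OF star[OF a], of "norm a"] by simp
  qed
  show ?thesis
    unfolding unital_positive_map_def A1.sa_part_sel A2.sa_part_sel
    using map add scale star pos nrm by (auto simp: A1.sa_part_le A2.sa_part_le z)
qed

section \<open>The seminorm on a crossed product\<close>

text \<open>For positive \<open>N\<close>, the proportion of an interval of length \<open>N\<close>
  that remains inside it after a shift by \<open>n\<close>; see
  \<open>card_interval_shift\<close>.\<close>

definition fejer :: "nat \<Rightarrow> int \<Rightarrow> real"
  where "fejer N n = max 0 (1 - \<bar>real_of_int n\<bar> / real N)"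

lemma fejer_bounds: "0 \<le> fejer N n" "fejer N n \<le> 1"
  by (auto simp: fejer_def)

lemma fejer_0: "fejer N 0 = 1"
  by (simp add: fejer_def)

lemma fejer_eq_0: "int N \<le> \<bar>n\<bar> \<Longrightarrow> 0 < N \<Longrightarrow> fejer N n = 0"
  by (simp add: fejer_def field_simps)

text \<open>Since division by \<open>0\<close> gives \<open>0\<close>, multiplication by \<open>n * fejer_defect N n\<close> is \<open>1 - (fejer N n)\<^sup>2\<close> also for \<open>n = 0\<close>.\<close>

definition fejer_defect :: "nat \<Rightarrow> int \<Rightarrow> real"
  where "fejer_defect N n = (1 - (fejer N n)\<^sup>2) / real_of_int n"

text \<open>A telescoping sum for each sign of \<open>n\<close>, from the comparison of
  \<open>1 / (y + 1) ^ 2\<close> with \<open>1 / y - 1 / (y + 1)\<close>.\<close>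

lemma sum_inverse_squares:
  assumes "finite F" "0 < N"
  shows "(\<Sum>n\<in>F. if n = 0 then 0 else 1 / (real N + \<bar>real_of_int n\<bar>)\<^sup>2) \<le> 2 / real N"
proof -
  let ?g = "\<lambda>n :: int. if n = 0 then 0 else 1 / (real N + \<bar>real_of_int n\<bar>)\<^sup>2"
  have le: "(\<Sum>n\<in>{- int K..int K}. ?g n) \<le> 2 * (1 / real N - 1 / (real N + real K))" for K
  proof (induction K)
    case (Suc K)
    have ins: "{- int (Suc K)..int (Suc K)} = insert (- int (Suc K)) (insert (int (Suc K)) {- int K..int K})"
      by auto
    have "(\<Sum>n\<in>{- int (Suc K)..int (Suc K)}. ?g n) = 2 / (real N + real (Suc K))\<^sup>2 + (\<Sum>n\<in>{- int K..int K}. ?g n)"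
      unfolding ins by (subst sum.insert, simp, simp, subst sum.insert) (auto simp: add_ac)
    also have "\<dots> \<le> 2 / (real N + real (Suc K))\<^sup>2 + 2 * (1 / real N - 1 / (real N + real K))"
      using Suc by simp
    also have "2 / (real N + real (Suc K))\<^sup>2 \<le> 2 * (1 / (real N + real K) - 1 / (real N + real (Suc K)))"
    proof -
      define y where "y = real N + real K"
      have y: "y > 0" using assms(2) by (simp add: y_def)
      have "1 / y - 1 / (y + 1) = 1 / (y * (y + 1))" using y by (simp add: field_simps)
      also have "\<dots> \<ge> 1 / (y + 1)\<^sup>2"
        using y by (intro divide_left_mono) (auto simp: power2_eq_square)
      finally show ?thesis by (simp add: y_def add_ac)
    qed
    finally show ?case by simp
  qed simp
  define K where "K = nat (Max (insert 0 (abs ` F)))"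
  have "F \<subseteq> {- int K..int K}"
  proof
    fix n assume "n \<in> F"
    hence "\<bar>n\<bar> \<le> Max (insert 0 (abs ` F))" using assms(1) by (intro Max_ge) auto
    thus "n \<in> {- int K..int K}" by (auto simp: K_def)
  qed
  hence "(\<Sum>n\<in>F. ?g n) \<le> (\<Sum>n\<in>{- int K..int K}. ?g n)"
    by (intro sum_mono2) auto
  also have "\<dots> \<le> 2 * (1 / real N - 1 / (real N + real K))" by (rule le)
  also have "\<dots> \<le> 2 / real N" by simp
  finally show ?thesis .
qed

text \<open>With \<open>r = |n|\<close>, the linear growth of the numerator near 0 and its
  boundedness far away are combined in the single bound \<open>4 * r / (N + r)\<close>, so that the
  squared defect is at most \<open>16 / (N + r) ^ 2\<close>. The right-hand side is written as a
  square to fit \<open>cs_multiplier\<close>.\<close>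

lemma fejer_defect_sum:
  assumes "finite F" "0 < N"
  shows "(\<Sum>n\<in>F. (fejer_defect N n)\<^sup>2) \<le> (sqrt (32 / real N))\<^sup>2"
proof -
  have "(fejer_defect N n)\<^sup>2 \<le> 16 * (if n = 0 then 0 else 1 / (real N + \<bar>real_of_int n\<bar>)\<^sup>2)" for n
  proof (cases "n = 0")
    case False
    define r where "r = \<bar>real_of_int n\<bar>"
    have r: "r > 0" "real N > 0" using False assms(2) by (auto simp: r_def)
    have "1 - (fejer N n)\<^sup>2 \<le> 4 * r / (real N + r)"
    proof (cases "real N \<le> r")
      case True
      thus ?thesis using r by (simp add: fejer_def r_def[symmetric] max_def field_simps)
    next
      case False
      hence f: "fejer N n = 1 - r / real N" using r by (simp add: fejer_def r_def[symmetric] max_def field_simps)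
      have "1 - (fejer N n)\<^sup>2 \<le> 2 * (r / real N)"
        unfolding f by (simp add: power2_eq_square algebra_simps)
      also have "\<dots> = 4 * r / (2 * real N)" by simp
      also have "\<dots> \<le> 4 * r / (real N + r)"
        using False r by (intro divide_left_mono) auto
      finally show ?thesis .
    qed
    moreover have "0 \<le> 1 - (fejer N n)\<^sup>2"
      using fejer_bounds[of N n] by (simp add: power_le_one)
    ultimately have "(1 - (fejer N n)\<^sup>2)\<^sup>2 \<le> (4 * r / (real N + r))\<^sup>2"
      by (intro power_mono)
    hence "(fejer_defect N n)\<^sup>2 \<le> (4 * r / (real N + r))\<^sup>2 / r\<^sup>2"
      unfolding fejer_defect_def power_divide r_def power2_abs by (intro divide_right_mono) auto
    also have "\<dots> = 16 * (1 / (real N + r)\<^sup>2)"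
      using r by (simp add: power_divide power_mult_distrib)
    finally show ?thesis using False by (simp add: r_def)
  qed (simp add: fejer_defect_def)
  hence "(\<Sum>n\<in>F. (fejer_defect N n)\<^sup>2)
      \<le> (\<Sum>n\<in>F. 16 * (if n = 0 then 0 else 1 / (real N + \<bar>real_of_int n\<bar>)\<^sup>2))"
    by (rule sum_mono)
  also have "\<dots> \<le> 16 * (2 / real N)"
    unfolding sum_distrib_left[symmetric] by (intro mult_left_mono sum_inverse_squares assms) auto
  finally show ?thesis by simp
qed

text \<open>All that the crossed product estimates use of the manifold: \<open>osc\<close> expresses
  finite diameter and \<open>VB_tot_bdd\<close> the Arzela-Ascoli property, both in terms of
  \<open>LB\<close> alone.\<close>

locale lip_functions =
  fixes VB :: "('x::topological_space \<Rightarrow>\<^sub>C complex) set" and LB :: "('x \<Rightarrow>\<^sub>C complex) \<Rightarrow> real"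
    and nrm :: "(int \<Rightarrow> complex) \<Rightarrow> real" and D :: real
  assumes VB_add: "f \<in> VB \<Longrightarrow> g \<in> VB \<Longrightarrow> f + g \<in> VB"
    and VB_cmult: "f \<in> VB \<Longrightarrow> bcontfun_cmult c f \<in> VB"
    and VB_const: "const_bcontfun c \<in> VB"
    and VB_cnj: "f \<in> VB \<Longrightarrow> cnj_bcontfun f \<in> VB"
    and LB_nonneg: "f \<in> VB \<Longrightarrow> 0 \<le> LB f"
    and LB_add: "f \<in> VB \<Longrightarrow> g \<in> VB \<Longrightarrow> LB (f + g) \<le> LB f + LB g"
    and LB_cmult: "f \<in> VB \<Longrightarrow> LB (bcontfun_cmult c f) = cmod c * LB f"
    and LB_const: "LB (const_bcontfun c) = 0"
    and VB_dense: "closure VB = UNIV"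
    and osc: "f \<in> VB \<Longrightarrow> cmod (apply_bcontfun f p - apply_bcontfun f q) \<le> D * LB f"
    and D_nonneg: "0 \<le> D"
    and VB_tot_bdd: "0 < e \<Longrightarrow> \<exists>F. finite F \<and> F \<subseteq> VB \<and>
      (\<forall>f\<in>VB. LB f \<le> R \<longrightarrow> norm f \<le> R \<longrightarrow> (\<exists>g\<in>F. norm (f - g) \<le> e))"
    and nrm: "order_preserving_norm nrm"
begin

lemma VB_zero: "0 \<in> VB"
  using VB_const[of 0] by simp

lemma LB_zero: "LB 0 = 0"
  using LB_const[of 0] by simp

lemma VB_scaleR: "f \<in> VB \<Longrightarrow> r *\<^sub>R f \<in> VB"
  by (simp add: scaleR_bcontfun_cmult VB_cmult)

lemma LB_scaleR: "f \<in> VB \<Longrightarrow> LB (r *\<^sub>R f) = \<bar>r\<bar> * LB f"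
  by (simp add: scaleR_bcontfun_cmult LB_cmult)

lemma VB_sum: "(\<And>i. i \<in> F \<Longrightarrow> f i \<in> VB) \<Longrightarrow> sum f F \<in> VB"
  by (induction F rule: infinite_finite_induct) (auto simp: VB_zero VB_add)

lemma LB_sum: "(\<And>i. i \<in> F \<Longrightarrow> f i \<in> VB) \<Longrightarrow> LB (sum f F) \<le> (\<Sum>i\<in>F. LB (f i))"
proof (induction F rule: infinite_finite_induct)
  case (insert i F)
  have "LB (f i + sum f F) \<le> LB (f i) + LB (sum f F)"
    by (intro LB_add VB_sum insert.prems) auto
  thus ?case using insert by fastforce
qed (auto simp: LB_zero)

definition fin_fun :: "(int \<Rightarrow> real) \<Rightarrow> bool"
  where "fin_fun h \<longleftrightarrow> finite {n. h n \<noteq> 0}"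

definition rnrm :: "(int \<Rightarrow> real) \<Rightarrow> real"
  where "rnrm h = nrm (\<lambda>n. complex_of_real (h n))"

lemma fin_funI: "finite G \<Longrightarrow> (\<And>n. n \<notin> G \<Longrightarrow> h n = 0) \<Longrightarrow> fin_fun h"
  unfolding fin_fun_def by (rule finite_subset[of _ G]) auto

lemma fin_fun_support: "fin_fun h \<Longrightarrow> (\<lambda>n. complex_of_real (h n)) \<in> finite_support UNIV"
  by (simp add: fin_fun_def finite_support_def)

lemma rnrm_nonneg: "fin_fun h \<Longrightarrow> 0 \<le> rnrm h"
  using nrm fin_fun_support[of h] by (simp add: order_preserving_norm_def rnrm_def)

lemma rnrm_add: "fin_fun h \<Longrightarrow> fin_fun k \<Longrightarrow> rnrm (\<lambda>n. h n + k n) \<le> rnrm h + rnrm k"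
  using nrm fin_fun_support[of h] fin_fun_support[of k] by (simp add: order_preserving_norm_def rnrm_def)

lemma rnrm_scale: "fin_fun h \<Longrightarrow> rnrm (\<lambda>n. r * h n) = \<bar>r\<bar> * rnrm h"
  using nrm fin_fun_support[of h] by (simp add: order_preserving_norm_def rnrm_def)

lemma rnrm_mono: "fin_fun h \<Longrightarrow> fin_fun k \<Longrightarrow> (\<And>n. 0 \<le> h n) \<Longrightarrow> (\<And>n. h n \<le> k n) \<Longrightarrow> rnrm h \<le> rnrm k"
  using nrm fin_fun_support[of h] fin_fun_support[of k] by (simp add: order_preserving_norm_def rnrm_def)

definition unit_nrm :: "int \<Rightarrow> real"
  where "unit_nrm k = rnrm (\<lambda>n. if n = k then 1 else 0)"

lemma fin_fun_unit: "fin_fun (\<lambda>n. if n = k then r else 0)"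
  by (rule fin_funI[of "{k}"]) auto

lemma unit_nrm_pos: "0 < unit_nrm k"
proof -
  have "(\<lambda>n. complex_of_real (if n = k then 1 else 0)) \<noteq> (\<lambda>_. 0)"
    by (auto simp: fun_eq_iff)
  hence "unit_nrm k \<noteq> 0"
    using nrm fin_fun_support[OF fin_fun_unit[of k 1]] by (simp add: order_preserving_norm_def rnrm_def unit_nrm_def)
  thus ?thesis using rnrm_nonneg[OF fin_fun_unit[of k 1]] by (simp add: unit_nrm_def)
qed

text \<open>\<open>h\<close> dominates \<open>h k\<close> times the indicator of \<open>k\<close>,
  and the norm preserves order. The bound is not uniform in \<open>k\<close>, which confines its use
  to finitely many coefficients at a time.\<close>

lemma coeff_le_rnrm:
  assumes "fin_fun h" "\<And>n. 0 \<le> h n"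
  shows "h k \<le> rnrm h / unit_nrm k"
proof -
  have "h k * unit_nrm k = rnrm (\<lambda>n. h k * (if n = k then 1 else 0))"
    using rnrm_scale[OF fin_fun_unit[of k 1], of "h k"] assms(2)[of k] by (simp add: unit_nrm_def)
  also have "\<dots> \<le> rnrm h"
    by (rule rnrm_mono) (use assms fin_fun_unit[of k "h k"] in \<open>auto simp: if_distrib cong: if_cong\<close>)
  finally show ?thesis using unit_nrm_pos[of k] by (simp add: pos_le_divide_eq)
qed

lemma fin_fun_LB: "x \<in> finite_support VB \<Longrightarrow> fin_fun (\<lambda>n. LB (x n))"
  by (rule fin_funI[of "{n. x n \<noteq> 0}"]) (auto simp: finite_support_def LB_zero)

end

locale lip_system = lip_functions VB LB nrm D + homeo_system \<psi>
  for VB :: "('x::topological_space \<Rightarrow>\<^sub>C complex) set" and LB nrm D and \<psi> :: "'x \<Rightarrow> 'x" +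
  assumes VB_pullback: "f \<in> VB \<Longrightarrow> pullback \<psi> f \<in> VB" "f \<in> VB \<Longrightarrow> pullback (inv \<psi>) f \<in> VB"
begin

abbreviation "FS \<equiv> finite_support VB"
abbreviation "CP \<equiv> reduced_crossed_product \<beta>"
abbreviation "VV \<equiv> crossed_subspace \<beta> VB"
abbreviation "LL \<equiv> crossed_seminorm \<beta> VB LB nrm"

definition deriv_seq :: "(int \<Rightarrow> ('x \<Rightarrow>\<^sub>C complex)) \<Rightarrow> int \<Rightarrow> ('x \<Rightarrow>\<^sub>C complex)"
  where "deriv_seq x = (\<lambda>n. real_of_int n *\<^sub>R x n)"

lemma VB_iterate: "f \<in> VB \<Longrightarrow> int_iterate \<beta> n f \<in> VB"
  by (rule int_iterate_invariant) (simp_all add: VB_pullback pullback_inverse(2)[OF homeo])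

lemma FS_UNIV: "x \<in> FS \<Longrightarrow> x \<in> finite_support UNIV"
  by (rule finite_support_UNIV)

lemma FS_VB: "x \<in> FS \<Longrightarrow> x n \<in> VB"
  by (simp add: finite_support_def)

lemma FS_adjoint: "x \<in> FS \<Longrightarrow> crossed_adjoint \<beta> x \<in> FS"
  by (rule adjoint_finite_support[where V = VB]) (simp_all add: VB_cnj VB_iterate)

lemma FS_add: "x \<in> FS \<Longrightarrow> y \<in> FS \<Longrightarrow> (\<lambda>n. x n + y n) \<in> FS"
  by (rule finite_support_map2) (assumption | simp add: VB_add FS_VB)+

lemma FS_cmult: "x \<in> FS \<Longrightarrow> (\<lambda>n. bcontfun_cmult c (x n)) \<in> FS"
  by (rule finite_support_map) (assumption | simp add: VB_cmult FS_VB)+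

lemma FS_scale: "x \<in> FS \<Longrightarrow> (\<lambda>n. r n *\<^sub>R x n) \<in> FS"
  by (rule finite_support_map) (assumption | simp add: VB_scaleR FS_VB)+

lemma FS_deriv: "x \<in> FS \<Longrightarrow> deriv_seq x \<in> FS"
  unfolding deriv_seq_def by (rule FS_scale)

lemma FS_single: "f \<in> VB \<Longrightarrow> single k f \<in> FS"
  by (erule single_finite_support) (rule VB_zero)

lemma LL_cs:
  assumes "x \<in> FS"
  shows "LL (cs x) = max (norm (cs (deriv_seq x)))
    (max (rnrm (\<lambda>n. LB (x n))) (rnrm (\<lambda>n. LB (crossed_adjoint \<beta> x n))))"
proof -
  have "inv_into FS cs (cs x) = x"
    by (rule inv_into_f_f[OF crossed_sum_inj[OF homeo] assms])
  thus ?thesis by (simp add: crossed_seminorm_def Let_def deriv_seq_def rnrm_def)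
qed

lemma VV_E:
  assumes "a \<in> VV"
  obtains x where "x \<in> FS" "a = cs x"
  using assms by (auto simp: crossed_subspace_def)

lemma VV_I: "x \<in> FS \<Longrightarrow> cs x \<in> VV"
  by (simp add: crossed_subspace_def)

lemma LL_bounds:
  assumes "x \<in> FS"
  shows "norm (cs (deriv_seq x)) \<le> LL (cs x)" "LB (x n) \<le> LL (cs x) / unit_nrm n"
proof -
  show "norm (cs (deriv_seq x)) \<le> LL (cs x)" by (simp add: LL_cs[OF assms])
  have "LB (x n) \<le> rnrm (\<lambda>n. LB (x n)) / unit_nrm n"
    using coeff_le_rnrm[OF fin_fun_LB[OF assms]] assms by (simp add: finite_support_def LB_nonneg)
  also have "\<dots> \<le> LL (cs x) / unit_nrm n"
    using unit_nrm_pos[of n] by (intro divide_right_mono) (auto simp: LL_cs[OF assms])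
  finally show "LB (x n) \<le> LL (cs x) / unit_nrm n" .
qed

text \<open>Only the derivation term of the seminorm enters, so the constant depends neither on
  \<open>\<psi>\<close> nor on \<open>nrm\<close>.\<close>

lemma fejer_approx:
  assumes "x \<in> FS" "0 < N"
  shows "norm (cs x - cs (\<lambda>n. (fejer N n)\<^sup>2 *\<^sub>R x n)) \<le> sqrt (32 / real N) * LL (cs x)"
proof -
  have "cs x - cs (\<lambda>n. (fejer N n)\<^sup>2 *\<^sub>R x n) = cs (\<lambda>n. x n - (fejer N n)\<^sup>2 *\<^sub>R x n)"
    by (intro cs_diff[symmetric] FS_UNIV FS_scale assms(1))
  also have "(\<lambda>n. x n - (fejer N n)\<^sup>2 *\<^sub>R x n) = (\<lambda>n. fejer_defect N n *\<^sub>R deriv_seq x n)"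
  proof
    fix n
    have "x n - (fejer N n)\<^sup>2 *\<^sub>R x n = (1 - (fejer N n)\<^sup>2) *\<^sub>R x n" by (simp add: scaleR_diff_left)
    also have "1 - (fejer N n)\<^sup>2 = fejer_defect N n * real_of_int n"
      by (cases "n = 0") (simp_all add: fejer_defect_def fejer_0)
    finally show "x n - (fejer N n)\<^sup>2 *\<^sub>R x n = fejer_defect N n *\<^sub>R deriv_seq x n"
      by (simp add: deriv_seq_def)
  qed
  also have "norm (cs \<dots>) \<le> sqrt (32 / real N) * norm (cs (deriv_seq x))"
    by (rule cs_multiplier[OF FS_deriv[OF assms(1)]]) (simp_all add: fejer_defect_sum[OF _ assms(2)] del: real_sqrt_pow2)
  also have "\<dots> \<le> sqrt (32 / real N) * LL (cs x)"
    by (intro mult_left_mono LL_bounds assms) simp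
  finally show ?thesis .
qed

text \<open>The sign stems from the exchange of \<open>n\<close> and \<open>- n\<close>. It makes
  \<open>\<i>\<close> times the derivation preserve self-adjointness, on which
  \<open>transfer_lipschitz\<close> relies.\<close>

lemma adjoint_deriv: "crossed_adjoint \<beta> (deriv_seq x) = (\<lambda>n. (-1) *\<^sub>R deriv_seq (crossed_adjoint \<beta> x) n)"
  by (intro ext bcontfun_eqI) (simp add: crossed_adjoint_apply deriv_seq_def)

lemma star_deriv:
  assumes "x \<in> FS"
  shows "star (cs (deriv_seq x)) = - cs (deriv_seq (crossed_adjoint \<beta> x))"
  using star_cs[OF FS_UNIV[OF FS_deriv[OF assms]]] cs_scaleR[OF FS_UNIV[OF FS_deriv[OF FS_adjoint[OF assms]]], of "-1"]
  by (simp only: adjoint_deriv scaleR_minus1_left)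

text \<open>6 exceeds \<open>sqrt 32\<close>, the cost of discarding all coefficients but the
  zeroth; \<open>D / unit_nrm 0\<close> bounds the oscillation of the latter. The value does not
  depend on \<open>\<psi>\<close>, so that one radius serves both crossed products in the distance
  estimate.\<close>

definition lip_diam :: real
  where "lip_diam = 6 + D / unit_nrm 0"

lemma cs_one: "cs (single 0 (const_bcontfun 1)) = 1"
  using cs_const[of 1] by simp

lemma LL_one: "LL 1 = 0"
proof -
  have x: "single 0 (const_bcontfun 1) \<in> FS" by (rule FS_single[OF VB_const])
  have "deriv_seq (single 0 (const_bcontfun 1)) = (\<lambda>n. 0 *\<^sub>R single 0 (const_bcontfun 1) n)"
    by (auto simp: deriv_seq_def single_def)
  hence d: "cs (deriv_seq (single 0 (const_bcontfun 1))) = 0"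
    using cs_scaleR[OF FS_UNIV[OF x], of 0] by simp
  have a: "crossed_adjoint \<beta> (single 0 (const_bcontfun 1)) = single 0 (const_bcontfun 1)"
    by (intro ext bcontfun_eqI) (auto simp: crossed_adjoint_apply single_def)
  have "rnrm (\<lambda>n. LB (single 0 (const_bcontfun 1) n)) = rnrm (\<lambda>n. 0 * 0)"
    by (rule arg_cong[of _ _ rnrm]) (auto simp: single_def LB_const LB_zero)
  also have "\<dots> = 0"
    using rnrm_scale[of "\<lambda>n. 0" 0] by (simp add: fin_fun_def)
  finally show ?thesis
    using LL_cs[OF x] by (simp add: d a cs_one)
qed

lemma diam_bound:
  assumes x: "x \<in> FS"
  shows "norm (cs x - apply_bcontfun (x 0) p *\<^sub>C 1) \<le> lip_diam * LL (cs x)"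
proof -
  define c where "c = apply_bcontfun (x 0) p"
  \<comment> \<open>For \<open>N = 1\<close> the Fejer weight is the indicator of 0.\<close>
  have tr: "(\<lambda>n. (fejer 1 n)\<^sup>2 *\<^sub>R x n) = single 0 (x 0)"
  proof
    fix n show "(fejer 1 n)\<^sup>2 *\<^sub>R x n = single 0 (x 0) n"
      by (cases "n = 0") (auto simp: single_def fejer_0 fejer_eq_0)
  qed
  have L: "0 \<le> LL (cs x)" by (rule order_trans[OF norm_ge_zero LL_bounds(1)[OF x]])
  have "sqrt 32 \<le> (6 :: real)" by (rule real_le_lsqrt) auto
  hence 1: "norm (cs x - cs (single 0 (x 0))) \<le> 6 * LL (cs x)"
    using fejer_approx[OF x, of 1] L unfolding tr by (simp add: order_trans[OF _ mult_right_mono])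
  have x0: "x 0 \<in> VB" using x by (simp add: finite_support_def)
  have "cs (single 0 (x 0)) - c *\<^sub>C 1 = cs (\<lambda>n. single 0 (x 0) n - single 0 (const_bcontfun c) n)"
    unfolding cs_const[symmetric] by (intro cs_diff[symmetric] FS_UNIV FS_single x0 VB_const)
  also have "norm \<dots> \<le> (\<Sum>n\<in>{0}. norm (single 0 (x 0) n - single 0 (const_bcontfun c) n))"
    by (rule norm_cs_le) (auto simp: single_def)
  also have "\<dots> \<le> D * LB (x 0)"
    using osc[OF x0] by (auto simp: single_def c_def intro!: norm_bound)
  also have "\<dots> \<le> D * (LL (cs x) / unit_nrm 0)"
    by (intro mult_left_mono LL_bounds x D_nonneg)
  finally have 2: "norm (cs (single 0 (x 0)) - c *\<^sub>C 1) \<le> D * (LL (cs x) / unit_nrm 0)" .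
  have "norm (cs x - c *\<^sub>C 1) \<le> norm (cs x - cs (single 0 (x 0))) + norm (cs (single 0 (x 0)) - c *\<^sub>C 1)"
    using norm_triangle_ineq[of "cs x - cs (single 0 (x 0))" "cs (single 0 (x 0)) - c *\<^sub>C 1"] by simp
  thus ?thesis using 1 2 by (simp add: lip_diam_def c_def algebra_simps)
qed

text \<open>Truncation by the squared Fejer weight leaves finitely many coefficients, each in a
  bounded Lipschitz ball of \<open>VB\<close>; the nets for these are combined to a net of
  sequences.\<close>

lemma tot_bdd_crossed:
  assumes e: "0 < e"
  shows "\<exists>F. finite F \<and> F \<subseteq> VV \<and> (\<forall>a\<in>VV. LL a \<le> 1 \<longrightarrow> norm a \<le> R \<longrightarrow> (\<exists>b\<in>F. norm (a - b) \<le> e))"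
proof -
  \<comment> \<open>\<open>128 = 4 * 32\<close> brings \<open>sqrt (32 / N)\<close> below
    \<open>e / 2\<close>.\<close>
  obtain N :: nat where N: "128 / e\<^sup>2 < real N" using reals_Archimedean2 by blast
  have N0: "0 < N" using N e by (metis divide_pos_pos of_nat_0_less_iff order_less_trans zero_less_numeral zero_less_power)
  have sN: "sqrt (32 / real N) \<le> e / 2"
  proof (rule real_le_lsqrt)
    have "128 < real N * e\<^sup>2" using N e by (simp add: field_simps)
    thus "32 / real N \<le> (e / 2)\<^sup>2" using N0 by (simp add: field_simps)
  qed (use e in simp)
  define G where "G = {- int N..int N}"
  \<comment> \<open>One radius for both the sup norms of the coefficients and their Lipschitz
    constants; the maximum exists because \<open>G\<close> is finite.\<close>
  define R' where "R' = max R (Max ((\<lambda>n. 1 / unit_nrm n) ` G))"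
  define e' where "e' = e / 2 / (2 * real N + 1)"
  have e': "e' > 0" using e by (simp add: e'_def)
  obtain F0 where F0: "finite F0" "F0 \<subseteq> VB"
    "\<forall>f\<in>VB. LB f \<le> R' \<longrightarrow> norm f \<le> R' \<longrightarrow> (\<exists>g\<in>F0. norm (f - g) \<le> e')"
    using VB_tot_bdd[OF e', of R'] by meson
  define y where "y g = (\<lambda>n. (fejer N n)\<^sup>2 *\<^sub>R (if n \<in> G then g n else 0))" for g :: "int \<Rightarrow> 'x \<Rightarrow>\<^sub>C complex"
  have yFS: "y g \<in> FS" if "g \<in> PiE G (\<lambda>_. F0)" for g
    by (rule finite_supportI[of G]) (use that F0(2) in \<open>auto simp: y_def G_def VB_zero intro!: VB_scaleR\<close>)
  show ?thesis
  proof (intro exI[of _ "(\<lambda>g. cs (y g)) ` PiE G (\<lambda>_. F0)"] conjI ballI impI)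
    show "finite ((\<lambda>g. cs (y g)) ` PiE G (\<lambda>_. F0))"
      using F0(1) by (intro finite_imageI finite_PiE) (auto simp: G_def)
    show "(\<lambda>g. cs (y g)) ` PiE G (\<lambda>_. F0) \<subseteq> VV"
      using yFS VV_I by auto
    fix a assume a: "a \<in> VV" "LL a \<le> 1" "norm a \<le> R"
    then obtain x where x: "x \<in> FS" "a = cs x" by (elim VV_E)
    have "\<exists>h\<in>F0. norm (x n - h) \<le> e'" if n: "n \<in> G" for n
    proof -
      have "x n \<in> VB" using x(1) by (simp add: finite_support_def)
      moreover have "norm (x n) \<le> R'"
        using norm_coeff_le[OF x(1), of n] a(3) x(2) by (simp add: R'_def)
      moreover have "LB (x n) \<le> R'"
      proof -
        have "LB (x n) \<le> LL (cs x) / unit_nrm n" by (rule LL_bounds[OF x(1)])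
        also have "\<dots> \<le> 1 / unit_nrm n"
          using a(2) x(2) unit_nrm_pos[of n] by (intro divide_right_mono) auto
        also have "\<dots> \<le> Max ((\<lambda>n. 1 / unit_nrm n) ` G)"
          using n by (intro Max_ge) (auto simp: G_def)
        finally show ?thesis by (simp add: R'_def)
      qed
      ultimately show ?thesis using F0(3) by blast
    qed
    then obtain g0 where g0: "\<And>n. n \<in> G \<Longrightarrow> g0 n \<in> F0 \<and> norm (x n - g0 n) \<le> e'" by metis
    define g where "g = restrict g0 G"
    have g: "g \<in> PiE G (\<lambda>_. F0)" using g0 by (auto simp: g_def)
    show "\<exists>b\<in>(\<lambda>g. cs (y g)) ` PiE G (\<lambda>_. F0). norm (a - b) \<le> e"
    proof (intro bexI[of _ "cs (y g)"])
      let ?t = "\<lambda>n. (fejer N n)\<^sup>2 *\<^sub>R x n"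
      have "norm (cs x - cs ?t) \<le> sqrt (32 / real N) * LL (cs x)" by (rule fejer_approx[OF x(1) N0])
      also have "\<dots> \<le> e / 2 * 1"
        using sN a(2) x(2) e order_trans[OF norm_ge_zero LL_bounds(1)[OF x(1)]] by (intro mult_mono) auto
      finally have 1: "norm (cs x - cs ?t) \<le> e / 2" by simp
      have "cs ?t - cs (y g) = cs (\<lambda>n. ?t n - y g n)"
        by (intro cs_diff[symmetric] FS_UNIV FS_scale x(1) yFS g)
      also have "norm \<dots> \<le> (\<Sum>n\<in>G. norm (?t n - y g n))"
      proof (rule norm_cs_le)
        fix n assume "n \<notin> G"
        thus "?t n - y g n = 0" using fejer_eq_0[of N n] N0 by (auto simp: y_def G_def)
      qed (simp add: G_def)
      also have "\<dots> \<le> (\<Sum>n\<in>G. e')"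
      proof (rule sum_mono)
        fix n assume n: "n \<in> G"
        hence "?t n - y g n = (fejer N n)\<^sup>2 *\<^sub>R (x n - g0 n)"
          by (simp add: y_def g_def scaleR_diff_right)
        hence "norm (?t n - y g n) = (fejer N n)\<^sup>2 * norm (x n - g0 n)" by simp
        also have "\<dots> \<le> 1 * e'"
          using g0[OF n] fejer_bounds[of N n] by (intro mult_mono) (auto simp: power_le_one)
        finally show "norm (?t n - y g n) \<le> e'" by simp
      qed
      also have "\<dots> = (2 * real N + 1) * e'" by (simp add: G_def)
      also have "\<dots> = e / 2" 
      proof -
        have "c * (r / c) = r" if "c \<noteq> 0" for c r :: real using that by simp
        moreover have "2 * real N + 1 \<noteq> 0" by linarith
        ultimately show ?thesis unfolding e'_def by blast
      qed
      finally have 2: "norm (cs ?t - cs (y g)) \<le> e / 2" .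
      show "norm (a - cs (y g)) \<le> e"
        using norm_triangle_ineq[of "cs x - cs ?t" "cs ?t - cs (y g)"] 1 2 by (simp add: x(2))
    qed (use g in auto)
  qed
qed

lemma CP_closure: "CP \<subseteq> closure VV"
  unfolding reduced_crossed_product_def
proof (rule closure_minimal)
  show "closed (closure VV)" by simp
  show "cs ` finite_support UNIV \<subseteq> closure VV"
  proof
    fix a assume "a \<in> cs ` finite_support UNIV"
    then obtain x where x: "x \<in> finite_support UNIV" "a = cs x" by blast
    define G where "G = {n. x n \<noteq> 0}"
    have G: "finite G" using x(1) by (simp add: G_def finite_support_def)
    show "a \<in> closure VV"
      unfolding closure_approachable
    proof (intro allI impI)
      fix e :: real assume e: "0 < e"
      define e' where "e' = e / (real (card G) + 1)"
      have e': "e' > 0" using e by (simp add: e'_def add_nonneg_pos)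
      have "\<exists>g\<in>VB. dist g (x n) < e'" for n
        using VB_dense e' by (metis UNIV_I closure_approachable)
      then obtain g where g: "\<And>n. g n \<in> VB" "\<And>n. dist (g n) (x n) < e'" by metis
      define y where "y n = (if n \<in> G then g n else 0)" for n
      have y: "y \<in> FS" by (rule finite_supportI[OF G]) (auto simp: y_def VB_zero g)
      have "cs y - cs x = cs (\<lambda>n. y n - x n)"
        by (intro cs_diff[symmetric] FS_UNIV y x)
      also have "norm \<dots> \<le> (\<Sum>n\<in>G. norm (y n - x n))"
        by (rule norm_cs_le[OF G]) (auto simp: y_def G_def)
      also have "\<dots> \<le> (\<Sum>n\<in>G. e')"
        by (rule sum_mono) (use g(2) in \<open>auto simp: y_def dist_norm less_imp_le\<close>)
      also have "\<dots> < e" using e by (simp add: e'_def field_simps add_pos_nonneg)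
      finally show "\<exists>b\<in>VV. dist b a < e"
        using VV_I[OF y] by (auto simp: x(2) dist_norm)
    qed
  qed
qed

lemma LL_adjoint:
  assumes x: "x \<in> FS"
  shows "LL (cs (crossed_adjoint \<beta> x)) = LL (cs x)"
proof -
  have "norm (cs (deriv_seq (crossed_adjoint \<beta> x))) = norm (cs (deriv_seq x))"
    using arg_cong[OF star_deriv[OF x], of norm] by (simp add: norm_star)
  thus ?thesis
    by (simp add: LL_cs[OF x] LL_cs[OF FS_adjoint[OF x]] crossed_adjoint_twice[OF FS_UNIV[OF x]] max.commute)
qed

sublocale lip_algebra CP VV LL lip_diam
proof
  show "unital_cstar_subalgebra CP" by (rule unital_cstar_subalgebra_crossed)
  show "VV \<subseteq> CP"
    unfolding reduced_crossed_product_def crossed_subspace_def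
    by (rule order_trans[OF _ closure_subset]) (auto intro: FS_UNIV)
  show "CP \<subseteq> closure VV" by (rule CP_closure)
  show "1 \<in> VV" using VV_I[OF FS_single[OF VB_const, of 0 1]] by (simp add: cs_one)
  show "LL 1 = 0" by (rule LL_one)
  show "0 \<le> lip_diam" using D_nonneg unit_nrm_pos[of 0] by (simp add: lip_diam_def)
  show "\<exists>F. finite F \<and> F \<subseteq> VV \<and> (\<forall>a\<in>VV. LL a \<le> 1 \<longrightarrow> norm a \<le> R \<longrightarrow> (\<exists>b\<in>F. norm (a - b) \<le> e))"
    if "0 < e" for e R by (rule tot_bdd_crossed[OF that])
  fix a assume "a \<in> VV"
  then obtain x where x: "x \<in> FS" "a = cs x" by (elim VV_E)
  show "\<exists>c. norm (a - c *\<^sub>C 1) \<le> lip_diam * LL a"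
    using diam_bound[OF x(1), of undefined] x(2) by blast
  show "0 \<le> LL a" unfolding x(2) by (rule order_trans[OF norm_ge_zero LL_bounds(1)[OF x(1)]])
  show "star a \<in> VV" unfolding x(2) star_cs[OF FS_UNIV[OF x(1)]] by (intro VV_I FS_adjoint x)
  show "LL (star a) = LL a" unfolding x(2) star_cs[OF FS_UNIV[OF x(1)]] by (rule LL_adjoint[OF x(1)])
  fix c
  have m: "c *\<^sub>C a = cs (\<lambda>n. bcontfun_cmult c (x n))"
    unfolding x(2) by (rule cs_cmult[OF FS_UNIV[OF x(1)], symmetric])
  show "c *\<^sub>C a \<in> VV" unfolding m by (intro VV_I FS_cmult x)
  show "LL (c *\<^sub>C a) = cmod c * LL a"
  proof -
    have "deriv_seq (\<lambda>n. bcontfun_cmult c (x n)) = (\<lambda>n. bcontfun_cmult c (deriv_seq x n))"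
      by (intro ext bcontfun_eqI) (simp add: deriv_seq_def scaleR_conv_of_real)
    hence 1: "norm (cs (deriv_seq (\<lambda>n. bcontfun_cmult c (x n)))) = cmod c * norm (cs (deriv_seq x))"
      using cs_cmult[OF FS_UNIV[OF FS_deriv[OF x(1)]], of c] by (simp add: norm_scaleC)
    have 2: "crossed_adjoint \<beta> (\<lambda>n. bcontfun_cmult c (x n)) = (\<lambda>n. bcontfun_cmult (cnj c) (crossed_adjoint \<beta> x n))"
      by (intro ext bcontfun_eqI) (simp add: crossed_adjoint_apply)
    have V: "x n \<in> VB" "crossed_adjoint \<beta> x n \<in> VB" for n
      using x(1) FS_adjoint[OF x(1)] by (simp_all add: finite_support_def)
    show ?thesis
      unfolding m unfolding LL_cs[OF FS_cmult[OF x(1)]] x(2) LL_cs[OF x(1)] 1 2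
      using rnrm_scale[OF fin_fun_LB[OF x(1)], of "cmod c"] rnrm_scale[OF fin_fun_LB[OF FS_adjoint[OF x(1)]], of "cmod c"]
      by (simp add: LB_cmult V max_mult_distrib_left)
  qed
  fix b assume "b \<in> VV"
  then obtain y where y: "y \<in> FS" "b = cs y" by (elim VV_E)
  have s: "a + b = cs (\<lambda>n. x n + y n)"
    unfolding x(2) y(2) by (intro cs_add[symmetric] FS_UNIV x y)
  show "a + b \<in> VV" unfolding s by (intro VV_I FS_add x y)
  show "LL (a + b) \<le> LL a + LL b"
  proof -
    have "deriv_seq (\<lambda>n. x n + y n) = (\<lambda>n. deriv_seq x n + deriv_seq y n)"
      by (simp add: deriv_seq_def scaleR_add_right)
    hence 1: "norm (cs (deriv_seq (\<lambda>n. x n + y n))) \<le> norm (cs (deriv_seq x)) + norm (cs (deriv_seq y))"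
      using cs_add[OF FS_UNIV[OF FS_deriv[OF x(1)]] FS_UNIV[OF FS_deriv[OF y(1)]]]
        norm_triangle_ineq[of "cs (deriv_seq x)" "cs (deriv_seq y)"] by simp
    have mono: "rnrm (\<lambda>n. LB (u n + v n)) \<le> rnrm (\<lambda>n. LB (u n)) + rnrm (\<lambda>n. LB (v n))"
      if uv: "u \<in> FS" "v \<in> FS" for u v
    proof -
      have V: "u n \<in> VB" "v n \<in> VB" for n using uv by (simp_all add: finite_support_def)
      have f: "fin_fun (\<lambda>n. LB (u n) + LB (v n))"
        by (rule fin_funI[of "{n. u n \<noteq> 0} \<union> {n. v n \<noteq> 0}"])
          (use uv in \<open>auto simp: finite_support_def LB_zero\<close>)
      have "rnrm (\<lambda>n. LB (u n + v n)) \<le> rnrm (\<lambda>n. LB (u n) + LB (v n))"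
        by (rule rnrm_mono[OF fin_fun_LB[OF FS_add[OF uv]] f]) (auto intro: LB_nonneg LB_add VB_add V)
      also have "\<dots> \<le> rnrm (\<lambda>n. LB (u n)) + rnrm (\<lambda>n. LB (v n))"
        by (intro rnrm_add fin_fun_LB uv)
      finally show ?thesis .
    qed
    have 2: "crossed_adjoint \<beta> (\<lambda>n. x n + y n) = (\<lambda>n. crossed_adjoint \<beta> x n + crossed_adjoint \<beta> y n)"
      by (intro ext bcontfun_eqI) (simp add: crossed_adjoint_apply)
    show ?thesis
      unfolding s unfolding LL_cs[OF FS_add[OF x(1) y(1)]] x(2) y(2) LL_cs[OF x(1)] LL_cs[OF y(1)] 2
      using 1 mono[OF x(1) y(1)] mono[OF FS_adjoint[OF x(1)] FS_adjoint[OF y(1)]]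
      by (intro max.boundedI) (rule order_trans, assumption, intro add_mono, simp, simp)+
  qed
qed

end

section \<open>Comparing two crossed products\<close>

text \<open>Provides the self-adjointness that \<open>op_pos_compression\<close> takes as a
  hypothesis, and applies to self-adjoint elements that are not positive.\<close>

lemma star_compression:
  fixes S :: "'i ell2_op" and T :: "'j ell2_op"
  assumes "star T = T"
    and S: "\<And>F. finite F \<Longrightarrow> \<exists>\<Lambda>. finite \<Lambda> \<and> (\<forall>u\<in>F. \<forall>v\<in>F. cinner (ket u) (op_apply S (ket v))
      = of_real k * (\<Sum>l\<in>\<Lambda>. if u \<in> D l \<and> v \<in> D l then cinner (ket (r l u)) (op_apply T (ket (r l v))) else 0))"
  shows "star S = S"
proof (rule star_eq_ketI)
  fix u v
  have c: "cnj (cinner (ket a) (op_apply T (ket b))) = cinner (ket b) (op_apply T (ket a))" for a b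
    by (metis assms(1) cinner_commute cinner_star)
  obtain \<Lambda> where \<Lambda>: "finite \<Lambda>" "\<forall>u'\<in>{u, v}. \<forall>v'\<in>{u, v}. cinner (ket u') (op_apply S (ket v'))
      = of_real k * (\<Sum>l\<in>\<Lambda>. if u' \<in> D l \<and> v' \<in> D l then cinner (ket (r l u')) (op_apply T (ket (r l v'))) else 0)"
    using S[of "{u, v}"] by auto
  have "cnj (cinner (ket v) (op_apply S (ket u))) = of_real k * (\<Sum>l\<in>\<Lambda>. cnj (if v \<in> D l \<and> u \<in> D l
      then cinner (ket (r l v)) (op_apply T (ket (r l u))) else 0))"
    using \<Lambda>(2) by simp
  also have "\<dots> = of_real k * (\<Sum>l\<in>\<Lambda>. if u \<in> D l \<and> v \<in> D l
      then cinner (ket (r l u)) (op_apply T (ket (r l v))) else 0)"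
    by (intro arg_cong[of _ _ "\<lambda>z. _ * z"] sum.cong) (auto simp: c)
  also have "\<dots> = cinner (ket u) (op_apply S (ket v))" using \<Lambda>(2) by simp
  finally show "cinner (ket u) (op_apply S (ket v)) = cnj (cinner (ket v) (op_apply S (ket u)))" ..
qed

text \<open>The divisor \<open>card I\<close> is the number of summands only for
  \<open>n = 0\<close>. A divisor independent of \<open>n\<close> keeps the map a constant multiple
  of a sum of compressions, and this value makes it unital; the Fejer weight is the price.\<close>

definition twisted_average ::
    "('x \<Rightarrow> 'x) \<Rightarrow> ('x \<Rightarrow> 'x) \<Rightarrow> int set \<Rightarrow> (int \<Rightarrow> ('x::topological_space \<Rightarrow>\<^sub>C complex)) \<Rightarrow> int \<Rightarrow> ('x \<Rightarrow>\<^sub>C complex)"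
  where "twisted_average \<phi> \<psi> I x = (\<lambda>n. (1 / real (card I)) *\<^sub>R (\<Sum>i | i \<in> I \<and> i - n \<in> I.
    int_iterate (pullback \<psi>) i (int_iterate (pullback \<phi>) (- i) (x n))))"

locale lip_pair = S: lip_system VB LB nrm D \<phi> + T: lip_system VB LB nrm D \<psi>
  for VB :: "('x::topological_space \<Rightarrow>\<^sub>C complex) set" and LB nrm D \<phi> \<psi> +
  fixes I :: "int set"
  assumes finite_I: "finite I" and I_nonempty: "I \<noteq> {}"
begin

abbreviation "avg \<equiv> twisted_average \<phi> \<psi> I"

lemma card_I: "0 < real (card I)"
  using finite_I I_nonempty by (simp add: card_gt_0_iff)

lemma avg_apply: "apply_bcontfun (avg x n) p
    = (1 / real (card I)) *\<^sub>R (\<Sum>i | i \<in> I \<and> i - n \<in> I. apply_bcontfun (x n) (int_iterate \<phi> (- i) (int_iterate \<psi> i p)))"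
  by (simp add: twisted_average_def bcontfun_sum_apply S.int_iterate_pullback T.int_iterate_pullback)

lemma avg_FS: "x \<in> S.FS \<Longrightarrow> avg x \<in> S.FS"
proof (rule finite_support_map)
  fix n
  show "avg x n = 0" if "x n = 0"
    by (rule bcontfun_eqI) (simp add: avg_apply that)
  show "avg x n \<in> VB" if "x \<in> S.FS"
    unfolding twisted_average_def using that
    by (intro S.VB_scaleR S.VB_sum T.VB_iterate S.VB_iterate) (simp add: S.FS_VB)
qed

definition transfer :: "(int \<times> 'x) ell2_op \<Rightarrow> (int \<times> 'x) ell2_op"
  where "transfer a = T.cs (avg (inv_into S.FS S.cs a))"

lemma transfer_cs: "x \<in> S.FS \<Longrightarrow> transfer (S.cs x) = T.cs (avg x)"
  unfolding transfer_def by (subst inv_into_f_f[OF crossed_sum_inj[OF S.homeo]]) simp_all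

text \<open>The partial isometry of index \<open>l\<close> sends \<open>(i, p)\<close> to
  \<open>(i - l, \<psi>^(-l) p)\<close>, for \<open>i - l\<close> in \<open>I\<close>. By
  \<open>cs_entry\<close>, the compressed entry evaluates \<open>x (i - j)\<close> at
  \<open>\<phi>^(l - i) \<psi>^(-l) p\<close>. With \<open>a = i - l\<close> this is
  \<open>\<phi>^(-a) \<psi>^a\<close> applied to \<open>\<psi>^(-i) p\<close>, the summand of index
  \<open>a\<close> in the twisted average.\<close>

lemma compression:
  assumes x: "x \<in> S.FS" and F: "finite F"
  shows "\<exists>\<Lambda>. finite \<Lambda> \<and> (\<forall>u\<in>F. \<forall>v\<in>F. cinner (ket u) (op_apply (T.cs (avg x)) (ket v))
      = of_real (1 / real (card I)) * (\<Sum>l\<in>\<Lambda>. if u \<in> {u. fst u - l \<in> I} \<and> v \<in> {u. fst u - l \<in> I}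
        then cinner (ket (fst u - l, int_iterate \<psi> (- l) (snd u)))
          (op_apply (S.cs x) (ket (fst v - l, int_iterate \<psi> (- l) (snd v)))) else 0))"
proof (intro exI conjI ballI)
  \<comment> \<open>These are the shifts that move the integer index of some element of
    \<open>F\<close> into \<open>I\<close>; all others contribute nothing on
    \<open>F\<close>.\<close>
  define \<Lambda> where "\<Lambda> = (\<lambda>(u, a). fst u - a) ` (F \<times> I)"
  show "finite \<Lambda>" using F finite_I by (simp add: \<Lambda>_def)
  fix u v :: "int \<times> 'x" assume uv: "u \<in> F" "v \<in> F"
  obtain i p j q where u: "u = (i, p)" and v: "v = (j, q)" by (cases u; cases v)
  have f: "finite {n. x n \<noteq> 0}" "finite {n. avg x n \<noteq> 0}"
    using x avg_FS[OF x] by (simp_all add: finite_support_def)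
  have inj: "int_iterate \<psi> (- l) p = int_iterate \<psi> (- l) q \<longleftrightarrow> p = q" for l
    using bij_int_iterate[OF T.homeo(1), of "- l"] by (simp add: bij_is_inj inj_eq)
  have "(\<Sum>l\<in>\<Lambda>. if u \<in> {u. fst u - l \<in> I} \<and> v \<in> {u. fst u - l \<in> I}
        then cinner (ket (fst u - l, int_iterate \<psi> (- l) (snd u)))
          (op_apply (S.cs x) (ket (fst v - l, int_iterate \<psi> (- l) (snd v)))) else 0)
      = (\<Sum>l\<in>{l \<in> \<Lambda>. i - l \<in> I \<and> j - l \<in> I}. if p = q
          then apply_bcontfun (x (i - j)) (int_iterate \<phi> (l - i) (int_iterate \<psi> (- l) p)) else 0)"
    unfolding u v using \<open>finite \<Lambda>\<close>
    by (intro sum.mono_neutral_cong_right) (auto simp: S.cs_entry[OF f(1)] inj)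
  also have "\<dots> = (\<Sum>a | a \<in> I \<and> a - (i - j) \<in> I. if p = q
          then apply_bcontfun (x (i - j)) (int_iterate \<phi> (- a) (int_iterate \<psi> (a - i) p)) else 0)"
  proof (rule sum.reindex_bij_witness[of _ "\<lambda>a. i - a" "\<lambda>l. i - l"])
    fix a assume a: "a \<in> {a. a \<in> I \<and> a - (i - j) \<in> I}"
    hence "i - a \<in> \<Lambda>" using uv(1) by (force simp: \<Lambda>_def u)
    thus "i - a \<in> {l \<in> \<Lambda>. i - l \<in> I \<and> j - l \<in> I}" using a by (simp add: algebra_simps)
  qed (auto simp: algebra_simps)
  also have "of_real (1 / real (card I)) * \<dots> = cinner (ket u) (op_apply (T.cs (avg x)) (ket v))"
    unfolding u v T.cs_entry[OF f(2)] avg_apply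
    by (simp add: int_iterate_add[OF T.homeo(1), symmetric] scaleR_conv_of_real)
  finally show "cinner (ket u) (op_apply (T.cs (avg x)) (ket v))
      = of_real (1 / real (card I)) * (\<Sum>l\<in>\<Lambda>. if u \<in> {u. fst u - l \<in> I} \<and> v \<in> {u. fst u - l \<in> I}
        then cinner (ket (fst u - l, int_iterate \<psi> (- l) (snd u)))
          (op_apply (S.cs x) (ket (fst v - l, int_iterate \<psi> (- l) (snd v)))) else 0)" ..
qed

lemma transfer_star:
  assumes x: "x \<in> S.FS" and "star (S.cs x) = S.cs x"
  shows "star (T.cs (avg x)) = T.cs (avg x)"
  by (rule star_compression[OF assms(2) compression[OF x]])

lemma transfer_pos:
  assumes x: "x \<in> S.FS" and "op_pos (S.cs x)"
  shows "op_pos (T.cs (avg x))"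
proof (rule op_pos_compression[OF assms(2)  _ _ compression[OF x]])
  show "star (T.cs (avg x)) = T.cs (avg x)"
    using assms by (intro transfer_star) (simp_all add: op_pos_def)
qed simp

lemma avg_add: "avg (\<lambda>n. x n + y n) = (\<lambda>n. avg x n + avg y n)"
  by (intro ext bcontfun_eqI) (simp add: avg_apply sum.distrib scaleR_add_right)

lemma avg_cmult: "avg (\<lambda>n. bcontfun_cmult c (x n)) = (\<lambda>n. bcontfun_cmult c (avg x n))"
  by (intro ext bcontfun_eqI) (simp add: avg_apply sum_distrib_left)

lemma avg_deriv: "avg (S.deriv_seq x) = T.deriv_seq (avg x)"
  by (intro ext bcontfun_eqI) (simp add: avg_apply S.deriv_seq_def T.deriv_seq_def scaleR_right.sum)

lemma avg_one: "avg (S.single 0 (const_bcontfun 1)) = T.single 0 (const_bcontfun 1)"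
proof (intro ext bcontfun_eqI)
  fix n p
  show "apply_bcontfun (avg (S.single 0 (const_bcontfun 1)) n) p = apply_bcontfun (T.single 0 (const_bcontfun 1) n) p"
    using card_I by (cases "n = 0") (auto simp: avg_apply S.single_def T.single_def scaleR_conv_of_real)
qed

lemma transfer_VV: "a \<in> S.VV \<Longrightarrow> transfer a \<in> T.VV"
  by (elim S.VV_E) (auto simp: transfer_cs intro!: T.VV_I avg_FS)

lemma transfer_scaleC:
  assumes "a \<in> S.VV"
  shows "transfer (c *\<^sub>C a) = c *\<^sub>C transfer a"
proof -
  obtain x where x: "x \<in> S.FS" "a = S.cs x" using assms by (elim S.VV_E)
  have "transfer (c *\<^sub>C a) = transfer (S.cs (\<lambda>n. bcontfun_cmult c (x n)))"
    by (simp add: x S.cs_cmult S.FS_UNIV)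
  also have "\<dots> = T.cs (\<lambda>n. bcontfun_cmult c (avg x n))"
    by (simp add: transfer_cs S.FS_cmult x avg_cmult)
  finally show ?thesis by (simp add: x transfer_cs T.cs_cmult T.FS_UNIV avg_FS)
qed

lemma transfer_positive_map: "unital_positive_map (sa_part S.CP S.VV) (sa_part T.CP T.VV) transfer"
proof (rule unital_positive_map_sa_part[OF S.lip_algebra_axioms T.lip_algebra_axioms])
  show "transfer 1 = 1"
    using transfer_cs[OF S.FS_single[OF S.VB_const], of 0 1] by (simp add: S.cs_one T.cs_one avg_one)
  fix a assume a: "a \<in> S.VV"
  then obtain x where x: "x \<in> S.FS" "a = S.cs x" by (elim S.VV_E)
  show "transfer a \<in> T.VV" by (rule transfer_VV[OF a])
  show "transfer (r *\<^sub>R a) = r *\<^sub>R transfer a" for r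
    using transfer_scaleC[OF a, of "of_real r"] by (simp add: scaleR_scaleC)
  show "star (transfer a) = transfer a" if "star a = a"
    using transfer_star[OF x(1)] that by (simp add: x transfer_cs)
  show "op_pos (transfer a)" if "op_pos a"
    using transfer_pos[OF x(1)] that by (simp add: x transfer_cs)
  fix b assume "b \<in> S.VV"
  then obtain y where y: "y \<in> S.FS" "b = S.cs y" by (elim S.VV_E)
  have "transfer (a + b) = transfer (S.cs (\<lambda>n. x n + y n))"
    by (simp add: x y S.cs_add S.FS_UNIV)
  also have "\<dots> = T.cs (\<lambda>n. avg x n + avg y n)"
    by (simp add: transfer_cs S.FS_add x y avg_add)
  finally show "transfer (a + b) = transfer a + transfer b"
    by (simp add: x y transfer_cs T.cs_add T.FS_UNIV avg_FS)
qed

text \<open>For self-adjoint elements the two Lipschitz terms agree, and each coefficient is an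
  average of at most \<open>card I\<close> twisted copies. The derivation term does not grow at all;
  \<open>1 \<le> K\<close> lets both terms share one factor.\<close>

lemma transfer_lipschitz:
  assumes lip: "\<And>i f. i \<in> I \<Longrightarrow> f \<in> VB \<Longrightarrow> LB (int_iterate T.\<beta> i (int_iterate S.\<beta> (- i) f)) \<le> K * LB f"
    and K: "1 \<le> K" and a: "a \<in> ou_carrier (sa_part S.CP S.VV)"
  shows "T.LL (transfer a) \<le> K * S.LL a"
proof -
  have a': "a \<in> S.VV" "star a = a" using a by (simp_all add: S.sa_part_sel)
  then obtain x where x: "x \<in> S.FS" "a = S.cs x" by (elim S.VV_E)
  have La: "0 \<le> S.LL a" by (rule S.L_nonneg[OF a'(1)])
  have sx: "crossed_adjoint S.\<beta> x = x"
    using S.cs_inj[OF S.FS_adjoint[OF x(1)] x(1)] a'(2) by (simp add: x S.star_cs S.FS_UNIV)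
  have sax: "crossed_adjoint T.\<beta> (avg x) = avg x"
    using T.cs_inj[OF T.FS_adjoint[OF avg_FS[OF x(1)]] avg_FS[OF x(1)]] transfer_star[OF x(1)] a'(2)
    by (simp add: x T.star_cs T.FS_UNIV avg_FS)
  have "LB (avg x n) \<le> K * LB (x n)" for n
  proof -
    let ?J = "{i. i \<in> I \<and> i - n \<in> I}"
    let ?g = "\<lambda>i. int_iterate T.\<beta> i (int_iterate S.\<beta> (- i) (x n))"
    have V: "?g i \<in> VB" for i by (intro S.VB_iterate T.VB_iterate S.FS_VB x)
    have "LB (avg x n) = (1 / real (card I)) * LB (sum ?g ?J)"
      unfolding twisted_average_def using S.LB_scaleR[OF S.VB_sum, of ?J ?g "1 / real (card I)", OF V] by simp
    also have "\<dots> \<le> (1 / real (card I)) * (\<Sum>i\<in>?J. LB (?g i))"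
      by (intro mult_left_mono S.LB_sum V) auto
    also have "\<dots> \<le> (1 / real (card I)) * (\<Sum>i\<in>?J. K * LB (x n))"
      by (intro mult_left_mono sum_mono lip S.FS_VB x) auto
    also have "\<dots> \<le> (1 / real (card I)) * (real (card I) * (K * LB (x n)))"
    proof (intro mult_left_mono)
      have "card ?J \<le> card I" by (rule card_mono[OF finite_I]) auto
      thus "(\<Sum>i\<in>?J. K * LB (x n)) \<le> real (card I) * (K * LB (x n))"
        using S.LB_nonneg[OF S.FS_VB[OF x(1)]] K by (simp add: mult_right_mono)
    qed simp
    also have "\<dots> = K * LB (x n)" using card_I by simp
    finally show ?thesis .
  qed
  hence "S.rnrm (\<lambda>n. LB (avg x n)) \<le> S.rnrm (\<lambda>n. K * LB (x n))"
    by (intro S.rnrm_mono S.fin_fun_LB avg_FS x S.fin_funI[of "{n. x n \<noteq> 0}"])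
      (use x in \<open>auto simp: S.LB_nonneg S.FS_VB avg_FS S.LB_zero finite_supportD\<close>)
  also have "\<dots> = K * S.rnrm (\<lambda>n. LB (x n))"
    using S.rnrm_scale[OF S.fin_fun_LB[OF x(1)], of K] K by simp
  also have "\<dots> \<le> K * S.LL a"
    using K by (intro mult_left_mono) (simp_all add: x S.LL_cs)
  finally have 1: "S.rnrm (\<lambda>n. LB (avg x n)) \<le> K * S.LL a" .
  have "norm (T.cs (T.deriv_seq (avg x))) \<le> norm (S.cs (S.deriv_seq x))"
  proof -
    let ?d = "S.cs (S.deriv_seq x)"
    have d: "?d \<in> S.VV" by (intro S.VV_I S.FS_deriv x)
    \<comment> \<open>The contraction property is available on self-adjoint elements only, and the
      derivation of a self-adjoint element is skew.\<close>
    have "star (\<i> *\<^sub>C ?d) = \<i> *\<^sub>C ?d"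
      using S.star_deriv[OF x(1)] by (simp add: star_scaleC sx scaleC_minus_left scaleC_minus_right)
    hence "norm (transfer (\<i> *\<^sub>C ?d)) \<le> norm (\<i> *\<^sub>C ?d)"
      using unital_positive_mapD(2)[OF transfer_positive_map, of "\<i> *\<^sub>C ?d"] S.V_scale[OF d]
      by (simp add: S.sa_part_sel)
    thus ?thesis
      by (simp add: transfer_scaleC[OF d] norm_scaleC transfer_cs S.FS_deriv x avg_deriv)
  qed
  also have "\<dots> \<le> S.LL a" unfolding x(2) by (rule S.LL_bounds[OF x(1)])
  also have "\<dots> \<le> K * S.LL a" using K La by (simp add: mult_le_cancel_right1)
  finally have 2: "norm (T.cs (T.deriv_seq (avg x))) \<le> K * S.LL a" .
  show ?thesis
    unfolding x(2) transfer_cs[OF x(1)] T.LL_cs[OF avg_FS[OF x(1)]] sax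
    using 1 2 by (simp add: x)
qed

end

section \<open>Composing the transfer maps in both directions\<close>

lemma card_interval_shift:
  fixes a n :: int
  shows "real (card {i. i \<in> {a..<a + int N} \<and> i - n \<in> {a..<a + int N}}) = real N * fejer N n"
proof (cases "N = 0")
  case False
  have "{i. i \<in> {a..<a + int N} \<and> i - n \<in> {a..<a + int N}} = {max a (a + n)..<min (a + int N) (a + n + int N)}"
    by auto
  hence "real (card {i. i \<in> {a..<a + int N} \<and> i - n \<in> {a..<a + int N}}) = max 0 (real N - \<bar>real_of_int n\<bar>)"
    by (auto simp: max_def min_def)
  also have "\<dots> = real N * fejer N n"
    using False by (simp add: fejer_def max_def field_simps)
  finally show ?thesis .
qed simp

text \<open>The composed coefficient is a sum over the square of \<open>N * fejer N n\<close> pairs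
  of indices with normalization \<open>1 / N ^ 2\<close>, and evaluates \<open>x n\<close> at doubly
  displaced points. Each displacement costs \<open>\<eta> * LB (x n)\<close>; apart from that,
  \<open>x n\<close> is multiplied by the squared weight. The coefficient errors are added up in
  norm over the finitely many \<open>n\<close> concerned, which produces the sum of the
  \<open>1 / unit_nrm n\<close>.\<close>

lemma transfer_inverse:
  assumes P: "lip_pair VB LB nrm D \<phi> \<psi> {a..<a + int N}" and Q: "lip_pair VB LB nrm D \<psi> \<phi> {b..<b + int N}"
    and N: "0 < N" and \<eta>: "0 \<le> \<eta>"
    and H: "\<And>i f p. i \<in> {a..<a + int N} \<Longrightarrow> f \<in> VB \<Longrightarrow>
      cmod (apply_bcontfun f (int_iterate \<phi> (- i) (int_iterate \<psi> i p)) - apply_bcontfun f p) \<le> \<eta> * LB f"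
    and H': "\<And>i f p. i \<in> {b..<b + int N} \<Longrightarrow> f \<in> VB \<Longrightarrow>
      cmod (apply_bcontfun f (int_iterate \<psi> (- i) (int_iterate \<phi> i p)) - apply_bcontfun f p) \<le> \<eta> * LB f"
    and \<xi>: "\<xi> \<in> crossed_subspace (pullback \<phi>) VB"
  shows "norm (\<xi> - lip_pair.transfer VB \<psi> \<phi> {b..<b + int N} (lip_pair.transfer VB \<phi> \<psi> {a..<a + int N} \<xi>))
    \<le> (sqrt (32 / real N) + 2 * \<eta> * (\<Sum>n\<in>{- int N..int N}. 1 / lip_functions.unit_nrm nrm n))
      * crossed_seminorm (pullback \<phi>) VB LB nrm \<xi>"
proof -
  interpret P: lip_pair VB LB nrm D \<phi> \<psi> "{a..<a + int N}" by (rule P)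
  interpret Q: lip_pair VB LB nrm D \<psi> \<phi> "{b..<b + int N}" by (rule Q)
  obtain x where x: "x \<in> P.S.FS" "\<xi> = P.S.cs x" using \<xi> by (elim P.S.VV_E)
  let ?t = "\<lambda>n. (fejer N n)\<^sup>2 *\<^sub>R x n"
  let ?y = "Q.avg (P.avg x)"
  let ?G = "{- int N..int N}"
  have y: "?y \<in> P.S.FS" by (intro Q.avg_FS P.avg_FS x)
  have eq: "P.transfer \<xi> = P.T.cs (P.avg x)" "Q.transfer (P.T.cs (P.avg x)) = P.S.cs ?y"
    using P.transfer_cs[OF x(1)] Q.transfer_cs[OF P.avg_FS[OF x(1)]] x(2) by simp_all
  have coeff: "norm (?t n - ?y n) \<le> 2 * \<eta> * LB (x n)" for n
  proof (rule norm_bound)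
    fix p
    define I where "I = {i. i \<in> {a..<a + int N} \<and> i - n \<in> {a..<a + int N}}"
    define J where "J = {i. i \<in> {b..<b + int N} \<and> i - n \<in> {b..<b + int N}}"
    define k where "k = 1 / (real N)\<^sup>2"
    define r where "r = 2 * \<eta> * LB (x n)"
    have xV: "x n \<in> VB" by (rule P.S.FS_VB[OF x(1)])
    have k0: "0 \<le> k" by (simp add: k_def)
    have r0: "0 \<le> r" using \<eta> P.S.LB_nonneg[OF xV] by (simp add: r_def)
    define q where "q j = int_iterate \<psi> (- j) (int_iterate \<phi> j p)" for j
    define g where "g i j = apply_bcontfun (x n) (int_iterate \<phi> (- i) (int_iterate \<psi> i (q j)))" for i j
    have g: "cmod (apply_bcontfun (x n) p - g i j) \<le> r" if "i \<in> I" "j \<in> J" for i j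
    proof -
      have "cmod (g i j - apply_bcontfun (x n) (q j)) \<le> \<eta> * LB (x n)"
        unfolding g_def by (rule H) (use that xV in \<open>auto simp: I_def\<close>)
      moreover have "cmod (apply_bcontfun (x n) (q j) - apply_bcontfun (x n) p) \<le> \<eta> * LB (x n)"
        unfolding q_def by (rule H') (use that xV in \<open>auto simp: J_def\<close>)
      ultimately show ?thesis
        using norm_triangle_ineq[of "g i j - apply_bcontfun (x n) (q j)" "apply_bcontfun (x n) (q j) - apply_bcontfun (x n) p"]
        by (simp add: norm_minus_commute r_def)
    qed
    have "real (card I) = real N * fejer N n" "real (card J) = real N * fejer N n"
      unfolding I_def J_def by (rule card_interval_shift)+
    hence c: "real (card J) * (real (card I) * k) = (fejer N n)\<^sup>2"
      using N by (simp add: k_def power2_eq_square)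
    have yp: "apply_bcontfun (?y n) p = (\<Sum>j\<in>J. \<Sum>i\<in>I. k *\<^sub>R g i j)"
      by (simp add: Q.avg_apply P.avg_apply q_def g_def scaleR_right.sum power2_eq_square k_def I_def J_def)
    have "(\<Sum>j\<in>J. \<Sum>i\<in>I. k *\<^sub>R apply_bcontfun (x n) p)
        = (real (card J) * (real (card I) * k)) *\<^sub>R apply_bcontfun (x n) p"
      by (simp add: scaleR_conv_of_real)
    hence tp: "apply_bcontfun (?t n) p = (\<Sum>j\<in>J. \<Sum>i\<in>I. k *\<^sub>R apply_bcontfun (x n) p)"
      by (simp only: c scaleR_bcontfun.rep_eq)
    have "apply_bcontfun (?t n - ?y n) p = (\<Sum>j\<in>J. \<Sum>i\<in>I. k *\<^sub>R (apply_bcontfun (x n) p - g i j))"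
      unfolding minus_bcontfun.rep_eq tp yp by (simp only: sum_subtractf scaleR_diff_right)
    also have "norm \<dots> \<le> (\<Sum>j\<in>J. \<Sum>i\<in>I. k * r)"
    proof (intro sum_norm_le)
      fix i j assume "j \<in> J" "i \<in> I"
      from mult_left_mono[OF g[OF this(2,1)] k0]
      show "norm (k *\<^sub>R (apply_bcontfun (x n) p - g i j)) \<le> k * r"
        by (simp only: norm_scaleR abs_of_nonneg[OF k0])
    qed
    also have "\<dots> = (real (card J) * (real (card I) * k)) * r"
      by simp
    also have "\<dots> \<le> 1 * r"
      unfolding c using fejer_bounds[of N n] r0 by (intro mult_right_mono) (auto simp: power_le_one)
    finally show "norm (apply_bcontfun (?t n - ?y n) p) \<le> 2 * \<eta> * LB (x n)" by (simp only: r_def mult_1)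
  qed
  \<comment> \<open>Outside the window both sequences vanish: one has weight 0, the other is an
    average over an empty index set.\<close>
  have zero: "?t n - ?y n = 0" if "n \<notin> ?G" for n
  proof -
    have f: "fejer N n = 0" using that N by (intro fejer_eq_0) auto
    have "card {i. i \<in> {b..<b + int N} \<and> i - n \<in> {b..<b + int N}} = 0"
      using card_interval_shift[of b N n] f by simp
    hence "{i. i \<in> {b..<b + int N} \<and> i - n \<in> {b..<b + int N}} = {}"
      by (subst (asm) card_0_eq) (auto intro: finite_subset[of _ "{b..<b + int N}"])
    hence "?y n = 0" by (simp only: twisted_average_def sum.empty scaleR_zero_right)
    thus ?thesis using f by simp
  qed
  have "P.S.cs ?t - P.S.cs ?y = P.S.cs (\<lambda>n. ?t n - ?y n)"
    by (intro P.S.cs_diff[symmetric] P.S.FS_UNIV P.S.FS_scale x(1) y)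
  hence "norm (P.S.cs ?t - P.S.cs ?y) = norm (P.S.cs (\<lambda>n. ?t n - ?y n))"
    by (rule arg_cong)
  also have "\<dots> \<le> (\<Sum>n\<in>?G. norm (?t n - ?y n))"
    by (rule P.S.norm_cs_le[OF finite_atLeastAtMost_int]) (rule zero)
  also have "\<dots> \<le> (\<Sum>n\<in>?G. 2 * \<eta> * (P.S.LL \<xi> / P.S.unit_nrm n))"
  proof (rule sum_mono)
    fix n
    have "2 * \<eta> * LB (x n) \<le> 2 * \<eta> * (P.S.LL \<xi> / P.S.unit_nrm n)"
      unfolding x(2) by (rule mult_left_mono[OF P.S.LL_bounds(2)[OF x(1)]]) (simp add: \<eta>)
    thus "norm (?t n - ?y n) \<le> 2 * \<eta> * (P.S.LL \<xi> / P.S.unit_nrm n)"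
      by (rule order_trans[OF coeff])
  qed
  also have "\<dots> = 2 * \<eta> * (\<Sum>n\<in>?G. 1 / P.S.unit_nrm n) * P.S.LL \<xi>"
    by (simp add: sum_distrib_left sum_distrib_right)
  finally have 1: "norm (P.S.cs ?t - P.S.cs ?y) \<le> 2 * \<eta> * (\<Sum>n\<in>?G. 1 / P.S.unit_nrm n) * P.S.LL \<xi>" .
  have "norm (P.S.cs x - P.S.cs ?t) \<le> sqrt (32 / real N) * P.S.LL \<xi>"
    unfolding x(2) by (rule P.S.fejer_approx[OF x(1) N])
  hence "norm (P.S.cs x - P.S.cs ?y) \<le> sqrt (32 / real N) * P.S.LL \<xi> + 2 * \<eta> * (\<Sum>n\<in>?G. 1 / P.S.unit_nrm n) * P.S.LL \<xi>"
    using norm_triangle_ineq[of "P.S.cs x - P.S.cs ?t" "P.S.cs ?t - P.S.cs ?y"] 1 by simp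
  thus ?thesis by (simp add: eq x(2)[symmetric] distrib_right)
qed

text \<open>The two intervals may lie anywhere, because the weight in
  \<open>card_interval_shift\<close> depends on their common length only; the freedom in
  \<open>a\<close> and \<open>b\<close> is used in
  \<open>dist_q_crossed_eventually_le\<close>.\<close>

lemma dist_q_crossed_le:
  assumes S: "lip_system VB LB nrm D \<phi>" and T: "lip_system VB LB nrm D \<psi>"
    and N: "0 < N" and \<eta>: "0 \<le> \<eta>" and \<epsilon>: "0 < \<epsilon>"
    and small: "sqrt (32 / real N) + 2 * \<eta> * (\<Sum>n\<in>{- int N..int N}. 1 / lip_functions.unit_nrm nrm n) \<le> \<epsilon>"
    and H: "\<And>i f p. i \<in> {a..<a + int N} \<Longrightarrow> f \<in> VB \<Longrightarrow>
      cmod (apply_bcontfun f (int_iterate \<phi> (- i) (int_iterate \<psi> i p)) - apply_bcontfun f p) \<le> \<eta> * LB f"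
    and H': "\<And>i f p. i \<in> {b..<b + int N} \<Longrightarrow> f \<in> VB \<Longrightarrow>
      cmod (apply_bcontfun f (int_iterate \<psi> (- i) (int_iterate \<phi> i p)) - apply_bcontfun f p) \<le> \<eta> * LB f"
    and K: "\<And>i f. i \<in> {a..<a + int N} \<Longrightarrow> f \<in> VB \<Longrightarrow>
      LB (int_iterate (pullback \<psi>) i (int_iterate (pullback \<phi>) (- i) f)) \<le> (1 + \<epsilon>) * LB f"
    and K': "\<And>i f. i \<in> {b..<b + int N} \<Longrightarrow> f \<in> VB \<Longrightarrow>
      LB (int_iterate (pullback \<phi>) i (int_iterate (pullback \<psi>) (- i) f)) \<le> (1 + \<epsilon>) * LB f"
  shows "dist_q (reduced_crossed_product (pullback \<phi>)) (crossed_subspace (pullback \<phi>) VB)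
      (crossed_seminorm (pullback \<phi>) VB LB nrm) (reduced_crossed_product (pullback \<psi>))
      (crossed_subspace (pullback \<psi>) VB) (crossed_seminorm (pullback \<psi>) VB LB nrm)
    \<le> ennreal (\<epsilon> * (1 + lip_system.lip_diam nrm D))"
proof -
  have I: "{c..<c + int N} \<noteq> {}" for c :: int using N by auto
  have P: "lip_pair VB LB nrm D \<phi> \<psi> {a..<a + int N}" and Q: "lip_pair VB LB nrm D \<psi> \<phi> {b..<b + int N}"
    using S T I by (auto simp: lip_pair_def lip_pair_axioms_def)
  interpret P: lip_pair VB LB nrm D \<phi> \<psi> "{a..<a + int N}" by (rule P)
  interpret Q: lip_pair VB LB nrm D \<psi> \<phi> "{b..<b + int N}" by (rule Q)
  show ?thesis
    unfolding dist_q_def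
  proof (rule ou_dist_q_le[OF P.S.bounded_lip_seminorm_sa_part P.T.bounded_lip_seminorm_sa_part
        P.transfer_positive_map Q.transfer_positive_map _ _ _ _ \<epsilon>])
    fix c assume c: "c \<in> ou_carrier (sa_part P.S.CP P.S.VV)"
    hence c': "c \<in> P.S.VV" by (simp add: P.S.sa_part_sel)
    show "P.T.LL (P.transfer c) \<le> (1 + \<epsilon>) * P.S.LL c"
      using \<epsilon> by (intro P.transfer_lipschitz[OF K _ c]) auto
    show "norm (c - Q.transfer (P.transfer c)) \<le> \<epsilon> * P.S.LL c"
      by (rule order_trans[OF transfer_inverse[OF P Q N \<eta> H H' c'] mult_right_mono[OF small P.S.L_nonneg[OF c']]])
  next
    fix c assume c: "c \<in> ou_carrier (sa_part P.T.CP P.T.VV)"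
    hence c': "c \<in> P.T.VV" by (simp add: P.T.sa_part_sel)
    show "P.S.LL (Q.transfer c) \<le> (1 + \<epsilon>) * P.T.LL c"
      using \<epsilon> by (intro Q.transfer_lipschitz[OF K' _ c]) auto
    show "norm (c - P.transfer (Q.transfer c)) \<le> \<epsilon> * P.T.LL c"
      by (rule order_trans[OF transfer_inverse[OF Q P N \<eta> H' H c'] mult_right_mono[OF small P.T.L_nonneg[OF c']]])
  qed
qed

section \<open>Finite-dimensional inner product spaces\<close>

text \<open>An orthogonal spanning set is normalized after dropping zero vectors; in dimension zero
  the basis is empty.\<close>

lemma orthonormal_basis_exists:
  "\<exists>B :: 'e::finite_dim_inner set. finite B \<and> (\<forall>b\<in>B. \<forall>c\<in>B. inner b c = (if b = c then 1 else 0)) \<and>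
    (\<forall>x. x = (\<Sum>b\<in>B. inner x b *\<^sub>R b))"
proof -
  obtain B0 :: "'e set" where B0: "finite B0" "\<forall>x. \<exists>a. x = (\<Sum>b\<in>B0. a b *\<^sub>R b)"
    using finite_spanning_set by blast
  obtain C where C: "finite C" "span C = span B0" "pairwise orthogonal C"
    using basis_orthogonal[OF B0(1)] by blast
  have "span B0 = UNIV"
  proof -
    have "x \<in> span B0" for x
    proof -
      obtain a where "x = (\<Sum>b\<in>B0. a b *\<^sub>R b)" using B0(2) by blast
      thus ?thesis by (simp add: span_sum span_scale span_base)
    qed
    thus ?thesis by blast
  qed
  hence spC: "span C = UNIV" using C by simp
  define B where "B = (\<lambda>c. c /\<^sub>R norm c) ` (C - {0})"
  have fin: "finite B" using C by (simp add: B_def)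
  have on: "inner b c = (if b = c then 1 else 0)" if m: "b \<in> B" "c \<in> B" for b c
  proof -
    obtain b' c' where bc: "b' \<in> C" "b' \<noteq> 0" "b = b' /\<^sub>R norm b'" "c' \<in> C" "c' \<noteq> 0" "c = c' /\<^sub>R norm c'"
      using m by (auto simp: B_def)
    show ?thesis
    proof (cases "b' = c'")
      case True
      thus ?thesis using bc by (simp add: dot_square_norm power2_eq_square)
    next
      case False
      hence "inner b' c' = 0" using C(3) bc by (auto simp: pairwise_def orthogonal_def)
      hence 0: "inner b c = 0" using bc by simp
      moreover have "inner b b = 1" using bc by (simp add: dot_square_norm power2_eq_square)
      ultimately show ?thesis by auto
    qed
  qed
  have spB: "span B = UNIV"
  proof -
    have "C \<subseteq> span B"
    proof
      fix c assume c: "c \<in> C"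
      show "c \<in> span B"
      proof (cases "c = 0")
        case False
        hence "norm c *\<^sub>R (c /\<^sub>R norm c) \<in> span B"
          using c by (intro span_scale span_base) (auto simp: B_def)
        thus ?thesis using False by simp
      qed (simp add: span_zero)
    qed
    thus ?thesis using spC span_mono[of C "span B"] span_span[of B] by blast
  qed
  have "x = (\<Sum>b\<in>B. inner x b *\<^sub>R b)" for x
  proof -
    have "x \<in> span B" by (simp add: spB)
    then obtain a where a: "x = (\<Sum>b\<in>B. a b *\<^sub>R b)" using span_finite[OF fin] by blast
    have "inner x c = a c" if c: "c \<in> B" for c
    proof -
      have "inner x c = (\<Sum>b\<in>B. a b * inner b c)" by (simp add: a inner_sum_left)
      also have "\<dots> = (\<Sum>b\<in>B. if b = c then a b else 0)" by (intro sum.cong) (auto simp: on c)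
      finally show ?thesis using fin c by simp
    qed
    thus ?thesis using a by (metis (no_types, lifting) sum.cong)
  qed
  thus ?thesis using fin on by blast
qed

definition onb :: "'e::finite_dim_inner set"
  where "onb = (SOME B. finite B \<and> (\<forall>b\<in>B. \<forall>c\<in>B. inner b c = (if b = c then 1 else 0)) \<and>
    (\<forall>x. x = (\<Sum>b\<in>B. inner x b *\<^sub>R b)))"

lemma onb: "finite (onb :: 'e::finite_dim_inner set)"
  "\<And>b c :: 'e. b \<in> onb \<Longrightarrow> c \<in> onb \<Longrightarrow> inner b c = (if b = c then 1 else 0)"
  "\<And>x :: 'e. x = (\<Sum>b\<in>onb. inner x b *\<^sub>R b)"
  using someI_ex[OF orthonormal_basis_exists[where 'e = 'e]] unfolding onb_def by blast+

declare onb(1) [simp]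

lemma linear_onb:
  fixes f :: "'e::finite_dim_inner \<Rightarrow> 'f::real_vector"
  assumes "linear f"
  shows "f x = (\<Sum>b\<in>onb. inner x b *\<^sub>R f b)"
proof -
  have "f x = f (\<Sum>b\<in>onb. inner x b *\<^sub>R b)" by (simp flip: onb(3))
  thus ?thesis by (simp add: linear_sum[OF assms] linear_scale[OF assms])
qed

lemma linear_bounded_linear:
  fixes f :: "'e::finite_dim_inner \<Rightarrow> 'f::real_normed_vector"
  assumes "linear f"
  shows "bounded_linear f"
proof -
  have "bounded_linear (\<lambda>x. \<Sum>b\<in>onb. inner x b *\<^sub>R f b)"
    by (intro bounded_linear_sum bounded_linear_scaleR_const bounded_linear_inner_left)
  also have "(\<lambda>x. \<Sum>b\<in>onb. inner x b *\<^sub>R f b) = f"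
    by (rule ext) (rule linear_onb[OF assms, symmetric])
  finally show ?thesis .
qed

text \<open>In finite dimension, pointwise convergence of linear maps is already joint convergence
  in the map and the vector. Linearity is asked for eventually, because differentials in a chart are
  known to be linear only once the base point lies in its domain.\<close>

lemma tendsto_linear_apply:
  fixes T :: "'i \<Rightarrow> 'e::finite_dim_inner \<Rightarrow> 'f::real_normed_vector"
  assumes lin: "eventually (\<lambda>i. linear (T i)) F" "linear T0"
    and T: "\<And>b. ((\<lambda>i. T i b) \<longlongrightarrow> T0 b) F" and v: "(v \<longlongrightarrow> v0) F"
  shows "((\<lambda>i. T i (v i)) \<longlongrightarrow> T0 v0) F"
proof -
  have "((\<lambda>i. \<Sum>b\<in>onb. inner (v i) b *\<^sub>R T i b) \<longlongrightarrow> (\<Sum>b\<in>onb. inner v0 b *\<^sub>R T0 b)) F"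
    by (intro tendsto_intros T v)
  moreover have "eventually (\<lambda>i. (\<Sum>b\<in>onb. inner (v i) b *\<^sub>R T i b) = T i (v i)) F"
    using lin(1) by eventually_elim (rule linear_onb[symmetric])
  ultimately show ?thesis
    unfolding linear_onb[OF lin(2), of v0, symmetric] by (rule Lim_transform_eventually)
qed

lemma compact_finite_dim:
  fixes S :: "'e::finite_dim_inner set"
  assumes "bounded S" "closed S"
  shows "compact S"
  unfolding compact_eq_seq_compact_metric seq_compact_def
proof (intro allI impI)
  fix f :: "nat \<Rightarrow> 'e" assume f: "\<forall>n. f n \<in> S"
  obtain B where B: "\<And>x. x \<in> S \<Longrightarrow> norm x \<le> B" using assms(1) by (auto simp: bounded_iff)
  have "\<exists>l r. strict_mono r \<and> (\<forall>\<epsilon>>0. eventually (\<lambda>n. \<forall>i\<in>onb. dist (inner (f (r n)) i) (inner l i) < \<epsilon>) sequentially)"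
  proof -
    define h where "h n b = (if b \<in> onb then inner (f n) b else 0)" for n b
    have "\<forall>\<delta>\<subseteq>onb. \<exists>l :: 'e \<Rightarrow> real. \<exists>r. strict_mono r \<and> (\<forall>\<epsilon>>0. eventually (\<lambda>n. \<forall>i\<in>\<delta>. dist (h (r n) i) (l i) < \<epsilon>) sequentially)"
    proof (rule compact_lemma_general[where f = h and proj = "\<lambda>g. g" and unproj = "\<lambda>g. g"])
      fix k :: 'e assume k: "k \<in> onb"
      have "\<bar>inner (f n) k\<bar> \<le> B" for n
      proof -
        have "norm k = 1" using onb(2)[OF k k] by (simp add: norm_eq_1)
        thus ?thesis using Cauchy_Schwarz_ineq2[of "f n" k] B[of "f n"] f by simp
      qed
      thus "bounded ((\<lambda>x. x k) ` range h)"
        using k by (auto simp: bounded_iff h_def)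
    qed (simp_all add: onb(1))
    then obtain l r where lr: "strict_mono r"
      "\<forall>\<epsilon>>0. eventually (\<lambda>n. \<forall>i\<in>onb. dist (h (r n) i) (l i) < \<epsilon>) sequentially" by blast
    define l' where "l' = (\<Sum>b\<in>onb. l b *\<^sub>R b)"
    have "inner l' i = l i" if i: "i \<in> onb" for i
    proof -
      have "inner l' i = (\<Sum>b\<in>onb. if b = i then l b else 0)"
        unfolding l'_def inner_sum_left by (intro sum.cong) (auto simp: onb(2) i)
      thus ?thesis using i by simp
    qed
    hence "\<forall>\<epsilon>>0. eventually (\<lambda>n. \<forall>i\<in>onb. dist (inner (f (r n)) i) (inner l' i) < \<epsilon>) sequentially"
      using lr(2) by (simp add: h_def)
    thus ?thesis using lr(1) by blast
  qed
  then obtain l r where lr: "strict_mono r"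
    "\<forall>\<epsilon>>0. eventually (\<lambda>n. \<forall>i\<in>onb. dist (inner (f (r n)) i) (inner l i) < \<epsilon>) sequentially" by blast
  have coord: "(\<lambda>n. inner (f (r n)) i) \<longlonglongrightarrow> inner l i" if "i \<in> onb" for i
    unfolding tendsto_iff using lr(2) that by (auto elim!: eventually_mono)
  have "(\<lambda>n. \<Sum>b\<in>onb. inner (f (r n)) b *\<^sub>R b) \<longlonglongrightarrow> (\<Sum>b\<in>onb. inner l b *\<^sub>R b)"
    by (intro tendsto_intros coord)
  hence lim: "(f \<circ> r) \<longlonglongrightarrow> l" by (simp add: o_def flip: onb(3))
  moreover have "l \<in> S" using closed_sequentially[OF assms(2) _ lim] f by simp
  ultimately show "\<exists>l\<in>S. \<exists>r. strict_mono r \<and> (f \<circ> r) \<longlonglongrightarrow> l" using lr(1) by blast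
qed

lemma compact_unit_sphere: "compact {v :: 'e::finite_dim_inner. norm v = 1}"
proof (rule compact_finite_dim)
  show "bounded {v :: 'e. norm v = 1}" by (auto simp: bounded_iff)
  show "closed {v :: 'e. norm v = 1}" by (intro closed_Collect_eq continuous_intros)
qed

text \<open>The tube lemma for filters. Applied to the manifold and to the unit sphere of the model
  space, it turns limits at single points and directions into uniform estimates.\<close>

lemma eventually_compact:
  assumes "compact K" "\<And>x. x \<in> K \<Longrightarrow> eventually (\<lambda>(i, y). P i y) (F \<times>\<^sub>F nhds x)"
  shows "eventually (\<lambda>i. \<forall>x\<in>K. P i x) F"
proof -
  have "\<exists>U Q. open U \<and> x \<in> U \<and> eventually Q F \<and> (\<forall>i y. Q i \<longrightarrow> y \<in> U \<longrightarrow> P i y)" if x: "x \<in> K" for x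
  proof -
    obtain Pf Pg where "eventually Pf F" "eventually Pg (nhds x)" "\<forall>i y. Pf i \<longrightarrow> Pg y \<longrightarrow> P i y"
      using assms(2)[OF x] unfolding eventually_prod_filter by auto
    moreover then obtain U where "open U" "x \<in> U" "\<forall>y\<in>U. Pg y" unfolding eventually_nhds by blast
    ultimately show ?thesis by (intro exI[of _ U] exI[of _ Pf]) auto
  qed
  then obtain U Q where UQ: "\<And>x. x \<in> K \<Longrightarrow> open (U x) \<and> x \<in> U x \<and> eventually (Q x) F \<and>
      (\<forall>i y. Q x i \<longrightarrow> y \<in> U x \<longrightarrow> P i y)" by metis
  have U: "\<And>x. x \<in> K \<Longrightarrow> open (U x)" "\<And>x. x \<in> K \<Longrightarrow> x \<in> U x" "\<And>x. x \<in> K \<Longrightarrow> eventually (Q x) F"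
    and Q: "\<And>x i y. x \<in> K \<Longrightarrow> Q x i \<Longrightarrow> y \<in> U x \<Longrightarrow> P i y"
    using UQ by simp_all
  have cover: "K \<subseteq> (\<Union>x\<in>K. U x)" using U(2) by (intro subsetI UN_I)
  obtain K' where K': "K' \<subseteq> K" "finite K'" "K \<subseteq> (\<Union>x\<in>K'. U x)"
    by (rule compactE_image[OF assms(1) U(1) cover])
  have "eventually (\<lambda>i. \<forall>x\<in>K'. Q x i) F"
    by (intro eventually_ball_finite[OF K'(2)] ballI) (rule U(3)[OF subsetD[OF K'(1)]])
  thus ?thesis
  proof eventually_elim
    case (elim i)
    show ?case
    proof
      fix y assume "y \<in> K"
      hence "y \<in> (\<Union>x\<in>K'. U x)" by (rule subsetD[OF K'(3)])
      then obtain x where x: "x \<in> K'" "y \<in> U x" by (rule UN_E)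
      show "P i y" by (rule Q[OF subsetD[OF K'(1) x(1)] bspec[OF elim x(1)] x(2)])
    qed
  qed
qed

section \<open>Smooth functions\<close>

lemma Ck_on_SucD: "Ck_on (Suc k) S f \<Longrightarrow> x \<in> S \<Longrightarrow> (f has_derivative frechet_derivative f (at x)) (at x)"
  by (simp add: frechet_derivative_works)

lemma Ck_on_cong:
  assumes "open S" "\<And>x. x \<in> S \<Longrightarrow> f x = g x" "Ck_on k S f"
  shows "Ck_on k S g"
  using assms(2,3)
proof (induction k arbitrary: f g)
  case 0
  have "continuous_on S f \<longleftrightarrow> continuous_on S g"
    by (rule continuous_on_cong[OF refl 0(1)])
  thus ?case using 0(2) by simp
next
  case (Suc k)
  have d: "(g has_derivative frechet_derivative f (at x)) (at x)" if "x \<in> S" for x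
    by (rule has_derivative_transform_within_open[OF Ck_on_SucD[OF Suc.prems(2) that] assms(1) that Suc.prems(1)])
  have eq: "frechet_derivative f (at x) = frechet_derivative g (at x)" if "x \<in> S" for x
    by (rule frechet_derivative_at[OF d[OF that]])
  have "Ck_on k S (\<lambda>x. frechet_derivative g (at x) v)" for v
    by (rule Suc.IH[of "\<lambda>x. frechet_derivative f (at x) v"]) (use Suc.prems(2) in \<open>simp_all add: eq\<close>)
  thus ?case using differentiableI[OF d] by simp
qed

lemma Ck_on_SucI:
  assumes "open S" "\<And>x. x \<in> S \<Longrightarrow> (f has_derivative D x) (at x)" "\<And>v. Ck_on k S (\<lambda>x. D x v)"
  shows "Ck_on (Suc k) S f"
proof -
  have "Ck_on k S (\<lambda>x. frechet_derivative f (at x) v)" for v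
  proof (rule Ck_on_cong[OF assms(1) _ assms(3)])
    show "D x v = frechet_derivative f (at x) v" if "x \<in> S" for x
      using frechet_derivative_at[OF assms(2)[OF that]] by simp
  qed
  thus ?thesis using differentiableI[OF assms(2)] by simp
qed

lemma Ck_on_subset: "T \<subseteq> S \<Longrightarrow> Ck_on k S f \<Longrightarrow> Ck_on k T f"
  by (induction k arbitrary: f) (auto intro: continuous_on_subset)

lemma Ck_on_mono: "Ck_on (Suc k) S f \<Longrightarrow> Ck_on k S f"
proof (induction k arbitrary: f)
  case 0
  thus ?case
    by (simp add: continuous_at_imp_continuous_on differentiable_imp_continuous_within)
next
  case (Suc k)
  have "Ck_on k S (\<lambda>x. frechet_derivative f (at x) v)" for v
    using Suc.prems by (intro Suc.IH) simp
  thus ?case using Suc.prems by simp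
qed

text \<open>The derivatives in \<open>Ck_on\<close> are taken in the full space and not relative to
  a set, so the local statements agree on overlaps.\<close>

lemma Ck_on_local:
  assumes "\<And>x. x \<in> S \<Longrightarrow> \<exists>U. open U \<and> x \<in> U \<and> Ck_on k U f"
  shows "Ck_on k S f"
  using assms
proof (induction k arbitrary: f)
  case 0
  show ?case unfolding Ck_on.simps
  proof (rule continuous_at_imp_continuous_on, rule ballI)
    fix x assume "x \<in> S"
    from 0[OF this] show "isCont f x" by (auto simp: continuous_on_eq_continuous_at)
  qed
next
  case (Suc k)
  have "Ck_on k S (\<lambda>x. frechet_derivative f (at x) v)" for v
    by (rule Suc.IH) (use Suc.prems in force)
  moreover have "f differentiable at x" if "x \<in> S" for x
    using Suc.prems[OF that] by auto
  ultimately show ?case by simp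
qed

lemma Ck_on_const: "Ck_on k S (\<lambda>x. c)"
proof (induction k arbitrary: c)
  case (Suc k)
  have "frechet_derivative (\<lambda>x. c) (at x) = (\<lambda>v. 0)" for x
    using frechet_derivative_at[OF has_derivative_const[of c "at x"]] by simp
  thus ?case using Suc by simp
qed simp

lemma Ck_on_bounded_linear:
  assumes "bounded_linear h"
  shows "Ck_on k S h"
proof (cases k)
  case 0
  thus ?thesis using linear_continuous_on[OF assms] by simp
next
  case (Suc j)
  have "(h has_derivative h) (at x)" for x
    by (rule bounded_linear_imp_has_derivative[OF assms])
  hence "Ck_on (Suc j) UNIV h" by (intro Ck_on_SucI[where D = "\<lambda>x. h"] Ck_on_const) auto
  thus ?thesis using Ck_on_subset[of S UNIV] Suc by blast
qed

lemma Ck_on_add: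
  assumes "open S" "Ck_on k S f" "Ck_on k S g"
  shows "Ck_on k S (\<lambda>x. f x + g x)"
  using assms(2,3)
proof (induction k arbitrary: f g)
  case (Suc k)
  show ?case
  proof (rule Ck_on_SucI[OF assms(1)])
    fix x assume "x \<in> S"
    thus "((\<lambda>x. f x + g x) has_derivative (\<lambda>v. frechet_derivative f (at x) v + frechet_derivative g (at x) v)) (at x)"
      using Suc.prems by (intro has_derivative_add Ck_on_SucD)
  qed (use Suc in simp)
qed (simp add: continuous_on_add)

lemma Ck_on_sum:
  assumes "open S" "\<And>i. i \<in> F \<Longrightarrow> Ck_on k S (f i)"
  shows "Ck_on k S (\<lambda>x. \<Sum>i\<in>F. f i x)"
  using assms(2) by (induction F rule: infinite_finite_induct) (auto simp: Ck_on_const Ck_on_add[OF assms(1)])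

lemma Ck_on_bilinear:
  assumes "bounded_bilinear m" "open S" "Ck_on k S f" "Ck_on k S g"
  shows "Ck_on k S (\<lambda>x. m (f x) (g x))"
  using assms(3,4)
proof (induction k arbitrary: f g)
  case 0
  thus ?case by (simp add: bounded_bilinear.continuous_on[OF assms(1)])
next
  case (Suc k)
  show ?case
  proof (rule Ck_on_SucI[OF assms(2)])
    fix x assume "x \<in> S"
    thus "((\<lambda>x. m (f x) (g x)) has_derivative
        (\<lambda>v. m (f x) (frechet_derivative g (at x) v) + m (frechet_derivative f (at x) v) (g x))) (at x)"
      using Suc.prems by (intro bounded_bilinear.FDERIV[OF assms(1)] Ck_on_SucD)
  next
    fix v
    have "Ck_on k S f" "Ck_on k S g" using Suc.prems Ck_on_mono by blast+
    thus "Ck_on k S (\<lambda>x. m (f x) (frechet_derivative g (at x) v) + m (frechet_derivative f (at x) v) (g x))"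
      using Suc.prems by (intro Ck_on_add[OF assms(2)] Suc.IH) auto
  qed
qed

lemma Ck_on_linear_compose:
  assumes "bounded_linear h" "open S" "Ck_on k S f"
  shows "Ck_on k S (\<lambda>x. h (f x))"
  using assms(3)
proof (induction k arbitrary: f)
  case 0
  thus ?case by (simp add: bounded_linear.continuous_on[OF assms(1)])
next
  case (Suc k)
  show ?case
  proof (rule Ck_on_SucI[OF assms(2)])
    fix x assume "x \<in> S"
    thus "((\<lambda>x. h (f x)) has_derivative (\<lambda>v. h (frechet_derivative f (at x) v))) (at x)"
      using Suc.prems by (intro bounded_linear.has_derivative[OF assms(1)] Ck_on_SucD)
  qed (use Suc in simp)
qed

text \<open>\<open>Ck_on\<close> speaks of derivatives in fixed directions, whereas the chain rule
  feeds a direction varying with the point into the outer derivative. Expanding that direction in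
  \<open>onb\<close> turns the derivative into a sum of products, to which the induction hypothesis
  applies.\<close>

lemma Ck_on_compose:
  fixes f :: "'e::finite_dim_inner \<Rightarrow> 'f::real_normed_vector" and g :: "'d::real_normed_vector \<Rightarrow> 'e"
  assumes "open S" "open T" "g ` S \<subseteq> T" "Ck_on k T f" "Ck_on k S g"
  shows "Ck_on k S (\<lambda>x. f (g x))"
  using assms(4,5)
proof (induction k arbitrary: f)
  case 0
  thus ?case using assms(3) by (auto intro: continuous_on_compose2)
next
  case (Suc k)
  have gT: "g x \<in> T" if "x \<in> S" for x using assms(3) that by blast
  have df: "(f has_derivative frechet_derivative f (at y)) (at y)" if "y \<in> T" for y
    by (rule Ck_on_SucD[OF Suc.prems(1) that])
  show ?case
  proof (rule Ck_on_SucI[OF assms(1)])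
    fix x assume x: "x \<in> S"
    have "((\<lambda>x. f (g x)) has_derivative (\<lambda>v. frechet_derivative f (at (g x)) (frechet_derivative g (at x) v))) (at x)"
      using diff_chain_at[OF Ck_on_SucD[OF Suc.prems(2) x] df[OF gT[OF x]]] by (simp add: o_def)
    also have "(\<lambda>v. frechet_derivative f (at (g x)) (frechet_derivative g (at x) v))
        = (\<lambda>v. \<Sum>b\<in>onb. inner (frechet_derivative g (at x) v) b *\<^sub>R frechet_derivative f (at (g x)) b)"
      by (intro ext linear_onb has_derivative_linear[OF df[OF gT[OF x]]])
    finally show "((\<lambda>x. f (g x)) has_derivative
      (\<lambda>v. \<Sum>b\<in>onb. inner (frechet_derivative g (at x) v) b *\<^sub>R frechet_derivative f (at (g x)) b)) (at x)" .
  next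
    fix v
    show "Ck_on k S (\<lambda>x. \<Sum>b\<in>onb. inner (frechet_derivative g (at x) v) b *\<^sub>R frechet_derivative f (at (g x)) b)"
    proof (intro Ck_on_sum[OF assms(1)] Ck_on_bilinear[OF bounded_bilinear_scaleR assms(1)]
        Ck_on_bilinear[OF bounded_bilinear_inner assms(1)] Ck_on_const)
      fix b
      show "Ck_on k S (\<lambda>x. frechet_derivative g (at x) v)" using Suc.prems(2) by simp
      show "Ck_on k S (\<lambda>x. frechet_derivative f (at (g x)) b)"
        using Suc.prems Ck_on_mono[OF Suc.prems(2)] by (intro Suc.IH) auto
    qed
  qed
qed

lemma smooth_onI: "(\<And>k. Ck_on k S f) \<Longrightarrow> smooth_on S f"
  by (simp add: smooth_on_def)

lemma smooth_onD: "smooth_on S f \<Longrightarrow> Ck_on k S f"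
  by (simp add: smooth_on_def)

lemma smooth_on_subset: "T \<subseteq> S \<Longrightarrow> smooth_on S f \<Longrightarrow> smooth_on T f"
  by (intro smooth_onI) (rule Ck_on_subset[OF _ smooth_onD])

lemma smooth_on_cong: "open S \<Longrightarrow> (\<And>x. x \<in> S \<Longrightarrow> f x = g x) \<Longrightarrow> smooth_on S f \<Longrightarrow> smooth_on S g"
  by (intro smooth_onI) (rule Ck_on_cong[OF _ _ smooth_onD])

lemma smooth_on_local:
  assumes "\<And>x. x \<in> S \<Longrightarrow> \<exists>U. open U \<and> x \<in> U \<and> smooth_on U f"
  shows "smooth_on S f"
  unfolding smooth_on_def
proof
  fix k show "Ck_on k S f"
    by (rule Ck_on_local) (use assms in \<open>auto simp: smooth_on_def\<close>)
qed

lemma smooth_on_has_derivative: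
  assumes "smooth_on S f" "x \<in> S"
  shows "(f has_derivative frechet_derivative f (at x)) (at x)"
  using assms Ck_on_SucD[of 0 S f x] by (simp only: smooth_on_def)

lemma smooth_on_continuous: "smooth_on S f \<Longrightarrow> continuous_on S f"
  using smooth_onD[of S f 0] by simp

lemma smooth_on_derivative_continuous:
  assumes "smooth_on S f"
  shows "continuous_on S (\<lambda>x. frechet_derivative f (at x) v)"
proof -
  have "Ck_on (Suc 0) S f" using assms by (simp only: smooth_on_def)
  thus ?thesis by simp
qed

lemma smooth_on_compose:
  fixes f :: "'e::finite_dim_inner \<Rightarrow> 'f::real_normed_vector" and g :: "'d::real_normed_vector \<Rightarrow> 'e"
  assumes "open S" "open T" "g ` S \<subseteq> T" "smooth_on T f" "smooth_on S g"
  shows "smooth_on S (\<lambda>x. f (g x))"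
  by (rule smooth_onI) (rule Ck_on_compose[OF assms(1-3) smooth_onD[OF assms(4)] smooth_onD[OF assms(5)]])

subsection \<open>A smooth bump\<close>

text \<open>The powers of \<open>1 / s\<close> make the family closed under differentiation up to
  linear combinations, so that smoothness is one induction over all \<open>j\<close>.\<close>

definition flat_exp :: "nat \<Rightarrow> real \<Rightarrow> real"
  where "flat_exp j s = (if 0 < s then (1 / s) ^ j * exp (- (1 / s)) else 0)"

lemma flat_exp_tendsto_0: "(flat_exp j \<longlongrightarrow> 0) (at 0)"
proof -
  have "((\<lambda>s. (inverse s) ^ j / exp (inverse s)) \<longlongrightarrow> (0 :: real)) (at_right 0)"
    by (rule filterlim_compose[OF tendsto_power_div_exp_0 filterlim_inverse_at_top_right])
  hence "(flat_exp j \<longlongrightarrow> 0) (at_right 0)"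
    by (rule Lim_transform_eventually)
      (auto simp: flat_exp_def eventually_at_right_field exp_minus divide_inverse intro!: exI[of _ 1])
  moreover have "(flat_exp j \<longlongrightarrow> 0) (at_left 0)"
    by (rule Lim_transform_eventually[OF tendsto_const])
      (auto simp: flat_exp_def eventually_at_left_field intro!: exI[of _ "-1"])
  ultimately show ?thesis by (intro filterlim_split_at)
qed

lemma flat_exp_has_derivative:
  "(flat_exp j has_real_derivative (flat_exp (j + 2) s - real j * flat_exp (j + 1) s)) (at s)"
proof (cases "s = 0")
  case True
  have "((\<lambda>h. flat_exp (Suc j) h) \<longlongrightarrow> 0) (at 0)" by (rule flat_exp_tendsto_0)
  \<comment> \<open>The difference quotient of \<open>flat_exp j\<close> at 0 is
    \<open>flat_exp (Suc j)\<close>.\<close>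
  hence "((\<lambda>h. (flat_exp j (0 + h) - flat_exp j 0) / h) \<longlongrightarrow> 0) (at 0)"
    by (rule Lim_transform_eventually) (auto simp: flat_exp_def eventually_at_filter)
  thus ?thesis by (simp add: True DERIV_def flat_exp_def)
next
  case False
  show ?thesis
  proof (cases "s > 0")
    case True
    have "((\<lambda>s. (1 / s) ^ j * exp (- (1 / s))) has_real_derivative
        (flat_exp (j + 2) s - real j * flat_exp (j + 1) s)) (at s)"
    proof -
      have u: "((\<lambda>s. 1 / s) has_real_derivative - (1 / s)\<^sup>2) (at s)"
        using True by (auto intro!: derivative_eq_intros simp: field_simps power2_eq_square)
      have "flat_exp (j + 2) s - real j * flat_exp (j + 1) s
          = real j * (1 / s) ^ (j - Suc 0) * - (1 / s)\<^sup>2 * exp (- (1 / s))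
            + exp (- (1 / s)) * - (- (1 / s)\<^sup>2) * (1 / s) ^ j"
      proof -
        have "U ^ (j + 2) * E - real j * (U ^ (j + 1) * E)
          = real j * U ^ (j - Suc 0) * - U\<^sup>2 * E + E * - (- U\<^sup>2) * U ^ j" for U E :: real
          by (cases j) (simp_all add: power2_eq_square algebra_simps)
        from this[of "1 / s" "exp (- (1 / s))"] show ?thesis
          using True by (simp only: flat_exp_def if_True)
      qed
      moreover have "((\<lambda>s. (1 / s) ^ j * exp (- (1 / s))) has_real_derivative
          real j * (1 / s) ^ (j - Suc 0) * - (1 / s)\<^sup>2 * exp (- (1 / s))
            + exp (- (1 / s)) * - (- (1 / s)\<^sup>2) * (1 / s) ^ j) (at s)"
        by (rule DERIV_cong[OF DERIV_mult[OF DERIV_power[OF u, of j] DERIV_fun_exp[OF DERIV_minus[OF u]]]]) simp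
      ultimately show ?thesis by simp
    qed
    thus ?thesis
      by (rule has_field_derivative_transform_within_open[where S = "{0<..}"]) (use True in \<open>auto simp: flat_exp_def\<close>)
  next
    case False
    have "((\<lambda>s. 0) has_real_derivative (flat_exp (j + 2) s - real j * flat_exp (j + 1) s)) (at s)"
      using False by (simp add: flat_exp_def)
    thus ?thesis
      by (rule has_field_derivative_transform_within_open[where S = "{..<0}"])
        (use False \<open>s \<noteq> 0\<close> in \<open>auto simp: flat_exp_def\<close>)
  qed
qed

lemma smooth_on_flat_exp: "smooth_on UNIV (flat_exp j)"
proof -
  have "Ck_on k UNIV (flat_exp j)" for k
  proof (induction k arbitrary: j)
    case 0
    show ?case
      using DERIV_isCont[OF flat_exp_has_derivative] by (simp add: continuous_at_imp_continuous_on)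
  next
    case (Suc k)
    show ?case
    proof (rule Ck_on_SucI)
      fix s :: real
      show "(flat_exp j has_derivative (\<lambda>v. (flat_exp (j + 2) s + (- real j) * flat_exp (j + 1) s) * v)) (at s)"
        using flat_exp_has_derivative[of j s] by (simp add: has_field_derivative_def)
      fix v :: real
      show "Ck_on k UNIV (\<lambda>s. (flat_exp (j + 2) s + (- real j) * flat_exp (j + 1) s) * v)"
        by (intro Ck_on_bilinear[OF bounded_bilinear_mult] Ck_on_add Ck_on_const Suc open_UNIV)
    qed simp
  qed
  thus ?thesis by (simp add: smooth_on_def)
qed

definition bump :: "'e::finite_dim_inner \<Rightarrow> real \<Rightarrow> 'e \<Rightarrow> real"
  where "bump x0 r x = flat_exp 0 (r\<^sup>2 - (norm (x - x0))\<^sup>2)"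

lemma bump_pos: "0 < bump x0 r x \<longleftrightarrow> (norm (x - x0))\<^sup>2 < r\<^sup>2"
  by (simp add: bump_def flat_exp_def)

lemma bump_outside: "r \<le> norm (x - x0) \<Longrightarrow> 0 \<le> r \<Longrightarrow> bump x0 r x = 0"
  by (simp add: bump_def flat_exp_def power_mono not_less)

lemma smooth_on_bump: "smooth_on UNIV (bump x0 r)"
proof -
  have 1: "smooth_on UNIV (\<lambda>x. r\<^sup>2 + (-1) * inner (x + (- x0)) (x + (- x0)))"
    unfolding smooth_on_def
    by (intro allI Ck_on_add Ck_on_bilinear[OF bounded_bilinear_mult] Ck_on_bilinear[OF bounded_bilinear_inner]
        Ck_on_const Ck_on_bounded_linear[OF bounded_linear_ident] open_UNIV)
  have "smooth_on UNIV (\<lambda>x. flat_exp 0 (r\<^sup>2 + (-1) * inner (x + (- x0)) (x + (- x0))))"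
    by (rule smooth_on_compose[OF open_UNIV open_UNIV _ smooth_on_flat_exp 1]) simp
  thus ?thesis by (simp add: bump_def[abs_def] power2_norm_eq_inner)
qed

section \<open>Geometry of a Riemannian manifold\<close>

lemma is_chartD:
  assumes "is_chart c"
  shows "open (chart_dom c)" "open (chart_map c ` chart_dom c)"
    "\<And>p. p \<in> chart_dom c \<Longrightarrow> chart_inv c (chart_map c p) = p"
    "\<And>x. x \<in> chart_map c ` chart_dom c \<Longrightarrow> chart_map c (chart_inv c x) = x"
    "\<And>x. x \<in> chart_map c ` chart_dom c \<Longrightarrow> chart_inv c x \<in> chart_dom c"
    "continuous_on (chart_dom c) (chart_map c)" "continuous_on (chart_map c ` chart_dom c) (chart_inv c)"
  using assms unfolding is_chart_def homeomorphism_def by auto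

lemma chart_image_open:
  assumes "is_chart c" "open U"
  shows "open (chart_map c ` (chart_dom c \<inter> U))"
proof -
  note c = is_chartD[OF assms(1)]
  have "chart_map c ` (chart_dom c \<inter> U) = chart_map c ` chart_dom c \<inter> chart_inv c -` U"
    using c(3,4,5) by (auto simp: image_iff)
  thus ?thesis using continuous_open_preimage[OF c(7,2) assms(2)] by simp
qed

lemma chart_preimage_open:
  assumes "is_chart c" "open U"
  shows "open (chart_dom c \<inter> chart_map c -` U)"
  using continuous_open_preimage[OF is_chartD(6,1)[OF assms(1)] assms(2)] .

lemma chart_map_tendsto:
  fixes c :: "('a::t2_space, 'e::finite_dim_inner) chart"
  assumes "is_chart c" "p0 \<in> chart_dom c" "(P \<longlongrightarrow> p0) G"
  shows "((\<lambda>i. chart_map c (P i)) \<longlongrightarrow> chart_map c p0) G"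
proof -
  have "isCont (chart_map c) p0"
    using is_chartD(1,6)[OF assms(1)] assms(2) by (simp add: continuous_on_eq_continuous_at)
  thus ?thesis using assms(3) by (rule isCont_tendsto_compose)
qed

lemma eventually_chart_dom:
  assumes "is_chart c" "p0 \<in> chart_dom c" "(P \<longlongrightarrow> p0) G"
  shows "eventually (\<lambda>i. P i \<in> chart_dom c) G"
  using topological_tendstoD[OF assms(3) is_chartD(1)[OF assms(1)] assms(2)] .

lemma linear_square_bound_sphere:
  fixes Q R :: "'e::finite_dim_inner \<Rightarrow> real"
  assumes "\<And>r v. Q (r *\<^sub>R v) = r\<^sup>2 * Q v" "\<And>r v. R (r *\<^sub>R v) = r\<^sup>2 * R v"
    and "\<And>v. norm v = 1 \<Longrightarrow> Q v \<le> R v"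
  shows "Q v \<le> R v"
proof (cases "v = 0")
  case True
  thus ?thesis using assms(1)[of 0 v] assms(2)[of 0 v] by simp
next
  case False
  define u where "u = (1 / norm v) *\<^sub>R v"
  have v: "v = norm v *\<^sub>R u" "norm u = 1" using False by (simp_all add: u_def)
  have "Q v = (norm v)\<^sup>2 * Q u" "R v = (norm v)\<^sup>2 * R u"
    using v(1) assms(1,2) by metis+
  thus ?thesis using assms(3)[OF v(2)] by (simp add: mult_left_mono)
qed

locale riemannian =
  fixes A :: "('a::t2_space, 'e::finite_dim_inner) chart set" and m :: "('a, 'e) metric_tensor"
  assumes man: "riemannian_manifold A m"
begin

lemma charts: "c \<in> A \<Longrightarrow> is_chart c"
  using man by (simp add: riemannian_manifold_def smooth_atlas_def)

lemma chart_at: "chart_at A p \<in> A" "p \<in> chart_dom (chart_at A p)"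
proof -
  have "(\<Union>c\<in>A. chart_dom c) = UNIV"
    using man by (simp add: riemannian_manifold_def smooth_atlas_def)
  hence "\<exists>c. c \<in> A \<and> p \<in> chart_dom c" by blast
  from someI_ex[OF this] show "chart_at A p \<in> A" "p \<in> chart_dom (chart_at A p)"
    by (simp_all add: chart_at_def)
qed

lemma transition_smooth:
  "c \<in> A \<Longrightarrow> c' \<in> A \<Longrightarrow> smooth_on (chart_map c ` (chart_dom c \<inter> chart_dom c')) (chart_map c' \<circ> chart_inv c)"
  using man by (simp add: riemannian_manifold_def smooth_atlas_def compatible_charts_def)

lemma metric: "riemannian_metric A m"
  using man by (simp add: riemannian_manifold_def)

lemma m_bilinear: "c \<in> A \<Longrightarrow> p \<in> chart_dom c \<Longrightarrow> bilinear (m c p)"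
  using conjunct1[OF metric[unfolded riemannian_metric_def]] by simp

lemma m_pos: "c \<in> A \<Longrightarrow> p \<in> chart_dom c \<Longrightarrow> v \<noteq> 0 \<Longrightarrow> 0 < m c p v v"
  using conjunct1[OF metric[unfolded riemannian_metric_def]] by simp

lemma m_smooth: "c \<in> A \<Longrightarrow> smooth_on (chart_map c ` chart_dom c) (\<lambda>x. m c (chart_inv c x) v w)"
  using conjunct1[OF conjunct2[OF metric[unfolded riemannian_metric_def]]] by simp

lemma m_transform: "c \<in> A \<Longrightarrow> c' \<in> A \<Longrightarrow> p \<in> chart_dom c \<Longrightarrow> p \<in> chart_dom c' \<Longrightarrow>
    m c' p (frechet_derivative (chart_map c' \<circ> chart_inv c) (at (chart_map c p)) v)
      (frechet_derivative (chart_map c' \<circ> chart_inv c) (at (chart_map c p)) w) = m c p v w"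
  using conjunct2[OF conjunct2[OF metric[unfolded riemannian_metric_def]]] by (simp add: Let_def)

lemma m_scale: "c \<in> A \<Longrightarrow> p \<in> chart_dom c \<Longrightarrow> m c p (r *\<^sub>R v) (r *\<^sub>R v) = r\<^sup>2 * m c p v v"
  using m_bilinear[of c p] by (simp add: bilinear_lmul bilinear_rmul power2_eq_square)

lemma m_nonneg: "c \<in> A \<Longrightarrow> p \<in> chart_dom c \<Longrightarrow> 0 \<le> m c p v v"
  using m_pos[of c p v] m_scale[of c p 0 v] by (cases "v = 0") (auto simp: less_imp_le)

text \<open>Smoothness of the metric concerns fixed tangent vectors; joint continuity in the point
  and the vector comes from expanding both arguments in the basis.\<close>

lemma m_tendsto:
  assumes c: "c \<in> A" "p0 \<in> chart_dom c" and P: "(P \<longlongrightarrow> p0) G" and V: "(V \<longlongrightarrow> v0) G"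
  shows "((\<lambda>i. m c (P i) (V i) (V i)) \<longlongrightarrow> m c p0 v0 v0) G"
proof -
  note ch = charts[OF c(1)]
  have expand: "m c p v v = (\<Sum>b\<in>onb. \<Sum>b'\<in>onb. inner v b * inner v b' * m c p b b')"
    if "p \<in> chart_dom c" for p v
  proof -
    have bil: "linear (\<lambda>v. m c p v w)" "linear (m c p w)" for w
      using m_bilinear[OF c(1) that] by (simp_all add: bilinear_def)
    have "m c p v v = (\<Sum>b\<in>onb. inner v b *\<^sub>R m c p b v)" by (rule linear_onb[OF bil(1)])
    also have "\<dots> = (\<Sum>b\<in>onb. inner v b *\<^sub>R (\<Sum>b'\<in>onb. inner v b' *\<^sub>R m c p b b'))"
      by (intro sum.cong refl arg_cong[of _ _ "\<lambda>z. _ *\<^sub>R z"] linear_onb[OF bil(2)])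
    finally show ?thesis by (simp add: sum_distrib_left mult.assoc)
  qed
  have coef: "((\<lambda>i. m c (P i) b b') \<longlongrightarrow> m c p0 b b') G" for b b'
  proof -
    have "isCont (\<lambda>x. m c (chart_inv c x) b b') (chart_map c p0)"
      using smooth_on_continuous[OF m_smooth[OF c(1), of b b']] is_chartD(2)[OF ch] c(2)
      by (simp add: continuous_on_eq_continuous_at)
    from isCont_tendsto_compose[OF this chart_map_tendsto[OF ch c(2) P]]
    have "((\<lambda>i. m c (chart_inv c (chart_map c (P i))) b b') \<longlongrightarrow> m c p0 b b') G"
      by (simp add: is_chartD(3)[OF ch c(2)])
    moreover have "eventually (\<lambda>i. m c (chart_inv c (chart_map c (P i))) b b' = m c (P i) b b') G"
      using eventually_chart_dom[OF ch c(2) P] by eventually_elim (simp add: is_chartD(3)[OF ch])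
    ultimately show ?thesis by (rule Lim_transform_eventually)
  qed
  have "((\<lambda>i. \<Sum>b\<in>onb. \<Sum>b'\<in>onb. inner (V i) b * inner (V i) b' * m c (P i) b b')
      \<longlongrightarrow> (\<Sum>b\<in>onb. \<Sum>b'\<in>onb. inner v0 b * inner v0 b' * m c p0 b b')) G"
    by (intro tendsto_intros V coef)
  hence "((\<lambda>i. \<Sum>b\<in>onb. \<Sum>b'\<in>onb. inner (V i) b * inner (V i) b' * m c (P i) b b') \<longlongrightarrow> m c p0 v0 v0) G"
    by (simp add: expand[OF c(2)])
  moreover have "eventually (\<lambda>i. (\<Sum>b\<in>onb. \<Sum>b'\<in>onb. inner (V i) b * inner (V i) b' * m c (P i) b b')
      = m c (P i) (V i) (V i)) G"
    using eventually_chart_dom[OF ch c(2) P] by eventually_elim (simp add: expand)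
  ultimately show ?thesis by (rule Lim_transform_eventually)
qed

lemma m_continuous:
  assumes c: "c \<in> A" "p \<in> chart_dom c"
  shows "continuous_on S (\<lambda>v. m c p v v)"
  unfolding continuous_on_def by (auto intro!: m_tendsto[OF c] tendsto_const tendsto_ident_at)

lemma m_lower_bound:
  assumes c: "c \<in> A" "p \<in> chart_dom c"
  obtains k where "0 < k" "\<And>v. k * (norm v)\<^sup>2 \<le> m c p v v"
proof -
  have "\<exists>k>0. \<forall>v. norm v = 1 \<longrightarrow> k \<le> m c p v v"
  proof (cases "{v :: 'e. norm v = 1} = {}")
    case False
    obtain u where u: "norm u = 1" "\<forall>v\<in>{v. norm v = 1}. m c p u u \<le> m c p v v"
      using continuous_attains_inf[OF compact_unit_sphere False m_continuous[OF c]] by blast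
    have "u \<noteq> 0" using u(1) by auto
    thus ?thesis using m_pos[OF c] u(2) by blast
  qed (intro exI[of _ 1], auto)
  then obtain k where k: "k > 0" "\<forall>v. norm v = 1 \<longrightarrow> k \<le> m c p v v" by blast
  have "k * (norm v)\<^sup>2 \<le> m c p v v" for v
    by (rule linear_square_bound_sphere[of "\<lambda>v. k * (norm v)\<^sup>2" "\<lambda>v. m c p v v"])
      (use k m_scale[OF c] in \<open>auto simp: power_mult_distrib\<close>)
  thus thesis using that k(1) by blast
qed

lemma m_upper_bound:
  assumes c: "c \<in> A" "p0 \<in> chart_dom c"
  obtains K where "0 < K" "eventually (\<lambda>p. p \<in> chart_dom c \<and> (\<forall>v. m c p v v \<le> (K * norm v)\<^sup>2)) (nhds p0)"
proof -
  have "\<exists>B. \<forall>v. norm v = 1 \<longrightarrow> m c p0 v v \<le> B"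
  proof -
    have "compact ((\<lambda>v. m c p0 v v) ` {v. norm v = 1})"
      by (intro compact_continuous_image m_continuous[OF c] compact_unit_sphere)
    hence "bdd_above ((\<lambda>v. m c p0 v v) ` {v. norm v = 1})"
      by (intro bounded_imp_bdd_above compact_imp_bounded)
    thus ?thesis by (auto simp: bdd_above_def)
  qed
  then obtain B where B: "\<And>v. norm v = 1 \<Longrightarrow> m c p0 v v \<le> B" by blast
  define K where "K = \<bar>B\<bar> + 1"
  have K: "K > 0" "B < K\<^sup>2"
  proof -
    show "K > 0" by (simp add: K_def)
    have "K * 1 \<le> K * K" by (intro mult_left_mono) (auto simp: K_def)
    thus "B < K\<^sup>2" by (simp add: K_def power2_eq_square)
  qed
  have "eventually (\<lambda>p. \<forall>v\<in>{v. norm v = 1}. m c p v v < K\<^sup>2) (nhds p0)"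
  proof (rule eventually_compact[OF compact_unit_sphere])
    fix v :: 'e assume v: "v \<in> {v. norm v = 1}"
    have "((\<lambda>i. m c (fst i) (snd i) (snd i)) \<longlongrightarrow> m c p0 v v) (nhds p0 \<times>\<^sub>F nhds v)"
      by (intro m_tendsto[OF c] filterlim_fst filterlim_snd)
    moreover have "m c p0 v v < K\<^sup>2" using B[of v] v K(2) by simp
    ultimately have "eventually (\<lambda>i. m c (fst i) (snd i) (snd i) < K\<^sup>2) (nhds p0 \<times>\<^sub>F nhds v)"
      by (rule order_tendstoD(2))
    thus "eventually (\<lambda>(p, v). m c p v v < K\<^sup>2) (nhds p0 \<times>\<^sub>F nhds v)"
      by (simp add: case_prod_unfold)
  qed
  moreover have "eventually (\<lambda>p. p \<in> chart_dom c) (nhds p0)"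
    using is_chartD(1)[OF charts[OF c(1)]] c(2) by (auto simp: eventually_nhds)
  ultimately have "eventually (\<lambda>p. p \<in> chart_dom c \<and> (\<forall>v. m c p v v \<le> (K * norm v)\<^sup>2)) (nhds p0)"
  proof eventually_elim
    case (elim p)
    have "m c p v v \<le> (K * norm v)\<^sup>2" for v
      by (rule linear_square_bound_sphere[of "\<lambda>v. m c p v v" "\<lambda>v. (K * norm v)\<^sup>2"])
        (use elim m_scale[OF c(1)] in \<open>auto simp: power_mult_distrib less_imp_le\<close>)
    thus ?case using elim by blast
  qed
  thus thesis using that K(1) by blast
qed

subsection \<open>Differentials of functions\<close>

definition dchart :: "('a, 'e) chart \<Rightarrow> ('a \<Rightarrow> complex) \<Rightarrow> 'a \<Rightarrow> 'e \<Rightarrow> complex"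
  where "dchart c f p = frechet_derivative (f \<circ> chart_inv c) (at (chart_map c p))"

lemma dchart_has_derivative:
  assumes "smooth_function A f" "c \<in> A" "p \<in> chart_dom c"
  shows "((f \<circ> chart_inv c) has_derivative dchart c f p) (at (chart_map c p))"
  unfolding dchart_def
  by (rule smooth_on_has_derivative[of "chart_map c ` chart_dom c"]) (use assms in \<open>auto simp: smooth_function_def\<close>)

lemma dchart_linear: "smooth_function A f \<Longrightarrow> c \<in> A \<Longrightarrow> p \<in> chart_dom c \<Longrightarrow> linear (dchart c f p)"
  by (rule has_derivative_linear[OF dchart_has_derivative])

lemma dchart_eqI:
  "((f \<circ> chart_inv c) has_derivative D) (at (chart_map c p)) \<Longrightarrow> dchart c f p = D"
  unfolding dchart_def by (rule frechet_derivative_at[symmetric])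

lemma dchart_transform:
  assumes f: "smooth_function A f" and c: "c \<in> A" "c' \<in> A" "p \<in> chart_dom c" "p \<in> chart_dom c'"
  shows "dchart c f p v
    = dchart c' f p (frechet_derivative (chart_map c' \<circ> chart_inv c) (at (chart_map c p)) v)"
proof -
  note c1 = is_chartD[OF charts[OF c(1)]] and c2 = is_chartD[OF charts[OF c(2)]]
  let ?S = "chart_map c ` (chart_dom c \<inter> chart_dom c')"
  have S: "open ?S" by (rule chart_image_open[OF charts[OF c(1)] c2(1)])
  have p: "chart_map c p \<in> ?S" using c by blast
  have "((chart_map c' \<circ> chart_inv c) has_derivative
      frechet_derivative (chart_map c' \<circ> chart_inv c) (at (chart_map c p))) (at (chart_map c p))"
    by (rule smooth_on_has_derivative[OF transition_smooth[OF c(1,2)] p])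
  moreover have "((f \<circ> chart_inv c') has_derivative dchart c' f p) (at ((chart_map c' \<circ> chart_inv c) (chart_map c p)))"
    using dchart_has_derivative[OF f c(2,4)] by (simp add: c1(3)[OF c(3)])
  ultimately have "(((f \<circ> chart_inv c') \<circ> (chart_map c' \<circ> chart_inv c)) has_derivative
      (dchart c' f p \<circ> frechet_derivative (chart_map c' \<circ> chart_inv c) (at (chart_map c p)))) (at (chart_map c p))"
    by (rule diff_chain_at)
  hence "((f \<circ> chart_inv c) has_derivative
      (dchart c' f p \<circ> frechet_derivative (chart_map c' \<circ> chart_inv c) (at (chart_map c p)))) (at (chart_map c p))"
    by (rule has_derivative_transform_within_open[OF _ S p]) (auto simp: c1(3) c2(3))
  from dchart_eqI[OF this] show ?thesis by simp
qed

definition dnorms :: "('a, 'e) chart \<Rightarrow> ('a \<Rightarrow> complex) \<Rightarrow> 'a \<Rightarrow> real set"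
  where "dnorms c f p = {cmod (dchart c f p v + \<i> * dchart c f p w) | v w. m c p v v + m c p w w \<le> 1}"

text \<open>The transition derivative preserves the metric and intertwines the two differentials, so
  the sets of values in two charts include each other.\<close>

lemma norm_df_chart:
  assumes f: "smooth_function A f" and c: "c \<in> A" "p \<in> chart_dom c"
  shows "norm_df A m f p = Sup (dnorms c f p)"
proof -
  have sub: "dnorms c1 f p \<subseteq> dnorms c2 f p"
    if "c1 \<in> A" "c2 \<in> A" "p \<in> chart_dom c1" "p \<in> chart_dom c2" for c1 c2
  proof
    fix r assume "r \<in> dnorms c1 f p"
    then obtain v w where vw: "r = cmod (dchart c1 f p v + \<i> * dchart c1 f p w)" "m c1 p v v + m c1 p w w \<le> 1"
      by (auto simp: dnorms_def)
    define T where "T = frechet_derivative (chart_map c2 \<circ> chart_inv c1) (at (chart_map c1 p))"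
    have "r = cmod (dchart c2 f p (T v) + \<i> * dchart c2 f p (T w))"
      using vw(1) dchart_transform[OF f that] by (simp add: T_def)
    moreover have "m c2 p (T v) (T v) + m c2 p (T w) (T w) \<le> 1"
      using vw(2) m_transform[OF that] by (simp add: T_def)
    ultimately show "r \<in> dnorms c2 f p" unfolding dnorms_def by blast
  qed
  have "norm_df A m f p = Sup (dnorms (chart_at A p) f p)"
    by (simp add: norm_df_def dnorms_def dchart_def Let_def)
  also have "dnorms (chart_at A p) f p = dnorms c f p"
    using sub[OF chart_at(1) c(1) chart_at(2) c(2)] sub[OF c(1) chart_at(1) c(2) chart_at(2)] by blast
  finally show ?thesis .
qed

text \<open>On the unit sphere at \<open>p0\<close> the squared inequality is strict, hence it
  persists at nearby points by \<open>eventually_compact\<close>; homogeneity extends it to all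
  vectors.\<close>

lemma dchart_local_bound:
  assumes f: "smooth_function A f" and c: "c \<in> A" "p0 \<in> chart_dom c"
  obtains K where "0 \<le> K"
    "eventually (\<lambda>p. p \<in> chart_dom c \<and> (\<forall>v. cmod (dchart c f p v) \<le> K * sqrt (m c p v v))) (nhds p0)"
proof -
  obtain k where k: "k > 0" "\<And>v. k * (norm v)\<^sup>2 \<le> m c p0 v v" using m_lower_bound[OF c] by blast
  obtain B where B: "\<And>v. cmod (dchart c f p0 v) \<le> norm v * B"
    using bounded_linear.bounded[OF linear_bounded_linear[OF dchart_linear[OF f c]]] by blast
  \<comment> \<open>\<open>B\<close> bounds the differential and \<open>k\<close> the metric from
    below at \<open>p0\<close>; the added 1 makes the estimate there strict.\<close>
  define K where "K = sqrt (B\<^sup>2 / k + 1)"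
  have K2: "K\<^sup>2 = B\<^sup>2 / k + 1" using k(1) by (simp add: K_def add_nonneg_nonneg)
  have Ev: "eventually (\<lambda>p. \<forall>v\<in>{v. norm v = 1}. (cmod (dchart c f p v))\<^sup>2 - K\<^sup>2 * m c p v v < 0) (nhds p0)"
  proof (rule eventually_compact[OF compact_unit_sphere])
    fix v :: 'e assume v: "v \<in> {v. norm v = 1}"
    have fst: "(fst \<longlongrightarrow> p0) (nhds p0 \<times>\<^sub>F nhds v)" and snd: "(snd \<longlongrightarrow> v) (nhds p0 \<times>\<^sub>F nhds v)"
      by (rule filterlim_fst filterlim_snd)+
    have "((\<lambda>i. dchart c f (fst i) (snd i)) \<longlongrightarrow> dchart c f p0 v) (nhds p0 \<times>\<^sub>F nhds v)"
    proof (rule tendsto_linear_apply[OF _ dchart_linear[OF f c] _ snd])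
      show "eventually (\<lambda>i. linear (dchart c f (fst i))) (nhds p0 \<times>\<^sub>F nhds v)"
        using eventually_chart_dom[OF charts[OF c(1)] c(2) fst] by eventually_elim (rule dchart_linear[OF f c(1)])
      fix b
      have "smooth_on (chart_map c ` chart_dom c) (f \<circ> chart_inv c)" using f c by (simp add: smooth_function_def)
      hence "isCont (\<lambda>x. frechet_derivative (f \<circ> chart_inv c) (at x) b) (chart_map c p0)"
        using smooth_on_derivative_continuous is_chartD(2)[OF charts[OF c(1)]] c(2)
        by (metis continuous_on_eq_continuous_at imageI)
      from isCont_tendsto_compose[OF this chart_map_tendsto[OF charts[OF c(1)] c(2) fst]]
      show "((\<lambda>i. dchart c f (fst i) b) \<longlongrightarrow> dchart c f p0 b) (nhds p0 \<times>\<^sub>F nhds v)"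
        by (simp add: dchart_def)
    qed
    hence "((\<lambda>i. (cmod (dchart c f (fst i) (snd i)))\<^sup>2 - K\<^sup>2 * m c (fst i) (snd i) (snd i))
        \<longlongrightarrow> (cmod (dchart c f p0 v))\<^sup>2 - K\<^sup>2 * m c p0 v v) (nhds p0 \<times>\<^sub>F nhds v)"
      by (intro tendsto_intros m_tendsto[OF c] fst snd)
    moreover have "(cmod (dchart c f p0 v))\<^sup>2 - K\<^sup>2 * m c p0 v v < 0"
    proof -
      have "cmod (dchart c f p0 v) \<le> B" using B[of v] v by simp
      hence "(cmod (dchart c f p0 v))\<^sup>2 \<le> B\<^sup>2" by (intro power_mono) auto
      also have "\<dots> = B\<^sup>2 / k * k" using k(1) by simp
      also have "\<dots> < (B\<^sup>2 / k + 1) * k" using k(1) by (intro mult_strict_right_mono) auto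
      also have "\<dots> \<le> K\<^sup>2 * m c p0 v v"
        unfolding K2 using k(1) k(2)[of v] v by (intro mult_left_mono) (simp_all add: add_nonneg_nonneg)
      finally show ?thesis by simp
    qed
    ultimately have "eventually (\<lambda>i. (cmod (dchart c f (fst i) (snd i)))\<^sup>2 - K\<^sup>2 * m c (fst i) (snd i) (snd i) < 0) (nhds p0 \<times>\<^sub>F nhds v)"
      by (rule order_tendstoD(2))
    thus "eventually (\<lambda>(p, v). (cmod (dchart c f p v))\<^sup>2 - K\<^sup>2 * m c p v v < 0) (nhds p0 \<times>\<^sub>F nhds v)"
      by (simp add: case_prod_unfold)
  qed
  have dom: "eventually (\<lambda>p. p \<in> chart_dom c) (nhds p0)"
    using is_chartD(1)[OF charts[OF c(1)]] c(2) by (auto simp: eventually_nhds)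
  have K0: "0 \<le> K" using k(1) by (simp add: K_def add_nonneg_nonneg)
  have "eventually (\<lambda>p. p \<in> chart_dom c \<and> (\<forall>v. cmod (dchart c f p v) \<le> K * sqrt (m c p v v))) (nhds p0)"
    using Ev dom
  proof eventually_elim
    case (elim p)
    note lin = dchart_linear[OF f c(1) elim(2)]
    have "cmod (dchart c f p v) \<le> K * sqrt (m c p v v)" for v
    proof -
      have "(cmod (dchart c f p v))\<^sup>2 \<le> K\<^sup>2 * m c p v v"
        by (rule linear_square_bound_sphere[of "\<lambda>v. (cmod (dchart c f p v))\<^sup>2" "\<lambda>v. K\<^sup>2 * m c p v v"])
          (use elim m_scale[OF c(1)] in \<open>auto simp: power_mult_distrib linear_scale[OF lin] less_imp_le\<close>)
      hence "sqrt ((cmod (dchart c f p v))\<^sup>2) \<le> sqrt (K\<^sup>2 * m c p v v)" by (rule real_sqrt_le_mono)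
      thus ?thesis using K0 by (simp add: real_sqrt_mult)
    qed
    thus ?case using elim by blast
  qed
  thus thesis using that K0 by blast
qed

lemma dchart_pair_bound:
  assumes c: "c \<in> A" "p \<in> chart_dom c" and K: "0 \<le> K" "\<And>v. cmod (dchart c f p v) \<le> K * sqrt (m c p v v)"
  shows "cmod (dchart c f p v + \<i> * dchart c f p w) \<le> 2 * K * sqrt (m c p v v + m c p w w)"
proof -
  have "cmod (dchart c f p v + \<i> * dchart c f p w) \<le> cmod (dchart c f p v) + cmod (dchart c f p w)"
    using norm_triangle_ineq[of "dchart c f p v" "\<i> * dchart c f p w"] by (simp add: norm_mult)
  also have "\<dots> \<le> K * sqrt (m c p v v) + K * sqrt (m c p w w)" by (intro add_mono K)
  also have "\<dots> \<le> K * sqrt (m c p v v + m c p w w) + K * sqrt (m c p v v + m c p w w)"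
    using m_nonneg[OF c] K(1) by (intro add_mono mult_left_mono) auto
  finally show ?thesis by simp
qed

lemma dnorms_bdd:
  assumes f: "smooth_function A f" and c: "c \<in> A" "p \<in> chart_dom c"
  shows "bdd_above (dnorms c f p)"
proof -
  obtain K where K: "0 \<le> K" "eventually (\<lambda>p. p \<in> chart_dom c \<and> (\<forall>v. cmod (dchart c f p v) \<le> K * sqrt (m c p v v))) (nhds p)"
    using dchart_local_bound[OF f c] by blast
  have K': "\<And>v. cmod (dchart c f p v) \<le> K * sqrt (m c p v v)"
    using eventually_nhds_x_imp_x[OF K(2)] by blast
  show ?thesis
  proof (rule bdd_aboveI[of _ "2 * K"])
    fix r assume "r \<in> dnorms c f p"
    then obtain v w where vw: "r = cmod (dchart c f p v + \<i> * dchart c f p w)" "m c p v v + m c p w w \<le> 1"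
      by (auto simp: dnorms_def)
    have "r \<le> 2 * K * sqrt (m c p v v + m c p w w)"
      unfolding vw(1) by (rule dchart_pair_bound[OF c K(1) K'])
    also have "\<dots> \<le> 2 * K * 1" using K(1) vw(2) by (intro mult_left_mono) auto
    finally show "r \<le> 2 * K" by simp
  qed
qed

lemma norm_df_nonneg:
  assumes f: "smooth_function A f"
  shows "0 \<le> norm_df A m f p"
proof -
  note c = chart_at[of p]
  have "0 \<in> dnorms (chart_at A p) f p"
    unfolding dnorms_def using linear_0[OF dchart_linear[OF f c]] m_scale[OF c, of 0 0]
    by (intro CollectI exI[of _ 0]) simp
  thus ?thesis unfolding norm_df_chart[OF f c] by (rule cSup_upper[OF _ dnorms_bdd[OF f c]])
qed

lemma norm_df_upper:
  assumes f: "smooth_function A f" and c: "c \<in> A" "p \<in> chart_dom c"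
  shows "cmod (dchart c f p v + \<i> * dchart c f p w) \<le> norm_df A m f p * sqrt (m c p v v + m c p w w)"
proof -
  define s where "s = sqrt (m c p v v + m c p w w)"
  have s2: "s\<^sup>2 = m c p v v + m c p w w" using m_nonneg[OF c] by (simp add: s_def)
  note lin = dchart_linear[OF f c]
  show ?thesis
  proof (cases "s = 0")
    case True
    hence "m c p v v = 0" "m c p w w = 0"
      using s2 m_nonneg[OF c, of v] m_nonneg[OF c, of w] by simp_all
    hence "v = 0" "w = 0" using m_pos[OF c] by (metis less_irrefl)+
    thus ?thesis using linear_0[OF lin] norm_df_nonneg[OF f] m_nonneg[OF c] by simp
  next
    case False
    hence s: "s > 0" using m_nonneg[OF c] by (simp add: s_def less_le)
    have "m c p ((1/s) *\<^sub>R v) ((1/s) *\<^sub>R v) + m c p ((1/s) *\<^sub>R w) ((1/s) *\<^sub>R w) = (1 / s)\<^sup>2 * s\<^sup>2"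
      by (simp add: m_scale[OF c] s2 distrib_left)
    hence "m c p ((1/s) *\<^sub>R v) ((1/s) *\<^sub>R v) + m c p ((1/s) *\<^sub>R w) ((1/s) *\<^sub>R w) \<le> 1"
      using s by (simp add: power_divide)
    hence "cmod (dchart c f p ((1/s) *\<^sub>R v) + \<i> * dchart c f p ((1/s) *\<^sub>R w)) \<in> dnorms c f p"
      unfolding dnorms_def by blast
    hence "cmod (dchart c f p ((1/s) *\<^sub>R v) + \<i> * dchart c f p ((1/s) *\<^sub>R w)) \<le> norm_df A m f p"
      unfolding norm_df_chart[OF f c] by (rule cSup_upper[OF _ dnorms_bdd[OF f c]])
    moreover have "dchart c f p ((1/s) *\<^sub>R v) + \<i> * dchart c f p ((1/s) *\<^sub>R w)
        = (1/s) *\<^sub>R (dchart c f p v + \<i> * dchart c f p w)"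
      by (simp add: linear_scale[OF lin] scaleR_add_right)
    ultimately have "cmod (dchart c f p v + \<i> * dchart c f p w) / s \<le> norm_df A m f p"
      using s by (simp only: norm_scaleR) simp
    thus ?thesis using s by (simp add: s_def[symmetric] pos_divide_le_eq)
  qed
qed

lemma norm_df_le:
  assumes f: "smooth_function A f" and c: "c \<in> A" "p \<in> chart_dom c" and "0 \<le> K"
    and K: "\<And>v w. cmod (dchart c f p v + \<i> * dchart c f p w) \<le> K * sqrt (m c p v v + m c p w w)"
  shows "norm_df A m f p \<le> K"
  unfolding norm_df_chart[OF f c]
proof (rule cSup_least)
  show "dnorms c f p \<noteq> {}"
    unfolding dnorms_def using m_scale[OF c, of 0 0] by (auto intro!: exI[of _ 0])
  fix r assume "r \<in> dnorms c f p"
  then obtain v w where vw: "r = cmod (dchart c f p v + \<i> * dchart c f p w)" "m c p v v + m c p w w \<le> 1"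
    by (auto simp: dnorms_def)
  have "r \<le> K * sqrt (m c p v v + m c p w w)" unfolding vw(1) by (rule K)
  also have "\<dots> \<le> K * 1" using \<open>0 \<le> K\<close> vw(2) by (intro mult_left_mono) auto
  finally show "r \<le> K" by simp
qed

end

text \<open>Used for the norm of the differential, where local bounds are what
  \<open>dchart_local_bound\<close> delivers.\<close>

lemma compact_local_bound:
  fixes g :: "'a::topological_space \<Rightarrow> real"
  assumes "compact S" "\<And>x. x \<in> S \<Longrightarrow> \<exists>b. eventually (\<lambda>y. g y \<le> b) (nhds x)"
  shows "\<exists>B. \<forall>x\<in>S. g x \<le> B"
proof -
  have "\<exists>b U. open U \<and> x \<in> U \<and> (\<forall>y\<in>U. g y \<le> b)" if "x \<in> S" for x
    using assms(2)[OF that] unfolding eventually_nhds by blast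
  then obtain b U where bU: "\<And>x. x \<in> S \<Longrightarrow> open (U x)" "\<And>x. x \<in> S \<Longrightarrow> x \<in> U x"
    "\<And>x y. x \<in> S \<Longrightarrow> y \<in> U x \<Longrightarrow> g y \<le> b x" by metis
  have cover: "S \<subseteq> (\<Union>x\<in>S. U x)" using bU(2) by (intro subsetI UN_I)
  obtain K where K: "K \<subseteq> S" "finite K" "S \<subseteq> (\<Union>x\<in>K. U x)"
    by (rule compactE_image[OF assms(1) bU(1) cover])
  have "g y \<le> Max (b ` K)" if y: "y \<in> S" for y
  proof -
    have "y \<in> (\<Union>x\<in>K. U x)" by (rule subsetD[OF K(3) y])
    then obtain x where x: "x \<in> K" "y \<in> U x" by (rule UN_E)
    have "g y \<le> b x" by (rule bU(3)[OF subsetD[OF K(1) x(1)] x(2)])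
    also have "\<dots> \<le> Max (b ` K)" using K(2) x(1) by (intro Max_ge) auto
    finally show ?thesis .
  qed
  thus ?thesis by blast
qed

section \<open>Calculus of smooth functions and maps\<close>

context riemannian
begin

lemma smooth_functionI:
  "(\<And>c. c \<in> A \<Longrightarrow> smooth_on (chart_map c ` chart_dom c) (f \<circ> chart_inv c)) \<Longrightarrow> smooth_function A f"
  by (simp add: smooth_function_def)

lemma smooth_functionD:
  "smooth_function A f \<Longrightarrow> c \<in> A \<Longrightarrow> smooth_on (chart_map c ` chart_dom c) (f \<circ> chart_inv c)"
  by (simp add: smooth_function_def)

lemma chart_image_open': "c \<in> A \<Longrightarrow> open (chart_map c ` chart_dom c)"
  by (rule is_chartD(2)[OF charts])

lemma smooth_function_const: "smooth_function A (\<lambda>p. k)"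
  by (rule smooth_functionI, rule smooth_onI) (simp add: o_def Ck_on_const)

lemma smooth_function_bilinear:
  assumes "bounded_bilinear b" "smooth_function A f" "smooth_function A g"
  shows "smooth_function A (\<lambda>p. b (f p) (g p))"
proof (rule smooth_functionI, rule smooth_onI)
  fix c k assume c: "c \<in> A"
  have "Ck_on k (chart_map c ` chart_dom c) (\<lambda>x. b ((f \<circ> chart_inv c) x) ((g \<circ> chart_inv c) x))"
    by (intro Ck_on_bilinear[OF assms(1) chart_image_open'[OF c]] smooth_onD smooth_functionD assms c)
  thus "Ck_on k (chart_map c ` chart_dom c) ((\<lambda>p. b (f p) (g p)) \<circ> chart_inv c)" by (simp add: o_def)
qed

lemma smooth_function_add:
  assumes "smooth_function A f" "smooth_function A g"
  shows "smooth_function A (\<lambda>p. f p + g p)"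
proof (rule smooth_functionI, rule smooth_onI)
  fix c k assume c: "c \<in> A"
  have "Ck_on k (chart_map c ` chart_dom c) (\<lambda>x. (f \<circ> chart_inv c) x + (g \<circ> chart_inv c) x)"
    by (intro Ck_on_add[OF chart_image_open'[OF c]] smooth_onD smooth_functionD assms c)
  thus "Ck_on k (chart_map c ` chart_dom c) ((\<lambda>p. f p + g p) \<circ> chart_inv c)" by (simp add: o_def)
qed

lemma smooth_function_linear:
  assumes "bounded_linear h" "smooth_function A f"
  shows "smooth_function A (\<lambda>p. h (f p))"
proof (rule smooth_functionI, rule smooth_onI)
  fix c k assume c: "c \<in> A"
  have "Ck_on k (chart_map c ` chart_dom c) (\<lambda>x. h ((f \<circ> chart_inv c) x))"
    by (intro Ck_on_linear_compose[OF assms(1) chart_image_open'[OF c]] smooth_onD smooth_functionD assms c)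
  thus "Ck_on k (chart_map c ` chart_dom c) ((\<lambda>p. h (f p)) \<circ> chart_inv c)" by (simp add: o_def)
qed

lemma smooth_function_continuous:
  assumes f: "smooth_function A f"
  shows "continuous_on UNIV f"
proof (rule continuous_at_imp_continuous_on, rule ballI)
  fix p
  note c = chart_at[of p]
  let ?c = "chart_at A p"
  note ch = charts[OF c(1)]
  have "isCont (f \<circ> chart_inv ?c) (chart_map ?c p)"
    using smooth_on_continuous[OF smooth_functionD[OF f c(1)]] chart_image_open'[OF c(1)] c(2)
    by (metis continuous_on_eq_continuous_at imageI)
  from isCont_tendsto_compose[OF this chart_map_tendsto[OF ch c(2) tendsto_ident_at]]
  have "((\<lambda>q. f (chart_inv ?c (chart_map ?c q))) \<longlongrightarrow> f p) (at p)"
    by (simp add: is_chartD(3)[OF ch c(2)])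
  moreover have "eventually (\<lambda>q. f (chart_inv ?c (chart_map ?c q)) = f q) (at p)"
    using eventually_chart_dom[OF ch c(2) tendsto_ident_at] by eventually_elim (simp add: is_chartD(3)[OF ch])
  ultimately show "isCont f p" unfolding isCont_def by (rule Lim_transform_eventually)
qed

lemma dchart_add:
  assumes "smooth_function A f" "smooth_function A g" "c \<in> A" "p \<in> chart_dom c"
  shows "dchart c (\<lambda>p. f p + g p) p v = dchart c f p v + dchart c g p v"
proof -
  have "((\<lambda>p. f p + g p) \<circ> chart_inv c has_derivative (\<lambda>v. dchart c f p v + dchart c g p v)) (at (chart_map c p))"
    using has_derivative_add[OF dchart_has_derivative[OF assms(1,3,4)] dchart_has_derivative[OF assms(2,3,4)]]
    by (simp add: o_def)
  from dchart_eqI[OF this] show ?thesis by simp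
qed

lemma dchart_linear_compose:
  assumes "bounded_linear h" "smooth_function A f" "c \<in> A" "p \<in> chart_dom c"
  shows "dchart c (\<lambda>p. h (f p)) p v = h (dchart c f p v)"
proof -
  have "((\<lambda>p. h (f p)) \<circ> chart_inv c has_derivative (\<lambda>v. h (dchart c f p v))) (at (chart_map c p))"
    using bounded_linear.has_derivative[OF assms(1) dchart_has_derivative[OF assms(2,3,4)]]
    by (simp add: o_def)
  from dchart_eqI[OF this] show ?thesis by simp
qed

lemma dchart_const: "dchart c (\<lambda>p. k) p v = 0"
proof -
  have "((\<lambda>p. k) \<circ> chart_inv c has_derivative (\<lambda>v. 0)) (at (chart_map c p))" by (simp add: o_def)
  from dchart_eqI[OF this] show ?thesis by simp
qed

subsection \<open>Smooth maps\<close>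

lemma smooth_mapsD:
  assumes "\<phi> \<in> smooth_maps A"
  shows "continuous_on UNIV \<phi>"
    "\<And>c c'. c \<in> A \<Longrightarrow> c' \<in> A \<Longrightarrow>
      smooth_on (chart_map c ` (chart_dom c \<inter> \<phi> -` chart_dom c')) (chart_map c' \<circ> \<phi> \<circ> chart_inv c)"
  using assms by (simp_all add: smooth_maps_def)

lemma smooth_map_domain_open:
  assumes "continuous_on UNIV \<phi>" "c \<in> A" "c' \<in> A"
  shows "open (chart_dom c \<inter> \<phi> -` chart_dom c')" "open (chart_map c ` (chart_dom c \<inter> \<phi> -` chart_dom c'))"
proof -
  have "open (\<phi> -` chart_dom c')"
    using open_vimage[OF is_chartD(1)[OF charts[OF assms(3)]] assms(1)] .
  thus "open (chart_dom c \<inter> \<phi> -` chart_dom c')" "open (chart_map c ` (chart_dom c \<inter> \<phi> -` chart_dom c'))"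
    using is_chartD(1)[OF charts[OF assms(2)]] chart_image_open[OF charts[OF assms(2)]] by auto
qed

lemma jacobian_has_derivative:
  assumes "\<phi> \<in> smooth_maps A" "c \<in> A" "c' \<in> A" "p \<in> chart_dom c" "\<phi> p \<in> chart_dom c'"
  shows "((chart_map c' \<circ> \<phi> \<circ> chart_inv c) has_derivative jacobian c c' \<phi> p) (at (chart_map c p))"
  unfolding jacobian_def
  by (rule smooth_on_has_derivative[OF smooth_mapsD(2)[OF assms(1-3)]]) (use assms in auto)

lemma jacobian_linear:
  "\<phi> \<in> smooth_maps A \<Longrightarrow> c \<in> A \<Longrightarrow> c' \<in> A \<Longrightarrow> p \<in> chart_dom c \<Longrightarrow> \<phi> p \<in> chart_dom c' \<Longrightarrow>
    linear (jacobian c c' \<phi> p)"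
  by (rule has_derivative_linear[OF jacobian_has_derivative])

lemma smooth_function_compose:
  assumes f: "smooth_function A f" and \<phi>: "\<phi> \<in> smooth_maps A"
  shows "smooth_function A (\<lambda>p. f (\<phi> p))"
proof (rule smooth_functionI, rule smooth_on_local)
  fix c x assume c: "c \<in> A" and x: "x \<in> chart_map c ` chart_dom c"
  then obtain p where p: "p \<in> chart_dom c" "x = chart_map c p" by blast
  define c' where "c' = chart_at A (\<phi> p)"
  have c': "c' \<in> A" "\<phi> p \<in> chart_dom c'" unfolding c'_def by (rule chart_at)+
  let ?S = "chart_map c ` (chart_dom c \<inter> \<phi> -` chart_dom c')"
  have S: "open ?S" by (rule smooth_map_domain_open(2)[OF smooth_mapsD(1)[OF \<phi>] c c'(1)])
  note ch = is_chartD[OF charts[OF c]] and ch' = is_chartD[OF charts[OF c'(1)]]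
  have "smooth_on ?S (\<lambda>x. (f \<circ> chart_inv c') ((chart_map c' \<circ> \<phi> \<circ> chart_inv c) x))"
  proof (rule smooth_on_compose[OF S ch'(2) _ smooth_functionD[OF f c'(1)] smooth_mapsD(2)[OF \<phi> c c'(1)]])
    show "(chart_map c' \<circ> \<phi> \<circ> chart_inv c) ` ?S \<subseteq> chart_map c' ` chart_dom c'"
      by (auto simp: ch(3))
  qed
  hence "smooth_on ?S ((\<lambda>p. f (\<phi> p)) \<circ> chart_inv c)"
    by (rule smooth_on_cong[OF S, rotated]) (auto simp: ch(3) ch'(3))
  thus "\<exists>U. open U \<and> x \<in> U \<and> smooth_on U ((\<lambda>p. f (\<phi> p)) \<circ> chart_inv c)"
    using S p c'(2) by blast
qed

lemma dchart_compose:
  assumes f: "smooth_function A f" and \<phi>: "\<phi> \<in> smooth_maps A"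
    and c: "c \<in> A" "c' \<in> A" "p \<in> chart_dom c" "\<phi> p \<in> chart_dom c'"
  shows "dchart c (\<lambda>p. f (\<phi> p)) p v = dchart c' f (\<phi> p) (jacobian c c' \<phi> p v)"
proof -
  note ch = is_chartD[OF charts[OF c(1)]] and ch' = is_chartD[OF charts[OF c(2)]]
  let ?S = "chart_map c ` (chart_dom c \<inter> \<phi> -` chart_dom c')"
  have S: "open ?S" by (rule smooth_map_domain_open(2)[OF smooth_mapsD(1)[OF \<phi>] c(1,2)])
  have p: "chart_map c p \<in> ?S" using c by blast
  have "((f \<circ> chart_inv c') has_derivative dchart c' f (\<phi> p)) (at ((chart_map c' \<circ> \<phi> \<circ> chart_inv c) (chart_map c p)))"
    using dchart_has_derivative[OF f c(2,4)] by (simp add: ch(3)[OF c(3)])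
  from diff_chain_at[OF jacobian_has_derivative[OF \<phi> c] this]
  have "((\<lambda>p. f (\<phi> p)) \<circ> chart_inv c has_derivative dchart c' f (\<phi> p) \<circ> jacobian c c' \<phi> p) (at (chart_map c p))"
    by (rule has_derivative_transform_within_open[OF _ S p]) (auto simp: ch(3) ch'(3))
  from dchart_eqI[OF this] show ?thesis by simp
qed

lemma smooth_maps_compose:
  assumes \<phi>: "\<phi> \<in> smooth_maps A" and \<psi>: "\<psi> \<in> smooth_maps A"
  shows "(\<lambda>p. \<phi> (\<psi> p)) \<in> smooth_maps A"
  unfolding smooth_maps_def
proof (intro CollectI conjI ballI)
  show "continuous_on UNIV (\<lambda>p. \<phi> (\<psi> p))"
    using continuous_on_compose2[OF smooth_mapsD(1)[OF \<phi>] smooth_mapsD(1)[OF \<psi>]] by simp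
  fix c c'' assume c: "c \<in> A" "c'' \<in> A"
  note ch = is_chartD[OF charts[OF c(1)]]
  show "smooth_on (chart_map c ` (chart_dom c \<inter> (\<lambda>p. \<phi> (\<psi> p)) -` chart_dom c''))
      (chart_map c'' \<circ> (\<lambda>p. \<phi> (\<psi> p)) \<circ> chart_inv c)"
  proof (rule smooth_on_local)
    fix x assume "x \<in> chart_map c ` (chart_dom c \<inter> (\<lambda>p. \<phi> (\<psi> p)) -` chart_dom c'')"
    then obtain p where p: "p \<in> chart_dom c" "\<phi> (\<psi> p) \<in> chart_dom c''" "x = chart_map c p" by blast
    define c' where "c' = chart_at A (\<psi> p)"
    have c': "c' \<in> A" "\<psi> p \<in> chart_dom c'" unfolding c'_def by (rule chart_at)+
    note ch' = is_chartD[OF charts[OF c'(1)]]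
    let ?T = "chart_map c' ` (chart_dom c' \<inter> \<phi> -` chart_dom c'')"
    let ?S = "chart_map c ` (chart_dom c \<inter> \<psi> -` (chart_dom c' \<inter> \<phi> -` chart_dom c''))"
    note op = smooth_map_domain_open[OF smooth_mapsD(1)[OF \<phi>] c'(1) c(2)]
    have S: "open ?S"
      by (rule chart_image_open[OF charts[OF c(1)] open_vimage[OF op(1) smooth_mapsD(1)[OF \<psi>]]])
    have "smooth_on ?S (\<lambda>x. (chart_map c'' \<circ> \<phi> \<circ> chart_inv c') ((chart_map c' \<circ> \<psi> \<circ> chart_inv c) x))"
    proof (rule smooth_on_compose[OF S op(2) _ smooth_mapsD(2)[OF \<phi> c'(1) c(2)]])
      show "(chart_map c' \<circ> \<psi> \<circ> chart_inv c) ` ?S \<subseteq> ?T" by (auto simp: ch(3))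
      show "smooth_on ?S (chart_map c' \<circ> \<psi> \<circ> chart_inv c)"
        by (rule smooth_on_subset[OF _ smooth_mapsD(2)[OF \<psi> c(1) c'(1)]]) auto
    qed
    hence "smooth_on ?S (chart_map c'' \<circ> (\<lambda>p. \<phi> (\<psi> p)) \<circ> chart_inv c)"
      by (rule smooth_on_cong[OF S, rotated]) (auto simp: ch(3) ch'(3))
    thus "\<exists>U. open U \<and> x \<in> U \<and> smooth_on U (chart_map c'' \<circ> (\<lambda>p. \<phi> (\<psi> p)) \<circ> chart_inv c)"
      using S p c'(2) by blast
  qed
qed

lemma jacobian_compose:
  assumes \<phi>: "\<phi> \<in> smooth_maps A" and \<psi>: "\<psi> \<in> smooth_maps A"
    and c: "c \<in> A" "c' \<in> A" "c'' \<in> A" "p \<in> chart_dom c" "\<psi> p \<in> chart_dom c'" "\<phi> (\<psi> p) \<in> chart_dom c''"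
  shows "jacobian c c'' (\<lambda>p. \<phi> (\<psi> p)) p v = jacobian c' c'' \<phi> (\<psi> p) (jacobian c c' \<psi> p v)"
proof -
  note ch = is_chartD[OF charts[OF c(1)]] and ch' = is_chartD[OF charts[OF c(2)]]
  let ?S = "chart_map c ` (chart_dom c \<inter> \<psi> -` chart_dom c')"
  have S: "open ?S" by (rule smooth_map_domain_open(2)[OF smooth_mapsD(1)[OF \<psi>] c(1,2)])
  have p: "chart_map c p \<in> ?S" using c by blast
  have "((chart_map c'' \<circ> \<phi> \<circ> chart_inv c') has_derivative jacobian c' c'' \<phi> (\<psi> p))
      (at ((chart_map c' \<circ> \<psi> \<circ> chart_inv c) (chart_map c p)))"
    using jacobian_has_derivative[OF \<phi> c(2,3,5,6)] by (simp add: ch(3)[OF c(4)])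
  from diff_chain_at[OF jacobian_has_derivative[OF \<psi> c(1,2,4,5)] this]
  have "(chart_map c'' \<circ> (\<lambda>p. \<phi> (\<psi> p)) \<circ> chart_inv c has_derivative
      jacobian c' c'' \<phi> (\<psi> p) \<circ> jacobian c c' \<psi> p) (at (chart_map c p))"
    by (rule has_derivative_transform_within_open[OF _ S p]) (auto simp: ch(3) ch'(3))
  from frechet_derivative_at[OF this] show ?thesis
    unfolding jacobian_def[of c c'' "\<lambda>p. \<phi> (\<psi> p)"] by (metis comp_apply)
qed

lemma smooth_maps_id: "(\<lambda>p. p) \<in> smooth_maps A"
  unfolding smooth_maps_def using transition_smooth by (auto simp: vimage_def o_def)

lemma smooth_maps_funpow: "\<phi> \<in> smooth_maps A \<Longrightarrow> (\<phi> ^^ n) \<in> smooth_maps A"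
proof (induction n)
  case (Suc n)
  thus ?case using smooth_maps_compose[of \<phi> "\<phi> ^^ n"] by (simp add: o_def)
qed (simp add: smooth_maps_id id_def)

end

locale compact_riemannian = riemannian A m
  for A :: "('a::t2_space, 'e::finite_dim_inner) chart set" and m :: "('a, 'e) metric_tensor" +
  assumes compact: "compact (UNIV :: 'a set)" and connected: "connected (UNIV :: 'a set)"
begin

abbreviation "CI \<equiv> smooth_bcontfuns A"
abbreviation "LC \<equiv> lipschitz_seminorm A m"

lemma CI_smooth: "f \<in> CI \<Longrightarrow> smooth_function A (apply_bcontfun f)"
  by (simp add: smooth_bcontfuns_def)

lemma bcontfun_of_continuous: "continuous_on UNIV g \<Longrightarrow> g \<in> bcontfun" for g :: "'a \<Rightarrow> complex"
  using compact_imp_bounded[OF compact_continuous_image[OF _ compact]] by (simp add: bcontfun_def)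

lemma norm_df_bdd:
  assumes f: "smooth_function A f"
  shows "bdd_above (range (norm_df A m f))"
proof -
  have "\<exists>b. eventually (\<lambda>p. norm_df A m f p \<le> b) (nhds p0)" for p0
  proof -
    note c = chart_at[of p0]
    obtain K where K: "0 \<le> K"
      "eventually (\<lambda>p. p \<in> chart_dom (chart_at A p0) \<and> (\<forall>v. cmod (dchart (chart_at A p0) f p v) \<le> K * sqrt (m (chart_at A p0) p v v))) (nhds p0)"
      using dchart_local_bound[OF f c] by blast
    from K(2) have "eventually (\<lambda>p. norm_df A m f p \<le> 2 * K) (nhds p0)"
    proof eventually_elim
      case (elim p)
      show ?case
        by (rule norm_df_le[OF f c(1)], use elim K in simp, use K in simp, rule dchart_pair_bound[OF c(1)])
          (use elim K in auto)
    qed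
    thus ?thesis by blast
  qed
  with compact_local_bound[OF compact, of "norm_df A m f"] obtain B where "\<forall>p\<in>UNIV. norm_df A m f p \<le> B" by blast
  thus ?thesis by (intro bdd_aboveI[of _ B]) auto
qed

lemma norm_df_le_LC: "f \<in> CI \<Longrightarrow> norm_df A m (apply_bcontfun f) p \<le> LC f"
  unfolding lipschitz_seminorm_def by (rule cSUP_upper[OF _ norm_df_bdd[OF CI_smooth]]) simp

lemma LC_le: "(\<And>p. norm_df A m (apply_bcontfun f) p \<le> K) \<Longrightarrow> LC f \<le> K"
  unfolding lipschitz_seminorm_def by (rule cSUP_least) simp_all

lemma LC_nonneg: "f \<in> CI \<Longrightarrow> 0 \<le> LC f"
  using norm_df_nonneg[OF CI_smooth] norm_df_le_LC order_trans by blast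

lemma dchart_pair_le_LC:
  assumes "f \<in> CI" "c \<in> A" "p \<in> chart_dom c"
  shows "cmod (dchart c (apply_bcontfun f) p v + \<i> * dchart c (apply_bcontfun f) p w)
    \<le> LC f * sqrt (m c p v v + m c p w w)"
  by (rule order_trans[OF norm_df_upper[OF CI_smooth[OF assms(1)] assms(2,3)]])
    (use norm_df_le_LC[OF assms(1)] m_nonneg[OF assms(2,3)] in \<open>auto intro!: mult_right_mono\<close>)

lemma dchart_le_LC:
  assumes "f \<in> CI" "c \<in> A" "p \<in> chart_dom c"
  shows "cmod (dchart c (apply_bcontfun f) p v) \<le> LC f * sqrt (m c p v v)"
  using dchart_pair_le_LC[OF assms, of v 0] linear_0[OF dchart_linear[OF CI_smooth[OF assms(1)] assms(2,3)]]
    m_scale[OF assms(2,3), of 0 0] by simp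

lemma LC_leI:
  assumes f: "f \<in> CI" and "0 \<le> K"
    and K: "\<And>p. \<exists>c\<in>A. p \<in> chart_dom c \<and> (\<forall>v w. cmod (dchart c (apply_bcontfun f) p v + \<i> * dchart c (apply_bcontfun f) p w)
      \<le> K * sqrt (m c p v v + m c p w w))"
  shows "LC f \<le> K"
proof (rule LC_le)
  fix p
  obtain c where "c \<in> A" "p \<in> chart_dom c" "\<And>v w. cmod (dchart c (apply_bcontfun f) p v + \<i> * dchart c (apply_bcontfun f) p w)
      \<le> K * sqrt (m c p v v + m c p w w)" using K[of p] by blast
  thus "norm_df A m (apply_bcontfun f) p \<le> K"
    by (intro norm_df_le[OF CI_smooth[OF f] _ _ \<open>0 \<le> K\<close>])
qed

lemma CI_add: "f \<in> CI \<Longrightarrow> g \<in> CI \<Longrightarrow> f + g \<in> CI"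
  using smooth_function_add[of "apply_bcontfun f" "apply_bcontfun g"]
  by (simp add: smooth_bcontfuns_def plus_bcontfun.rep_eq)

lemma apply_cmult: "apply_bcontfun (bcontfun_cmult k f) = (\<lambda>p. k * apply_bcontfun f p)"
  by (rule ext) simp

lemma CI_cmult: "f \<in> CI \<Longrightarrow> bcontfun_cmult k f \<in> CI"
  using smooth_function_linear[OF bounded_linear_mult_right[of k], of "apply_bcontfun f"]
  by (simp add: smooth_bcontfuns_def apply_cmult)

lemma CI_const: "const_bcontfun k \<in> CI"
  using smooth_function_const[of k] by (simp add: smooth_bcontfuns_def const_bcontfun.rep_eq)

lemma CI_cnj: "f \<in> CI \<Longrightarrow> cnj_bcontfun f \<in> CI"
proof -
  assume "f \<in> CI"
  hence "smooth_function A (\<lambda>p. cnj (apply_bcontfun f p))"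
    using smooth_function_linear[OF bounded_linear_cnj] CI_smooth by blast
  moreover have "apply_bcontfun (cnj_bcontfun f) = (\<lambda>p. cnj (apply_bcontfun f p))"
    by (rule ext) (simp add: cnj_bcontfun_apply)
  ultimately show ?thesis by (simp add: smooth_bcontfuns_def)
qed

lemma LC_const: "LC (const_bcontfun k) = 0"
proof -
  have "LC (const_bcontfun k) \<le> 0"
    by (rule LC_leI[OF CI_const]) (auto simp: const_bcontfun.rep_eq dchart_const intro!: bexI[OF _ chart_at(1)] chart_at(2))
  thus ?thesis using LC_nonneg[OF CI_const] by (simp add: order_antisym)
qed

lemma LC_add:
  assumes f: "f \<in> CI" and g: "g \<in> CI"
  shows "LC (f + g) \<le> LC f + LC g"
proof (rule LC_leI[OF CI_add[OF f g]])
  show "0 \<le> LC f + LC g" using LC_nonneg[OF f] LC_nonneg[OF g] by simp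
  fix p
  note c = chart_at[of p]
  let ?c = "chart_at A p"
  have "cmod (dchart ?c (apply_bcontfun (f + g)) p v + \<i> * dchart ?c (apply_bcontfun (f + g)) p w)
      \<le> (LC f + LC g) * sqrt (m ?c p v v + m ?c p w w)" for v w
  proof -
    have "dchart ?c (apply_bcontfun (f + g)) p u = dchart ?c (apply_bcontfun f) p u + dchart ?c (apply_bcontfun g) p u" for u
      unfolding plus_bcontfun.rep_eq by (rule dchart_add[OF CI_smooth[OF f] CI_smooth[OF g] c])
    hence "dchart ?c (apply_bcontfun (f + g)) p v + \<i> * dchart ?c (apply_bcontfun (f + g)) p w
      = (dchart ?c (apply_bcontfun f) p v + \<i> * dchart ?c (apply_bcontfun f) p w)
        + (dchart ?c (apply_bcontfun g) p v + \<i> * dchart ?c (apply_bcontfun g) p w)"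
      by (simp add: distrib_left)
    thus ?thesis
      using norm_triangle_mono[OF dchart_pair_le_LC[OF f c, of v w] dchart_pair_le_LC[OF g c, of v w]]
      by (simp add: distrib_right)
  qed
  thus "\<exists>c\<in>A. p \<in> chart_dom c \<and> (\<forall>v w. cmod (dchart c (apply_bcontfun (f + g)) p v + \<i> * dchart c (apply_bcontfun (f + g)) p w)
      \<le> (LC f + LC g) * sqrt (m c p v v + m c p w w))" using c by blast
qed

lemma LC_cmult_le:
  assumes f: "f \<in> CI"
  shows "LC (bcontfun_cmult k f) \<le> cmod k * LC f"
proof (rule LC_leI[OF CI_cmult[OF f]])
  show "0 \<le> cmod k * LC f" using LC_nonneg[OF f] by simp
  fix p
  note c = chart_at[of p]
  let ?c = "chart_at A p"
  have "cmod (dchart ?c (apply_bcontfun (bcontfun_cmult k f)) p v + \<i> * dchart ?c (apply_bcontfun (bcontfun_cmult k f)) p w)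
      \<le> (cmod k * LC f) * sqrt (m ?c p v v + m ?c p w w)" for v w
  proof -
    have "dchart ?c (apply_bcontfun (bcontfun_cmult k f)) p u = k * dchart ?c (apply_bcontfun f) p u" for u
      unfolding apply_cmult by (rule dchart_linear_compose[OF bounded_linear_mult_right CI_smooth[OF f] c])
    hence "dchart ?c (apply_bcontfun (bcontfun_cmult k f)) p v + \<i> * dchart ?c (apply_bcontfun (bcontfun_cmult k f)) p w
      = k * (dchart ?c (apply_bcontfun f) p v + \<i> * dchart ?c (apply_bcontfun f) p w)"
      by (simp add: distrib_left)
    thus ?thesis using mult_left_mono[OF dchart_pair_le_LC[OF f c, of v w] norm_ge_zero[of k]]
      by (simp only: norm_mult mult.assoc)
  qed
  thus "\<exists>c\<in>A. p \<in> chart_dom c \<and> (\<forall>v w. cmod (dchart c (apply_bcontfun (bcontfun_cmult k f)) p v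
      + \<i> * dchart c (apply_bcontfun (bcontfun_cmult k f)) p w) \<le> (cmod k * LC f) * sqrt (m c p v v + m c p w w))"
    using c by blast
qed

lemma LC_cmult:
  assumes f: "f \<in> CI"
  shows "LC (bcontfun_cmult k f) = cmod k * LC f"
proof (cases "k = 0")
  case True
  have "bcontfun_cmult 0 f = const_bcontfun 0" by (rule bcontfun_eqI) simp
  thus ?thesis using LC_const[of 0] True by simp
next
  case False
  have "bcontfun_cmult (inverse k) (bcontfun_cmult k f) = f" using False by (intro bcontfun_eqI) simp
  hence "LC f \<le> cmod (inverse k) * LC (bcontfun_cmult k f)"
    using LC_cmult_le[OF CI_cmult[OF f], of "inverse k" k] by simp
  hence "cmod k * LC f \<le> LC (bcontfun_cmult k f)"
    using mult_left_mono[of "LC f" "cmod (inverse k) * LC (bcontfun_cmult k f)" "cmod k"] False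
    by (simp add: norm_inverse mult.assoc[symmetric])
  thus ?thesis using LC_cmult_le[OF f, of k] by simp
qed

subsection \<open>Oscillation, diameter and total boundedness\<close>

text \<open>The mean value inequality on a ball in a chart. One neighbourhood serves all
  \<open>f\<close>, with \<open>LC f\<close> as the only dependence; in this way Lipschitz estimates
  are possible without the Riemannian distance.\<close>

lemma oscillation_local:
  assumes e: "0 < e"
  obtains U where "open U" "p0 \<in> U"
    "\<And>f q. f \<in> CI \<Longrightarrow> q \<in> U \<Longrightarrow> cmod (apply_bcontfun f q - apply_bcontfun f p0) \<le> e * LC f"
proof -
  define c where "c = chart_at A p0"
  have c: "c \<in> A" "p0 \<in> chart_dom c" unfolding c_def by (rule chart_at)+
  note ch = is_chartD[OF charts[OF c(1)]]
  obtain K where K: "0 < K" "eventually (\<lambda>p. p \<in> chart_dom c \<and> (\<forall>v. m c p v v \<le> (K * norm v)\<^sup>2)) (nhds p0)"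
    using m_upper_bound[OF c] by blast
  then obtain W where W: "open W" "p0 \<in> W" "\<And>p v. p \<in> W \<Longrightarrow> p \<in> chart_dom c \<and> m c p v v \<le> (K * norm v)\<^sup>2"
    unfolding eventually_nhds by blast
  have "open (chart_map c ` (chart_dom c \<inter> W))" by (rule chart_image_open[OF charts[OF c(1)] W(1)])
  moreover have "chart_map c p0 \<in> chart_map c ` (chart_dom c \<inter> W)" using c W by blast
  ultimately obtain r0 where r0: "0 < r0" "ball (chart_map c p0) r0 \<subseteq> chart_map c ` (chart_dom c \<inter> W)"
    using openE by blast
  \<comment> \<open>\<open>K\<close> compares the metric with the norm of the chart on
    \<open>W\<close>, so a displacement below \<open>e / K\<close> in the chart changes
    \<open>f\<close> by at most \<open>e * LC f\<close>.\<close>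
  define r where "r = min r0 (e / K)"
  have r: "0 < r" "r \<le> r0" "K * r \<le> e"
    using r0(1) e K(1) by (auto simp: r_def min_def field_simps)
  let ?B = "ball (chart_map c p0) r"
  have B: "?B \<subseteq> chart_map c ` (chart_dom c \<inter> W)" using r0(2) r(2) by (meson order_trans subset_ball)
  define U where "U = chart_dom c \<inter> chart_map c -` ?B"
  have "cmod (apply_bcontfun f q - apply_bcontfun f p0) \<le> e * LC f" if f: "f \<in> CI" and q: "q \<in> U" for f q
  proof -
    let ?g = "apply_bcontfun f \<circ> chart_inv c"
    have "cmod (?g (chart_map c q) - ?g (chart_map c p0)) \<le> (LC f * K) * norm (chart_map c q - chart_map c p0)"
    proof (rule differentiable_bound[of ?B ?g "\<lambda>x. dchart c (apply_bcontfun f) (chart_inv c x)"])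
      fix x assume "x \<in> ?B"
      then obtain p where p: "p \<in> chart_dom c" "p \<in> W" "x = chart_map c p" using B by blast
      have inv: "chart_inv c x = p" by (simp add: p ch(3))
      have "(?g has_derivative dchart c (apply_bcontfun f) p) (at x)"
        unfolding p(3) by (rule dchart_has_derivative[OF CI_smooth[OF f] c(1) p(1)])
      thus "(?g has_derivative dchart c (apply_bcontfun f) (chart_inv c x)) (at x within ?B)"
        unfolding inv by (rule has_derivative_at_withinI)
      show "onorm (dchart c (apply_bcontfun f) (chart_inv c x)) \<le> LC f * K"
        unfolding inv
      proof (rule onorm_bound)
        show "0 \<le> LC f * K" using LC_nonneg[OF f] K(1) by simp
        fix v
        have "sqrt (m c p v v) \<le> K * norm v"
          using W(3)[OF p(2)] K(1) by (intro real_le_lsqrt) auto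
        thus "norm (dchart c (apply_bcontfun f) p v) \<le> LC f * K * norm v"
          using order_trans[OF dchart_le_LC[OF f c(1) p(1)] mult_left_mono[OF _ LC_nonneg[OF f]]] by (simp add: mult.assoc)
      qed
    qed (use q r in \<open>auto simp: U_def\<close>)
    also have "\<dots> \<le> (LC f * K) * r"
      using q LC_nonneg[OF f] K(1) by (intro mult_left_mono) (auto simp: U_def dist_norm norm_minus_commute)
    also have "\<dots> \<le> e * LC f" using mult_left_mono[OF r(3) LC_nonneg[OF f]] by (simp add: mult_ac)
    finally show ?thesis using q c(2) by (simp add: U_def ch(3))
  qed
  moreover have "open U" unfolding U_def by (rule chart_preimage_open[OF charts[OF c(1)]]) simp
  moreover have "p0 \<in> U" using c(2) r by (simp add: U_def)
  ultimately show thesis using that by blast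
qed

lemma osc_triangle:
  assumes "cmod (apply_bcontfun f p - apply_bcontfun f q) \<le> D * LC f"
    "cmod (apply_bcontfun f q - apply_bcontfun f r) \<le> D' * LC f"
  shows "cmod (apply_bcontfun f p - apply_bcontfun f r) \<le> (D + D') * LC f"
  using norm_triangle_mono[OF assms] by (simp add: distrib_right)

text \<open>The points for which such a constant exists form an open and closed set, since by
  \<open>oscillation_local\<close> membership is locally constant; connectedness does the
  rest.\<close>

lemma diameter_pointwise: "\<exists>D. \<forall>f\<in>CI. cmod (apply_bcontfun f q - apply_bcontfun f p0) \<le> D * LC f"
proof -
  define S where "S = {q. \<exists>D. \<forall>f\<in>CI. cmod (apply_bcontfun f q - apply_bcontfun f p0) \<le> D * LC f}"
  have nb: "\<exists>U. open U \<and> q \<in> U \<and> (\<forall>r\<in>U. r \<in> S \<longleftrightarrow> q \<in> S)" for q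
  proof -
    obtain U where U: "open U" "q \<in> U"
      "\<And>f r. f \<in> CI \<Longrightarrow> r \<in> U \<Longrightarrow> cmod (apply_bcontfun f r - apply_bcontfun f q) \<le> 1 * LC f"
      using oscillation_local[of 1 q] by (metis zero_less_one)
    have "r \<in> S \<longleftrightarrow> q \<in> S" if r: "r \<in> U" for r
    proof
      assume "q \<in> S"
      then obtain D where "\<forall>f\<in>CI. cmod (apply_bcontfun f q - apply_bcontfun f p0) \<le> D * LC f" by (auto simp: S_def)
      hence "\<forall>f\<in>CI. cmod (apply_bcontfun f r - apply_bcontfun f p0) \<le> (1 + D) * LC f"
        using osc_triangle[OF U(3)[OF _ r]] by blast
      thus "r \<in> S" unfolding S_def by blast
    next
      assume "r \<in> S"
      then obtain D where "\<forall>f\<in>CI. cmod (apply_bcontfun f r - apply_bcontfun f p0) \<le> D * LC f" by (auto simp: S_def)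
      hence "\<forall>f\<in>CI. cmod (apply_bcontfun f q - apply_bcontfun f p0) \<le> (1 + D) * LC f"
        using osc_triangle[of _ q r 1 p0] U(3)[OF _ r] by (simp add: norm_minus_commute)
      thus "q \<in> S" unfolding S_def by blast
    qed
    thus ?thesis using U(1,2) by blast
  qed
  have "open T" if T: "\<And>q r U. q \<in> T \<Longrightarrow> (\<forall>r\<in>U. r \<in> S \<longleftrightarrow> q \<in> S) \<Longrightarrow> r \<in> U \<Longrightarrow> r \<in> T" for T
  proof (subst open_subopen, rule ballI)
    fix q assume q: "q \<in> T"
    obtain U where "open U" "q \<in> U" "\<forall>r\<in>U. r \<in> S \<longleftrightarrow> q \<in> S" using nb[of q] by auto
    thus "\<exists>U. open U \<and> q \<in> U \<and> U \<subseteq> T" using T[OF q] by (intro exI[of _ U] conjI subsetI)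
  qed
  from this[of S] this[of "- S"] have "open S" "open (- S)" by simp_all
  moreover have "p0 \<in> S" unfolding S_def by (auto intro!: exI[of _ 0])
  ultimately have "S = UNIV"
    using connected connected_clopen[of "UNIV :: 'a set"] by (auto simp: closed_def)
  hence "q \<in> S" by simp
  thus ?thesis by (simp add: S_def)
qed

text \<open>Finitely many neighbourhoods with oscillation constant 1 make the pointwise constants
  uniform; comparing two points through \<open>p0\<close> doubles the result.\<close>

lemma diameter:
  obtains D where "0 \<le> D"
    "\<And>f p q. f \<in> CI \<Longrightarrow> cmod (apply_bcontfun f p - apply_bcontfun f q) \<le> D * LC f"
proof -
  fix p0 :: 'a
  obtain d where d: "\<And>q f. f \<in> CI \<Longrightarrow> cmod (apply_bcontfun f q - apply_bcontfun f p0) \<le> d q * LC f"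
    using diameter_pointwise[of _ p0] by metis
  have "\<exists>U. open U \<and> q \<in> U \<and> (\<forall>f\<in>CI. \<forall>r\<in>U. cmod (apply_bcontfun f r - apply_bcontfun f q) \<le> 1 * LC f)" for q
    using oscillation_local[of 1 q] by (metis zero_less_one)
  then obtain U where U: "\<And>q. open (U q)" "\<And>q. q \<in> U q"
    "\<And>q f r. f \<in> CI \<Longrightarrow> r \<in> U q \<Longrightarrow> cmod (apply_bcontfun f r - apply_bcontfun f q) \<le> 1 * LC f" by metis
  have "UNIV \<subseteq> (\<Union>q\<in>UNIV. U q)" using U(2) by blast
  then obtain Q where Q: "finite Q" "UNIV \<subseteq> (\<Union>q\<in>Q. U q)"
    using compactE_image[OF compact, of UNIV U] U(1) by metis
  define D where "D = 1 + Max (insert 0 (d ` Q))"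
  have D: "0 \<le> D" using Q(1) by (simp add: D_def add_nonneg_nonneg Max_ge_iff)
  have bd: "cmod (apply_bcontfun f p - apply_bcontfun f p0) \<le> D * LC f" if f: "f \<in> CI" for f p
  proof -
    have "p \<in> (\<Union>q\<in>Q. U q)" using Q(2) by auto
    then obtain q where q: "q \<in> Q" "p \<in> U q" by (rule UN_E)
    have "cmod (apply_bcontfun f p - apply_bcontfun f p0) \<le> (1 + d q) * LC f"
      by (rule osc_triangle[OF U(3)[OF f q(2)] d[OF f]])
    also have "d q \<le> Max (insert 0 (d ` Q))" using Q(1) q(1) by (intro Max_ge) auto
    hence "(1 + d q) * LC f \<le> D * LC f" using LC_nonneg[OF f] by (intro mult_right_mono) (auto simp: D_def)
    finally show ?thesis .
  qed
  have "cmod (apply_bcontfun f p - apply_bcontfun f q) \<le> (D + D) * LC f" if f: "f \<in> CI" for f p q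
    by (rule osc_triangle[OF bd[OF f]]) (use bd[OF f, of q] in \<open>simp add: norm_minus_commute\<close>)
  thus thesis using that[of "D + D"] D by simp
qed

text \<open>Arzela-Ascoli by discretization: a function is recorded by approximate values from the
  finite set \<open>Z\<close> at the finitely many points of \<open>Q\<close>, and two functions of
  \<open>B\<close> with a common record differ by at most four times \<open>e / 4\<close>.\<close>

lemma CI_tot_bdd:
  assumes e: "0 < e"
  shows "\<exists>F. finite F \<and> F \<subseteq> CI \<and> (\<forall>f\<in>CI. LC f \<le> R \<longrightarrow> norm f \<le> R \<longrightarrow> (\<exists>g\<in>F. norm (f - g) \<le> e))"
proof -
  \<comment> \<open>A positive substitute for \<open>R\<close>, by which one can divide.\<close>
  define R1 where "R1 = \<bar>R\<bar> + 1"
  have R1: "R1 > 0" "R \<le> R1" by (auto simp: R1_def)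
  have e4: "0 < e / 4 / R1" using e R1 by simp
  have "\<exists>U. open U \<and> q \<in> U \<and> (\<forall>f\<in>CI. \<forall>r\<in>U. cmod (apply_bcontfun f r - apply_bcontfun f q) \<le> e / 4 / R1 * LC f)" for q
    using oscillation_local[OF e4, of q] by metis
  then obtain U where U: "\<And>q. open (U q)" "\<And>q. q \<in> U q"
    "\<And>q f r. f \<in> CI \<Longrightarrow> r \<in> U q \<Longrightarrow> cmod (apply_bcontfun f r - apply_bcontfun f q) \<le> e / 4 / R1 * LC f" by metis
  have "UNIV \<subseteq> (\<Union>q\<in>UNIV. U q)" using U(2) by blast
  then obtain Q where Q: "finite Q" "UNIV \<subseteq> (\<Union>q\<in>Q. U q)"
    using compactE_image[OF compact, of UNIV U] U(1) by metis
  have "compact (cball (0::complex) R)" by simp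
  then obtain Z where Z: "finite Z" "cball (0::complex) R \<subseteq> (\<Union>z\<in>Z. ball z (e / 4))"
    using compact_eq_totally_bounded[of "cball (0::complex) R"] e
    by (meson divide_pos_pos zero_less_numeral)
  define B where "B = {f \<in> CI. LC f \<le> R \<and> norm f \<le> R}"
  define M where "M f g \<longleftrightarrow> (\<forall>q\<in>Q. cmod (apply_bcontfun f q - g q) < e / 4)" for f :: "'a \<Rightarrow>\<^sub>C complex" and g
  have pat: "\<exists>g\<in>PiE Q (\<lambda>_. Z). M f g" if "f \<in> B" for f
  proof -
    have "\<exists>z\<in>Z. cmod (apply_bcontfun f q - z) < e / 4" for q
    proof -
      have "apply_bcontfun f q \<in> cball 0 R"
        using norm_bounded[of f q] that by (simp add: B_def)
      hence "apply_bcontfun f q \<in> (\<Union>z\<in>Z. ball z (e / 4))" by (rule subsetD[OF Z(2)])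
      thus ?thesis by (auto simp: dist_norm norm_minus_commute)
    qed
    then obtain g where "\<And>q. g q \<in> Z" "\<And>q. cmod (apply_bcontfun f q - g q) < e / 4" by metis
    thus ?thesis by (intro bexI[of _ "restrict g Q"]) (auto simp: M_def)
  qed
  \<comment> \<open>A record itself is no smooth function; representatives chosen in
    \<open>B\<close> keep the net inside \<open>CI\<close>.\<close>
  define rep where "rep g = (SOME f. f \<in> B \<and> M f g)" for g
  have close: "norm (f - h) \<le> e" if f: "f \<in> B" "M f g" and h: "h \<in> B" "M h g" for f h g
  proof (rule norm_bound)
    fix p
    have "p \<in> (\<Union>q\<in>Q. U q)" using Q(2) by auto
    then obtain q where q: "q \<in> Q" "p \<in> U q" by (rule UN_E)
    have o: "cmod (apply_bcontfun k p - apply_bcontfun k q) \<le> e / 4" if k: "k \<in> B" for k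
    proof -
      have "cmod (apply_bcontfun k p - apply_bcontfun k q) \<le> e / 4 / R1 * LC k"
        using U(3) k q(2) by (simp add: B_def)
      also have "\<dots> \<le> e / 4 / R1 * R1"
        using k e4 R1 by (intro mult_left_mono) (auto simp: B_def)
      finally show ?thesis using R1 by simp
    qed
    have "cmod (apply_bcontfun f q - g q) < e / 4" "cmod (apply_bcontfun h q - g q) < e / 4"
      using f(2) h(2) q(1) by (auto simp: M_def)
    moreover have eq: "apply_bcontfun (f - h) p = ((apply_bcontfun f p - apply_bcontfun f q) - (apply_bcontfun h p - apply_bcontfun h q))
        + ((apply_bcontfun f q - g q) - (apply_bcontfun h q - g q))"
      by (simp add: minus_bcontfun.rep_eq)
    ultimately show "norm (apply_bcontfun (f - h) p) \<le> e"
      unfolding eq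
      using o[OF f(1)] o[OF h(1)] norm_triangle_ineq4[of "apply_bcontfun f p - apply_bcontfun f q" "apply_bcontfun h p - apply_bcontfun h q"]
        norm_triangle_ineq4[of "apply_bcontfun f q - g q" "apply_bcontfun h q - g q"]
        norm_triangle_ineq[of "(apply_bcontfun f p - apply_bcontfun f q) - (apply_bcontfun h p - apply_bcontfun h q)"
          "(apply_bcontfun f q - g q) - (apply_bcontfun h q - g q)"]
      by linarith
  qed
  show ?thesis
  proof (intro exI[of _ "rep ` {g \<in> PiE Q (\<lambda>_. Z). \<exists>f\<in>B. M f g}"] conjI ballI impI)
    have rep: "rep g \<in> B \<and> M (rep g) g" if "\<exists>f\<in>B. M f g" for g
      unfolding rep_def by (rule someI_ex) (use that in blast)
    show "finite (rep ` {g \<in> PiE Q (\<lambda>_. Z). \<exists>f\<in>B. M f g})"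
      using finite_PiE[OF Q(1), of "\<lambda>_. Z"] Z(1) by simp
    show "rep ` {g \<in> PiE Q (\<lambda>_. Z). \<exists>f\<in>B. M f g} \<subseteq> CI"
      using rep by (auto simp: B_def)
    fix f assume "f \<in> CI" "LC f \<le> R" "norm f \<le> R"
    hence f: "f \<in> B" by (simp add: B_def)
    then obtain g where g: "g \<in> PiE Q (\<lambda>_. Z)" "M f g" using pat by blast
    have ex: "\<exists>f\<in>B. M f g" using f g(2) by blast
    have "norm (f - rep g) \<le> e" using close[OF f g(2)] rep[OF ex] by blast
    thus "\<exists>h\<in>rep ` {g \<in> PiE Q (\<lambda>_. Z). \<exists>f\<in>B. M f g}. norm (f - h) \<le> e" using g(1) ex by blast
  qed
qed

end

context compact_riemannian
begin

subsection \<open>Density of the smooth functions\<close>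

text \<open>A bump in a chart at \<open>p\<close>, extended by zero. The support lies in a compact
  set \<open>K\<close>, which is closed since the manifold is Hausdorff; so points outside the chart
  have a neighbourhood off \<open>K\<close> on which the extension is 0.\<close>

lemma separating_smooth_function:
  assumes "p \<noteq> q"
  obtains h :: "'a \<Rightarrow> real" where "smooth_function A (\<lambda>x. complex_of_real (h x))" "h p \<noteq> h q"
proof -
  define c where "c = chart_at A p"
  have c: "c \<in> A" "p \<in> chart_dom c" unfolding c_def by (rule chart_at)+
  note ch = is_chartD[OF charts[OF c(1)]]
  let ?T = "chart_map c ` (chart_dom c \<inter> - {q})"
  have "open ?T" by (rule chart_image_open[OF charts[OF c(1)]]) (simp add: open_Compl)
  moreover have "chart_map c p \<in> ?T" using c assms by blast
  ultimately obtain r where r: "0 < r" "cball (chart_map c p) r \<subseteq> ?T"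
    using open_contains_cball by blast
  let ?B = "cball (chart_map c p) r"
  have BD: "?B \<subseteq> chart_map c ` chart_dom c" using r(2) by blast
  define K where "K = chart_inv c ` ?B"
  have "compact ?B" by (rule compact_finite_dim) simp_all
  hence K: "closed K"
    unfolding K_def by (intro compact_imp_closed compact_continuous_image continuous_on_subset[OF ch(7) BD])
  define h where "h x = (if x \<in> chart_dom c then bump (chart_map c p) r (chart_map c x) else 0)" for x
  have out: "h x = 0" if "x \<in> chart_dom c \<Longrightarrow> chart_map c x \<notin> ?B" for x
    using that r(1) by (auto simp: h_def dist_norm norm_minus_commute intro!: bump_outside)
  have "h p > 0" using c(2) r(1) by (simp add: h_def bump_pos)
  moreover have "h q = 0"
  proof (rule out)
    assume q: "q \<in> chart_dom c"
    show "chart_map c q \<notin> ?B"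
    proof
      assume "chart_map c q \<in> ?B"
      then obtain y where y: "y \<in> chart_dom c" "y \<noteq> q" "chart_map c q = chart_map c y" using r(2) by blast
      thus False using ch(3)[OF q] ch(3)[OF y(1)] by simp
    qed
  qed
  moreover have "smooth_function A (\<lambda>x. complex_of_real (h x))"
  proof (rule smooth_functionI, rule smooth_on_local)
    fix c' x' assume c': "c' \<in> A" and "x' \<in> chart_map c' ` chart_dom c'"
    then obtain y where y: "y \<in> chart_dom c'" "x' = chart_map c' y" by blast
    note ch' = is_chartD[OF charts[OF c']]
    show "\<exists>U. open U \<and> x' \<in> U \<and> smooth_on U ((\<lambda>x. complex_of_real (h x)) \<circ> chart_inv c')"
    proof (cases "y \<in> chart_dom c")
      case True
      let ?S = "chart_map c' ` (chart_dom c' \<inter> chart_dom c)"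
      have S: "open ?S" by (rule chart_image_open[OF charts[OF c'] ch(1)])
      have "smooth_on ?S (\<lambda>x. bump (chart_map c p) r ((chart_map c \<circ> chart_inv c') x))"
        by (rule smooth_on_compose[OF S open_UNIV _ smooth_on_bump transition_smooth[OF c' c(1)]]) simp
      hence "smooth_on ?S (\<lambda>x. complex_of_real (bump (chart_map c p) r ((chart_map c \<circ> chart_inv c') x)))"
        unfolding smooth_on_def using Ck_on_linear_compose[OF bounded_linear_of_real S] by blast
      hence "smooth_on ?S ((\<lambda>x. complex_of_real (h x)) \<circ> chart_inv c')"
        by (rule smooth_on_cong[OF S, rotated]) (auto simp: h_def ch'(3))
      thus ?thesis using S y True by blast
    next
      case False
      let ?S = "chart_map c' ` (chart_dom c' \<inter> - K)"
      have S: "open ?S" by (rule chart_image_open[OF charts[OF c']]) (use K in \<open>simp add: open_Compl\<close>)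
      have "smooth_on ?S (\<lambda>x. 0 :: complex)" by (rule smooth_onI) (rule Ck_on_const)
      hence "smooth_on ?S ((\<lambda>x. complex_of_real (h x)) \<circ> chart_inv c')"
      proof (rule smooth_on_cong[OF S, rotated])
        fix x assume "x \<in> ?S"
        then obtain z where z: "z \<in> chart_dom c'" "z \<notin> K" "x = chart_map c' z" by blast
        have "h z = 0"
        proof (rule out)
          assume "z \<in> chart_dom c"
          from ch(3)[OF this] z(2) show "chart_map c z \<notin> ?B" unfolding K_def by (metis imageI)
        qed
        thus "0 = ((\<lambda>x. complex_of_real (h x)) \<circ> chart_inv c') x" by (simp add: z(3) ch'(3)[OF z(1)])
      qed
      moreover have "y \<notin> K" using False BD ch(5) unfolding K_def by blast
      ultimately show ?thesis using S y by blast
    qed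
  qed
  ultimately show thesis using that[of h] by simp
qed

text \<open>The real Stone-Weierstrass theorem, applied separately to the real and the imaginary
  part.\<close>

lemma CI_dense: "closure CI = UNIV"
proof (intro equalityI subset_UNIV subsetI)
  fix f :: "'a \<Rightarrow>\<^sub>C complex"
  define P where "P h \<longleftrightarrow> smooth_function A (\<lambda>p. complex_of_real (h p))" for h
  have approx: "\<exists>g. P g \<and> (\<forall>x\<in>UNIV. \<bar>h x - g x\<bar> < e)" if "continuous_on UNIV h" "0 < e" for h :: "'a \<Rightarrow> real" and e
  proof (rule Stone_Weierstrass_HOL[OF compact])
    show "P (\<lambda>x. k)" for k unfolding P_def by (rule smooth_function_const)
    show "continuous_on UNIV g" if "P g" for g
      using continuous_on_Re[OF smooth_function_continuous[OF that[unfolded P_def]]] by simp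
    show "P (\<lambda>x. g x + k x)" if "P g \<and> P k" for g k
      using smooth_function_add[of "\<lambda>x. complex_of_real (g x)" "\<lambda>x. complex_of_real (k x)"] that by (simp add: P_def)
    show "P (\<lambda>x. g x * k x)" if "P g \<and> P k" for g k
      using smooth_function_bilinear[OF bounded_bilinear_mult, of "\<lambda>x. complex_of_real (g x)" "\<lambda>x. complex_of_real (k x)"] that
      by (simp add: P_def)
    show "\<exists>g. P g \<and> g x \<noteq> g y" if "x \<in> UNIV \<and> y \<in> UNIV \<and> x \<noteq> y" for x y
      using separating_smooth_function[of x y] that unfolding P_def by metis
  qed (use that in auto)
  show "f \<in> closure CI"
    unfolding closure_approachable
  proof (intro allI impI)
    fix e :: real assume "0 < e"
    hence e: "0 < e / 4" by simp
    have cf: "continuous_on UNIV (apply_bcontfun f)" using apply_bcontfun[of f] by (simp add: bcontfun_def)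
    obtain g where g: "P g" "\<And>x. \<bar>Re (apply_bcontfun f x) - g x\<bar> < e / 4"
      using approx[OF continuous_on_Re[OF cf] e] by auto
    obtain h where h: "P h" "\<And>x. \<bar>Im (apply_bcontfun f x) - h x\<bar> < e / 4"
      using approx[OF continuous_on_Im[OF cf] e] by auto
    define F where "F = (\<lambda>x. complex_of_real (g x) + \<i> * complex_of_real (h x))"
    have sF: "smooth_function A F"
      unfolding F_def using g(1) h(1)
      by (intro smooth_function_add smooth_function_linear[OF bounded_linear_mult_right]) (simp_all add: P_def)
    have F: "apply_bcontfun (Bcontfun F) = F"
      by (rule Bcontfun_inverse[OF bcontfun_of_continuous[OF smooth_function_continuous[OF sF]]])
    have "dist (Bcontfun F) f \<le> e / 2"
    proof (rule dist_bound)
      fix x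
      have "cmod (F x - apply_bcontfun f x) \<le> \<bar>Re (F x - apply_bcontfun f x)\<bar> + \<bar>Im (F x - apply_bcontfun f x)\<bar>"
        by (rule cmod_le)
      also have "\<dots> \<le> e / 2" using g(2)[of x] h(2)[of x] by (simp add: F_def abs_minus_commute)
      finally show "dist (apply_bcontfun (Bcontfun F) x) (apply_bcontfun f x) \<le> e / 2" by (simp add: F dist_norm)
    qed
    moreover have "Bcontfun F \<in> CI" using sF by (simp add: smooth_bcontfuns_def F)
    ultimately show "\<exists>y\<in>CI. dist y f < e" using e by (intro bexI[of _ "Bcontfun F"]) auto
  qed
qed

end

subsection \<open>Convergence of smooth maps with their first derivatives\<close>

context riemannian
begin

text \<open>Limits are taken jointly in the index, the point and, for Jacobians, the vector. This
  encodes locally uniform convergence in a form for which composition of maps is mere substitution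
  of limits.\<close>

definition C1_lim :: "'i filter \<Rightarrow> ('i \<Rightarrow> 'a \<Rightarrow> 'a) \<Rightarrow> ('a \<Rightarrow> 'a) \<Rightarrow> bool"
  where "C1_lim F \<phi> \<phi>0 \<longleftrightarrow> (\<forall>i. \<phi> i \<in> smooth_maps A) \<and> \<phi>0 \<in> smooth_maps A \<and>
    (\<forall>p0. ((\<lambda>(i, p). \<phi> i p) \<longlongrightarrow> \<phi>0 p0) (F \<times>\<^sub>F nhds p0)) \<and>
    (\<forall>c\<in>A. \<forall>c'\<in>A. \<forall>p0\<in>chart_dom c. \<phi>0 p0 \<in> chart_dom c' \<longrightarrow>
      (\<forall>v0. ((\<lambda>(i, p, v). jacobian c c' (\<phi> i) p v) \<longlongrightarrow> jacobian c c' \<phi>0 p0 v0) (F \<times>\<^sub>F (nhds p0 \<times>\<^sub>F nhds v0))))"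

lemma C1_limD:
  assumes "C1_lim F \<phi> \<phi>0"
  shows "\<phi> i \<in> smooth_maps A" "\<phi>0 \<in> smooth_maps A"
  using assms by (simp_all add: C1_lim_def)

lemma C1_lim_tendsto:
  assumes "C1_lim F \<phi> \<phi>0" "filterlim I F G" "(P \<longlongrightarrow> p0) G"
  shows "((\<lambda>j. \<phi> (I j) (P j)) \<longlongrightarrow> \<phi>0 p0) G"
proof -
  have "filterlim (\<lambda>(i, p). \<phi> i p) (nhds (\<phi>0 p0)) (F \<times>\<^sub>F nhds p0)" using assms(1) by (simp add: C1_lim_def)
  from filterlim_compose[OF this filterlim_Pair[OF assms(2,3)]] show ?thesis by simp
qed

lemma C1_lim_jacobian_tendsto:
  assumes "C1_lim F \<phi> \<phi>0" "filterlim I F G" "(P \<longlongrightarrow> p0) G" "(V \<longlongrightarrow> v0) G"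
    and "c \<in> A" "c' \<in> A" "p0 \<in> chart_dom c" "\<phi>0 p0 \<in> chart_dom c'"
  shows "((\<lambda>j. jacobian c c' (\<phi> (I j)) (P j) (V j)) \<longlongrightarrow> jacobian c c' \<phi>0 p0 v0) G"
proof -
  have "filterlim (\<lambda>(i, p, v). jacobian c c' (\<phi> i) p v) (nhds (jacobian c c' \<phi>0 p0 v0)) (F \<times>\<^sub>F (nhds p0 \<times>\<^sub>F nhds v0))"
    using assms(1,5-8) by (simp add: C1_lim_def)
  from filterlim_compose[OF this filterlim_Pair[OF assms(2) filterlim_Pair[OF assms(3,4)]]] show ?thesis by simp
qed

text \<open>The chain rule through a chart at the limit point \<open>\<omega>0 p0\<close>. All
  moving points eventually lie in the chosen charts, so the product formula for Jacobians holds
  eventually.\<close>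

lemma C1_lim_compose:
  assumes \<phi>: "C1_lim F \<phi> \<phi>0" and \<omega>: "C1_lim F \<omega> \<omega>0"
  shows "C1_lim F (\<lambda>i p. \<phi> i (\<omega> i p)) (\<lambda>p. \<phi>0 (\<omega>0 p))"
  unfolding C1_lim_def
proof (intro conjI allI ballI impI)
  show "(\<lambda>p. \<phi> i (\<omega> i p)) \<in> smooth_maps A" for i by (rule smooth_maps_compose[OF C1_limD(1)[OF \<phi>] C1_limD(1)[OF \<omega>]])
  show "(\<lambda>p. \<phi>0 (\<omega>0 p)) \<in> smooth_maps A" by (rule smooth_maps_compose[OF C1_limD(2)[OF \<phi>] C1_limD(2)[OF \<omega>]])
  show "((\<lambda>(i, p). \<phi> i (\<omega> i p)) \<longlongrightarrow> \<phi>0 (\<omega>0 p0)) (F \<times>\<^sub>F nhds p0)" for p0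
    unfolding case_prod_unfold
    by (rule C1_lim_tendsto[OF \<phi> filterlim_fst C1_lim_tendsto[OF \<omega> filterlim_fst filterlim_snd]])
  fix c c'' p0 and v0 :: 'e assume c: "c \<in> A" "c'' \<in> A" "p0 \<in> chart_dom c" "\<phi>0 (\<omega>0 p0) \<in> chart_dom c''"
  define c' where "c' = chart_at A (\<omega>0 p0)"
  have c': "c' \<in> A" "\<omega>0 p0 \<in> chart_dom c'" unfolding c'_def by (rule chart_at)+
  let ?G = "F \<times>\<^sub>F (nhds p0 \<times>\<^sub>F nhds v0)"
  have lim: "filterlim fst F ?G" "((\<lambda>j. fst (snd j)) \<longlongrightarrow> p0) ?G" "((\<lambda>j. snd (snd j)) \<longlongrightarrow> v0) ?G"
    by (rule filterlim_fst, rule filterlim_compose[OF filterlim_fst filterlim_snd],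
        rule filterlim_compose[OF filterlim_snd filterlim_snd])
  have lim\<omega>: "((\<lambda>j. \<omega> (fst j) (fst (snd j))) \<longlongrightarrow> \<omega>0 p0) ?G" by (rule C1_lim_tendsto[OF \<omega> lim(1,2)])
  have J\<omega>: "((\<lambda>j. jacobian c c' (\<omega> (fst j)) (fst (snd j)) (snd (snd j))) \<longlongrightarrow> jacobian c c' \<omega>0 p0 v0) ?G"
    by (rule C1_lim_jacobian_tendsto[OF \<omega> lim c(1) c'(1) c(3) c'(2)])
  have "((\<lambda>j. jacobian c' c'' (\<phi> (fst j)) (\<omega> (fst j) (fst (snd j)))
      (jacobian c c' (\<omega> (fst j)) (fst (snd j)) (snd (snd j)))) \<longlongrightarrow> jacobian c' c'' \<phi>0 (\<omega>0 p0) (jacobian c c' \<omega>0 p0 v0)) ?G"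
    by (rule C1_lim_jacobian_tendsto[OF \<phi> lim(1) lim\<omega> J\<omega> c'(1) c(2) c'(2) c(4)])
  moreover have "eventually (\<lambda>j. jacobian c' c'' (\<phi> (fst j)) (\<omega> (fst j) (fst (snd j)))
      (jacobian c c' (\<omega> (fst j)) (fst (snd j)) (snd (snd j)))
      = jacobian c c'' (\<lambda>p. \<phi> (fst j) (\<omega> (fst j) p)) (fst (snd j)) (snd (snd j))) ?G"
    using eventually_chart_dom[OF charts[OF c(1)] c(3) lim(2)]
      eventually_chart_dom[OF charts[OF c'(1)] c'(2) lim\<omega>]
      eventually_chart_dom[OF charts[OF c(2)] c(4) C1_lim_tendsto[OF \<phi> lim(1) lim\<omega>]]
  proof eventually_elim
    case (elim j)
    show ?case
      by (rule jacobian_compose[OF C1_limD(1)[OF \<phi>] C1_limD(1)[OF \<omega>] c(1) c'(1) c(2) elim, symmetric])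
  qed
  ultimately have "((\<lambda>j. jacobian c c'' (\<lambda>p. \<phi> (fst j) (\<omega> (fst j) p)) (fst (snd j)) (snd (snd j)))
      \<longlongrightarrow> jacobian c' c'' \<phi>0 (\<omega>0 p0) (jacobian c c' \<omega>0 p0 v0)) ?G"
    by (rule Lim_transform_eventually)
  thus "((\<lambda>(i, p, v). jacobian c c'' (\<lambda>p. \<phi> i (\<omega> i p)) p v) \<longlongrightarrow> jacobian c c'' (\<lambda>p. \<phi>0 (\<omega>0 p)) p0 v0) ?G"
    unfolding case_prod_unfold
      jacobian_compose[OF C1_limD(2)[OF \<phi>] C1_limD(2)[OF \<omega>] c(1) c'(1) c(2) c(3) c'(2) c(4)] .
qed

lemma jacobian_tendsto:
  assumes \<phi>: "\<phi> \<in> smooth_maps A" and c: "c \<in> A" "c' \<in> A" "p0 \<in> chart_dom c" "\<phi> p0 \<in> chart_dom c'"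
    and P: "(P \<longlongrightarrow> p0) G" and V: "(V \<longlongrightarrow> v0) G"
  shows "((\<lambda>j. jacobian c c' \<phi> (P j) (V j)) \<longlongrightarrow> jacobian c c' \<phi> p0 v0) G"
proof (rule tendsto_linear_apply[OF _ jacobian_linear[OF \<phi> c] _ V])
  note op = smooth_map_domain_open[OF smooth_mapsD(1)[OF \<phi>] c(1,2)]
  have dom: "eventually (\<lambda>j. P j \<in> chart_dom c \<inter> \<phi> -` chart_dom c') G"
    using topological_tendstoD[OF P op(1)] c by simp
  thus "eventually (\<lambda>j. linear (jacobian c c' \<phi> (P j))) G"
    by eventually_elim (use jacobian_linear[OF \<phi> c(1,2)] in auto)
  fix b
  have "isCont (\<lambda>x. frechet_derivative (chart_map c' \<circ> \<phi> \<circ> chart_inv c) (at x) b) (chart_map c p0)"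
    using smooth_on_derivative_continuous[OF smooth_mapsD(2)[OF \<phi> c(1,2)]] op(2) c(3,4)
    by (subst (asm) continuous_on_eq_continuous_at) auto
  from isCont_tendsto_compose[OF this chart_map_tendsto[OF charts[OF c(1)] c(3) P]]
  show "((\<lambda>j. jacobian c c' \<phi> (P j) b) \<longlongrightarrow> jacobian c c' \<phi> p0 b) G" by (simp add: jacobian_def)
qed

lemma C1_lim_const:
  assumes \<phi>: "\<phi> \<in> smooth_maps A"
  shows "C1_lim F (\<lambda>i. \<phi>) \<phi>"
  unfolding C1_lim_def
proof (intro conjI allI ballI impI \<phi>)
  show "((\<lambda>(i, p). \<phi> p) \<longlongrightarrow> \<phi> p0) (F \<times>\<^sub>F nhds p0)" for p0
  proof -
    have "isCont \<phi> p0" using smooth_mapsD(1)[OF \<phi>] by (simp add: continuous_on_eq_continuous_at)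
    from isCont_tendsto_compose[OF this filterlim_snd] show ?thesis by (simp add: case_prod_unfold)
  qed
  fix c c' p0 and v0 :: 'e assume c: "c \<in> A" "c' \<in> A" "p0 \<in> chart_dom c" "\<phi> p0 \<in> chart_dom c'"
  show "((\<lambda>(i, p, v). jacobian c c' \<phi> p v) \<longlongrightarrow> jacobian c c' \<phi> p0 v0) (F \<times>\<^sub>F (nhds p0 \<times>\<^sub>F nhds v0))"
    unfolding case_prod_unfold
    by (rule jacobian_tendsto[OF \<phi> c filterlim_compose[OF filterlim_fst filterlim_snd] filterlim_compose[OF filterlim_snd filterlim_snd]])
qed

lemma C1_lim_funpow: "C1_lim F \<phi> \<phi>0 \<Longrightarrow> C1_lim F (\<lambda>i. \<phi> i ^^ n) (\<phi>0 ^^ n)"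
proof (induction n)
  case 0
  show ?case using C1_lim_const[OF smooth_maps_id, of F] by (simp add: id_def)
next
  case (Suc n)
  show ?case using C1_lim_compose[OF Suc.prems Suc.IH[OF Suc.prems]] by (simp add: o_def)
qed

lemma jacobian_id:
  assumes "c \<in> A" "p \<in> chart_dom c"
  shows "jacobian c c (\<lambda>p. p) p v = v"
proof -
  note ch = is_chartD[OF charts[OF assms(1)]]
  have "((chart_map c \<circ> (\<lambda>p. p) \<circ> chart_inv c) has_derivative (\<lambda>v. v)) (at (chart_map c p))"
    by (rule has_derivative_transform_within_open[OF has_derivative_ident ch(2)]) (use assms ch(4) in auto)
  from frechet_derivative_at[OF this] show ?thesis unfolding jacobian_def by metis
qed

end

context compact_riemannian
begin

text \<open>A point near \<open>x\<close> and its image eventually share one neighbourhood from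
  \<open>oscillation_local\<close>; going through \<open>x\<close> costs \<open>e / 2\<close>
  twice.\<close>

lemma C1_lim_id_displacement:
  assumes \<phi>: "C1_lim F \<phi> (\<lambda>p. p)" and e: "0 < e"
  shows "eventually (\<lambda>i. \<forall>f\<in>CI. \<forall>p. cmod (apply_bcontfun f (\<phi> i p) - apply_bcontfun f p) \<le> e * LC f) F"
proof -
  have "eventually (\<lambda>i. \<forall>p\<in>UNIV. \<forall>f\<in>CI. cmod (apply_bcontfun f (\<phi> i p) - apply_bcontfun f p) \<le> e * LC f) F"
  proof (rule eventually_compact[OF compact])
    fix x :: 'a
    have e2: "0 < e / 2" using e by simp
    obtain U where U: "open U" "x \<in> U"
      "\<And>f q. f \<in> CI \<Longrightarrow> q \<in> U \<Longrightarrow> cmod (apply_bcontfun f q - apply_bcontfun f x) \<le> e / 2 * LC f"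
      using oscillation_local[OF e2, of x] by metis
    have "eventually (\<lambda>j. \<phi> (fst j) (snd j) \<in> U) (F \<times>\<^sub>F nhds x)"
      by (rule topological_tendstoD[OF C1_lim_tendsto[OF \<phi> filterlim_fst filterlim_snd] U(1,2)])
    moreover have "eventually (\<lambda>j. snd j \<in> U) (F \<times>\<^sub>F nhds x)"
      by (rule topological_tendstoD[OF filterlim_snd U(1,2)])
    ultimately show "eventually (\<lambda>(i, y). \<forall>f\<in>CI. cmod (apply_bcontfun f (\<phi> i y) - apply_bcontfun f y) \<le> e * LC f) (F \<times>\<^sub>F nhds x)"
    proof eventually_elim
      case (elim j)
      have "cmod (apply_bcontfun f (\<phi> (fst j) (snd j)) - apply_bcontfun f (snd j)) \<le> e * LC f" if f: "f \<in> CI" for f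
        using osc_triangle[OF U(3)[OF f elim(1)], of "snd j" "e / 2"] U(3)[OF f elim(2)] by (simp add: norm_minus_commute)
      thus ?case by (simp add: case_prod_unfold)
    qed
  qed
  thus ?thesis by (rule eventually_mono) blast
qed

text \<open>In the limit the Jacobian is the identity, and the inequality is strict on nonzero
  vectors since \<open>(1 + e) ^ 2\<close> exceeds 1; compactness of the sphere makes it hold nearby
  for all directions.\<close>

lemma C1_lim_id_metric:
  assumes \<phi>: "C1_lim F \<phi> (\<lambda>p. p)" and e: "0 < e" and c: "c \<in> A" "x \<in> chart_dom c"
  shows "eventually (\<lambda>j. \<forall>v. m c (\<phi> (fst j) (snd j)) (jacobian c c (\<phi> (fst j)) (snd j) v) (jacobian c c (\<phi> (fst j)) (snd j) v)
    \<le> (1 + e)\<^sup>2 * m c (snd j) v v) (F \<times>\<^sub>F nhds x)"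
proof -
  let ?J = "\<lambda>j. jacobian c c (\<phi> (fst j)) (snd j)"
  let ?P = "\<lambda>j v. m c (\<phi> (fst j) (snd j)) (?J j v) (?J j v) \<le> (1 + e)\<^sup>2 * m c (snd j) v v"
  let ?S = "{v :: 'e. norm v = 1}"
  have "eventually (\<lambda>j. \<forall>v\<in>?S. ?P j v) (F \<times>\<^sub>F nhds x)"
  proof (rule eventually_compact[OF compact_unit_sphere])
    fix v0 :: 'e assume "v0 \<in> ?S"
    hence v0: "v0 \<noteq> 0" by auto
    let ?G = "(F \<times>\<^sub>F nhds x) \<times>\<^sub>F nhds v0"
    have lim: "filterlim (\<lambda>j. fst (fst j)) F ?G" "((\<lambda>j. snd (fst j)) \<longlongrightarrow> x) ?G" "(snd \<longlongrightarrow> v0) ?G"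
      by (rule filterlim_compose[OF filterlim_fst filterlim_fst], rule filterlim_compose[OF filterlim_snd filterlim_fst],
          rule filterlim_snd)
    have J: "((\<lambda>j. ?J (fst j) (snd j)) \<longlongrightarrow> v0) ?G"
      using C1_lim_jacobian_tendsto[OF \<phi> lim c(1) c(1) c(2) c(2)] by (simp add: jacobian_id[OF c])
    have "((\<lambda>j. m c (\<phi> (fst (fst j)) (snd (fst j))) (?J (fst j) (snd j)) (?J (fst j) (snd j))
        - (1 + e)\<^sup>2 * m c (snd (fst j)) (snd j) (snd j)) \<longlongrightarrow> m c x v0 v0 - (1 + e)\<^sup>2 * m c x v0 v0) ?G"
      by (intro tendsto_diff tendsto_mult tendsto_const m_tendsto[OF c C1_lim_tendsto[OF \<phi> lim(1,2)] J] m_tendsto[OF c lim(2,3)])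
    moreover have "m c x v0 v0 - (1 + e)\<^sup>2 * m c x v0 v0 < 0"
    proof -
      have "1 < (1 + e)\<^sup>2" using e by (simp add: power2_eq_square algebra_simps add_pos_pos)
      thus ?thesis using m_pos[OF c v0] by simp
    qed
    ultimately have "eventually (\<lambda>j. m c (\<phi> (fst (fst j)) (snd (fst j))) (?J (fst j) (snd j)) (?J (fst j) (snd j))
        - (1 + e)\<^sup>2 * m c (snd (fst j)) (snd j) (snd j) < 0) ?G"
      by (rule order_tendstoD(2))
    thus "eventually (\<lambda>(j, v). ?P j v) ?G" by (rule eventually_mono) (simp add: case_prod_unfold)
  qed
  moreover have "eventually (\<lambda>j. snd j \<in> chart_dom c) (F \<times>\<^sub>F nhds x)"
    by (rule eventually_chart_dom[OF charts[OF c(1)] c(2) filterlim_snd])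
  moreover have "eventually (\<lambda>j. \<phi> (fst j) (snd j) \<in> chart_dom c) (F \<times>\<^sub>F nhds x)"
    by (rule eventually_chart_dom[OF charts[OF c(1)] c(2) C1_lim_tendsto[OF \<phi> filterlim_fst filterlim_snd]])
  ultimately show ?thesis
  proof eventually_elim
    case (elim j)
    have lin: "linear (?J j)" by (rule jacobian_linear[OF C1_limD(1)[OF \<phi>] c(1) c(1) elim(2,3)])
    have "?P j v" for v
    proof (rule linear_square_bound_sphere[of "\<lambda>v. m c (\<phi> (fst j) (snd j)) (?J j v) (?J j v)" "\<lambda>v. (1 + e)\<^sup>2 * m c (snd j) v v"])
      show "m c (\<phi> (fst j) (snd j)) (?J j (r *\<^sub>R v)) (?J j (r *\<^sub>R v)) = r\<^sup>2 * m c (\<phi> (fst j) (snd j)) (?J j v) (?J j v)" for r v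
        by (simp add: linear_scale[OF lin] m_scale[OF c(1) elim(3)])
      show "(1 + e)\<^sup>2 * m c (snd j) (r *\<^sub>R v) (r *\<^sub>R v) = r\<^sup>2 * ((1 + e)\<^sup>2 * m c (snd j) v v)" for r v
        by (simp add: m_scale[OF c(1) elim(2)])
    qed (use elim(1) in auto)
    thus ?case by blast
  qed
qed

text \<open>\<open>g\<close> is the pullback of \<open>f\<close>, described by its values; this form
  matches the iterated pullbacks of the application. The squared metric estimate is additive in the
  real and imaginary directions, so the complexified norm grows by the same factor.\<close>

lemma C1_lim_id_lipschitz:
  assumes \<phi>: "C1_lim F \<phi> (\<lambda>p. p)" and e: "0 < e"
  shows "eventually (\<lambda>i. \<forall>f\<in>CI. \<forall>g\<in>CI. (\<forall>p. apply_bcontfun g p = apply_bcontfun f (\<phi> i p)) \<longrightarrow> LC g \<le> (1 + e) * LC f) F"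
proof -
  \<comment> \<open>One chart has to contain both the point and its image, for only then can the
    Jacobian be compared with the identity.\<close>
  define Q where "Q i y \<longleftrightarrow> (\<exists>c\<in>A. y \<in> chart_dom c \<and> \<phi> i y \<in> chart_dom c \<and>
    (\<forall>v. m c (\<phi> i y) (jacobian c c (\<phi> i) y v) (jacobian c c (\<phi> i) y v) \<le> (1 + e)\<^sup>2 * m c y v v))" for i y
  have "eventually (\<lambda>i. \<forall>y\<in>UNIV. Q i y) F"
  proof (rule eventually_compact[OF compact])
    fix x :: 'a
    note c = chart_at[of x]
    have "eventually (\<lambda>j. snd j \<in> chart_dom (chart_at A x)) (F \<times>\<^sub>F nhds x)"
      by (rule eventually_chart_dom[OF charts[OF c(1)] c(2) filterlim_snd])
    moreover have "eventually (\<lambda>j. \<phi> (fst j) (snd j) \<in> chart_dom (chart_at A x)) (F \<times>\<^sub>F nhds x)"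
      by (rule eventually_chart_dom[OF charts[OF c(1)] c(2) C1_lim_tendsto[OF \<phi> filterlim_fst filterlim_snd]])
    ultimately show "eventually (\<lambda>(i, y). Q i y) (F \<times>\<^sub>F nhds x)"
      using C1_lim_id_metric[OF \<phi> e c]
    proof eventually_elim
      case (elim j)
      show ?case unfolding case_prod_unfold Q_def
        by (rule bexI[OF _ c(1)], intro conjI, rule elim(1), rule elim(2), rule elim(3))
    qed
  qed
  thus ?thesis
  proof eventually_elim
    case (elim i)
    show ?case
    proof (intro ballI impI)
      fix f g assume f: "f \<in> CI" and g: "g \<in> CI" and fg: "\<forall>p. apply_bcontfun g p = apply_bcontfun f (\<phi> i p)"
      hence fg': "apply_bcontfun g = (\<lambda>p. apply_bcontfun f (\<phi> i p))" by auto
      show "LC g \<le> (1 + e) * LC f"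
      proof (rule LC_leI[OF g])
        show "0 \<le> (1 + e) * LC f" using e LC_nonneg[OF f] by simp
        fix p
        obtain c where c: "c \<in> A" "p \<in> chart_dom c" "\<phi> i p \<in> chart_dom c"
          and M: "\<And>v. m c (\<phi> i p) (jacobian c c (\<phi> i) p v) (jacobian c c (\<phi> i) p v) \<le> (1 + e)\<^sup>2 * m c p v v"
          using elim unfolding Q_def by blast
        have "cmod (dchart c (apply_bcontfun g) p v + \<i> * dchart c (apply_bcontfun g) p w)
            \<le> (1 + e) * LC f * sqrt (m c p v v + m c p w w)" for v w
        proof -
          let ?J = "jacobian c c (\<phi> i) p"
          have "cmod (dchart c (apply_bcontfun g) p v + \<i> * dchart c (apply_bcontfun g) p w)
              = cmod (dchart c (apply_bcontfun f) (\<phi> i p) (?J v) + \<i> * dchart c (apply_bcontfun f) (\<phi> i p) (?J w))"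
            unfolding fg' dchart_compose[OF CI_smooth[OF f] C1_limD(1)[OF \<phi>] c(1) c(1) c(2) c(3)] ..
          also have "\<dots> \<le> LC f * sqrt (m c (\<phi> i p) (?J v) (?J v) + m c (\<phi> i p) (?J w) (?J w))"
            by (rule dchart_pair_le_LC[OF f c(1,3)])
          also have "\<dots> \<le> LC f * sqrt ((1 + e)\<^sup>2 * (m c p v v + m c p w w))"
            using M[of v] M[of w] by (intro mult_left_mono LC_nonneg[OF f] real_sqrt_le_mono) (simp add: distrib_left)
          also have "\<dots> = (1 + e) * LC f * sqrt (m c p v v + m c p w w)"
            using e by (simp add: real_sqrt_mult)
          finally show ?thesis .
        qed
        thus "\<exists>c\<in>A. p \<in> chart_dom c \<and> (\<forall>v w. cmod (dchart c (apply_bcontfun g) p v + \<i> * dchart c (apply_bcontfun g) p w)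
            \<le> (1 + e) * LC f * sqrt (m c p v v + m c p w w))" using c by blast
      qed
    qed
  qed
qed

end

subsection \<open>The Whitney topology\<close>

context riemannian
begin

text \<open>Whitney neighbourhoods admit all coordinate charts. Restricting the target chart to
  \<open>V\<close> is the device that forces images of \<open>K\<close> into a prescribed open
  set.\<close>

lemma restricted_chart:
  assumes c: "c \<in> A" and V: "open V" "V \<subseteq> chart_dom c"
  shows "(V, chart_map c) \<in> coordinate_charts A"
proof -
  note ch = is_chartD[OF charts[OF c]]
  have inj: "inj_on (chart_map c) V"
    by (rule inj_on_subset[OF inj_on_inverseI V(2)]) (rule ch(3))
  have inv: "chart_inv (V, chart_map c) (chart_map c p) = p" if "p \<in> V" for p
    unfolding chart_inv_def using inv_into_f_f[OF inj that] by simp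
  have op: "open (chart_map c ` V)"
    using chart_image_open[OF charts[OF c] V(1)] V(2) by (simp add: Int_absorb1)
  have "homeomorphism V (chart_map c ` V) (chart_map c) (chart_inv (V, chart_map c))"
    unfolding homeomorphism_def
  proof (intro conjI ballI)
    show "continuous_on V (chart_map c)" by (rule continuous_on_subset[OF ch(6) V(2)])
    have "continuous_on (chart_map c ` V) (chart_inv c)"
      by (rule continuous_on_subset[OF ch(7) image_mono[OF V(2)]])
    thus "continuous_on (chart_map c ` V) (chart_inv (V, chart_map c))"
      by (rule continuous_on_eq) (use inv ch(3) V(2) in auto)
  qed (use inv in \<open>auto simp: image_image\<close>)
  hence "is_chart (V, chart_map c)" using V(1) op by (simp add: is_chart_def)
  moreover have "compatible_charts (V, chart_map c) c'" if c': "c' \<in> A" for c'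
    unfolding compatible_charts_def fst_conv snd_conv
  proof
    have S: "open (chart_map c ` (V \<inter> chart_dom c'))"
      using chart_image_open[OF charts[OF c] open_Int[OF V(1) is_chartD(1)[OF charts[OF c']]]] V(2)
      by (simp add: Int_absorb1 le_infI1)
    have "smooth_on (chart_map c ` (V \<inter> chart_dom c')) (chart_map c' \<circ> chart_inv c)"
      by (rule smooth_on_subset[OF _ transition_smooth[OF c c']]) (use V(2) in blast)
    thus "smooth_on (chart_map c ` (V \<inter> chart_dom c')) (chart_map c' \<circ> chart_inv (V, chart_map c))"
      by (rule smooth_on_cong[OF S, rotated]) (use V(2) in \<open>auto simp: inv ch(3)\<close>)
    show "smooth_on (chart_map c' ` (V \<inter> chart_dom c')) (chart_map c \<circ> chart_inv c')"
      by (rule smooth_on_subset[OF _ transition_smooth[OF c' c]]) (use V(2) in blast)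
  qed
  ultimately show ?thesis by (simp add: coordinate_charts_def)
qed

lemma atlas_coordinate_chart: "c \<in> A \<Longrightarrow> c \<in> coordinate_charts A"
  using restricted_chart[of c "chart_dom c"] is_chartD(1)[OF charts] by simp

lemma compact_neighbourhood:
  assumes c: "c \<in> A" "p0 \<in> chart_dom c" and W: "open W" "p0 \<in> W"
  obtains K where "compact K" "K \<subseteq> chart_dom c \<inter> W" "eventually (\<lambda>p. p \<in> K) (nhds p0)"
proof -
  note ch = is_chartD[OF charts[OF c(1)]]
  have "open (chart_map c ` (chart_dom c \<inter> W))" by (rule chart_image_open[OF charts[OF c(1)] W(1)])
  moreover have "chart_map c p0 \<in> chart_map c ` (chart_dom c \<inter> W)" using c W by blast
  ultimately obtain r where r: "0 < r" "cball (chart_map c p0) r \<subseteq> chart_map c ` (chart_dom c \<inter> W)"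
    using open_contains_cball by blast
  let ?B = "cball (chart_map c p0) r"
  have BD: "?B \<subseteq> chart_map c ` chart_dom c" using r(2) by blast
  have "compact ?B" by (rule compact_finite_dim) simp_all
  hence "compact (chart_inv c ` ?B)"
    by (intro compact_continuous_image continuous_on_subset[OF ch(7) BD])
  moreover have "chart_inv c ` ?B \<subseteq> chart_dom c \<inter> W"
  proof
    fix y assume "y \<in> chart_inv c ` ?B"
    then obtain p where "p \<in> chart_dom c" "p \<in> W" "y = chart_inv c (chart_map c p)" using r(2) by blast
    thus "y \<in> chart_dom c \<inter> W" by (simp add: ch(3))
  qed
  moreover have "eventually (\<lambda>p. p \<in> chart_inv c ` ?B) (nhds p0)"
  proof -
    have "chart_dom c \<inter> chart_map c -` ball (chart_map c p0) r \<subseteq> chart_inv c ` ?B"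
    proof
      fix p assume p: "p \<in> chart_dom c \<inter> chart_map c -` ball (chart_map c p0) r"
      hence "chart_map c p \<in> ?B" by auto
      hence "chart_inv c (chart_map c p) \<in> chart_inv c ` ?B" by (rule imageI)
      thus "p \<in> chart_inv c ` ?B" using p by (simp add: ch(3))
    qed
    moreover have "open (chart_dom c \<inter> chart_map c -` ball (chart_map c p0) r)"
      by (rule chart_preimage_open[OF charts[OF c(1)]]) simp
    ultimately show ?thesis
      unfolding eventually_nhds using c(2) r(1)
      by (intro exI[of _ "chart_dom c \<inter> chart_map c -` ball (chart_map c p0) r"]) auto
  qed
  ultimately show thesis by (rule that)
qed

definition jacobian_sup :: "('a, 'e) chart \<Rightarrow> ('a, 'e) chart \<Rightarrow> 'a set \<Rightarrow> ('a \<Rightarrow> 'a) \<Rightarrow> ('a \<Rightarrow> 'a) \<Rightarrow> ennreal"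
  where "jacobian_sup c c' K f g = (SUP p\<in>K. ennreal (onorm (\<lambda>v. jacobian c c' f p v - jacobian c c' g p v)))"

lemma jacobian_diff_bounded_linear:
  assumes "f \<in> smooth_maps A" "g \<in> smooth_maps A" "c \<in> A" "c' \<in> A" "p \<in> chart_dom c" "f p \<in> chart_dom c'" "g p \<in> chart_dom c'"
  shows "bounded_linear (\<lambda>v. jacobian c c' f p v - jacobian c c' g p v)"
  by (intro bounded_linear_sub linear_bounded_linear jacobian_linear assms)

lemma jacobian_sup_triangle:
  assumes f: "f \<in> smooth_maps A" "g \<in> smooth_maps A" "h \<in> smooth_maps A" and c: "c \<in> A" "c' \<in> A" "K \<subseteq> chart_dom c"
    and K: "f ` K \<subseteq> chart_dom c'" "g ` K \<subseteq> chart_dom c'" "h ` K \<subseteq> chart_dom c'"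
  shows "jacobian_sup c c' K f h \<le> jacobian_sup c c' K f g + jacobian_sup c c' K g h"
  unfolding jacobian_sup_def[of c c' K f h]
proof (rule SUP_least)
  fix p assume p: "p \<in> K"
  have dom: "p \<in> chart_dom c" "f p \<in> chart_dom c'" "g p \<in> chart_dom c'" "h p \<in> chart_dom c'" using p c(3) K by auto
  let ?J = "\<lambda>f. jacobian c c' f p"
  note bl = jacobian_diff_bounded_linear[OF f(1,2) c(1,2) dom(1,2,3)] jacobian_diff_bounded_linear[OF f(2,3) c(1,2) dom(1,3,4)]
  have "onorm (\<lambda>v. ?J f v - ?J h v) \<le> onorm (\<lambda>v. ?J f v - ?J g v) + onorm (\<lambda>v. ?J g v - ?J h v)"
    using onorm_triangle[OF bl] by simp
  hence "ennreal (onorm (\<lambda>v. ?J f v - ?J h v)) \<le> ennreal (onorm (\<lambda>v. ?J f v - ?J g v)) + ennreal (onorm (\<lambda>v. ?J g v - ?J h v))"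
    by (subst ennreal_plus[symmetric]) (auto intro: onorm_pos_le bl simp del: ennreal_plus intro!: ennreal_leI)
  also have "\<dots> \<le> jacobian_sup c c' K f g + jacobian_sup c c' K g h"
    unfolding jacobian_sup_def by (intro add_mono SUP_upper p)
  finally show "ennreal (onorm (\<lambda>v. ?J f v - ?J h v)) \<le> jacobian_sup c c' K f g + jacobian_sup c c' K g h" .
qed

text \<open>Shrinking the domain of the target chart makes the uniform closeness condition of the Whitney
  neighbourhoods superfluous.\<close>

lemma whitney_open_basic:
  assumes f: "f \<in> smooth_maps A" and c: "c \<in> A" "c' \<in> A" and K: "compact K" "K \<subseteq> chart_dom c"
    and V: "open V" "V \<subseteq> chart_dom c'" "f ` K \<subseteq> V"
  shows "whitney_open A m {g \<in> smooth_maps A. g ` K \<subseteq> V \<and> jacobian_sup c c' K f g < ennreal e}"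
  unfolding whitney_open_def
proof (intro conjI ballI)
  fix g assume "g \<in> {g \<in> smooth_maps A. g ` K \<subseteq> V \<and> jacobian_sup c c' K f g < ennreal e}"
  hence g: "g \<in> smooth_maps A" "g ` K \<subseteq> V" "jacobian_sup c c' K f g < ennreal e" by auto
  then obtain s where s: "0 \<le> s" "jacobian_sup c c' K f g = ennreal s" by (cases "jacobian_sup c c' K f g") auto
  hence se: "s < e" using g(3) by (simp add: ennreal_less_iff)
  \<comment> \<open>The radius is what \<open>g\<close> leaves over of \<open>e\<close>; by the
    triangle inequality the neighbourhood of \<open>g\<close> stays inside the set.\<close>
  let ?W = "whitney_nbhd A m g c (V, chart_map c') K (e - s)"
  have "?W \<in> whitney_nbhds A m g"
    unfolding whitney_nbhds_def mem_Collect_eq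
    by (rule exI[of _ c], rule exI[of _ "(V, chart_map c')"], rule exI[of _ K], rule exI[of _ "e - s"])
      (use atlas_coordinate_chart[OF c(1)] restricted_chart[OF c(2) V(1,2)] K g(2) se in simp)
  moreover have "h \<in> {g \<in> smooth_maps A. g ` K \<subseteq> V \<and> jacobian_sup c c' K f g < ennreal e}" if "h \<in> ?W" for h
  proof -
    have h: "h \<in> smooth_maps A" "h ` K \<subseteq> V" "jacobian_sup c c' K g h < ennreal (e - s)"
      using that by (auto simp: whitney_nbhd_def jacobian_sup_def jacobian_def)
    have "jacobian_sup c c' K f h \<le> jacobian_sup c c' K f g + jacobian_sup c c' K g h"
      by (rule jacobian_sup_triangle[OF f g(1) h(1) c K(2)]) (use V g h in auto)
    also have "\<dots> < ennreal s + ennreal (e - s)" using h(3) by (simp add: s ennreal_add_left_cancel_less)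
    also have "\<dots> = ennreal e" using s se by (simp add: ennreal_plus[symmetric] del: ennreal_plus)
    finally show ?thesis using h by simp
  qed
  ultimately show "\<exists>F. finite F \<and> F \<subseteq> whitney_nbhds A m g \<and>
      smooth_maps A \<inter> \<Inter> F \<subseteq> {g \<in> smooth_maps A. g ` K \<subseteq> V \<and> jacobian_sup c c' K f g < ennreal e}"
    by (intro exI[of _ "{?W}"]) auto
qed auto

text \<open>The sets of \<open>whitney_open_basic\<close> give both halves of the convergence: small
  targets for the points, and small Jacobian differences for the derivatives, after splitting off
  the Jacobian of \<open>\<psi> t0\<close>, which is continuous by itself.\<close>

lemma diffeo_topology_C1_lim:
  fixes \<psi> :: "'t::topological_space \<Rightarrow> 'a \<Rightarrow> 'a"
  assumes cont: "continuous_map euclidean (diffeo_topology A m) \<psi>"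
  shows "\<psi> t \<in> diffeos A" "C1_lim (nhds t0) \<psi> (\<psi> t0)"
proof -
  show diffeo: "\<psi> t \<in> diffeos A" for t
    using continuous_map_funspace[OF cont] unfolding diffeo_topology_def
    by (auto simp: Pi_iff topspace_subtopology)
  have smooth: "\<psi> t \<in> smooth_maps A" for t using diffeo[of t] by (simp add: diffeos_def)
  have ev: "eventually (\<lambda>t. \<psi> t \<in> S) (nhds t0)" if S: "whitney_open A m S" "\<psi> t0 \<in> S" for S
  proof -
    have "openin (diffeo_topology A m) (diffeos A \<inter> S)"
      unfolding diffeo_topology_def using S(1)
      by (intro openin_subtopology_Int2) (simp add: openin_whitney_topology)
    hence "open {t. \<psi> t \<in> diffeos A \<inter> S}"
      using openin_continuous_map_preimage[OF cont, of "diffeos A \<inter> S"] by simp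
    moreover have "t0 \<in> {t. \<psi> t \<in> diffeos A \<inter> S}" using diffeo S(2) by simp
    ultimately have "eventually (\<lambda>t. t \<in> {t. \<psi> t \<in> diffeos A \<inter> S}) (nhds t0)" by (rule eventually_nhds_in_open)
    thus ?thesis by (rule eventually_mono) simp
  qed
  have basic: "eventually (\<lambda>t. \<psi> t ` K \<subseteq> V \<and> jacobian_sup c c' K (\<psi> t0) (\<psi> t) < ennreal e) (nhds t0)"
    if "c \<in> A" "c' \<in> A" "compact K" "K \<subseteq> chart_dom c" "open V" "V \<subseteq> chart_dom c'" "\<psi> t0 ` K \<subseteq> V" "0 < e" for c c' K V e
  proof -
    have "jacobian_sup c c' K (\<psi> t0) (\<psi> t0) \<le> 0"
      unfolding jacobian_sup_def by (rule SUP_least) (simp add: onorm_zero)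
    hence "jacobian_sup c c' K (\<psi> t0) (\<psi> t0) < ennreal e" using that(8) by simp
    from ev[OF whitney_open_basic[OF smooth[of t0] that(1-7), of e]] this that(7) smooth
    show ?thesis by (auto elim: eventually_mono)
  qed
  show "C1_lim (nhds t0) \<psi> (\<psi> t0)"
    unfolding C1_lim_def
  proof (intro conjI allI ballI impI smooth)
    fix p0
    show "((\<lambda>(t, p). \<psi> t p) \<longlongrightarrow> \<psi> t0 p0) (nhds t0 \<times>\<^sub>F nhds p0)"
    proof (rule topological_tendstoI)
      fix N assume N: "open N" "\<psi> t0 p0 \<in> N"
      define V where "V = chart_dom (chart_at A (\<psi> t0 p0)) \<inter> N"
      note c' = chart_at[of "\<psi> t0 p0"]
      have V: "open V" "\<psi> t0 p0 \<in> V" using is_chartD(1)[OF charts[OF c'(1)]] N c'(2) by (auto simp: V_def)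
      obtain K where K: "compact K" "K \<subseteq> chart_dom (chart_at A p0) \<inter> \<psi> t0 -` V" "eventually (\<lambda>p. p \<in> K) (nhds p0)"
        by (rule compact_neighbourhood[OF chart_at open_vimage[OF V(1) smooth_mapsD(1)[OF smooth[of t0]]]]) (use V in auto)
      have "eventually (\<lambda>t. \<psi> t ` K \<subseteq> V \<and> jacobian_sup (chart_at A p0) (chart_at A (\<psi> t0 p0)) K (\<psi> t0) (\<psi> t) < ennreal 1) (nhds t0)"
        by (rule basic[OF chart_at(1) c'(1) K(1) _ V(1)]) (use K in \<open>auto simp: V_def\<close>)
      from eventually_prodI[OF this K(3)]
      show "eventually (\<lambda>x. (case x of (t, p) \<Rightarrow> \<psi> t p) \<in> N) (nhds t0 \<times>\<^sub>F nhds p0)"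
        by (rule eventually_mono) (auto simp: V_def)
    qed
    fix c c' and v0 :: 'e assume c: "c \<in> A" "c' \<in> A" "p0 \<in> chart_dom c" "\<psi> t0 p0 \<in> chart_dom c'"
    let ?G = "nhds t0 \<times>\<^sub>F (nhds p0 \<times>\<^sub>F nhds v0)"
    let ?Jlim = "\<lambda>(t, p, v). jacobian c c' (\<psi> t0) p v" and ?J = "\<lambda>(t, p, v). jacobian c c' (\<psi> t) p v"
    note V = is_chartD(1)[OF charts[OF c(2)]]
    obtain K where K: "compact K" "K \<subseteq> chart_dom c \<inter> \<psi> t0 -` chart_dom c'" "eventually (\<lambda>p. p \<in> K) (nhds p0)"
      by (rule compact_neighbourhood[OF c(1,3) open_vimage[OF V smooth_mapsD(1)[OF smooth[of t0]]]]) (use c(4) in auto)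
    have J0: "(?Jlim \<longlongrightarrow> jacobian c c' (\<psi> t0) p0 v0) ?G"
      unfolding case_prod_unfold
      by (rule jacobian_tendsto[OF smooth c filterlim_compose[OF filterlim_fst filterlim_snd] filterlim_compose[OF filterlim_snd filterlim_snd]])
    have "((\<lambda>x. ?Jlim x - ?J x) \<longlongrightarrow> 0) ?G"
    proof (rule tendstoI)
      fix e :: real assume e: "0 < e"
      \<comment> \<open>The vectors are eventually shorter than \<open>norm v0 + 1\<close>, so an
        operator norm below \<open>d\<close> yields values below \<open>e\<close>.\<close>
      define d where "d = e / (norm v0 + 1)"
      have n: "0 < norm v0 + 1" by (simp add: add_nonneg_pos)
      hence d: "0 < d" "d * (norm v0 + 1) = e" using e by (simp_all add: d_def)
      have e1: "eventually (\<lambda>t. \<psi> t ` K \<subseteq> chart_dom c' \<and> jacobian_sup c c' K (\<psi> t0) (\<psi> t) < ennreal d) (nhds t0)"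
        by (rule basic[OF c(1,2) K(1) _ V]) (use K(2) d in auto)
      have e2: "eventually (\<lambda>v. v \<in> ball v0 1) (nhds v0)" by (rule eventually_nhds_in_open) simp_all
      from eventually_prodI[OF e1 eventually_prodI[OF K(3) e2]]
      show "eventually (\<lambda>x. dist (?Jlim x - ?J x) 0 < e) ?G"
      proof (rule eventually_mono, clarsimp split: prod.splits)
        fix t p v assume *: "\<psi> t ` K \<subseteq> chart_dom c'" "jacobian_sup c c' K (\<psi> t0) (\<psi> t) < ennreal d" "p \<in> K" "dist v0 v < 1"
        have bl: "bounded_linear (\<lambda>v. jacobian c c' (\<psi> t0) p v - jacobian c c' (\<psi> t) p v)"
          by (rule jacobian_diff_bounded_linear[OF smooth smooth c(1,2)]) (use * K(2) in auto)
        have "ennreal (onorm (\<lambda>v. jacobian c c' (\<psi> t0) p v - jacobian c c' (\<psi> t) p v)) \<le> jacobian_sup c c' K (\<psi> t0) (\<psi> t)"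
          unfolding jacobian_sup_def by (rule SUP_upper[OF *(3)])
        hence "onorm (\<lambda>v. jacobian c c' (\<psi> t0) p v - jacobian c c' (\<psi> t) p v) < d"
          using le_less_trans[OF _ *(2)] onorm_pos_le[OF bl] by (metis ennreal_less_iff)
        moreover have "norm v < norm v0 + 1"
          using *(4) norm_triangle_ineq2[of v v0] by (simp add: dist_norm norm_minus_commute)
        ultimately have "onorm (\<lambda>v. jacobian c c' (\<psi> t0) p v - jacobian c c' (\<psi> t) p v) * norm v < d * (norm v0 + 1)"
          by (intro mult_strict_mono' onorm_pos_le[OF bl]) auto
        thus "norm (jacobian c c' (\<psi> t0) p v - jacobian c c' (\<psi> t) p v) < e"
          using onorm[OF bl, of v] d(2) by simp
      qed
    qed
    from tendsto_diff[OF J0 this] have "((\<lambda>x. ?Jlim x - (?Jlim x - ?J x)) \<longlongrightarrow> jacobian c c' (\<psi> t0) p0 v0 - 0) ?G" .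
    moreover have "(\<lambda>x. ?Jlim x - (?Jlim x - ?J x)) = ?J" by (rule ext) simp
    ultimately show "(?J \<longlongrightarrow> jacobian c c' (\<psi> t0) p0 v0) ?G" by simp
  qed
qed

end

subsection \<open>Continuity of the family\<close>

context compact_riemannian
begin

lemma lip_functions_smooth:
  assumes "order_preserving_norm nrm"
  obtains D where "lip_functions CI LC nrm D"
proof (rule diameter)
  fix D assume D: "0 \<le> D" "\<And>f p q. f \<in> CI \<Longrightarrow> cmod (apply_bcontfun f p - apply_bcontfun f q) \<le> D * LC f"
  have "lip_functions CI LC nrm D"
    by unfold_locales (fact CI_add CI_cmult CI_const CI_cnj LC_nonneg LC_add LC_cmult LC_const CI_dense D CI_tot_bdd assms)+
  thus thesis by (rule that)
qed

lemma CI_pullback: "\<phi> \<in> smooth_maps A \<Longrightarrow> f \<in> CI \<Longrightarrow> pullback \<phi> f \<in> CI"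
proof -
  assume \<phi>: "\<phi> \<in> smooth_maps A" and "f \<in> CI"
  have "apply_bcontfun (pullback \<phi> f) = (\<lambda>p. apply_bcontfun f (\<phi> p))"
    using pullback_apply[OF smooth_mapsD(1)[OF \<phi>]] by auto
  thus ?thesis using smooth_function_compose[OF CI_smooth[OF \<open>f \<in> CI\<close>] \<phi>] by (simp add: smooth_bcontfuns_def)
qed

lemma lip_system_diffeo:
  assumes "lip_functions CI LC nrm D" "\<phi> \<in> diffeos A"
  shows "lip_system CI LC nrm D \<phi>"
proof -
  have "\<phi> \<in> smooth_maps A" "inv \<phi> \<in> smooth_maps A" "bij \<phi>" using assms(2) by (auto simp: diffeos_def)
  thus ?thesis
    using assms(1) CI_pullback smooth_mapsD(1)
    by (simp add: lip_system_def lip_system_axioms_def homeo_system_def)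
qed

lemma inv_funpow:
  assumes "bij f"
  shows "(f ^^ n) ((inv f ^^ n) x) = x" "(inv f ^^ n) ((f ^^ n) x) = x"
  by (simp_all add: bij_imp_bij_inv inv_fn[OF assms, symmetric] bij_fn[OF assms] bij_is_surj surj_f_inv_f bij_is_inj assms)

lemma C1_lim_close:
  assumes "C1_lim F \<phi> (\<lambda>p. p)" "0 < \<eta>" "0 < \<epsilon>"
  shows "eventually (\<lambda>i. (\<forall>f\<in>CI. \<forall>p. cmod (apply_bcontfun f (\<phi> i p) - apply_bcontfun f p) \<le> \<eta> * LC f) \<and>
    (\<forall>f\<in>CI. \<forall>g\<in>CI. (\<forall>p. apply_bcontfun g p = apply_bcontfun f (\<phi> i p)) \<longrightarrow> LC g \<le> (1 + \<epsilon>) * LC f)) F"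
  using C1_lim_id_displacement[OF assms(1,2)] C1_lim_id_lipschitz[OF assms(1,3)] by (rule eventually_conj)

lemma dist_q_crossed_eventually_le:
  fixes \<psi> :: "'t::topological_space \<Rightarrow> 'a \<Rightarrow> 'a"
  assumes cont: "continuous_map euclidean (diffeo_topology A m) \<psi>" and L: "lip_functions CI LC nrm D" and \<epsilon>: "0 < \<epsilon>"
  shows "eventually (\<lambda>t. dist_q (reduced_crossed_product (pullback (\<psi> t))) (crossed_subspace (pullback (\<psi> t)) CI)
      (crossed_seminorm (pullback (\<psi> t)) CI LC nrm) (reduced_crossed_product (pullback (\<psi> t0)))
      (crossed_subspace (pullback (\<psi> t0)) CI) (crossed_seminorm (pullback (\<psi> t0)) CI LC nrm)
    \<le> ennreal (\<epsilon> * (1 + lip_system.lip_diam nrm D))) (nhds t0)"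
proof -
  interpret L: lip_functions CI LC nrm D by (rule L)
  note diffeo = diffeo_topology_C1_lim(1)[OF cont] and lim = diffeo_topology_C1_lim(2)[OF cont, of t0]
  have sys: "lip_system CI LC nrm D (\<psi> t)" for t by (rule lip_system_diffeo[OF L diffeo])
  have bij: "bij (\<psi> t0)" and smooth: "inv (\<psi> t0) \<in> smooth_maps A" using diffeo[of t0] by (simp_all add: diffeos_def)
  \<comment> \<open>\<open>128 = 4 * 32\<close> reserves half of \<open>\<epsilon>\<close> for the
    truncation and leaves the other half to the displacements.\<close>
  obtain N :: nat where N: "128 / \<epsilon>\<^sup>2 < real N" using reals_Archimedean2 by blast
  have "0 < 128 / \<epsilon>\<^sup>2" using \<epsilon> by simp
  hence N0: "0 < real N" using N by linarith
  have "32 / real N \<le> (\<epsilon> / 2)\<^sup>2" using N N0 \<epsilon> by (simp add: field_simps power2_eq_square)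
  hence sN: "sqrt (32 / real N) \<le> \<epsilon> / 2" using \<epsilon> by (intro real_le_lsqrt) auto
  define \<Sigma> where "\<Sigma> = (\<Sum>n\<in>{- int N..int N}. 1 / L.unit_nrm n)"
  have \<Sigma>: "0 \<le> \<Sigma>" unfolding \<Sigma>_def using L.unit_nrm_pos by (intro sum_nonneg) (simp add: less_imp_le)
  \<comment> \<open>Depends on \<open>N\<close> and \<open>nrm\<close> but not on \<open>t\<close>,
    so the neighbourhood of \<open>t0\<close> can be chosen afterwards.\<close>
  define \<eta> where "\<eta> = \<epsilon> / (4 * (\<Sigma> + 1))"
  have \<eta>: "0 < \<eta>" using \<epsilon> \<Sigma> by (simp add: \<eta>_def)
  have "2 * \<eta> * \<Sigma> \<le> 2 * \<eta> * (\<Sigma> + 1)" using \<eta> by (intro mult_left_mono) auto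
  also have "\<dots> = \<epsilon> / 2" using \<Sigma> by (simp add: \<eta>_def field_simps)
  finally have small: "sqrt (32 / real N) + 2 * \<eta> * \<Sigma> \<le> \<epsilon>" using sN by simp
  define Q where "Q \<phi> \<longleftrightarrow> (\<forall>f\<in>CI. \<forall>p. cmod (apply_bcontfun f (\<phi> p) - apply_bcontfun f p) \<le> \<eta> * LC f) \<and>
    (\<forall>f\<in>CI. \<forall>g\<in>CI. (\<forall>p. apply_bcontfun g p = apply_bcontfun f (\<phi> p)) \<longrightarrow> LC g \<le> (1 + \<epsilon>) * LC f)" for \<phi> :: "'a \<Rightarrow> 'a"
  have inv_lim: "C1_lim (nhds t0) (\<lambda>t. inv (\<psi> t0) ^^ j) (inv (\<psi> t0) ^^ j)" for j
    by (rule C1_lim_const[OF smooth_maps_funpow[OF smooth]])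
  have 1: "eventually (\<lambda>t. Q (\<lambda>p. (\<psi> t ^^ j) ((inv (\<psi> t0) ^^ j) p))) (nhds t0)" for j
    unfolding Q_def
    by (rule C1_lim_close[OF _ \<eta> \<epsilon>])
      (use C1_lim_compose[OF C1_lim_funpow[OF lim, of j] inv_lim[of j]] in \<open>simp only: inv_funpow[OF bij]\<close>)
  have 2: "eventually (\<lambda>t. Q (\<lambda>p. (inv (\<psi> t0) ^^ j) ((\<psi> t ^^ j) p))) (nhds t0)" for j
    unfolding Q_def
    by (rule C1_lim_close[OF _ \<eta> \<epsilon>])
      (use C1_lim_compose[OF inv_lim[of j] C1_lim_funpow[OF lim, of j]] in \<open>simp only: inv_funpow[OF bij]\<close>)
  have "eventually (\<lambda>t. \<forall>j\<in>{..<N}. Q (\<lambda>p. (\<psi> t ^^ j) ((inv (\<psi> t0) ^^ j) p)) \<and> Q (\<lambda>p. (inv (\<psi> t0) ^^ j) ((\<psi> t ^^ j) p))) (nhds t0)"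
    by (intro eventually_ball_finite ballI eventually_conj 1 2 finite_lessThan)
  thus ?thesis
  proof eventually_elim
    case (elim t)
    interpret S: lip_system CI LC nrm D "\<psi> t" by (rule sys)
    interpret T: lip_system CI LC nrm D "\<psi> t0" by (rule sys)
    \<comment> \<open>The interval ends at 0 and so \<open>- i\<close> ranges over
      \<open>{0..<N}\<close>: \<open>\<psi> t\<close> occurs with nonnegative powers, negative ones
      fall on \<open>\<psi> t0\<close>. The index 0 is split off because \<open>int_iterate\<close>
      treats it as nonnegative.\<close>
    have Q1: "Q (\<lambda>p. int_iterate (\<psi> t) (- i) (int_iterate (\<psi> t0) i p))" if "i \<in> {- int N + 1..<- int N + 1 + int N}" for i
    proof -
      have i: "i \<le> 0" "nat (- i) < N" using that by auto
      have "(\<lambda>p. int_iterate (\<psi> t) (- i) (int_iterate (\<psi> t0) i p)) = (\<lambda>p. (\<psi> t ^^ nat (- i)) ((inv (\<psi> t0) ^^ nat (- i)) p))"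
        using i(1) by (cases "i = 0") (auto simp: int_iterate_def)
      thus ?thesis using elim i(2) by simp
    qed
    \<comment> \<open>In the opposite direction the interval starts at 0; again the negative powers
      belong to \<open>\<psi> t0\<close>.\<close>
    have Q2: "Q (\<lambda>p. int_iterate (\<psi> t0) (- i) (int_iterate (\<psi> t) i p))" if "i \<in> {0..<0 + int N}" for i
    proof -
      have i: "0 \<le> i" "nat i < N" using that by auto
      have "(\<lambda>p. int_iterate (\<psi> t0) (- i) (int_iterate (\<psi> t) i p)) = (\<lambda>p. (inv (\<psi> t0) ^^ nat i) ((\<psi> t ^^ nat i) p))"
        using i(1) by (cases "i = 0") (auto simp: int_iterate_def)
      thus ?thesis using elim i(2) by simp
    qed
    show ?case
    proof (rule dist_q_crossed_le[OF sys sys _ less_imp_le[OF \<eta>] \<epsilon>, where N = N and a = "- int N + 1" and b = 0])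
      show "0 < N" using N0 by simp
      show "sqrt (32 / real N) + 2 * \<eta> * (\<Sum>n\<in>{- int N..int N}. 1 / L.unit_nrm n) \<le> \<epsilon>"
        using small by (simp only: \<Sigma>_def)
    next
      fix i f p assume "i \<in> {- int N + 1..<- int N + 1 + int N}" "f \<in> CI"
      thus "cmod (apply_bcontfun f (int_iterate (\<psi> t) (- i) (int_iterate (\<psi> t0) i p)) - apply_bcontfun f p) \<le> \<eta> * LC f"
        using Q1 unfolding Q_def by blast
    next
      fix i f p assume "i \<in> {0..<0 + int N}" "f \<in> CI"
      thus "cmod (apply_bcontfun f (int_iterate (\<psi> t0) (- i) (int_iterate (\<psi> t) i p)) - apply_bcontfun f p) \<le> \<eta> * LC f"
        using Q2 unfolding Q_def by blast
    next
      fix i f assume i: "i \<in> {- int N + 1..<- int N + 1 + int N}" and f: "f \<in> CI"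
      have "int_iterate (pullback (\<psi> t0)) i (int_iterate (pullback (\<psi> t)) (- i) f) \<in> CI"
        by (intro T.VB_iterate S.VB_iterate f)
      moreover have "apply_bcontfun (int_iterate (pullback (\<psi> t0)) i (int_iterate (pullback (\<psi> t)) (- i) f)) p
          = apply_bcontfun f (int_iterate (\<psi> t) (- i) (int_iterate (\<psi> t0) i p))" for p
        by (simp only: S.int_iterate_pullback T.int_iterate_pullback)
      ultimately show "LC (int_iterate (pullback (\<psi> t0)) i (int_iterate (pullback (\<psi> t)) (- i) f)) \<le> (1 + \<epsilon>) * LC f"
        using Q1[OF i] f unfolding Q_def by blast
    next
      fix i f assume i: "i \<in> {0..<0 + int N}" and f: "f \<in> CI"
      have "int_iterate (pullback (\<psi> t)) i (int_iterate (pullback (\<psi> t0)) (- i) f) \<in> CI"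
        by (intro T.VB_iterate S.VB_iterate f)
      moreover have "apply_bcontfun (int_iterate (pullback (\<psi> t)) i (int_iterate (pullback (\<psi> t0)) (- i) f)) p
          = apply_bcontfun f (int_iterate (\<psi> t0) (- i) (int_iterate (\<psi> t) i p))" for p
        by (simp only: S.int_iterate_pullback T.int_iterate_pullback)
      ultimately show "LC (int_iterate (pullback (\<psi> t)) i (int_iterate (pullback (\<psi> t0)) (- i) f)) \<le> (1 + \<epsilon>) * LC f"
        using Q2[OF i] f unfolding Q_def by blast
    qed
  qed
qed

end

theorem theoremD:
  fixes A :: "('a::t2_space, 'e::finite_dim_inner) chart set"
    and m :: "('a, 'e) metric_tensor"
    and \<psi> :: "'t::t2_space \<Rightarrow> 'a \<Rightarrow> 'a"
    and nrm :: "(int \<Rightarrow> complex) \<Rightarrow> real"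
  defines "\<beta> \<equiv> \<lambda>t. pullback (\<psi> t)"
  defines "C \<equiv> \<lambda>t. reduced_crossed_product (\<beta> t)"
    and "V \<equiv> \<lambda>t. crossed_subspace (\<beta> t) (smooth_bcontfuns A)"
    and "L \<equiv> \<lambda>t. crossed_seminorm (\<beta> t) (smooth_bcontfuns A) (lipschitz_seminorm A m) nrm"
  assumes "riemannian_manifold A m"
    and "compact (UNIV :: 'a set)"
    and "connected (UNIV :: 'a set)"
    and "compact (UNIV :: 't set)"
    and "continuous_map euclidean (diffeo_topology A m) \<psi>"
    and "order_preserving_norm nrm"
  shows "(\<forall>t. cqms (C t) (V t) (L t)) \<and>
    (\<forall>t0. ((\<lambda>t. dist_q (C t) (V t) (L t) (C t0) (V t0) (L t0)) \<longlongrightarrow> 0) (at t0))"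
proof -
  interpret compact_riemannian A m by unfold_locales (fact assms)+
  obtain D where D: "lip_functions CI LC nrm D" by (rule lip_functions_smooth[OF assms(10)])
  note sys = lip_system_diffeo[OF D diffeo_topology_C1_lim(1)[OF assms(9)]]
  have "cqms (C t) (V t) (L t)" for t
  proof -
    interpret lip_system CI LC nrm D "\<psi> t" by (rule sys)
    show ?thesis using cqms by (simp add: C_def V_def L_def \<beta>_def)
  qed
  moreover have "((\<lambda>t. dist_q (C t) (V t) (L t) (C t0) (V t0) (L t0)) \<longlongrightarrow> 0) (at t0)" for t0
  proof (rule order_tendstoI)
    fix a :: ennreal assume "0 < a"
    \<comment> \<open>A value strictly between 0 and \<open>a\<close> turns the bound with
      \<open>\<le>\<close> into the strict inequality demanded by the order topology; being below
      \<open>a\<close> it is also finite.\<close>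
    then obtain b where b: "0 < b" "b < a" using dense by blast
    then obtain \<delta> where \<delta>: "b = ennreal \<delta>" "0 < \<delta>" by (cases b) auto
    interpret lip_system CI LC nrm D "\<psi> t0" by (rule sys)
    have pos: "0 < 1 + lip_diam"
      using lip_functions.D_nonneg[OF D] unit_nrm_pos[of 0] by (simp add: lip_diam_def add_pos_nonneg)
    hence "0 < \<delta> / (1 + lip_diam)" using \<delta> by simp
    from dist_q_crossed_eventually_le[OF assms(9) D this, of t0]
    have "eventually (\<lambda>t. dist_q (C t) (V t) (L t) (C t0) (V t0) (L t0) \<le> b) (nhds t0)"
      using pos by (simp add: C_def V_def L_def \<beta>_def \<delta>(1))
    hence "eventually (\<lambda>t. dist_q (C t) (V t) (L t) (C t0) (V t0) (L t0) < a) (nhds t0)"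
      by (rule eventually_mono) (use b(2) in auto)
    thus "eventually (\<lambda>t. dist_q (C t) (V t) (L t) (C t0) (V t0) (L t0) < a) (at t0)"
      by (rule filter_leD[OF at_within_le_nhds])
  qed simp
  ultimately show ?thesis by blast
qed

end
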